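(* Let $\mathbf{Pos}$ be the full subcategory of the category $\mathbf{Cat}$ of small categories whose objects are posets considered as categories, and let $\mathbf{Cat}_i$ be the wide subcategory of $\mathbf{Cat}$ whose morphisms are the inclusions. Let $B,\widetilde{B}\colon \mathbf{Cat}\to\mathbf{Top}$ be the functors given by $B\mathcal{C}=|N\mathcal{C}|$ and $\widetilde{B}\mathcal{C}=|B_\bullet(\ast,\mathcal{F}_\bullet\mathcal{C},\ast)|$. Then there exists a natural homeomorphism $(\bar\alpha,\bar t)$ from $\widetilde{B}|_{\mathbf{Pos}}$ to $B|_{\mathbf{Pos}}$ with a twist on $B|_{\mathbf{Pos}}$ away from $\mathbf{Cat}_i\cap\mathbf{Pos}$.
   Context: Twisted natural transformations. Let $\mathcal{C},\mathcal{M}$ be categories, $\mathcal{I}$ a wide subcategory of $\mathcal{C}$, and $F,G\colon\mathcal{C}\to\mathcal{M}$ functors. A pair $(\alpha,t)$ is a natural transformation from $F$ to $G$ with a twist on $G$ away from $\mathcal{I}$ if to every morphism $f\colon c\to c'$ in $\mathcal{C}$, $\alpha$ assigns a morphism $\alpha(f)\colon F(c)\to G(c')$ and $t$ assigns a morphism $t(f)\colon G(c)\to G(c)$ in $\mathcal{M}$ such that: (i) $\alpha(hgf)=G(h)\,t(h)\,\alpha(g)\,F(f)$ for every ternary composition $hgf$ in $\mathcal{C}$; (ii) $t(f)=\mathrm{id}_{G(c)}$ for every morphism $f\colon c\to c'$ in $\mathcal{I}$; (iii) $G(f_1)\,t(g_1)=t(g_2)\,G(f_1)$ for all $f_1,f_2\in\mathcal{I}$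 and $g_1,g_2\in\mathcal{C}$ with $f_2g_1=g_2f_1$. It is a natural isomorphism (natural homeomorphism when $\mathcal{M}=\mathbf{Top}$) with a twist on $G$ away from $\mathcal{I}$ if moreover $\alpha(\mathrm{id}_x)$ is an isomorphism for every object $x$ of $\mathcal{C}$. $\mathbf{Top}$ is the category of (compactly generated) topological spaces, and products of spaces are taken there. An inclusion of small categories means a functor that is injective on objects and faithful (equivalently, injective on morphisms). $N\mathcal{C}$ is the nerve of $\mathcal{C}$, and $|\cdot|$ is geometric realization (of simplicial sets or of simplicial spaces). Free category. For a small category $\mathcal{C}$, the category $\mathcal{F}\mathcal{C}$ has the same objects as $\mathcal{C}$. A morphism from $c$ to $d$ in $\mathcal{F}\mathcal{C}$ is a word $(f_n)\cdots(f_1)$ of composable non-identity morphisms of $\mathcal{C}$ starting at $c$ and ending at $d$. Composition is concatenation and identities are empty words. Write $\mathcal{F}f=(f)$ for the one-letter word (the empty word if $f$ is an identity). A functor $H\colon\mathcal{C}\to\mathcal{D}$ induces $\mathcal{F}H\colon\mathcal{F}\mathcal{C}\to\mathcal{F}\mathcal{D}$ by $\mathcal{F}f\mapsto\mathcal{F}(H(f))$. This is a comonad on $\mathbf{Cat}$ with counit $U_{\mathcal{C}}\colon\mathcal{F}\mathcal{C}\to\mathcal{C}$, $\mathcal{F}f\mapsto f$, and comultiplication $\Delta_{\mathcal{C}}\colon\mathcal{F}\mathcal{C}\to\mathcal{F}^2\mathcal{C}$, $\mathcal{F}f\mapsto\mathcal{F}^2f$, both the identity on objects. Standard resolution. $\mathcal{F}_\bullet\mathcal{C}$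 is the simplicially enriched category with the objects of $\mathcal{C}$ and hom simplicial sets $\mathcal{F}_n\mathcal{C}(c,d)=\mathcal{F}^{n+1}\mathcal{C}(c,d)$, with face maps $d_i=\mathcal{F}^i(U_{\mathcal{F}^{n-i}\mathcal{C}})$ and degeneracy maps $s_i=\mathcal{F}^i(\Delta_{\mathcal{F}^{n-i}\mathcal{C}})$, $0\le i\le n$. Enriched bar construction. For a simplicially enriched category $\mathcal{E}$, $B_\bullet(\ast,\mathcal{E},\ast)$ is the simplicial space with $$B_n(\ast,\mathcal{E},\ast)=\coprod_{\alpha_0,\dots,\alpha_n\in\mathrm{obj}(\mathcal{E})}|\mathcal{E}(\alpha_{n-1},\alpha_n)\times\cdots\times\mathcal{E}(\alpha_0,\alpha_1)|,$$ where inner face maps are given by composition in $\mathcal{E}$, outer face maps by dropping the outer factor (so $d_0$ drops $\mathcal{E}(\alpha_0,\alpha_1)$ and $d_n$ drops $\mathcal{E}(\alpha_{n-1},\alpha_n)$), and degeneracies by insertion of identities. *)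

theory Defs
  imports "HOL-Analysis.Analysis" "HOL-Homology.Simplices"
begin

section \<open>Categories and functors\<close>

record ('o, 'm) cat =
  Obj :: "'o set"
  Arr :: "'m set"
  Dom :: "'m \<Rightarrow> 'o"
  Cod :: "'m \<Rightarrow> 'o"
  Idn :: "'o \<Rightarrow> 'm"
  Comp :: "'m \<Rightarrow> 'm \<Rightarrow> 'm"  \<comment> \<open>\<open>Comp C g f\<close> is \<open>g\<close> after \<open>f\<close>\<close>

definition hom_set :: "('o, 'm) cat \<Rightarrow> 'o \<Rightarrow> 'o \<Rightarrow> 'm set" where
  "hom_set C x y = {f \<in> Arr C. Dom C f = x \<and> Cod C f = y}"

definition category :: "('o, 'm) cat \<Rightarrow> bool" where
  "category C \<longleftrightarrow>
     (\<forall>f\<in>Arr C. Dom C f \<in> Obj C \<and> Cod C f \<in> Obj C) \<and>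
     (\<forall>x\<in>Obj C. Idn C x \<in> hom_set C x x) \<and>
     (\<forall>f\<in>Arr C. \<forall>g\<in>Arr C. Dom C g = Cod C f \<longrightarrow> Comp C g f \<in> hom_set C (Dom C f) (Cod C g)) \<and>
     (\<forall>f\<in>Arr C. Comp C f (Idn C (Dom C f)) = f \<and> Comp C (Idn C (Cod C f)) f = f) \<and>
     (\<forall>f\<in>Arr C. \<forall>g\<in>Arr C. \<forall>h\<in>Arr C. Dom C g = Cod C f \<longrightarrow> Dom C h = Cod C g \<longrightarrow>
        Comp C h (Comp C g f) = Comp C (Comp C h g) f)"

text \<open>Two records with the same carriers and the same structure on them should be the same small
  category. So the objects of the category of small categories are taken to be those records whose
  operations are \<open>undefined\<close> off their domains.\<close>

definition normalized :: "('o, 'm) cat \<Rightarrow> bool" where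
  "normalized C \<longleftrightarrow>
     Dom C \<in> extensional (Arr C) \<and> Cod C \<in> extensional (Arr C) \<and> Idn C \<in> extensional (Obj C) \<and>
     (\<forall>g f. \<not> (f \<in> Arr C \<and> g \<in> Arr C \<and> Dom C g = Cod C f) \<longrightarrow> Comp C g f = undefined)"

definition iso_in :: "('o, 'm) cat \<Rightarrow> 'm \<Rightarrow> bool" where
  "iso_in C f \<longleftrightarrow> f \<in> Arr C \<and>
     (\<exists>g\<in>hom_set C (Cod C f) (Dom C f).
        Comp C g f = Idn C (Dom C f) \<and> Comp C f g = Idn C (Cod C f))"

record ('o, 'm, 'p, 'n) funct =
  Src :: "('o, 'm) cat"
  Tgt :: "('p, 'n) cat"
  OMap :: "'o \<Rightarrow> 'p"
  AMap :: "'m \<Rightarrow> 'n"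

definition is_functor :: "('o, 'm, 'p, 'n) funct \<Rightarrow> bool" where
  "is_functor F \<longleftrightarrow>
     category (Src F) \<and> category (Tgt F) \<and>
     OMap F \<in> extensional (Obj (Src F)) \<and> AMap F \<in> extensional (Arr (Src F)) \<and>
     (\<forall>x\<in>Obj (Src F). OMap F x \<in> Obj (Tgt F) \<and> AMap F (Idn (Src F) x) = Idn (Tgt F) (OMap F x)) \<and>
     (\<forall>f\<in>Arr (Src F).
        AMap F f \<in> hom_set (Tgt F) (OMap F (Dom (Src F) f)) (OMap F (Cod (Src F) f))) \<and>
     (\<forall>f\<in>Arr (Src F). \<forall>g\<in>Arr (Src F). Dom (Src F) g = Cod (Src F) f \<longrightarrow>
        AMap F (Comp (Src F) g f) = Comp (Tgt F) (AMap F g) (AMap F f))"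

definition id_functor :: "('o, 'm) cat \<Rightarrow> ('o, 'm, 'o, 'm) funct" where
  "id_functor C = \<lparr>Src = C, Tgt = C, OMap = restrict id (Obj C), AMap = restrict id (Arr C)\<rparr>"

definition comp_functor ::
  "('p, 'n, 'q, 'k) funct \<Rightarrow> ('o, 'm, 'p, 'n) funct \<Rightarrow> ('o, 'm, 'q, 'k) funct" where
  "comp_functor G F = \<lparr>Src = Src F, Tgt = Tgt G,
     OMap = compose (Obj (Src F)) (OMap G) (OMap F),
     AMap = compose (Arr (Src F)) (AMap G) (AMap F)\<rparr>"

text \<open>Restriction of a functor to a subcategory.\<close>

definition restrict_functor ::
  "('o, 'm, 'p, 'n) funct \<Rightarrow> ('o, 'm) cat \<Rightarrow> ('o, 'm, 'p, 'n) funct" where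
  "restrict_functor F S = \<lparr>Src = S, Tgt = Tgt F,
     OMap = restrict (OMap F) (Obj S), AMap = restrict (AMap F) (Arr S)\<rparr>"

definition wide_subcategory :: "('o, 'm) cat \<Rightarrow> ('o, 'm) cat \<Rightarrow> bool" where
  "wide_subcategory I C \<longleftrightarrow>
     category C \<and> category I \<and> Obj I = Obj C \<and> Arr I \<subseteq> Arr C \<and>
     (\<forall>f\<in>Arr I. Dom I f = Dom C f \<and> Cod I f = Cod C f) \<and>
     (\<forall>x\<in>Obj I. Idn I x = Idn C x) \<and>
     (\<forall>f\<in>Arr I. \<forall>g\<in>Arr I. Dom I g = Cod I f \<longrightarrow> Comp I g f = Comp C g f)"

definition full_subcat :: "('o, 'm) cat \<Rightarrow> 'o set \<Rightarrow> ('o, 'm) cat" where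
  "full_subcat C S = C\<lparr>Obj := Obj C \<inter> S, Arr := {f \<in> Arr C. Dom C f \<in> S \<and> Cod C f \<in> S}\<rparr>"

definition wide_subcat :: "('o, 'm) cat \<Rightarrow> ('m \<Rightarrow> bool) \<Rightarrow> ('o, 'm) cat" where
  "wide_subcat C P = C\<lparr>Arr := {f \<in> Arr C. P f}\<rparr>"

text \<open>Intersection of two subcategories of a common category.\<close>

definition inter_cat :: "('o, 'm) cat \<Rightarrow> ('o, 'm) cat \<Rightarrow> ('o, 'm) cat" where
  "inter_cat A B = A\<lparr>Obj := Obj A \<inter> Obj B, Arr := Arr A \<inter> Arr B\<rparr>"


section \<open>Twisted natural transformations\<close>

definition twisted_nat_trans ::
  "('o, 'm) cat \<Rightarrow> ('p, 'n) cat \<Rightarrow> ('o, 'm) cat \<Rightarrow> ('o, 'm, 'p, 'n) funct \<Rightarrow> ('o, 'm, 'p, 'n) funct \<Rightarrow>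
   ('m \<Rightarrow> 'n) \<Rightarrow> ('m \<Rightarrow> 'n) \<Rightarrow> bool" where
  "twisted_nat_trans C M I F G \<alpha> t \<longleftrightarrow>
     category C \<and> category M \<and> wide_subcategory I C \<and>
     is_functor F \<and> Src F = C \<and> Tgt F = M \<and>
     is_functor G \<and> Src G = C \<and> Tgt G = M \<and>
     (\<forall>f\<in>Arr C. \<alpha> f \<in> hom_set M (OMap F (Dom C f)) (OMap G (Cod C f)) \<and>
                t f \<in> hom_set M (OMap G (Dom C f)) (OMap G (Dom C f))) \<and>
     (\<forall>f\<in>Arr C. \<forall>g\<in>Arr C. \<forall>h\<in>Arr C. Dom C g = Cod C f \<longrightarrow> Dom C h = Cod C g \<longrightarrow>
        \<alpha> (Comp C h (Comp C g f)) =
          Comp M (AMap G h) (Comp M (t h) (Comp M (\<alpha> g) (AMap F f)))) \<and>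
     (\<forall>f\<in>Arr I. t f = Idn M (OMap G (Dom C f))) \<and>
     (\<forall>f1\<in>Arr I. \<forall>f2\<in>Arr I. \<forall>g1\<in>Arr C. \<forall>g2\<in>Arr C.
        Dom C f2 = Cod C g1 \<longrightarrow> Dom C g2 = Cod C f1 \<longrightarrow> Comp C f2 g1 = Comp C g2 f1 \<longrightarrow>
        Comp M (AMap G f1) (t g1) = Comp M (t g2) (AMap G f1))"

definition twisted_nat_iso ::
  "('o, 'm) cat \<Rightarrow> ('p, 'n) cat \<Rightarrow> ('o, 'm) cat \<Rightarrow> ('o, 'm, 'p, 'n) funct \<Rightarrow> ('o, 'm, 'p, 'n) funct \<Rightarrow>
   ('m \<Rightarrow> 'n) \<Rightarrow> ('m \<Rightarrow> 'n) \<Rightarrow> bool" where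
  "twisted_nat_iso C M I F G \<alpha> t \<longleftrightarrow>
     twisted_nat_trans C M I F G \<alpha> t \<and> (\<forall>x\<in>Obj C. iso_in M (\<alpha> (Idn C x)))"


section \<open>Small categories, posets, inclusions\<close>

text \<open>Smallness is relative to a universe: the small categories are those whose objects and arrows
  form subsets of two arbitrary fixed types.\<close>

definition Cat :: "(('o, 'm) cat, ('o, 'm, 'o, 'm) funct) cat" where
  "Cat = \<lparr>Obj = {C. category C \<and> normalized C},
     Arr = {H. is_functor H \<and> normalized (Src H) \<and> normalized (Tgt H)},
     Dom = Src, Cod = Tgt, Idn = id_functor, Comp = comp_functor\<rparr>"

definition poset_category :: "('o, 'm) cat \<Rightarrow> bool" where
  "poset_category C \<longleftrightarrow> category C \<and>
     (\<forall>x\<in>Obj C. \<forall>y\<in>Obj C. \<forall>f\<in>hom_set C x y. \<forall>g\<in>hom_set C x y. f = g) \<and>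
     (\<forall>x\<in>Obj C. \<forall>y\<in>Obj C. hom_set C x y \<noteq> {} \<and> hom_set C y x \<noteq> {} \<longrightarrow> x = y)"

definition Pos :: "(('o, 'm) cat, ('o, 'm, 'o, 'm) funct) cat" where
  "Pos = full_subcat Cat {C. poset_category C}"

definition faithful :: "('o, 'm, 'p, 'n) funct \<Rightarrow> bool" where
  "faithful H \<longleftrightarrow> (\<forall>x\<in>Obj (Src H). \<forall>y\<in>Obj (Src H). inj_on (AMap H) (hom_set (Src H) x y))"

definition inclusion :: "('o, 'm, 'p, 'n) funct \<Rightarrow> bool" where
  "inclusion H \<longleftrightarrow> inj_on (OMap H) (Obj (Src H)) \<and> faithful H"

definition Cat_i :: "(('o, 'm) cat, ('o, 'm, 'o, 'm) funct) cat" where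
  "Cat_i = wide_subcat Cat inclusion"


section \<open>Compactly generated spaces\<close>

text \<open>The final topology on the image of a map; for an injection this transports the topology.\<close>

definition image_topology :: "'a topology \<Rightarrow> ('a \<Rightarrow> 'b) \<Rightarrow> 'b topology" where
  "image_topology X q =
     topology (\<lambda>U. U \<subseteq> q ` topspace X \<and> openin X {x \<in> topspace X. q x \<in> U})"

lemma openin_image_topology:
  "openin (image_topology X q) U \<longleftrightarrow>
     U \<subseteq> q ` topspace X \<and> openin X {x \<in> topspace X. q x \<in> U}"
proof -
  have 1: "{x \<in> topspace X. q x \<in> S \<inter> T} = {x \<in> topspace X. q x \<in> S} \<inter> {x \<in> topspace X. q x \<in> T}" for S T
    by auto
  have 2: "{x \<in> topspace X. q x \<in> \<Union> \<K>} = (\<Union>K\<in>\<K>. {x \<in> topspace X. q x \<in> K})" for \<K>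
    by auto
  have "istopology (\<lambda>U. U \<subseteq> q ` topspace X \<and> openin X {x \<in> topspace X. q x \<in> U})"
    unfolding istopology_def 1 2 by (auto intro!: openin_Union)
  then show ?thesis by (simp add: image_topology_def)
qed

lemma topspace_image_topology [simp]: "topspace (image_topology X q) = q ` topspace X"
proof -
  have "{x \<in> topspace X. q x \<in> q ` topspace X} = topspace X" by auto
  then have "openin (image_topology X q) (q ` topspace X)"
    by (simp add: openin_image_topology)
  then show ?thesis
    by (meson openin_image_topology openin_subset openin_topspace subset_antisym)
qed

lemma quotient_map_image_topology: "quotient_map X (image_topology X q) q"
  by (auto simp: quotient_map_def openin_image_topology)

definition kification :: "'a topology \<Rightarrow> 'a topology" where
  "kification X =
     topology (\<lambda>U. U \<subseteq> topspace X \<and> (\<forall>K. compactin X K \<longrightarrow> openin (subtopology X K) (K \<inter> U)))"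

lemma openin_kification:
  "openin (kification X) U \<longleftrightarrow>
     U \<subseteq> topspace X \<and> (\<forall>K. compactin X K \<longrightarrow> openin (subtopology X K) (K \<inter> U))"
proof -
  have 1: "openin (subtopology X K) (K \<inter> (S \<inter> T))"
    if "openin (subtopology X K) (K \<inter> S)" "openin (subtopology X K) (K \<inter> T)" for K S T
    using openin_Int[OF that] by (simp add: Int_ac)
  have 2: "openin (subtopology X K) (K \<inter> \<Union> \<K>)"
    if "\<And>S. S \<in> \<K> \<Longrightarrow> openin (subtopology X K) (K \<inter> S)" for K \<K>
    unfolding Int_Union using that by (intro openin_Union) auto
  have "istopology (\<lambda>U. U \<subseteq> topspace X \<and> (\<forall>K. compactin X K \<longrightarrow> openin (subtopology X K) (K \<inter> U)))"
    unfolding istopology_def using 1 2 by (simp add: Sup_le_iff le_infI1)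
  then show ?thesis by (simp add: kification_def)
qed

lemma kification_eq: "k_space X \<Longrightarrow> kification X = X"
  by (auto simp: topology_eq openin_kification k_space_alt dest: openin_subset)

text \<open>The product in the category of compactly generated spaces.\<close>

definition k_prod :: "'a topology \<Rightarrow> 'b topology \<Rightarrow> ('a \<times> 'b) topology" where
  "k_prod X Y = kification (prod_topology X Y)"

text \<open>An arrow is a triple (domain, function, codomain), the function being \<open>undefined\<close> off
  the domain.\<close>

type_synonym 'p cmap = "'p topology \<times> ('p \<Rightarrow> 'p) \<times> 'p topology"

definition Top :: "('p topology, 'p cmap) cat" where
  "Top = \<lparr>Obj = {X. k_space X},
     Arr = {(X, f, Y). k_space X \<and> k_space Y \<and> continuous_map X Y f \<and> f \<in> extensional (topspace X)},
     Dom = fst, Cod = (\<lambda>(X, f, Y). Y),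
     Idn = (\<lambda>X. (X, restrict id (topspace X), X)),
     Comp = (\<lambda>(Y', g, Z) (X, f, Y). (X, compose (topspace X) g f, Z))\<rparr>"


section \<open>Simplicial sets, simplicial spaces and their realizations\<close>

text \<open>\<open>Face X n i\<close> is \<open>d\<^sub>i : X\<^sub>n \<rightarrow> X\<^bsub>n-1\<^esub>\<close> (for \<open>n \<ge> 1\<close>, \<open>i \<le> n\<close>) and \<open>Degen X n i\<close> is
  \<open>s\<^sub>i : X\<^sub>n \<rightarrow> X\<^bsub>n+1\<^esub>\<close> (for \<open>i \<le> n\<close>).\<close>

record 's sset =
  Simp :: "nat \<Rightarrow> 's set"
  Face :: "nat \<Rightarrow> nat \<Rightarrow> 's \<Rightarrow> 's"
  Degen :: "nat \<Rightarrow> nat \<Rightarrow> 's \<Rightarrow> 's"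

record 'p sspace =
  SpTop :: "nat \<Rightarrow> 'p topology"
  SpFace :: "nat \<Rightarrow> nat \<Rightarrow> 'p \<Rightarrow> 'p"
  SpDegen :: "nat \<Rightarrow> nat \<Rightarrow> 'p \<Rightarrow> 'p"

definition discrete_sspace :: "'s sset \<Rightarrow> 's sspace" where
  "discrete_sspace X =
     \<lparr>SpTop = (\<lambda>n. discrete_topology (Simp X n)), SpFace = Face X, SpDegen = Degen X\<rparr>"

abbreviation simplex_topology :: "nat \<Rightarrow> (nat \<Rightarrow> real) topology" where
  "simplex_topology n \<equiv> subtopology (powertop_real UNIV) (standard_simplex n)"

text \<open>The \<open>i\<close>-th coface \<open>\<Delta>\<^sup>n \<rightarrow> \<Delta>\<^bsup>n+1\<^esup>\<close> is \<^const>\<open>simplical_face\<close>; this is the \<open>i\<close>-th codegeneracy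
  \<open>\<Delta>\<^bsup>n+1\<^esup> \<rightarrow> \<Delta>\<^sup>n\<close>.\<close>

definition codegeneracy :: "nat \<Rightarrow> (nat \<Rightarrow> real) \<Rightarrow> nat \<Rightarrow> real" where
  "codegeneracy i u = (\<lambda>j. if j < i then u j else if j = i then u i + u (Suc i) else u (Suc j))"

type_synonym 'p rpoint = "nat \<times> 'p \<times> (nat \<Rightarrow> real)"

inductive glue :: "'p sspace \<Rightarrow> 'p rpoint \<Rightarrow> 'p rpoint \<Rightarrow> bool" for X where
  face: "\<lbrakk>x \<in> topspace (SpTop X (Suc n)); u \<in> standard_simplex n; i \<le> Suc n\<rbrakk> \<Longrightarrow>
     glue X (n, SpFace X (Suc n) i x, u) (Suc n, x, simplical_face i u)"
| degen: "\<lbrakk>x \<in> topspace (SpTop X n); u \<in> standard_simplex (Suc n); i \<le> n\<rbrakk> \<Longrightarrow>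
     glue X (Suc n, SpDegen X n i x, u) (n, x, codegeneracy i u)"

definition rclass :: "'p sspace \<Rightarrow> 'p rpoint \<Rightarrow> 'p rpoint set" where
  "rclass X a = {b. equivclp (glue X) a b}"

definition realization :: "'p sspace \<Rightarrow> 'p rpoint set topology" where
  "realization X =
     image_topology (sum_topology (\<lambda>n. k_prod (SpTop X n) (simplex_topology n)) UNIV) (rclass X)"

text \<open>The map into the realization of \<open>Y\<close> induced by a simplicial map \<open>\<phi>\<close>, whose components are
  \<open>\<phi> n\<close>. All the classes in the union are equal.\<close>

definition realization_map ::
  "'q sspace \<Rightarrow> (nat \<Rightarrow> 'p \<Rightarrow> 'q) \<Rightarrow> 'p rpoint set \<Rightarrow> 'q rpoint set" where
  "realization_map Y \<phi> c = (\<Union>(n, x, u)\<in>c. rclass Y (n, \<phi> n x, u))"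


section \<open>The nerve and the functor \<open>B\<close>\<close>

text \<open>Operations on strings \<open>\<alpha>\<^sub>0 \<rightarrow> \<dots> \<rightarrow> \<alpha>\<^sub>n\<close>, given by the list \<open>[\<alpha>\<^sub>0, \<dots>, \<alpha>\<^sub>n]\<close> of objects and the list
  \<open>[x\<^sub>1, \<dots>, x\<^sub>n]\<close> of arrows \<open>x\<^sub>j : \<alpha>\<^bsub>j-1\<^esub> \<rightarrow> \<alpha>\<^sub>j\<close>.\<close>

definition face_objs :: "nat \<Rightarrow> 'o list \<Rightarrow> 'o list" where
  "face_objs i as = take i as @ drop (Suc i) as"

definition face_arrs :: "('m \<Rightarrow> 'm \<Rightarrow> 'm) \<Rightarrow> nat \<Rightarrow> nat \<Rightarrow> 'm list \<Rightarrow> 'm list" where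
  "face_arrs cmp n i xs =
     (if i = 0 then tl xs
      else if i = n then butlast xs
      else take (i - 1) xs @ cmp (xs ! i) (xs ! (i - 1)) # drop (Suc i) xs)"

definition degen_objs :: "nat \<Rightarrow> 'o list \<Rightarrow> 'o list" where
  "degen_objs i as = take (Suc i) as @ drop i as"

definition degen_arrs :: "'m \<Rightarrow> nat \<Rightarrow> 'm list \<Rightarrow> 'm list" where
  "degen_arrs e i xs = take i xs @ e # drop i xs"

definition nerve :: "('o, 'm) cat \<Rightarrow> ('o list \<times> 'm list) sset" where
  "nerve C =
     \<lparr>Simp = (\<lambda>n. {(as, fs). length as = Suc n \<and> length fs = n \<and> set as \<subseteq> Obj C \<and>
                    (\<forall>j<n. fs ! j \<in> hom_set C (as ! j) (as ! Suc j))}),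
      Face = (\<lambda>n i (as, fs). (face_objs i as, face_arrs (Comp C) n i fs)),
      Degen = (\<lambda>n i (as, fs). (degen_objs i as, degen_arrs (Idn C (as ! i)) i fs))\<rparr>"

definition nerve_map ::
  "('o, 'm, 'p, 'n) funct \<Rightarrow> nat \<Rightarrow> 'o list \<times> 'm list \<Rightarrow> 'p list \<times> 'n list" where
  "nerve_map H n = (\<lambda>(as, fs). (map (OMap H) as, map (AMap H) fs))"


section \<open>Free categories and the standard resolution\<close>

text \<open>\<open>Word c [f\<^sub>1, \<dots>, f\<^sub>n] d\<close> is the word \<open>(f\<^sub>n)\<dots>(f\<^sub>1)\<close> from \<open>c\<close> to \<open>d\<close>. So that free categories can be
  iterated within one type, \<open>Letter\<close> embeds the arrows of the category one starts from.\<close>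

datatype ('o, 'm) word =
  Letter 'm
| Word (wsrc: 'o) (wlist: "('o, 'm) word list") (wtgt: 'o)

type_synonym ('o, 'm) wcat = "('o, ('o, 'm) word) cat"
type_synonym ('o, 'm) wfunct = "('o, ('o, 'm) word, 'o, ('o, 'm) word) funct"

text \<open>The isomorphic copy of a category (and of a functor) with \<open>Letter f\<close> in place of \<open>f\<close>.\<close>

definition letter_cat :: "('o, 'm) cat \<Rightarrow> ('o, 'm) wcat" where
  "letter_cat C = \<lparr>Obj = Obj C, Arr = Letter ` Arr C,
     Dom = (\<lambda>w. case w of Letter f \<Rightarrow> Dom C f | _ \<Rightarrow> undefined),
     Cod = (\<lambda>w. case w of Letter f \<Rightarrow> Cod C f | _ \<Rightarrow> undefined),
     Idn = (\<lambda>x. Letter (Idn C x)),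
     Comp = (\<lambda>v w. case (v, w) of (Letter g, Letter f) \<Rightarrow> Letter (Comp C g f) | _ \<Rightarrow> undefined)\<rparr>"

definition letter_funct :: "('o, 'm, 'o, 'm) funct \<Rightarrow> ('o, 'm) wfunct" where
  "letter_funct H = \<lparr>Src = letter_cat (Src H), Tgt = letter_cat (Tgt H), OMap = OMap H,
     AMap = restrict (\<lambda>w. case w of Letter f \<Rightarrow> Letter (AMap H f) | _ \<Rightarrow> undefined)
              (Letter ` Arr (Src H))\<rparr>"

fun is_path :: "('o, 'm) cat \<Rightarrow> 'o \<Rightarrow> 'm list \<Rightarrow> 'o \<Rightarrow> bool" where
  "is_path C c [] d \<longleftrightarrow> c \<in> Obj C \<and> c = d"
| "is_path C c (f # fs) d \<longleftrightarrow> f \<in> Arr C \<and> Dom C f = c \<and> is_path C (Cod C f) fs d"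

abbreviation is_identity :: "('o, 'm) cat \<Rightarrow> 'm \<Rightarrow> bool" where
  "is_identity C f \<equiv> f \<in> Idn C ` Obj C"

definition free_cat :: "('o, 'm) wcat \<Rightarrow> ('o, 'm) wcat" where
  "free_cat C = \<lparr>Obj = Obj C,
     Arr = {Word c fs d | c fs d. is_path C c fs d \<and> (\<forall>f\<in>set fs. \<not> is_identity C f)},
     Dom = wsrc, Cod = wtgt, Idn = (\<lambda>c. Word c [] c),
     Comp = (\<lambda>v w. Word (wsrc w) (wlist w @ wlist v) (wtgt v))\<rparr>"

text \<open>The arrow \<open>\<F>f\<close> of the free category on \<open>C\<close>.\<close>

definition gen :: "('o, 'm) wcat \<Rightarrow> ('o, 'm) word \<Rightarrow> ('o, 'm) word" where
  "gen C f = Word (Dom C f) (if is_identity C f then [] else [f]) (Cod C f)"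

text \<open>The functor from the free category on \<open>C\<close> to \<open>E\<close> which is \<open>h\<close> on objects and maps \<open>\<F>f\<close> to
  \<open>\<phi> f\<close>.\<close>

definition free_ext ::
  "('o, 'm) wcat \<Rightarrow> ('o, 'm) wcat \<Rightarrow> ('o \<Rightarrow> 'o) \<Rightarrow> (('o, 'm) word \<Rightarrow> ('o, 'm) word) \<Rightarrow> ('o, 'm) wfunct"
  where
  "free_ext C E h \<phi> = \<lparr>Src = free_cat C, Tgt = E, OMap = restrict h (Obj C),
     AMap = restrict (\<lambda>w. foldl (\<lambda>g f. Comp E (\<phi> f) g) (Idn E (h (wsrc w))) (wlist w))
              (Arr (free_cat C))\<rparr>"

definition free_map :: "('o, 'm) wfunct \<Rightarrow> ('o, 'm) wfunct" where
  "free_map H =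
     free_ext (Src H) (free_cat (Tgt H)) (OMap H) (\<lambda>f. gen (Tgt H) (AMap H f))"

definition counit :: "('o, 'm) wcat \<Rightarrow> ('o, 'm) wfunct" where
  "counit C = free_ext C C id id"

definition comult :: "('o, 'm) wcat \<Rightarrow> ('o, 'm) wfunct" where
  "comult C = free_ext C (free_cat (free_cat C)) id (\<lambda>f. gen (free_cat C) (gen C f))"

text \<open>Simplicially enriched categories: \<open>EComp E a b c k\<close> is composition
  \<open>E(b,c)\<^sub>k \<times> E(a,b)\<^sub>k \<rightarrow> E(a,c)\<^sub>k\<close>, and \<open>EIdn E a k\<close> is the (degenerate) identity \<open>k\<close>-simplex of \<open>E(a,a)\<close>.\<close>

record ('o, 's) secat =
  EObj :: "'o set"
  EHom :: "'o \<Rightarrow> 'o \<Rightarrow> 's sset"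
  EComp :: "'o \<Rightarrow> 'o \<Rightarrow> 'o \<Rightarrow> nat \<Rightarrow> 's \<Rightarrow> 's \<Rightarrow> 's"
  EIdn :: "'o \<Rightarrow> nat \<Rightarrow> 's"

definition free_pow :: "nat \<Rightarrow> ('o, 'm) cat \<Rightarrow> ('o, 'm) wcat" where
  "free_pow n C = (free_cat ^^ n) (letter_cat C)"

definition resolution :: "('o, 'm) cat \<Rightarrow> ('o, ('o, 'm) word) secat" where
  "resolution C = \<lparr>EObj = Obj C,
     EHom = (\<lambda>a b. \<lparr>Simp = (\<lambda>n. hom_set (free_pow (Suc n) C) a b),
                    Face = (\<lambda>n i. AMap ((free_map ^^ i) (counit (free_pow (n - i) C)))),
                    Degen = (\<lambda>n i. AMap ((free_map ^^ i) (comult (free_pow (n - i) C))))\<rparr>),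
     EComp = (\<lambda>a b c n. Comp (free_pow (Suc n) C)),
     EIdn = (\<lambda>a n. Idn (free_pow (Suc n) C) a)\<rparr>"

definition resolution_map ::
  "('o, 'm, 'o, 'm) funct \<Rightarrow> nat \<Rightarrow> ('o, 'm) word \<Rightarrow> ('o, 'm) word" where
  "resolution_map H n = AMap ((free_map ^^ Suc n) (letter_funct H))"


section \<open>The enriched bar construction\<close>

text \<open>The product of simplicial sets \<open>E(\<alpha>\<^bsub>n-1\<^esub>,\<alpha>\<^sub>n) \<times> \<dots> \<times> E(\<alpha>\<^sub>0,\<alpha>\<^sub>1)\<close>, a tuple being listed starting with
  its component in \<open>E(\<alpha>\<^sub>0,\<alpha>\<^sub>1)\<close>.\<close>

definition chain_sset :: "('o, 's) secat \<Rightarrow> 'o list \<Rightarrow> 's list sset" where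
  "chain_sset E as =
     \<lparr>Simp = (\<lambda>k. {xs. length as = Suc (length xs) \<and>
                      (\<forall>j<length xs. xs ! j \<in> Simp (EHom E (as ! j) (as ! Suc j)) k)}),
      Face = (\<lambda>k i xs. map (\<lambda>j. Face (EHom E (as ! j) (as ! Suc j)) k i (xs ! j)) [0..<length xs]),
      Degen = (\<lambda>k i xs. map (\<lambda>j. Degen (EHom E (as ! j) (as ! Suc j)) k i (xs ! j)) [0..<length xs])\<rparr>"

abbreviation chain_space :: "('o, 's) secat \<Rightarrow> 'o list \<Rightarrow> 's list sspace" where
  "chain_space E as \<equiv> discrete_sspace (chain_sset E as)"

type_synonym ('o, 's) bar_point = "'o list \<times> 's list rpoint set"

definition bar :: "('o, 's) secat \<Rightarrow> ('o, 's) bar_point sspace" where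
  "bar E =
     \<lparr>SpTop = (\<lambda>n. sum_topology (\<lambda>as. realization (chain_space E as))
                {as. length as = Suc n \<and> set as \<subseteq> EObj E}),
      SpFace = (\<lambda>n i (as, c). (face_objs i as,
                 realization_map (chain_space E (face_objs i as))
                   (\<lambda>k. face_arrs (EComp E (as ! (i - 1)) (as ! i) (as ! Suc i) k) n i) c)),
      SpDegen = (\<lambda>n i (as, c). (degen_objs i as,
                 realization_map (chain_space E (degen_objs i as))
                   (\<lambda>k. degen_arrs (EIdn E (as ! i) k) i) c))\<rparr>"

definition bar_map ::
  "('o, 'm, 'o, 'm) funct \<Rightarrow> nat \<Rightarrow> ('o, ('o, 'm) word) bar_point \<Rightarrow> ('o, ('o, 'm) word) bar_point"
  where
  "bar_map H n = (\<lambda>(as, c). (map (OMap H) as,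
     realization_map (chain_space (resolution (Tgt H)) (map (OMap H) as))
       (\<lambda>k. map (resolution_map H k)) c))"


section \<open>The functors \<open>B\<close> and \<open>B\<close>-tilde\<close>

text \<open>The two constructions yield spaces with points in different types. To have a common target
  category of spaces, both types are embedded in their sum.\<close>

type_synonym ('o, 'm) universe =
  "('o, ('o, 'm) word) bar_point rpoint set + ('o list \<times> 'm list) rpoint set"

definition B_space :: "('o, 'm) cat \<Rightarrow> ('o, 'm) universe topology" where
  "B_space C = image_topology (realization (discrete_sspace (nerve C))) Inr"

definition B_map :: "('o, 'm, 'o, 'm) funct \<Rightarrow> ('o, 'm) universe \<Rightarrow> ('o, 'm) universe" where
  "B_map H = map_sum id (realization_map (discrete_sspace (nerve (Tgt H))) (nerve_map H))"

definition Btilde_space :: "('o, 'm) cat \<Rightarrow> ('o, 'm) universe topology" where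
  "Btilde_space C = image_topology (realization (bar (resolution C))) Inl"

definition Btilde_map :: "('o, 'm, 'o, 'm) funct \<Rightarrow> ('o, 'm) universe \<Rightarrow> ('o, 'm) universe" where
  "Btilde_map H = map_sum (realization_map (bar (resolution (Tgt H))) (bar_map H)) id"

type_synonym ('o, 'm) space_functor =
  "(('o, 'm) cat, ('o, 'm, 'o, 'm) funct, ('o, 'm) universe topology, ('o, 'm) universe cmap) funct"

definition B :: "('o, 'm) space_functor" where
  "B = \<lparr>Src = Cat, Tgt = Top, OMap = restrict B_space (Obj Cat),
     AMap = restrict (\<lambda>H. (B_space (Src H), restrict (B_map H) (topspace (B_space (Src H))),
                          B_space (Tgt H))) (Arr Cat)\<rparr>"

definition Btilde :: "('o, 'm) space_functor" where
  "Btilde = \<lparr>Src = Cat, Tgt = Top, OMap = restrict Btilde_space (Obj Cat),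
     AMap = restrict (\<lambda>H. (Btilde_space (Src H),
                          restrict (Btilde_map H) (topspace (Btilde_space (Src H))),
                          Btilde_space (Tgt H))) (Arr Cat)\<rparr>"

end

theory Submission
  imports Defs
begin

text \<open>
  Everything rests on coordinates. Let \<open>C\<close> be a poset. A letter of a word is a strict step upwards, so
  a word with nested brackets amounts to a finite chain of objects together with the smaller chains
  at which the brackets of each level break (lemmas \<open>word_inject\<close> and \<open>word_exists\<close>). A \<open>k\<close>-simplex
  of the standard resolution between \<open>a\<close> and \<open>b\<close> is thus a flag \<open>S\<^sub>0 \<subseteq> \<dots> \<subseteq> S\<^sub>k\<close> of finite chains from \<open>a\<close>
  to \<open>b\<close>; faces omit a member, degeneracies repeat one, composition is union. A point of the
  realization is then a function \<open>w\<close> with values in \<open>[0,1]\<close> and support a finite chain, namely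
  \<open>w(c)\<close> is the total weight of the members of the flag that contain \<open>c\<close>. Adding the barycentric
  coordinates of the bar direction, a point of \<open>B\<close>-tilde becomes a pair \<open>(v,w)\<close>, where
  \<open>\<Sum>v = 1\<close>, where \<open>w = 1\<close> wherever \<open>v > 0\<close>, and where \<open>w\<close> lives between the least and the greatest
  object with \<open>v > 0\<close>. A point of \<open>BC\<close> is a function \<open>z \<ge> 0\<close> with \<open>\<Sum>z = 1\<close> and support a finite chain.

  The homeomorphism is \<open>z(c) \<sim> v(c) + w(c) \<theta>(c)\<close>, normalised to sum \<open>1\<close>, where \<open>\<theta>(c)\<close> is the minimum of
  the masses that \<open>v\<close> has strictly below and strictly above \<open>c\<close>. The factor \<open>\<theta>\<close> vanishes outside the
  convex hull of the support of \<open>v\<close>, which is where an outer face of the bar construction forgets \<open>w\<close>;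
  so \<open>z\<close> respects the gluing. It can be inverted because \<open>\<theta>(c)\<close> is also the minimum of the maxima of
  \<open>z\<close> strictly below and strictly above \<open>c\<close> (lemmas \<open>threshold\<close> and \<open>threshold_realized\<close>): knowing
  \<open>z\<close> one gets \<open>\<theta>\<close>, then \<open>v = max(0, z - \<theta>)\<close> and \<open>w = min(1, z / \<theta>)\<close> up to a common factor.

  A functor pushes \<open>z\<close> and \<open>v\<close> forward by sums over fibres, but \<open>w\<close> by maxima; this is why the
  homeomorphism is natural for inclusions only. To repair the rest, attach to a function \<open>\<kappa>\<close> on
  objects with convex fibres a map \<open>T\<^sub>\<kappa>\<close> (\<open>comparison\<close>) as above, in which the masses of
  \<open>\<theta>\<close> are taken in the other fibres of \<open>\<kappa>\<close> only and \<open>w(c)\<close> is replaced by its excess over the earlier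
  objects of the same fibre. The excesses telescope to the maximum, and hence
  \<open>B(h) \<circ> T\<^bsub>\<kappa>\<circ>h\<^esub> = T\<^sub>\<kappa> \<circ> B\<close>-tilde\<open>(h)\<close> for every order preserving \<open>h\<close> (lemma
  \<open>nerve_push_comparison\<close>); moreover \<open>T\<^sub>\<kappa>\<close> depends only on the fibres of \<open>\<kappa>\<close>. With \<open>a\<^sub>C = T\<^bsub>id\<^esub>\<close> and
  \<open>\<tau>\<^sub>f = T\<^sub>f\<close> the required pair is \<open>\<alpha>(f) = a \<circ> B\<close>-tilde\<open>(f)\<close>, \<open>t(f) = \<tau>\<^sub>f \<circ> a\<^sup>-\<^sup>1\<close>; its axioms are a formal
  consequence (lemma \<open>twisted_nat_iso_from_lifts\<close>).

  Topologically, both spaces are tested on cells: \<open>\<Delta>\<^sup>n\<close> for the nerve, \<open>\<Delta>\<^sup>k \<times> \<Delta>\<^sup>n\<close> for the bar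
  construction, the latter because a product with a compact Hausdorff space preserves quotient maps.
  On cells the formula for \<open>z\<close> is visibly continuous. No formula is needed for the continuity of the
  inverse: each simplex of \<open>BC\<close> is covered by the images of finitely many compact cells, so the
  continuous bijection \<open>T\<^bsub>id\<^esub>\<close> is a quotient map.
\<close>

section \<open>Maps out of sums, products and realizations\<close>

lemma continuous_map_from_sum_prod:
  assumes "\<And>i. i \<in> I \<Longrightarrow> continuous_map (prod_topology (X i) Z) Y (\<lambda>(x, z). g ((i, x), z))"
  shows "continuous_map (prod_topology (sum_topology X I) Z) Y g"
  unfolding continuous_map_def
proof (intro conjI allI impI)
  show "g \<in> topspace (prod_topology (sum_topology X I) Z) \<rightarrow> topspace Y"
    using assms[THEN continuous_map_funspace] by (fastforce simp: Pi_iff)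
next
  fix U assume U: "openin Y U"
  let ?W = "{p \<in> topspace (prod_topology (sum_topology X I) Z). g p \<in> U}"
  show "openin (prod_topology (sum_topology X I) Z) ?W"
    unfolding openin_prod_topology_alt
  proof (intro allI impI)
    fix p z assume "(p, z) \<in> ?W"
    then obtain i x where i: "i \<in> I" "p = (i, x)" "x \<in> topspace (X i)" "z \<in> topspace Z"
        "g ((i, x), z) \<in> U"
      by auto
    have "openin (prod_topology (X i) Z)
            {q \<in> topspace (prod_topology (X i) Z). (case q of (x, z) \<Rightarrow> g ((i, x), z)) \<in> U}"
      using assms[OF i(1)] U by (rule openin_continuous_map_preimage)
    then obtain A B where AB: "openin (X i) A" "openin Z B" "x \<in> A" "z \<in> B"
        "A \<times> B \<subseteq> {q \<in> topspace (prod_topology (X i) Z). (case q of (x, z) \<Rightarrow> g ((i, x), z)) \<in> U}"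
      using i unfolding openin_prod_topology_alt
      by (smt (verit, best) SigmaI case_prod_conv mem_Collect_eq topspace_prod_topology)
    have "open_map (X i) (sum_topology X I) (Pair i)"
      using open_map_component_injection[of i I X] i(1) by simp
    then have "openin (sum_topology X I) (Pair i ` A)"
      using AB(1) by (auto simp: open_map_def)
    moreover have "(Pair i ` A) \<times> B \<subseteq> ?W"
      using AB i(1) by auto
    ultimately show "\<exists>A B. openin (sum_topology X I) A \<and> openin Z B \<and> p \<in> A \<and> z \<in> B \<and> A \<times> B \<subseteq> ?W"
      using AB i(2) by blast
  qed
qed

lemma continuous_map_from_sum:
  assumes "\<And>i. i \<in> I \<Longrightarrow> continuous_map (X i) Y (\<lambda>x. g (i, x))"
  shows "continuous_map (sum_topology X I) Y g"
  unfolding continuous_map_def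
proof (intro conjI allI impI)
  show "g \<in> topspace (sum_topology X I) \<rightarrow> topspace Y"
    using assms[THEN continuous_map_funspace] by (fastforce simp: Pi_iff)
next
  fix U assume U: "openin Y U"
  show "openin (sum_topology X I) {x \<in> topspace (sum_topology X I). g x \<in> U}"
    unfolding openin_sum_topology
    using openin_continuous_map_preimage[OF assms U] by auto
qed

lemma continuous_map_from_discrete_prod:
  assumes "\<And>d. d \<in> D \<Longrightarrow> continuous_map Z Y (\<lambda>z. g (d, z))"
  shows "continuous_map (prod_topology (discrete_topology D) Z) Y g"
  unfolding continuous_map_def
proof (intro conjI allI impI)
  show "g \<in> topspace (prod_topology (discrete_topology D) Z) \<rightarrow> topspace Y"
    using assms[THEN continuous_map_funspace] by (fastforce simp: Pi_iff)
next
  fix U assume U: "openin Y U"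
  show "openin (prod_topology (discrete_topology D) Z)
          {p \<in> topspace (prod_topology (discrete_topology D) Z). g p \<in> U}"
    unfolding openin_prod_topology_alt
  proof (intro allI impI)
    fix d z assume dz: "(d, z) \<in> {p \<in> topspace (prod_topology (discrete_topology D) Z). g p \<in> U}"
    then have "openin Z {z \<in> topspace Z. g (d, z) \<in> U}"
      using openin_continuous_map_preimage[OF assms U] by auto
    then show "\<exists>A B. openin (discrete_topology D) A \<and> openin Z B \<and> d \<in> A \<and> z \<in> B \<and>
        A \<times> B \<subseteq> {p \<in> topspace (prod_topology (discrete_topology D) Z). g p \<in> U}"
      using dz by (intro exI[of _ "{d}"] exI[of _ "{z \<in> topspace Z. g (d, z) \<in> U}"]) auto
  qed
qed

lemma Hausdorff_space_simplex: "Hausdorff_space (simplex_topology n)"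
  by (simp add: Hausdorff_space_subtopology Hausdorff_space_product_topology)

lemma compact_space_simplex: "compact_space (simplex_topology n)"
  using compactin_standard_simplex compact_space_subtopology by blast

lemma topspace_simplex [simp]: "topspace (simplex_topology n) = standard_simplex n"
  by (rule topspace_standard_simplex)

text \<open>A simplex is compact Hausdorff, so the product with it is already compactly generated and
  the \<open>k\<close>-product is the ordinary one.\<close>

lemma k_prod_simplex:
  assumes "k_space X"
  shows "k_prod X (simplex_topology n) = prod_topology X (simplex_topology n)"
    and "k_space (prod_topology X (simplex_topology n))"
proof -
  show *: "k_space (prod_topology X (simplex_topology n))"
    using assms Hausdorff_space_simplex compact_space_simplex
    by (intro k_space_prod_topology_right) (auto intro: compact_imp_locally_compact_space)
  show "k_prod X (simplex_topology n) = prod_topology X (simplex_topology n)"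
    unfolding k_prod_def by (rule kification_eq[OF *])
qed

lemma k_space_sum_topology:
  assumes "\<And>i. i \<in> I \<Longrightarrow> k_space (X i)"
  shows "k_space (sum_topology X I)"
  unfolding k_space_alt
proof (intro allI impI iffI)
  fix S K assume "openin (sum_topology X I) S" "compactin (sum_topology X I) K"
  then show "openin (subtopology (sum_topology X I) K) (K \<inter> S)"
    by (simp add: openin_subtopology_Int2)
next
  fix S assume S: "S \<subseteq> topspace (sum_topology X I)"
    and *: "\<forall>K. compactin (sum_topology X I) K \<longrightarrow> openin (subtopology (sum_topology X I) K) (K \<inter> S)"
  have "openin (X i) {x. (i, x) \<in> S}" if i: "i \<in> I" for i
  proof -
    have "openin (subtopology (X i) K) (K \<inter> {x. (i, x) \<in> S})" if K: "compactin (X i) K" for K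
    proof -
      have c: "continuous_map (X i) (sum_topology X I) (Pair i)"
        using continuous_map_component_injection[of i I X] i by simp
      have "openin (subtopology (sum_topology X I) (Pair i ` K)) (Pair i ` K \<inter> S)"
        using * image_compactin[OF K c] by blast
      then obtain T where T: "openin (sum_topology X I) T" "Pair i ` K \<inter> S = T \<inter> Pair i ` K"
        by (auto simp: openin_subtopology)
      have "openin (X i) {x \<in> topspace (X i). (i, x) \<in> T}"
        using openin_continuous_map_preimage[OF c T(1)] by simp
      moreover have "K \<inter> {x. (i, x) \<in> S} = {x \<in> topspace (X i). (i, x) \<in> T} \<inter> K"
        using T(2) compactin_subset_topspace[OF K] by auto
      ultimately show ?thesis by (auto simp: openin_subtopology)
    qed
    moreover have "{x. (i, x) \<in> S} \<subseteq> topspace (X i)" using S by auto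
    ultimately show ?thesis using assms[OF i] unfolding k_space_alt by blast
  qed
  then show "openin (sum_topology X I) S"
    using S by (auto simp: openin_sum_topology)
qed

definition valid_point :: "'p sspace \<Rightarrow> 'p rpoint \<Rightarrow> bool" where
  "valid_point X a = (case a of (n, x, u) \<Rightarrow> x \<in> topspace (SpTop X n) \<and> u \<in> standard_simplex n)"

lemma valid_point_simp [simp]:
  "valid_point X (n, x, u) \<longleftrightarrow> x \<in> topspace (SpTop X n) \<and> u \<in> standard_simplex n"
  by (simp add: valid_point_def)

lemma rclass_eq_iff: "rclass X a = rclass X b \<longleftrightarrow> equivclp (glue X) a b"
  unfolding rclass_def
  by (auto intro: equivclp_sym equivclp_trans)

lemma rclass_self: "a \<in> rclass X a"
  by (simp add: rclass_def)

context
  fixes X :: "'p sspace"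
  assumes k: "\<And>n. k_space (SpTop X n)"
begin

lemma realization_eq:
  "realization X =
     image_topology (sum_topology (\<lambda>n. prod_topology (SpTop X n) (simplex_topology n)) UNIV) (rclass X)"
  unfolding realization_def by (simp add: k_prod_simplex k)

lemma topspace_realization: "topspace (realization X) = rclass X ` Collect (valid_point X)"
  unfolding realization_eq by (auto simp: valid_point_def image_iff)

lemma quotient_map_rclass:
  "quotient_map (sum_topology (\<lambda>n. prod_topology (SpTop X n) (simplex_topology n)) UNIV)
     (realization X) (rclass X)"
  unfolding realization_eq by (rule quotient_map_image_topology)

lemma k_space_realization: "k_space (realization X)"
  using quotient_map_rclass
  by (rule k_space_quotient_map_image) (simp add: k_space_sum_topology k_prod_simplex k)

lemma continuous_map_rclass:
  "continuous_map (prod_topology (SpTop X n) (simplex_topology n)) (realization X)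
     (\<lambda>(x, u). rclass X (n, x, u))"
proof -
  have "continuous_map (prod_topology (SpTop X n) (simplex_topology n))
          (sum_topology (\<lambda>n. prod_topology (SpTop X n) (simplex_topology n)) UNIV) (Pair n)"
    using continuous_map_component_injection[of n UNIV] by fastforce
  from continuous_map_compose[OF this quotient_imp_continuous_map[OF quotient_map_rclass]]
  show ?thesis by (simp add: o_def case_prod_unfold)
qed

lemma continuous_map_from_realization:
  assumes "\<And>n. continuous_map (prod_topology (SpTop X n) (simplex_topology n)) Y
                  (\<lambda>(x, u). g (rclass X (n, x, u)))"
  shows "continuous_map (realization X) Y g"
proof -
  have "continuous_map (sum_topology (\<lambda>n. prod_topology (SpTop X n) (simplex_topology n)) UNIV) Y
          (g \<circ> rclass X)"
    using assms by (intro continuous_map_from_sum) (simp add: case_prod_unfold)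
  then show ?thesis
    using continuous_compose_quotient_map[OF quotient_map_rclass] by blast
qed

text \<open>The product of a quotient map with a locally compact Hausdorff space is again a quotient
  map. This is what allows continuity on the realization of a simplicial space, whose levels are
  themselves realizations, to be tested on products of simplices.\<close>

lemma continuous_map_from_realization_prod:
  assumes Z: "locally_compact_space Z" "Hausdorff_space Z"
    and "\<And>n. continuous_map (prod_topology (prod_topology (SpTop X n) (simplex_topology n)) Z) Y
                  (\<lambda>((x, u), z). g (rclass X (n, x, u), z))"
  shows "continuous_map (prod_topology (realization X) Z) Y g"
proof -
  have "quotient_map
          (prod_topology (sum_topology (\<lambda>n. prod_topology (SpTop X n) (simplex_topology n)) UNIV) Z)
          (prod_topology (realization X) Z) (\<lambda>(x, z). (rclass X x, z))"
    using Z quotient_map_rclass by (intro quotient_map_prod_left) auto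
  moreover have "continuous_map
          (prod_topology (sum_topology (\<lambda>n. prod_topology (SpTop X n) (simplex_topology n)) UNIV) Z) Y
          (g \<circ> (\<lambda>(x, z). (rclass X x, z)))"
    using assms(3) by (intro continuous_map_from_sum_prod) (simp add: case_prod_unfold)
  ultimately show ?thesis
    using continuous_compose_quotient_map by blast
qed

end

lemma k_space_discrete_sspace [simp]: "k_space (SpTop (discrete_sspace X) n)"
  by (simp add: discrete_sspace_def k_space_discrete_topology)

lemma continuous_map_from_discrete_realization:
  assumes "\<And>n x. x \<in> Simp X n \<Longrightarrow>
     continuous_map (simplex_topology n) Y (\<lambda>u. g (rclass (discrete_sspace X) (n, x, u)))"
  shows "continuous_map (realization (discrete_sspace X)) Y g"
proof (rule continuous_map_from_realization)
  show "continuous_map (prod_topology (SpTop (discrete_sspace X) n) (simplex_topology n)) Y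
        (\<lambda>(x, u). g (rclass (discrete_sspace X) (n, x, u)))" for n
    using assms unfolding discrete_sspace_def sspace.select_convs
    by (intro continuous_map_from_discrete_prod) auto
qed simp

lemma continuous_map_from_discrete_realization_prod:
  assumes Z: "locally_compact_space Z" "Hausdorff_space Z"
    and *: "\<And>n x. x \<in> Simp X n \<Longrightarrow> continuous_map (prod_topology (simplex_topology n) Z) Y
           (\<lambda>(u, z). g (rclass (discrete_sspace X) (n, x, u), z))"
  shows "continuous_map (prod_topology (realization (discrete_sspace X)) Z) Y g"
proof (rule continuous_map_from_realization_prod[OF _ Z])
  fix n
  have "continuous_map (prod_topology (SpTop (discrete_sspace X) n) (prod_topology (simplex_topology n) Z)) Y
      (\<lambda>(x, u, z). g (rclass (discrete_sspace X) (n, x, u), z))"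
    using * unfolding discrete_sspace_def sspace.select_convs
    by (intro continuous_map_from_discrete_prod) auto
  moreover have "continuous_map (prod_topology (prod_topology (SpTop (discrete_sspace X) n) (simplex_topology n)) Z)
      (prod_topology (SpTop (discrete_sspace X) n) (prod_topology (simplex_topology n) Z))
      (\<lambda>((x, u), z). (x, u, z))"
    by (simp add: case_prod_unfold continuous_map_paired)
       (intro conjI continuous_map_fst_of continuous_map_snd_of continuous_map_fst continuous_map_snd
         continuous_map_compose[OF continuous_map_fst, unfolded o_def]; simp)
  ultimately have "continuous_map (prod_topology (prod_topology (SpTop (discrete_sspace X) n) (simplex_topology n)) Z) Y
      ((\<lambda>(x, u, z). g (rclass (discrete_sspace X) (n, x, u), z)) \<circ> (\<lambda>((x, u), z). (x, u, z)))"
    by (rule continuous_map_compose[rotated])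
  then show "continuous_map (prod_topology (prod_topology (SpTop (discrete_sspace X) n) (simplex_topology n)) Z) Y
        (\<lambda>((x, u), z). g (rclass (discrete_sspace X) (n, x, u), z))"
    by (simp add: o_def case_prod_unfold)
qed simp


section \<open>Simplicial maps\<close>

definition simplicial_map :: "'p sspace \<Rightarrow> 'q sspace \<Rightarrow> (nat \<Rightarrow> 'p \<Rightarrow> 'q) \<Rightarrow> bool" where
  "simplicial_map X Y \<phi> \<longleftrightarrow>
     (\<forall>n. \<forall>x\<in>topspace (SpTop X n). \<phi> n x \<in> topspace (SpTop Y n)) \<and>
     (\<forall>n i. \<forall>x\<in>topspace (SpTop X (Suc n)). i \<le> Suc n \<longrightarrow>
        \<phi> n (SpFace X (Suc n) i x) = SpFace Y (Suc n) i (\<phi> (Suc n) x)) \<and>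
     (\<forall>n i. \<forall>x\<in>topspace (SpTop X n). i \<le> n \<longrightarrow>
        \<phi> (Suc n) (SpDegen X n i x) = SpDegen Y n i (\<phi> n x))"

lemma simplicial_map_glue:
  assumes "simplicial_map X Y \<phi>" "equivclp (glue X) (n, x, u) (m, y, v)"
  shows "equivclp (glue Y) (n, \<phi> n x, u) (m, \<phi> m y, v)"
proof -
  define F where "F = (\<lambda>(n, x, u :: nat \<Rightarrow> real). (n, \<phi> n x, u))"
  have g: "glue Y (F a) (F b)" if "glue X a b" for a b
    using that
  proof cases
    case (face x n u i)
    then show ?thesis
      using assms(1) glue.face[of "\<phi> (Suc n) x" Y n u i] by (auto simp: simplicial_map_def F_def)
  next
    case (degen x n u i)
    then show ?thesis
      using assms(1) glue.degen[of "\<phi> n x" Y n u i] by (auto simp: simplicial_map_def F_def)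
  qed
  have "equivclp (glue Y) (F (n, x, u)) (F (m, y, v))"
    using assms(2)
  proof (induction rule: equivclp_induct)
    case (step b c)
    then show ?case using g by (meson converse_r_into_equivclp equivclp_trans r_into_equivclp)
  qed simp
  then show ?thesis by (simp add: F_def)
qed

text \<open>The union that defines \<^const>\<open>realization_map\<close> is over equal classes, as a simplicial map
  sends glued points to glued points.\<close>

lemma realization_map_rclass:
  assumes "simplicial_map X Y \<phi>"
  shows "realization_map Y \<phi> (rclass X (n, x, u)) = rclass Y (n, \<phi> n x, u)"
proof -
  have "rclass Y (m, \<phi> m y, v) = rclass Y (n, \<phi> n x, u)" if "(m, y, v) \<in> rclass X (n, x, u)" for m y v
    using simplicial_map_glue[OF assms, of n x u m y v] that
    by (simp add: rclass_eq_iff) (simp add: rclass_def equivclp_sym)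
  then have "realization_map Y \<phi> (rclass X (n, x, u)) = (\<Union>a\<in>rclass X (n, x, u). rclass Y (n, \<phi> n x, u))"
    unfolding realization_map_def by (intro SUP_cong refl) (auto split: prod.split)
  moreover have "rclass X (n, x, u) \<noteq> {}"
    using rclass_self by blast
  ultimately show ?thesis by simp
qed


section \<open>Simplicial spaces with vertices in an ordered set\<close>

text \<open>The index \<open>k\<close> is split off and the others are renumbered in the manner of the coface map;
  both invariance computations for barycentric coordinates reduce to this.\<close>

lemma sum_skip:
  fixes h :: "nat \<Rightarrow> 'a::comm_monoid_add"
  assumes "k \<le> Suc n"
  shows "sum h {..Suc n} = h k + (\<Sum>j\<le>n. h (if j < k then j else Suc j))"
proof -
  let ?s = "\<lambda>j. if j < k then j else Suc j"
  have "{..Suc n} = insert k (?s ` {..n})"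
  proof (intro Set.set_eqI iffI)
    fix x assume x: "x \<in> {..Suc n}"
    show "x \<in> insert k (?s ` {..n})"
    proof (cases "x < k")
      case True
      then have "x = ?s x" "x \<in> {..n}" using assms by auto
      then show ?thesis by blast
    next
      case False
      show ?thesis
      proof (cases "x = k")
        case False
        with \<open>\<not> x < k\<close> x have "x = ?s (x - 1)" "x - 1 \<in> {..n}" by auto
        then show ?thesis by blast
      qed simp
    qed
  qed (use assms in \<open>auto split: if_splits\<close>)
  moreover have "k \<notin> ?s ` {..n}" by auto
  moreover have "inj_on ?s {..n}" by (auto simp: inj_on_def split: if_splits)
  ultimately have "sum h {..Suc n} = h k + sum h (?s ` {..n})"
    by (simp only: sum.insert finite_imageI finite_atMost not_False_eq_True)
  then show ?thesis
    using sum.reindex[OF \<open>inj_on ?s {..n}\<close>, of h] by (simp add: o_def)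
qed

lemma sum_simplical_face:
  assumes "k \<le> Suc n"
  shows "(\<Sum>j\<le>Suc n. h j * simplical_face k u j) =
    (\<Sum>j\<le>n. h (if j < k then j else Suc j) * (u j :: real))"
proof -
  have "(\<Sum>j\<le>n. h (if j < k then j else Suc j) * simplical_face k u (if j < k then j else Suc j)) =
        (\<Sum>j\<le>n. h (if j < k then j else Suc j) * (u j :: real))"
    by (intro sum.cong refl) (auto simp: simplical_face_def)
  then show ?thesis
    by (subst sum_skip[OF assms]) (simp add: simplical_face_def)
qed

lemma sum_codegeneracy:
  assumes "i \<le> n"
  shows "(\<Sum>j\<le>Suc n. h (if j \<le> i then j else j - 1) * u j) = (\<Sum>j\<le>n. h j * codegeneracy i u j)"
proof -
  let ?g = "\<lambda>j. h (if j \<le> i then j else j - 1) * u j"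
  have "(\<Sum>j\<le>Suc n. ?g j) = h i * u (Suc i) + (\<Sum>j\<le>n. ?g (if j < Suc i then j else Suc j))"
    using sum_skip[of "Suc i" n ?g] assms by simp
  also have "(\<Sum>j\<le>n. ?g (if j < Suc i then j else Suc j)) =
      (\<Sum>j\<le>n. h j * codegeneracy i u j - (if j = i then h i * u (Suc i) else 0))"
    by (intro sum.cong refl) (auto simp: codegeneracy_def algebra_simps)
  also have "\<dots> = (\<Sum>j\<le>n. h j * codegeneracy i u j) - h i * u (Suc i)"
    using assms by (simp add: sum_subtractf)
  finally show ?thesis by simp
qed

lemma standard_simplex_iff:
  "u \<in> standard_simplex n \<longleftrightarrow> (\<forall>i. 0 \<le> u i) \<and> (\<forall>i>n. u i = 0) \<and> sum u {..n} = 1"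
proof -
  have "u i \<le> 1" if "\<forall>i. 0 \<le> u i" "\<forall>i>n. u i = 0" "sum u {..n} = 1" for i
    using that member_le_sum[of i "{..n}" u] by (cases "i \<le> n") auto
  then show ?thesis by (auto simp: standard_simplex_def)
qed

lemma codegeneracy_in_standard_simplex:
  assumes "u \<in> standard_simplex (Suc n)" "i \<le> n"
  shows "codegeneracy i u \<in> standard_simplex n"
  using assms sum_codegeneracy[of i n "\<lambda>_. 1" u]
  unfolding standard_simplex_iff by (auto simp: codegeneracy_def)

text \<open>By strong induction: if \<open>f i\<close> is \<open>g k\<close> and \<open>g i\<close> is \<open>f l\<close>, then agreement below \<open>i\<close> excludes
  \<open>k < i\<close> and \<open>l < i\<close>, and asymmetry excludes that both are greater than \<open>i\<close>.\<close>

lemma strictly_increasing_enumeration_unique: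
  fixes f g :: "nat \<Rightarrow> 'a" and lt :: "'a \<Rightarrow> 'a \<Rightarrow> bool"
  assumes asym: "\<And>x y. lt x y \<Longrightarrow> \<not> lt y x"
    and f: "\<And>i j. i < j \<Longrightarrow> j \<le> n \<Longrightarrow> lt (f i) (f j)"
    and g: "\<And>i j. i < j \<Longrightarrow> j \<le> m \<Longrightarrow> lt (g i) (g j)"
    and eq: "f ` {..n} = g ` {..m}"
  shows "n = m \<and> (\<forall>i\<le>n. f i = g i)"
proof -
  have inj: "inj_on h {..k}" if "\<And>i j. i < j \<Longrightarrow> j \<le> k \<Longrightarrow> lt (h i) (h j)" for h :: "nat \<Rightarrow> 'a" and k
    unfolding inj_on_def by (metis asym atMost_iff linorder_less_linear that)
  have nm: "n = m"
    using card_image[OF inj[of n f, OF f]] card_image[OF inj[of m g, OF g]] eq by simp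
  have "f i = g i" if "i \<le> n" for i
    using that
  proof (induction i rule: less_induct)
    case (less i)
    obtain k where k: "k \<le> m" "f i = g k" using eq less.prems by blast
    obtain l where l: "l \<le> n" "g i = f l" using eq less.prems nm by (metis atMost_iff imageE image_eqI)
    have "\<not> k < i"
    proof
      assume "k < i"
      then have "f k = f i" using less k by simp
      then show False using f[of k i] asym \<open>k < i\<close> less.prems by metis
    qed
    moreover have "\<not> l < i"
    proof
      assume "l < i"
      then have "g l = g i" using less l by simp
      then show False using g[of l i] asym \<open>l < i\<close> less.prems nm by metis
    qed
    moreover have "\<not> (i < k \<and> i < l)" using f[of i l] g[of i k] asym k l by metis
    ultimately show ?case using k l by (metis linorder_neqE_nat)
  qed
  with nm show ?thesis by simp
qed

text \<open>With \<open>F\<close> the indicator of a vertex \<open>p\<close> this is the barycentric coordinate at \<open>p\<close>. Other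
  functions \<open>F\<close> occur when the vertices are sets: the indicator of \<open>p \<in> S\<close> gives the weight \<open>w(p)\<close>.\<close>

definition vertex_sum :: "('x \<Rightarrow> nat \<Rightarrow> 'p) \<Rightarrow> ('p \<Rightarrow> real) \<Rightarrow> 'x rpoint \<Rightarrow> real" where
  "vertex_sum V F a = (case a of (n, x, u) \<Rightarrow> \<Sum>i\<le>n. F (V x i) * u i)"

text \<open>The value does not depend on the chosen representative, by \<open>vertex_coord_rclass\<close> below.\<close>

definition vertex_coord :: "('x \<Rightarrow> nat \<Rightarrow> 'p) \<Rightarrow> ('p \<Rightarrow> real) \<Rightarrow> 'x rpoint set \<Rightarrow> real" where
  "vertex_coord V F c = vertex_sum V F (SOME a. a \<in> c)"

text \<open>\<open>V x i\<close> plays the role of the \<open>i\<close>-th vertex of \<open>x\<close>. It behaves like one under faces and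
  degeneracies, which makes all \<^const>\<open>vertex_sum\<close>s invariant under the gluing.\<close>

locale vertexed =
  fixes X :: "'x sspace" and V :: "'x \<Rightarrow> nat \<Rightarrow> 'p"
  assumes face_in: "\<And>n i x. x \<in> topspace (SpTop X (Suc n)) \<Longrightarrow> i \<le> Suc n \<Longrightarrow>
      SpFace X (Suc n) i x \<in> topspace (SpTop X n)"
    and degen_in: "\<And>n i x. x \<in> topspace (SpTop X n) \<Longrightarrow> i \<le> n \<Longrightarrow>
      SpDegen X n i x \<in> topspace (SpTop X (Suc n))"
    and V_face: "\<And>n i x j. x \<in> topspace (SpTop X (Suc n)) \<Longrightarrow> i \<le> Suc n \<Longrightarrow> j \<le> n \<Longrightarrow>
      V (SpFace X (Suc n) i x) j = V x (if j < i then j else Suc j)"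
    and V_degen: "\<And>n i x j. x \<in> topspace (SpTop X n) \<Longrightarrow> i \<le> n \<Longrightarrow> j \<le> Suc n \<Longrightarrow>
      V (SpDegen X n i x) j = V x (if j \<le> i then j else j - 1)"
begin

lemma vertex_sum_glue:
  assumes "glue X a b"
  shows "vertex_sum V F a = vertex_sum V F b"
  using assms
proof cases
  case (face x n u i)
  have "(\<Sum>j\<le>n. F (V (SpFace X (Suc n) i x) j) * u j) =
      (\<Sum>j\<le>n. F (V x (if j < i then j else Suc j)) * u j)"
    using face by (intro sum.cong) (auto simp: V_face)
  then show ?thesis
    using face sum_simplical_face[of i n "\<lambda>j. F (V x j)" u] by (simp add: vertex_sum_def del: sum.atMost_Suc)
next
  case (degen x n u i)
  have "(\<Sum>j\<le>Suc n. F (V (SpDegen X n i x) j) * u j) =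
      (\<Sum>j\<le>Suc n. F (V x (if j \<le> i then j else j - 1)) * u j)"
    using degen by (intro sum.cong) (auto simp: V_degen)
  then show ?thesis
    using degen sum_codegeneracy[of i n "\<lambda>j. F (V x j)" u] by (simp add: vertex_sum_def del: sum.atMost_Suc)
qed

lemma vertex_sum_equivclp: "equivclp (glue X) a b \<Longrightarrow> vertex_sum V F a = vertex_sum V F b"
  by (induction rule: equivclp_induct) (auto simp: vertex_sum_glue)

lemma vertex_coord_rclass: "vertex_coord V F (rclass X a) = vertex_sum V F a"
  unfolding vertex_coord_def
  by (metis (mono_tags, lifting) mem_Collect_eq rclass_def rclass_self someI_ex vertex_sum_equivclp)

end

text \<open>If the vertices of a simplex increase, and a repeated vertex forces a degeneracy, then every point
  of the realization has a representative with strictly increasing vertices and positive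
  coordinates, and its vertices and coordinates can be read off from the barycentric coordinates.
  Only the simplex itself may still be ambiguous: in the bar construction it carries more data than
  its vertices.\<close>

locale vertexed_poset = vertexed X V for X :: "'x sspace" and V :: "'x \<Rightarrow> nat \<Rightarrow> 'p" +
  fixes le :: "'p \<Rightarrow> 'p \<Rightarrow> bool"
  assumes le_trans: "\<And>p q r. le p q \<Longrightarrow> le q r \<Longrightarrow> le p r"
    and le_antisym: "\<And>p q. le p q \<Longrightarrow> le q p \<Longrightarrow> p = q"
    and le_V: "\<And>n x i. x \<in> topspace (SpTop X n) \<Longrightarrow> i < n \<Longrightarrow> le (V x i) (V x (Suc i))"
    and degenerate: "\<And>n x i. x \<in> topspace (SpTop X (Suc n)) \<Longrightarrow> i \<le> n \<Longrightarrow> V x i = V x (Suc i) \<Longrightarrow>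
      \<exists>y\<in>topspace (SpTop X n). x = SpDegen X n i y"
begin

definition reduced :: "'x rpoint \<Rightarrow> bool" where
  "reduced a = (case a of (n, x, u) \<Rightarrow> x \<in> topspace (SpTop X n) \<and> u \<in> standard_simplex n \<and>
     (\<forall>i\<le>n. 0 < u i) \<and> (\<forall>i<n. V x i \<noteq> V x (Suc i)))"

lemma exists_reduced:
  assumes "valid_point X a"
  shows "\<exists>b. reduced b \<and> rclass X a = rclass X b"
proof -
  have "\<exists>b. reduced b \<and> rclass X (n, x, u) = rclass X b"
    if "x \<in> topspace (SpTop X n)" "u \<in> standard_simplex n" for n x u
    using that
  proof (induction n arbitrary: x u)
    case 0
    then have "reduced (0, x, u)" by (auto simp: reduced_def standard_simplex_iff)
    then show ?case by blast
  next
    case (Suc n)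
    consider (zero) i where "i \<le> Suc n" "u i = 0"
      | (eq) i where "i \<le> n" "V x i = V x (Suc i)"
      | (red) "reduced (Suc n, x, u)"
    proof -
      have "0 \<le> u i" for i using Suc.prems(2) by (simp add: standard_simplex_iff)
      then have "reduced (Suc n, x, u)"
        if "\<forall>i\<le>Suc n. u i \<noteq> 0" "\<forall>i\<le>n. V x i \<noteq> V x (Suc i)"
        using that Suc.prems unfolding reduced_def by (auto simp: less_le)
      then show ?thesis using that by blast
    qed
    then show ?case
    proof cases
      case zero
      define u' where "u' = (\<lambda>j. u (if j < i then j else Suc j))"
      have u: "u = simplical_face i u'"
        using zero by (auto simp: u'_def simplical_face_def fun_eq_iff)
      have "u' \<in> standard_simplex n"
        using Suc.prems(2) zero sum_skip[of i n u] unfolding standard_simplex_iff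
        by (auto simp: u'_def)
      moreover from this have "glue X (n, SpFace X (Suc n) i x, u') (Suc n, x, u)"
        using Suc.prems zero u glue.face by metis
      ultimately show ?thesis
        using Suc.IH[of "SpFace X (Suc n) i x" u'] Suc.prems zero
        by (metis face_in converse_r_into_equivclp rclass_eq_iff)
    next
      case eq
      then obtain y where y: "y \<in> topspace (SpTop X n)" "x = SpDegen X n i y"
        using degenerate Suc.prems by blast
      then have "glue X (Suc n, x, u) (n, y, codegeneracy i u)"
        using glue.degen[of y X n u i] Suc.prems eq by simp
      then show ?thesis
        using Suc.IH[of y "codegeneracy i u"] y codegeneracy_in_standard_simplex Suc.prems eq
        by (metis r_into_equivclp rclass_eq_iff)
    next
      case red
      then show ?thesis by blast
    qed
  qed
  then show ?thesis using assms by (cases a) (auto simp: valid_point_def)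
qed

lemma le_V_le:
  assumes "x \<in> topspace (SpTop X n)" "i < j" "j \<le> n"
  shows "le (V x i) (V x j)"
  using assms(2,3)
proof (induction j)
  case (Suc j)
  then show ?case using le_V[OF assms(1), of j] le_trans
    by (metis Suc_le_lessD less_Suc_eq order_less_imp_le)
qed simp

lemma reduced_strict:
  assumes "reduced (n, x, u)" "i < j" "j \<le> n"
  shows "le (V x i) (V x j) \<and> V x i \<noteq> V x j"
proof -
  have x: "x \<in> topspace (SpTop X n)" and ne: "V x i \<noteq> V x (Suc i)"
    using assms by (auto simp: reduced_def)
  have "le (V x i) (V x (Suc i))" using le_V[OF x] assms by simp
  moreover have "Suc i = j \<or> le (V x (Suc i)) (V x j)" using le_V_le[OF x, of "Suc i" j] assms by linarith
  ultimately show ?thesis using ne le_antisym le_trans by metis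
qed

lemma vertex_sum_reduced:
  assumes "reduced (n, x, u)" "i \<le> n"
  shows "vertex_sum V (\<lambda>q. of_bool (q = V x i)) (n, x, u) = u i"
proof -
  have "of_bool (V x j = V x i) * u j = (if j = i then u i else 0)" if "j \<le> n" for j
    using reduced_strict[OF assms(1)] that assms(2) by (cases j i rule: linorder_cases) fastforce+
  then have "vertex_sum V (\<lambda>q. of_bool (q = V x i)) (n, x, u) = (\<Sum>j\<le>n. if j = i then u i else 0)"
    unfolding vertex_sum_def prod.case by (intro sum.cong) simp_all
  then show ?thesis using assms(2) by simp
qed

lemma vertex_sum_pos_iff:
  assumes "reduced (n, x, u)"
  shows "0 < vertex_sum V (\<lambda>q. of_bool (q = p)) (n, x, u) \<longleftrightarrow> p \<in> V x ` {..n}"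
proof
  show "p \<in> V x ` {..n}" if "0 < vertex_sum V (\<lambda>q. of_bool (q = p)) (n, x, u)"
  proof (rule ccontr)
    assume "p \<notin> V x ` {..n}"
    then have "vertex_sum V (\<lambda>q. of_bool (q = p)) (n, x, u) = 0"
      unfolding vertex_sum_def by (auto intro!: sum.neutral)
    with that show False by simp
  qed
  show "0 < vertex_sum V (\<lambda>q. of_bool (q = p)) (n, x, u)" if "p \<in> V x ` {..n}"
    using that vertex_sum_reduced[OF assms] assms by (auto simp: reduced_def)
qed

lemma reduced_unique:
  assumes a: "reduced (n, x, u)" and b: "reduced (m, y, v)"
    and eq: "\<And>p. vertex_sum V (\<lambda>q. of_bool (q = p)) (n, x, u) = vertex_sum V (\<lambda>q. of_bool (q = p)) (m, y, v)"
  shows "n = m" "i \<le> n \<Longrightarrow> V x i = V y i" "u = v"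
proof -
  have "V x ` {..n} = V y ` {..m}"
    using vertex_sum_pos_iff[OF a] vertex_sum_pos_iff[OF b] eq by (metis subsetI subset_antisym)
  then have *: "n = m \<and> (\<forall>i\<le>n. V x i = V y i)"
    using reduced_strict[OF a] reduced_strict[OF b] le_antisym
    by (intro strictly_increasing_enumeration_unique[of "\<lambda>p q. le p q \<and> p \<noteq> q"]) auto
  then show "n = m" "i \<le> n \<Longrightarrow> V x i = V y i" by auto
  have "u i = v i" for i
  proof (cases "i \<le> n")
    case True
    then show ?thesis using vertex_sum_reduced[OF a] vertex_sum_reduced[OF b] eq * by metis
  next
    case False
    then show ?thesis using a b * by (auto simp: reduced_def standard_simplex_iff)
  qed
  then show "u = v" ..
qed

end

text \<open>In a simplicial set whose simplices are determined by their vertices, a repeated vertex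
  does force a degeneracy, as \<open>s\<^sub>i d\<^sub>i x\<close> has the vertices of \<open>x\<close>; and the barycentric coordinates
  determine the point.\<close>

locale vertexed_sset = vertexed "discrete_sspace X" V
  for X :: "'x sset" and V :: "'x \<Rightarrow> nat \<Rightarrow> 'p" +
  fixes le :: "'p \<Rightarrow> 'p \<Rightarrow> bool"
  assumes trans: "\<And>p q r. le p q \<Longrightarrow> le q r \<Longrightarrow> le p r"
    and antisym: "\<And>p q. le p q \<Longrightarrow> le q p \<Longrightarrow> p = q"
    and increasing: "\<And>n x i. x \<in> Simp X n \<Longrightarrow> i < n \<Longrightarrow> le (V x i) (V x (Suc i))"
    and V_inject: "\<And>n x y. x \<in> Simp X n \<Longrightarrow> y \<in> Simp X n \<Longrightarrow> (\<And>i. i \<le> n \<Longrightarrow> V x i = V y i) \<Longrightarrow> x = y"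
begin

lemma Simp_face: "x \<in> Simp X (Suc n) \<Longrightarrow> i \<le> Suc n \<Longrightarrow> Face X (Suc n) i x \<in> Simp X n"
  and Simp_degen: "x \<in> Simp X n \<Longrightarrow> i \<le> n \<Longrightarrow> Degen X n i x \<in> Simp X (Suc n)"
  and V_Face: "x \<in> Simp X (Suc n) \<Longrightarrow> i \<le> Suc n \<Longrightarrow> j \<le> n \<Longrightarrow>
      V (Face X (Suc n) i x) j = V x (if j < i then j else Suc j)"
  and V_Degen: "x \<in> Simp X n \<Longrightarrow> i \<le> n \<Longrightarrow> j \<le> Suc n \<Longrightarrow>
      V (Degen X n i x) j = V x (if j \<le> i then j else j - 1)"
  using face_in[of x n i] degen_in[of x n i] V_face[of x n i j] V_degen[of x n i j]
  by (simp_all add: discrete_sspace_def)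

sublocale vertexed_poset "discrete_sspace X" V le
proof
  fix n x i assume x: "x \<in> topspace (SpTop (discrete_sspace X) (Suc n))" and i: "i \<le> n"
    and eq: "V x i = V x (Suc i)"
  from x have x: "x \<in> Simp X (Suc n)" by (simp add: discrete_sspace_def)
  have y: "Face X (Suc n) i x \<in> Simp X n" using Simp_face x i by simp
  have "V (Degen X n i (Face X (Suc n) i x)) j = V x j" if "j \<le> Suc n" for j
  proof -
    have "(if j \<le> i then j else j - 1) \<le> n" using that i by auto
    then have "V (Degen X n i (Face X (Suc n) i x)) j =
      V x (if (if j \<le> i then j else j - 1) < i then (if j \<le> i then j else j - 1)
           else Suc (if j \<le> i then j else j - 1))"
      using V_Degen[OF y i that] V_Face[OF x, of i "if j \<le> i then j else j - 1"] i by simp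
    then show ?thesis using eq by (cases j i rule: linorder_cases) auto
  qed
  then have "x = Degen X n i (Face X (Suc n) i x)"
    using V_inject[OF x Simp_degen[OF y i]] by metis
  then show "\<exists>y\<in>topspace (SpTop (discrete_sspace X) n). x = SpDegen (discrete_sspace X) n i y"
    using y by (auto simp: discrete_sspace_def)
qed (use trans antisym increasing in \<open>auto simp: discrete_sspace_def\<close>)

lemma rclass_eqI:
  assumes "valid_point (discrete_sspace X) a" "valid_point (discrete_sspace X) b"
    and "\<And>p. vertex_sum V (\<lambda>q. of_bool (q = p)) a = vertex_sum V (\<lambda>q. of_bool (q = p)) b"
  shows "rclass (discrete_sspace X) a = rclass (discrete_sspace X) b"
proof -
  obtain a' where a': "reduced a'" "rclass (discrete_sspace X) a = rclass (discrete_sspace X) a'"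
    using exists_reduced assms(1) by blast
  obtain b' where b': "reduced b'" "rclass (discrete_sspace X) b = rclass (discrete_sspace X) b'"
    using exists_reduced assms(2) by blast
  obtain n x u where [simp]: "a' = (n, x, u)" by (cases a')
  obtain m y v where [simp]: "b' = (m, y, v)" by (cases b')
  have "vertex_sum V (\<lambda>q. of_bool (q = p)) (n, x, u) = vertex_sum V (\<lambda>q. of_bool (q = p)) (m, y, v)" for p
    using assms(3) vertex_coord_rclass a'(2) b'(2) \<open>a' = _\<close> \<open>b' = _\<close> by metis
  from reduced_unique[OF _ _ this] a'(1) b'(1)
  have "n = m" "u = v" "\<And>i. i \<le> n \<Longrightarrow> V x i = V y i" by auto
  moreover from this have "x = y"
    using a'(1) b'(1) unfolding reduced_def
    by (intro V_inject[of _ n]) (auto simp: discrete_sspace_def)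
  ultimately show ?thesis using a' b' by simp
qed

end

text \<open>The simplicial identities hold because both sides have the same vertices. All maps between
  nerves and between spaces of words are treated in this way, so that no identity between words has
  to be checked directly.\<close>

lemma simplicial_map_vertexwise:
  fixes le :: "'p \<Rightarrow> 'p \<Rightarrow> bool" and le' :: "'q \<Rightarrow> 'q \<Rightarrow> bool"
  assumes "vertexed_sset X V le" "vertexed_sset Y W le'"
    and in_Y: "\<And>n x. x \<in> Simp X n \<Longrightarrow> \<phi> n x \<in> Simp Y n"
    and h: "\<And>n x i. x \<in> Simp X n \<Longrightarrow> i \<le> n \<Longrightarrow> W (\<phi> n x) i = h (V x i)"
  shows "simplicial_map (discrete_sspace X) (discrete_sspace Y) \<phi>"
proof -
  interpret X: vertexed_sset X V le by fact
  interpret Y: vertexed_sset Y W le' by fact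
  have "\<phi> n (Face X (Suc n) i x) = Face Y (Suc n) i (\<phi> (Suc n) x)" if "x \<in> Simp X (Suc n)" "i \<le> Suc n" for n i x
    using that by (intro Y.V_inject[of _ n]) (auto simp: in_Y X.Simp_face Y.Simp_face h X.V_Face Y.V_Face)
  moreover have "\<phi> (Suc n) (Degen X n i x) = Degen Y n i (\<phi> n x)" if "x \<in> Simp X n" "i \<le> n" for n i x
    using that by (intro Y.V_inject[of _ "Suc n"]) (auto simp: in_Y X.Simp_degen Y.Simp_degen h X.V_Degen Y.V_Degen)
  ultimately show ?thesis
    using in_Y by (simp add: simplicial_map_def discrete_sspace_def)
qed

section \<open>Chains in a poset category\<close>

definition arr_le :: "('o, 'm) cat \<Rightarrow> 'o \<Rightarrow> 'o \<Rightarrow> bool" where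
  "arr_le C x y \<longleftrightarrow> hom_set C x y \<noteq> {}"

definition chain_in :: "('o, 'm) cat \<Rightarrow> 'o \<Rightarrow> 'o \<Rightarrow> 'o set \<Rightarrow> bool" where
  "chain_in C a b S \<longleftrightarrow> finite S \<and> a \<in> S \<and> b \<in> S \<and> S \<subseteq> Obj C \<and>
     (\<forall>p\<in>S. arr_le C a p \<and> arr_le C p b) \<and> (\<forall>p\<in>S. \<forall>q\<in>S. arr_le C p q \<or> arr_le C q p)"

locale poset_cat =
  fixes C :: "('o, 'm) cat"
  assumes poset: "poset_category C"
begin

lemma cat: "category C"
  using poset by (simp add: poset_category_def)

lemma arr_le_Obj: "arr_le C x y \<Longrightarrow> x \<in> Obj C \<and> y \<in> Obj C"
  using cat by (auto simp: arr_le_def category_def hom_set_def)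

lemma arr_le_refl: "x \<in> Obj C \<Longrightarrow> arr_le C x x"
  using cat by (auto simp: arr_le_def category_def)

lemma arr_le_trans: "arr_le C x y \<Longrightarrow> arr_le C y z \<Longrightarrow> arr_le C x z"
  using cat unfolding arr_le_def category_def hom_set_def by blast

lemma arr_le_antisym: "arr_le C x y \<Longrightarrow> arr_le C y x \<Longrightarrow> x = y"
  using poset arr_le_Obj by (auto simp: arr_le_def poset_category_def)

lemma arrow_unique: "f \<in> hom_set C x y \<Longrightarrow> g \<in> hom_set C x y \<Longrightarrow> f = g"
  using poset arr_le_Obj[of x y] unfolding poset_category_def arr_le_def by blast

lemma chain_in_Un:
  assumes "chain_in C a b S" "chain_in C b c T"
  shows "chain_in C a c (S \<union> T)"
  using assms unfolding chain_in_def by (auto intro: arr_le_trans)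

lemma chain_in_self: "chain_in C a a S \<Longrightarrow> S = {a}"
  unfolding chain_in_def by (auto intro: arr_le_antisym)

lemma chain_in_pair: "arr_le C a b \<Longrightarrow> chain_in C a b {a, b}"
  unfolding chain_in_def using arr_le_Obj arr_le_refl by auto

lemma chain_in_arr_le: "chain_in C a b S \<Longrightarrow> arr_le C a b"
  unfolding chain_in_def by blast

lemma chain_in_lower: "chain_in C a c S \<Longrightarrow> b \<in> S \<Longrightarrow> chain_in C a b {p \<in> S. arr_le C p b}"
  unfolding chain_in_def using arr_le_refl by auto

lemma chain_in_upper: "chain_in C a c S \<Longrightarrow> b \<in> S \<Longrightarrow> chain_in C b c {p \<in> S. arr_le C b p}"
  unfolding chain_in_def using arr_le_refl by auto

end

section \<open>The objects visited by a word\<close>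

text \<open>\<open>visited C l x\<close> collects the objects at which the bracketed word \<open>x\<close> can be cut when its
  brackets are opened down to depth \<open>l\<close>. At depth \<open>0\<close> only the two ends are seen, and once the letters
  of the original category are reached nothing more can be opened.\<close>

fun visited :: "('o, 'm) cat \<Rightarrow> nat \<Rightarrow> ('o, 'm) word \<Rightarrow> 'o set" where
  "visited C l (Letter f) = {Dom C f, Cod C f}"
| "visited C 0 (Word c fs d) = {c, d}"
| "visited C (Suc l) (Word c fs d) = {c, d} \<union> \<Union> (visited C l ` set fs)"

text \<open>The same set for a composable list of words that is not enclosed in a bracket.\<close>

definition path_visited :: "('o, 'm) cat \<Rightarrow> nat \<Rightarrow> 'o \<Rightarrow> ('o, 'm) word list \<Rightarrow> 'o \<Rightarrow> 'o set" where
  "path_visited C l c fs d = {c, d} \<union> \<Union> (visited C l ` set fs)"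

lemma visited_Suc_Word: "visited C (Suc l) (Word c fs d) = path_visited C l c fs d"
  by (simp add: path_visited_def)

lemma free_pow_0: "free_pow 0 C = letter_cat C"
  by (simp add: free_pow_def)

lemma free_pow_Suc: "free_pow (Suc n) C = free_cat (free_pow n C)"
  by (simp add: free_pow_def)

lemma free_cat_simps [simp]:
  "Obj (free_cat E) = Obj E" "Dom (free_cat E) = wsrc" "Cod (free_cat E) = wtgt"
  "Idn (free_cat E) c = Word c [] c"
  "Comp (free_cat E) v w = Word (wsrc w) (wlist w @ wlist v) (wtgt v)"
  by (simp_all add: free_cat_def)

lemma letter_cat_simps [simp]:
  "Obj (letter_cat C) = Obj C" "Arr (letter_cat C) = Letter ` Arr C"
  "Dom (letter_cat C) (Letter f) = Dom C f" "Cod (letter_cat C) (Letter f) = Cod C f"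
  "Idn (letter_cat C) c = Letter (Idn C c)"
  "Comp (letter_cat C) (Letter g) (Letter f) = Letter (Comp C g f)"
  by (simp_all add: letter_cat_def)

lemma Obj_free_pow [simp]: "Obj (free_pow n C) = Obj C"
  by (induction n) (simp_all add: free_pow_0 free_pow_Suc)

lemma Arr_free_cat:
  "w \<in> Arr (free_cat E) \<longleftrightarrow>
     (\<exists>c fs d. w = Word c fs d \<and> is_path E c fs d \<and> (\<forall>f\<in>set fs. \<not> is_identity E f))"
  by (auto simp: free_cat_def)

lemma hom_free_cat:
  "w \<in> hom_set (free_cat E) c d \<longleftrightarrow>
     (\<exists>fs. w = Word c fs d \<and> is_path E c fs d \<and> (\<forall>f\<in>set fs. \<not> is_identity E f))"
  by (auto simp: hom_set_def Arr_free_cat)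

lemma is_path_append:
  "is_path E c fs d \<Longrightarrow> is_path E d gs e \<Longrightarrow> is_path E c (fs @ gs) e"
  by (induction fs arbitrary: c) auto

context poset_cat
begin

text \<open>The two facts about iterated free categories on a poset that are proved together: visited
  objects form a chain between the ends, and the only endomorphisms are identities.\<close>

definition good_level :: "nat \<Rightarrow> bool" where
  "good_level m \<longleftrightarrow>
     (\<forall>a\<in>Obj C. Idn (free_pow m C) a \<in> hom_set (free_pow m C) a a) \<and>
     (\<forall>x\<in>Arr (free_pow m C).
        (\<forall>l. chain_in C (Dom (free_pow m C) x) (Cod (free_pow m C) x) (visited C l x)) \<and>
        (Dom (free_pow m C) x = Cod (free_pow m C) x \<longrightarrow> x = Idn (free_pow m C) (Dom (free_pow m C) x)))"

text \<open>A letter that is not an identity moves strictly upwards, so a nonempty path cannot return to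
  its start.\<close>

lemma path_chain_aux:
  assumes "good_level m" "is_path (free_pow m C) c fs d"
  shows "chain_in C c d (path_visited C l c fs d) \<and>
    ((\<forall>f\<in>set fs. \<not> is_identity (free_pow m C) f) \<and> fs \<noteq> [] \<longrightarrow> c \<noteq> d)"
  using assms(2)
proof (induction fs arbitrary: c)
  case Nil
  then show ?case using chain_in_pair[of c c] arr_le_refl by (auto simp: path_visited_def)
next
  case (Cons f fs)
  let ?e = "Cod (free_pow m C) f"
  have f: "f \<in> Arr (free_pow m C)" "Dom (free_pow m C) f = c" and p: "is_path (free_pow m C) ?e fs d"
    using Cons.prems by auto
  have 1: "chain_in C c ?e (visited C l f)"
    using assms(1) f by (auto simp: good_level_def)
  have 2: "chain_in C ?e d (path_visited C l ?e fs d)" using Cons.IH[OF p] by blast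
  have "path_visited C l c (f # fs) d = visited C l f \<union> path_visited C l ?e fs d"
    using 1 by (auto simp: path_visited_def chain_in_def)
  moreover have "c \<noteq> d" if "\<not> is_identity (free_pow m C) f"
  proof
    assume "c = d"
    then have "c = ?e" using chain_in_arr_le[OF 1] chain_in_arr_le[OF 2] arr_le_antisym by simp
    then have "f = Idn (free_pow m C) c" using assms(1) f by (auto simp: good_level_def)
    then show False using that chain_in_arr_le[OF 1] arr_le_Obj by auto
  qed
  ultimately show ?case using chain_in_Un[OF 1 2] by simp
qed

lemma good_level: "good_level m"
proof (induction m)
  case 0
  have "chain_in C (Dom C f) (Cod C f) {Dom C f, Cod C f}" if "f \<in> Arr C" for f
    using that by (intro chain_in_pair) (auto simp: arr_le_def hom_set_def)
  moreover have "f = Idn C (Dom C f)" if "f \<in> Arr C" "Dom C f = Cod C f" for f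
    using that cat arrow_unique[of f "Dom C f" "Dom C f" "Idn C (Dom C f)"]
    by (auto simp: hom_set_def category_def)
  ultimately show ?case
    using cat by (auto simp: good_level_def free_pow_0 hom_set_def category_def)
next
  case (Suc m)
  have *: "Word a [] a \<in> hom_set (free_cat (free_pow m C)) a a" if "a \<in> Obj C" for a
    using that by (simp add: hom_free_cat)
  have "chain_in C c d (visited C l (Word c fs d)) \<and> (c = d \<longrightarrow> fs = [])"
    if "is_path (free_pow m C) c fs d" "\<forall>f\<in>set fs. \<not> is_identity (free_pow m C) f" for c fs d l
  proof (cases l)
    case 0
    then show ?thesis
      using path_chain_aux[OF Suc that(1)] that(2) chain_in_pair chain_in_arr_le by (metis visited.simps(2))
  next
    case (Suc k)
    then show ?thesis
      using path_chain_aux[OF \<open>good_level m\<close> that(1)] that(2) by (auto simp: visited_Suc_Word simp del: visited.simps)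
  qed
  then show ?case
    using * by (auto simp: good_level_def free_pow_Suc Arr_free_cat simp del: visited.simps)
qed

lemma path_chain: "is_path (free_pow m C) c fs d \<Longrightarrow> chain_in C c d (path_visited C l c fs d)"
  using path_chain_aux[OF good_level] by blast

lemma path_nonempty:
  "is_path (free_pow m C) c fs d \<Longrightarrow> \<forall>f\<in>set fs. \<not> is_identity (free_pow m C) f \<Longrightarrow> fs \<noteq> [] \<Longrightarrow> c \<noteq> d"
  using path_chain_aux[OF good_level] by blast

lemma Idn_free_pow: "a \<in> Obj C \<Longrightarrow> Idn (free_pow m C) a \<in> hom_set (free_pow m C) a a"
  using good_level by (simp add: good_level_def)

lemma visited_chain: "x \<in> hom_set (free_pow m C) a b \<Longrightarrow> chain_in C a b (visited C l x)"
  using good_level[of m] by (auto simp: good_level_def hom_set_def)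

lemma hom_arr_le: "x \<in> hom_set (free_pow m C) a b \<Longrightarrow> arr_le C a b"
  using visited_chain chain_in_arr_le by blast

lemma hom_Obj: "x \<in> hom_set (free_pow m C) a b \<Longrightarrow> a \<in> Obj C \<and> b \<in> Obj C"
  using hom_arr_le arr_le_Obj by blast

text \<open>Composition of words is concatenation, at whose joint the common end is visited. At depth
  \<open>0\<close> the union formula fails, since the joint is not visible there.\<close>

lemma Comp_free_pow:
  assumes "x \<in> hom_set (free_pow m C) a b" "y \<in> hom_set (free_pow m C) b c"
  shows "Comp (free_pow m C) y x \<in> hom_set (free_pow m C) a c"
    and "1 \<le> l \<Longrightarrow> l \<le> m \<Longrightarrow> visited C l (Comp (free_pow m C) y x) = visited C l x \<union> visited C l y"
proof -
  have "Comp (free_pow m C) y x \<in> hom_set (free_pow m C) a c \<and>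
    (1 \<le> l \<longrightarrow> l \<le> m \<longrightarrow> visited C l (Comp (free_pow m C) y x) = visited C l x \<union> visited C l y)"
  proof (cases m)
    case 0
    then show ?thesis using assms cat by (auto simp: free_pow_0 hom_set_def category_def)
  next
    case (Suc k)
    obtain fs gs where x: "x = Word a fs b" "is_path (free_pow k C) a fs b" "\<forall>f\<in>set fs. \<not> is_identity (free_pow k C) f"
      and y: "y = Word b gs c" "is_path (free_pow k C) b gs c" "\<forall>f\<in>set gs. \<not> is_identity (free_pow k C) f"
      using assms by (auto simp: Suc free_pow_Suc hom_free_cat)
    have "visited C l (Word a (fs @ gs) c) = visited C l x \<union> visited C l y" if "1 \<le> l"
    proof -
      from that obtain l' where l: "l = Suc l'" by (cases l) auto
      have "b \<in> path_visited C l' a (fs @ gs) c"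
      proof (cases "fs = []")
        case True
        then show ?thesis using x by (simp add: path_visited_def)
      next
        case False
        have "b = Cod (free_pow k C) (last fs) \<and> last fs \<in> Arr (free_pow k C)"
          using x(2) False by (induction fs arbitrary: a) auto
        then have "b \<in> visited C l' (last fs)"
          using visited_chain[of "last fs" k _ b l'] by (auto simp: hom_set_def chain_in_def)
        then show ?thesis using False by (auto simp: path_visited_def)
      qed
      then show ?thesis using x(1) y(1) by (auto simp: l path_visited_def)
    qed
    then show ?thesis
      using x y is_path_append by (auto simp: Suc free_pow_Suc hom_free_cat)
  qed
  then show "Comp (free_pow m C) y x \<in> hom_set (free_pow m C) a c"
    "1 \<le> l \<Longrightarrow> l \<le> m \<Longrightarrow> visited C l (Comp (free_pow m C) y x) = visited C l x \<union> visited C l y"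
    by auto
qed

lemma visited_0:
  assumes "x \<in> hom_set (free_pow m C) a b"
  shows "visited C 0 x = {a, b}"
proof (cases m)
  case 0
  then show ?thesis using assms by (auto simp: free_pow_0 hom_set_def)
next
  case (Suc k)
  then show ?thesis using assms by (auto simp: free_pow_Suc hom_free_cat)
qed

text \<open>One more pair of brackets shifts the depth by one. In a poset this is also true for an
  identity, which becomes the empty word: both visit a single object.\<close>

lemma gen_free_pow:
  assumes "x \<in> hom_set (free_pow m C) a b"
  shows "gen (free_pow m C) x \<in> hom_set (free_pow (Suc m) C) a b"
    and "visited C l (gen (free_pow m C) x) = visited C (l - 1) x"
proof -
  let ?E = "free_pow m C"
  have x: "x \<in> Arr ?E" "Dom ?E x = a" "Cod ?E x = b" using assms by (auto simp: hom_set_def)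
  have ab: "a \<in> Obj C" "b \<in> Obj C" using hom_Obj[OF assms] by auto
  have id: "a = b \<and> x = Idn ?E a" if "is_identity ?E x"
  proof -
    from that obtain e where "e \<in> Obj C" "x = Idn ?E e" by auto
    then show ?thesis using x Idn_free_pow[of e m] by (auto simp: hom_set_def)
  qed
  show "gen ?E x \<in> hom_set (free_pow (Suc m) C) a b"
    using x ab id unfolding gen_def free_pow_Suc hom_free_cat by auto
  have 1: "chain_in C a b (visited C k x)" for k using visited_chain[OF assms] .
  have 0: "visited C 0 x = {a, b}" using visited_0[OF assms] .
  show "visited C l (gen ?E x) = visited C (l - 1) x"
  proof (cases "is_identity ?E x")
    case True
    then have "a = b" using id by simp
    then have "visited C k x = {a}" for k using 1 chain_in_self by blast
    then show ?thesis using True x \<open>a = b\<close> by (cases l) (auto simp: gen_def)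
  next
    case False
    then show ?thesis using x 0 1[of "l - 1"] by (cases l) (auto simp: gen_def chain_in_def)
  qed
qed

end

lemma free_ext_simps [simp]:
  "Src (free_ext E E' h \<phi>) = free_cat E" "Tgt (free_ext E E' h \<phi>) = E'"
  "OMap (free_ext E E' h \<phi>) = restrict h (Obj E)"
  by (simp_all add: free_ext_def)

lemma free_map_simps [simp]:
  "Src (free_map H) = free_cat (Src H)" "Tgt (free_map H) = free_cat (Tgt H)"
  "OMap (free_map H) = restrict (OMap H) (Obj (Src H))"
  by (simp_all add: free_map_def)

section \<open>Functors between iterated free categories\<close>

text \<open>The effect on visited objects is all that matters about the functors of the resolution: depth
  \<open>l\<close> of the image is the \<open>h\<close>-image of depth \<open>\<sigma> l\<close>. Depth \<open>0\<close> is left out, as it only records the ends.\<close>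

definition acts_on_visited ::
  "('o, 'm) cat \<Rightarrow> ('o, 'm) cat \<Rightarrow> nat \<Rightarrow> nat \<Rightarrow> ('o \<Rightarrow> 'o) \<Rightarrow> (nat \<Rightarrow> nat) \<Rightarrow>
   (('o, 'm) word \<Rightarrow> ('o, 'm) word) \<Rightarrow> bool" where
  "acts_on_visited C D p q h \<sigma> \<phi> \<longleftrightarrow>
     (\<forall>a b. \<forall>x\<in>hom_set (free_pow p C) a b. \<phi> x \<in> hom_set (free_pow q D) (h a) (h b) \<and>
        (\<forall>l\<le>q. 1 \<le> l \<longrightarrow> visited D l (\<phi> x) = h ` visited C (\<sigma> l) x))"

text \<open>A word is sent to the composite of the images of its letters, so the visited sets are
  unions over the letters; opening the outer bracket of the source costs one level.\<close>

lemma acts_on_visited_free_ext: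
  assumes "poset_cat C" "poset_cat D" and \<phi>: "acts_on_visited C D p q h \<sigma> \<phi>"
    and h: "\<And>a. a \<in> Obj C \<Longrightarrow> h a \<in> Obj D"
    and h': "\<And>a. a \<in> Obj C \<Longrightarrow> h' a = h a"
  shows "acts_on_visited C D (Suc p) q h (\<lambda>l. Suc (\<sigma> l))
    (AMap (free_ext (free_pow p C) (free_pow q D) h' \<phi>))"
proof -
  interpret C: poset_cat C by fact
  interpret D: poset_cat D by fact
  let ?E = "free_pow q D"
  let ?cmp = "\<lambda>g f. Comp ?E (\<phi> f) g"
  have fold: "foldl ?cmp g fs \<in> hom_set ?E a (h d) \<and>
      (\<forall>l\<le>q. 1 \<le> l \<longrightarrow> visited D l (foldl ?cmp g fs) = visited D l g \<union> {h d} \<union> \<Union> ((\<lambda>f. h ` visited C (\<sigma> l) f) ` set fs))"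
    if "g \<in> hom_set ?E a (h c)" "is_path (free_pow p C) c fs d" for g a c fs d
    using that
  proof (induction fs arbitrary: g c)
    case Nil
    then show ?case using D.visited_chain[of g q a "h c"] by (auto simp: chain_in_def)
  next
    case (Cons f fs)
    let ?e = "Cod (free_pow p C) f"
    have f: "f \<in> hom_set (free_pow p C) c ?e" and pth: "is_path (free_pow p C) ?e fs d"
      using Cons.prems by (auto simp: hom_set_def)
    have g: "?cmp g f \<in> hom_set ?E a (h ?e)"
      using D.Comp_free_pow(1)[OF Cons.prems(1)] \<phi> f by (auto simp: acts_on_visited_def)
    have "visited D l (?cmp g f) = visited D l g \<union> h ` visited C (\<sigma> l) f" if "l \<le> q" "1 \<le> l" for l
      using D.Comp_free_pow(2)[OF Cons.prems(1), of "\<phi> f" "h ?e" l] \<phi> f that by (auto simp: acts_on_visited_def)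
    with Cons.IH[OF g pth] show ?case by auto
  qed
  show ?thesis
    unfolding acts_on_visited_def
  proof (intro allI ballI)
    fix a b x assume "x \<in> hom_set (free_pow (Suc p) C) a b"
    then have x: "x \<in> hom_set (free_cat (free_pow p C)) a b" by (simp add: free_pow_Suc)
    then obtain fs where fs: "x = Word a fs b" "is_path (free_pow p C) a fs b" by (auto simp: hom_free_cat)
    have ab: "a \<in> Obj C" "b \<in> Obj C"
      using C.hom_Obj[of x "Suc p"] x by (auto simp: free_pow_Suc)
    have i: "Idn ?E (h a) \<in> hom_set ?E (h a) (h a)"
      using D.Idn_free_pow h ab(1) by blast
    have l: "visited D l (Idn ?E (h a)) = {h a}" for l
      using D.visited_chain[OF i] D.chain_in_self by blast
    have "AMap (free_ext (free_pow p C) ?E h' \<phi>) x = foldl ?cmp (Idn ?E (h a)) fs"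
      using x fs h' ab by (simp add: free_ext_def hom_set_def)
    then show "AMap (free_ext (free_pow p C) ?E h' \<phi>) x \<in> hom_set ?E (h a) (h b) \<and>
       (\<forall>l\<le>q. 1 \<le> l \<longrightarrow> visited D l (AMap (free_ext (free_pow p C) ?E h' \<phi>) x) = h ` visited C (Suc (\<sigma> l)) x)"
      using fold[OF i fs(2)] l fs by auto
  qed
qed

lemma acts_on_visited_counit:
  assumes "poset_cat C"
  shows "acts_on_visited C C (Suc m) m id Suc (AMap (counit (free_pow m C)))"
proof -
  have "acts_on_visited C C m m id id id" by (auto simp: acts_on_visited_def)
  from acts_on_visited_free_ext[OF assms assms this, of id]
  show ?thesis by (simp add: counit_def)
qed

text \<open>Every letter gets two brackets in place of none, and one bracket is lost by composing: depth
  \<open>1\<close> is repeated.\<close>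

lemma acts_on_visited_comult:
  assumes "poset_cat C"
  shows "acts_on_visited C C (Suc m) (Suc (Suc m)) id (\<lambda>l. Suc (l - 2)) (AMap (comult (free_pow m C)))"
proof -
  interpret poset_cat C by fact
  have "acts_on_visited C C m (Suc (Suc m)) id (\<lambda>l. l - 2)
     (\<lambda>f. gen (free_pow (Suc m) C) (gen (free_pow m C) f))"
    unfolding acts_on_visited_def
  proof (intro allI ballI conjI impI)
    fix a b x l assume x: "x \<in> hom_set (free_pow m C) a b"
    show "gen (free_pow (Suc m) C) (gen (free_pow m C) x) \<in> hom_set (free_pow (Suc (Suc m)) C) (id a) (id b)"
      using gen_free_pow(1)[OF gen_free_pow(1)[OF x]] by simp
    show "visited C l (gen (free_pow (Suc m) C) (gen (free_pow m C) x)) = id ` visited C (l - 2) x"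
      using gen_free_pow(2)[OF gen_free_pow(1)[OF x]] gen_free_pow(2)[OF x] by (simp add: numeral_2_eq_2)
  qed
  from acts_on_visited_free_ext[OF assms assms this, of id]
  show ?thesis by (simp add: comult_def free_pow_Suc)
qed

lemma acts_on_visited_free_map:
  assumes "poset_cat C" "poset_cat D" and H: "acts_on_visited C D p q h \<sigma> (AMap H)"
    and "Src H = free_pow p C" "Tgt H = free_pow q D"
    and h: "\<And>a. a \<in> Obj C \<Longrightarrow> h a \<in> Obj D"
    and h': "\<And>a. a \<in> Obj C \<Longrightarrow> OMap H a = h a"
  shows "acts_on_visited C D (Suc p) (Suc q) h (\<lambda>l. if l = 1 then 1 else Suc (\<sigma> (l - 1))) (AMap (free_map H))"
proof -
  interpret C: poset_cat C by fact
  interpret D: poset_cat D by fact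
  have "acts_on_visited C D p (Suc q) h (\<lambda>l. if l = 1 then 0 else \<sigma> (l - 1)) (\<lambda>f. gen (free_pow q D) (AMap H f))"
    unfolding acts_on_visited_def
  proof (intro allI ballI conjI impI)
    fix a b x l assume x: "x \<in> hom_set (free_pow p C) a b"
    then have Hx: "AMap H x \<in> hom_set (free_pow q D) (h a) (h b)"
      and l: "\<And>l. l \<le> q \<Longrightarrow> 1 \<le> l \<Longrightarrow> visited D l (AMap H x) = h ` visited C (\<sigma> l) x"
      using H by (auto simp: acts_on_visited_def)
    show "gen (free_pow q D) (AMap H x) \<in> hom_set (free_pow (Suc q) D) (h a) (h b)"
      using D.gen_free_pow(1)[OF Hx] .
    assume "l \<le> Suc q" "1 \<le> l"
    then show "visited D l (gen (free_pow q D) (AMap H x)) = h ` visited C (if l = 1 then 0 else \<sigma> (l - 1)) x"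
      using D.gen_free_pow(2)[OF Hx, of l] l[of "l - 1"] C.visited_0[OF x] D.visited_0[OF Hx] by auto
  qed
  from acts_on_visited_free_ext[OF assms(1,2) this h h']
  have "acts_on_visited C D (Suc p) (Suc q) h (\<lambda>l. Suc (if l = 1 then 0 else \<sigma> (l - 1))) (AMap (free_map H))"
    using assms by (simp add: free_map_def free_pow_Suc)
  moreover have "(\<lambda>l. Suc (if l = 1 then 0 else \<sigma> (l - 1))) = (\<lambda>l. if l = 1 then 1 else Suc (\<sigma> (l - 1)))"
    by auto
  ultimately show ?thesis by metis
qed

lemma acts_on_visited_cong:
  assumes "acts_on_visited C D p q h \<sigma> \<phi>" "\<And>l. 1 \<le> l \<Longrightarrow> l \<le> q \<Longrightarrow> \<sigma> l = \<sigma>' l"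
  shows "acts_on_visited C D p q h \<sigma>' \<phi>"
  using assms by (simp add: acts_on_visited_def)

text \<open>Applying the free functor \<open>i\<close> times leaves the outer \<open>i\<close> levels alone and shifts the action
  on the inner ones.\<close>

lemma acts_on_visited_free_map_iterate:
  assumes "poset_cat C" "poset_cat D" and H: "acts_on_visited C D p q h \<sigma> (AMap H)"
    and "Src H = free_pow p C" "Tgt H = free_pow q D"
    and h: "\<And>a. a \<in> Obj C \<Longrightarrow> h a \<in> Obj D"
    and h': "\<And>a. a \<in> Obj C \<Longrightarrow> OMap H a = h a"
  shows "acts_on_visited C D (p + i) (q + i) h (\<lambda>l. if l \<le> i then l else \<sigma> (l - i) + i) (AMap ((free_map ^^ i) H))"
proof -
  have "Src ((free_map ^^ i) H) = free_pow (p + i) C \<and> Tgt ((free_map ^^ i) H) = free_pow (q + i) D \<and>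
    (\<forall>a\<in>Obj C. OMap ((free_map ^^ i) H) a = h a) \<and>
    acts_on_visited C D (p + i) (q + i) h (\<lambda>l. if l \<le> i then l else \<sigma> (l - i) + i) (AMap ((free_map ^^ i) H))"
  proof (induction i)
    case 0
    have "acts_on_visited C D p q h (\<lambda>l. if l \<le> 0 then l else \<sigma> (l - 0) + 0) (AMap H)"
      by (rule acts_on_visited_cong[OF H]) auto
    then show ?case using assms by simp
  next
    case (Suc i)
    have "acts_on_visited C D (Suc (p + i)) (Suc (q + i)) h
        (\<lambda>l. if l = 1 then 1 else Suc (if l - 1 \<le> i then l - 1 else \<sigma> (l - 1 - i) + i))
        (AMap (free_map ((free_map ^^ i) H)))"
      by (rule acts_on_visited_free_map[OF assms(1,2)]) (use Suc h in auto)
    then have "acts_on_visited C D (Suc (p + i)) (Suc (q + i)) h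
        (\<lambda>l. if l \<le> Suc i then l else \<sigma> (l - Suc i) + Suc i)
        (AMap (free_map ((free_map ^^ i) H)))"
      by (rule acts_on_visited_cong) auto
    then show ?case using Suc assms
      by (simp add: free_pow_Suc)
  qed
  then show ?thesis by blast
qed

lemma acts_on_visited_resolution_map:
  assumes "poset_cat C" "poset_cat D" "is_functor H" "Src H = C" "Tgt H = D"
  shows "acts_on_visited C D (Suc k) (Suc k) (OMap H) id (resolution_map H k)"
proof -
  have "acts_on_visited C D 0 0 (OMap H) id (AMap (letter_funct H))"
    using assms by (auto simp: acts_on_visited_def letter_funct_def free_pow_0 hom_set_def is_functor_def)
  from acts_on_visited_free_map_iterate[OF assms(1,2) this, of "Suc k"]
  have "acts_on_visited C D (0 + Suc k) (0 + Suc k) (OMap H) (\<lambda>l. if l \<le> Suc k then l else id (l - Suc k) + Suc k)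
     (AMap ((free_map ^^ Suc k) (letter_funct H)))"
    using assms by (auto simp: letter_funct_def free_pow_0 is_functor_def)
  then show ?thesis
    unfolding resolution_map_def by (simp add: acts_on_visited_def)
qed

text \<open>The \<open>i\<close>-th face forgets one level of brackets.\<close>

lemma acts_on_visited_face:
  assumes "poset_cat C" "i \<le> k"
  shows "acts_on_visited C C (Suc k) k id (\<lambda>l. if l \<le> i then l else Suc l)
     (AMap ((free_map ^^ i) (counit (free_pow (k - i) C))))"
  using acts_on_visited_free_map_iterate[OF assms(1) assms(1) acts_on_visited_counit[OF assms(1), of "k - i"], of i] assms(2)
  by (simp add: counit_def free_pow_Suc acts_on_visited_def)

lemma acts_on_visited_degen:
  assumes "poset_cat C" "i \<le> k"
  shows "acts_on_visited C C (Suc k) (Suc (Suc k)) id (\<lambda>l. if l \<le> Suc i then l else l - 1)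
     (AMap ((free_map ^^ i) (comult (free_pow (k - i) C))))"
proof -
  have "acts_on_visited C C (Suc (k - i) + i) (Suc (Suc (k - i)) + i) id
     (\<lambda>l. if l \<le> i then l else Suc (l - i - 2) + i)
     (AMap ((free_map ^^ i) (comult (free_pow (k - i) C))))"
    using acts_on_visited_free_map_iterate[OF assms(1) assms(1) acts_on_visited_comult[OF assms(1), of "k - i"], of i]
    by (simp add: comult_def free_pow_Suc)
  then have "acts_on_visited C C (Suc k) (Suc (Suc k)) id
     (\<lambda>l. if l \<le> i then l else Suc (l - i - 2) + i)
     (AMap ((free_map ^^ i) (comult (free_pow (k - i) C))))"
    using assms(2) by simp
  then show ?thesis by (rule acts_on_visited_cong) auto
qed

context poset_cat
begin

text \<open>Two chains that meet in \<open>b\<close> can be recovered from their union by cutting it at \<open>b\<close>.\<close>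

lemma chain_split:
  assumes "chain_in C a b S" "chain_in C b c T"
  shows "{p \<in> S \<union> T. arr_le C p b} = S" "{p \<in> S \<union> T. arr_le C b p} = T"
proof -
  have "p \<in> S" if "p \<in> T" "arr_le C p b" for p
    using that assms arr_le_antisym[of p b] unfolding chain_in_def by auto
  then show "{p \<in> S \<union> T. arr_le C p b} = S" using assms(1) unfolding chain_in_def by auto
  have "p \<in> T" if "p \<in> S" "arr_le C b p" for p
    using that assms arr_le_antisym[of p b] unfolding chain_in_def by auto
  then show "{p \<in> S \<union> T. arr_le C b p} = T" using assms(2) unfolding chain_in_def by auto
qed

lemma finite_chain_has_least:
  assumes "finite S" "S \<noteq> {}" "\<forall>p\<in>S. \<forall>q\<in>S. arr_le C p q \<or> arr_le C q p"
  shows "\<exists>e\<in>S. \<forall>p\<in>S. arr_le C e p"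
  using assms
proof (induction S rule: finite_ne_induct)
  case (insert x F)
  then obtain e where e: "e \<in> F" "\<forall>p\<in>F. arr_le C e p" by auto
  have x: "arr_le C x x" using insert.prems by auto
  from e insert.prems consider "arr_le C e x" | "arr_le C x e" by auto
  then show ?case
  proof cases
    case 1
    then show ?thesis using e by auto
  next
    case 2
    then have "\<forall>p\<in>F. arr_le C x p" using e arr_le_trans by blast
    then show ?thesis using x by auto
  qed
qed auto

lemma path_Cons_split:
  assumes "is_path (free_pow m C) c (f # fs) d" "e = Cod (free_pow m C) f"
  shows "f \<in> hom_set (free_pow m C) c e" "is_path (free_pow m C) e fs d"
    and "path_visited C l c (f # fs) d = visited C l f \<union> path_visited C l e fs d"
    and "{p \<in> path_visited C l c (f # fs) d. arr_le C p e} = visited C l f"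
    and "{p \<in> path_visited C l c (f # fs) d. arr_le C e p} = path_visited C l e fs d"
proof -
  show f: "f \<in> hom_set (free_pow m C) c e" and p: "is_path (free_pow m C) e fs d"
    using assms by (auto simp: hom_set_def)
  have 1: "chain_in C c e (visited C l f)" and 2: "chain_in C e d (path_visited C l e fs d)"
    using visited_chain[OF f] path_chain[OF p] by auto
  show 3: "path_visited C l c (f # fs) d = visited C l f \<union> path_visited C l e fs d"
    using 1 by (auto simp: path_visited_def chain_in_def)
  show "{p \<in> path_visited C l c (f # fs) d. arr_le C p e} = visited C l f"
    and "{p \<in> path_visited C l c (f # fs) d. arr_le C e p} = path_visited C l e fs d"
    using chain_split[OF 1 2] unfolding 3 by auto
qed

text \<open>The first letter ends at the least visited object of depth \<open>1\<close> after the start. The visited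
  sets of this letter and of the remaining word are cut out at that object, so two inductions, on the
  depth and on the length, determine the word.\<close>

lemma word_inject:
  assumes "x \<in> hom_set (free_pow m C) a b" "y \<in> hom_set (free_pow m C) a b"
    and "\<And>l. 1 \<le> l \<Longrightarrow> l \<le> m \<Longrightarrow> visited C l x = visited C l y"
  shows "x = y"
  using assms
proof (induction m arbitrary: a b x y)
  case 0
  then show ?case using arrow_unique by (fastforce simp: free_pow_0 hom_set_def)
next
  case (Suc m)
  let ?E = "free_pow m C"
  have path: "fs = gs"
    if "is_path ?E c fs b" "\<forall>f\<in>set fs. \<not> is_identity ?E f"
       "is_path ?E c gs b" "\<forall>f\<in>set gs. \<not> is_identity ?E f"
       "\<And>l. l \<le> m \<Longrightarrow> path_visited C l c fs b = path_visited C l c gs b" for c fs gs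
    using that
  proof (induction fs arbitrary: c gs)
    case Nil
    then show ?case using path_nonempty[of m c gs b] by auto
  next
    case (Cons f fs)
    have "c \<noteq> b" using path_nonempty[of m c "f # fs" b] Cons.prems by auto
    then obtain g gs' where gs: "gs = g # gs'" using Cons.prems by (cases gs) auto
    define e where "e = Cod ?E f"
    define e' where "e' = Cod ?E g"
    note F = path_Cons_split[OF Cons.prems(1) e_def]
    note G = path_Cons_split[OF Cons.prems(3)[unfolded gs] e'_def]
    have "e \<noteq> c" using path_nonempty[of m c "[f]" e] F(1) Cons.prems(2) hom_Obj[OF F(1)]
      by (auto simp: hom_set_def)
    have "e' \<noteq> c" using path_nonempty[of m c "[g]" e'] G(1) Cons.prems(4) hom_Obj[OF G(1)] gs
      by (auto simp: hom_set_def)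
    have p0: "path_visited C 0 c (f # fs) b = path_visited C 0 c (g # gs') b" using Cons.prems(5)[of 0] gs by simp
    have "e \<in> path_visited C 0 c (f # fs) b"
      using F(3)[of 0] visited_0[OF F(1)] by auto
    then have "e \<in> {c, e'} \<union> path_visited C 0 e' gs' b" using p0 G(3)[of 0] visited_0[OF G(1)] by simp
    then have "arr_le C e' e"
      using \<open>e \<noteq> c\<close> path_chain[OF G(2), of 0] unfolding chain_in_def by auto
    moreover have "e' \<in> path_visited C 0 c (g # gs') b"
      using G(3)[of 0] visited_0[OF G(1)] by auto
    then have "e' \<in> {c, e} \<union> path_visited C 0 e fs b" using p0 F(3)[of 0] visited_0[OF F(1)] by simp
    then have "arr_le C e e'"
      using \<open>e' \<noteq> c\<close> path_chain[OF F(2), of 0] unfolding chain_in_def by auto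
    ultimately have ee: "e' = e" using arr_le_antisym by blast
    have "visited C l f = visited C l g" if "l \<le> m" for l
      using F(4)[of l] G(4)[of l] Cons.prems(5)[OF that] gs ee by simp
    then have "f = g" using Suc.IH[OF F(1), of g] G(1) ee by auto
    moreover have "fs = gs'"
    proof (rule Cons.IH[OF F(2)])
      show "path_visited C l e fs b = path_visited C l e gs' b" if "l \<le> m" for l
        using F(5)[of l] G(5)[of l] Cons.prems(5)[OF that] gs ee by simp
    qed (use Cons.prems G ee gs in auto)
    ultimately show ?case using gs by simp
  qed
  obtain fs where x: "x = Word a fs b" "is_path ?E a fs b" "\<forall>f\<in>set fs. \<not> is_identity ?E f"
    using Suc.prems by (auto simp: free_pow_Suc hom_free_cat)
  obtain gs where y: "y = Word a gs b" "is_path ?E a gs b" "\<forall>f\<in>set gs. \<not> is_identity ?E f"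
    using Suc.prems by (auto simp: free_pow_Suc hom_free_cat)
  have "path_visited C l a fs b = path_visited C l a gs b" if "l \<le> m" for l
    using Suc.prems(3)[of "Suc l"] that x(1) y(1) by (simp add: visited_Suc_Word del: visited.simps)
  then show ?case using path[OF x(2,3) y(2,3)] x y by simp
qed

text \<open>The word is built in the way \<open>word_inject\<close> takes it apart: a bracket breaks at each object of
  \<open>T 1\<close>, and between two of these the deeper sets prescribe a word of smaller depth.\<close>

lemma word_exists:
  assumes "arr_le C a b" "\<And>l. 1 \<le> l \<Longrightarrow> l \<le> m \<Longrightarrow> chain_in C a b (T l)"
    and "\<And>l. 1 \<le> l \<Longrightarrow> l < m \<Longrightarrow> T l \<subseteq> T (Suc l)"
  shows "\<exists>x\<in>hom_set (free_pow m C) a b. \<forall>l. 1 \<le> l \<longrightarrow> l \<le> m \<longrightarrow> visited C l x = T l"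
  using assms
proof (induction m arbitrary: a b T)
  case 0
  then show ?case by (auto simp: free_pow_0 arr_le_def hom_set_def)
next
  case (Suc m)
  let ?E = "free_pow m C"
  have path: "\<exists>fs. is_path ?E a fs b \<and> (\<forall>f\<in>set fs. \<not> is_identity ?E f) \<and> (\<forall>l\<le>m. path_visited C l a fs b = T (Suc l))"
    if "\<And>l. 1 \<le> l \<Longrightarrow> l \<le> Suc m \<Longrightarrow> chain_in C a b (T l)"
      "\<And>l. 1 \<le> l \<Longrightarrow> l < Suc m \<Longrightarrow> T l \<subseteq> T (Suc l)" for a T
    using that
  proof (induction "card (T 1)" arbitrary: a T rule: less_induct)
    case less
    have c1: "chain_in C a b (T 1)" using less.prems by auto
    have T1: "T 1 \<subseteq> T (Suc l)" if "l \<le> m" for l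
      using that
    proof (induction l)
      case (Suc l)
      then show ?case using less.prems(2)[of "Suc l"] by auto
    qed simp
    show ?case
    proof (cases "a = b")
      case True
      then have "T (Suc l) = {a}" if "l \<le> m" for l
        using less.prems(1)[of "Suc l"] that chain_in_self by auto
      then show ?thesis using True c1
        by (intro exI[of _ "[]"]) (auto simp: path_visited_def chain_in_def)
    next
      case False
      obtain e where e: "e \<in> T 1 - {a}" "\<forall>p\<in>T 1 - {a}. arr_le C e p"
        using finite_chain_has_least[of "T 1 - {a}"] c1 False unfolding chain_in_def
        by (metis (no_types, lifting) Diff_iff empty_iff finite_Diff insert_iff)
      have ae: "arr_le C a e" using c1 e unfolding chain_in_def by auto
      have eT: "e \<in> T (Suc l)" if "l \<le> m" for l using T1[OF that] e by auto
      obtain f where f: "f \<in> hom_set ?E a e"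
        "\<forall>l. 1 \<le> l \<longrightarrow> l \<le> m \<longrightarrow> visited C l f = {p \<in> T (Suc l). arr_le C p e}"
      proof -
        have "\<exists>x\<in>hom_set ?E a e. \<forall>l. 1 \<le> l \<longrightarrow> l \<le> m \<longrightarrow> visited C l x = {p \<in> T (Suc l). arr_le C p e}"
        proof (rule Suc.IH[OF ae])
          show "chain_in C a e {p \<in> T (Suc l). arr_le C p e}" if "1 \<le> l" "l \<le> m" for l
            using chain_in_lower[OF less.prems(1)[of "Suc l"] eT] that by auto
          show "{p \<in> T (Suc l). arr_le C p e} \<subseteq> {p \<in> T (Suc (Suc l)). arr_le C p e}" if "1 \<le> l" "l < m" for l
            using less.prems(2)[of "Suc l"] that by auto
        qed
        then show ?thesis using that by blast
      qed
      have "{p \<in> T (Suc 0). arr_le C p e} = {a, e}"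
        using e c1 ae arr_le_refl arr_le_Obj arr_le_antisym unfolding chain_in_def by auto
      then have f': "visited C l f = {p \<in> T (Suc l). arr_le C p e}" if "l \<le> m" for l
        using f(2) that visited_0[OF f(1)] by (cases l) auto
      have "card {p \<in> T 1. arr_le C e p} < card (T 1)"
      proof (intro psubset_card_mono psubsetI)
        have "a \<notin> {p \<in> T 1. arr_le C e p}" using e ae arr_le_antisym by auto
        then show "{p \<in> T 1. arr_le C e p} \<noteq> T 1" using c1 unfolding chain_in_def by blast
      qed (use c1 in \<open>auto simp: chain_in_def\<close>)
      then obtain fs where fs: "is_path ?E e fs b" "\<forall>f\<in>set fs. \<not> is_identity ?E f"
        "\<forall>l\<le>m. path_visited C l e fs b = {p \<in> T (Suc l). arr_le C e p}"
      proof -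
        have "\<exists>fs. is_path ?E e fs b \<and> (\<forall>f\<in>set fs. \<not> is_identity ?E f) \<and>
          (\<forall>l\<le>m. path_visited C l e fs b = {p \<in> T (Suc l). arr_le C e p})"
        proof (rule less.hyps)
          show "card {p \<in> T 1. arr_le C e p} < card (T 1)" by fact
          show "chain_in C e b {p \<in> T l. arr_le C e p}" if "1 \<le> l" "l \<le> Suc m" for l
            using chain_in_upper[OF less.prems(1)[of l]] eT[of "l - 1"] that by auto
          show "{p \<in> T l. arr_le C e p} \<subseteq> {p \<in> T (Suc l). arr_le C e p}" if "1 \<le> l" "l < Suc m" for l
            using less.prems(2)[of l] that by auto
        qed
        then show ?thesis using that by blast
      qed
      have "\<not> is_identity ?E f"
        using f(1) e Idn_free_pow[of _ m] by (auto simp: hom_set_def)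
      moreover have p: "is_path ?E a (f # fs) b" using f(1) fs(1) by (auto simp: hom_set_def)
      moreover have "path_visited C l a (f # fs) b = T (Suc l)" if "l \<le> m" for l
      proof -
        have "path_visited C l a (f # fs) b = {p \<in> T (Suc l). arr_le C p e} \<union> {p \<in> T (Suc l). arr_le C e p}"
          using path_Cons_split(3)[OF p, of e l] f(1) f'[OF that] fs(3) that by (auto simp: hom_set_def)
        also have "\<dots> = T (Suc l)"
          using less.prems(1)[of "Suc l"] that eT[OF that] unfolding chain_in_def by auto
        finally show ?thesis .
      qed
      ultimately show ?thesis using fs(2) by (intro exI[of _ "f # fs"]) auto
    qed
  qed
  obtain fs where fs: "is_path ?E a fs b" "\<forall>f\<in>set fs. \<not> is_identity ?E f" "\<forall>l\<le>m. path_visited C l a fs b = T (Suc l)"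
    using path[of a T] Suc.prems by blast
  have "visited C l (Word a fs b) = T l" if "1 \<le> l" "l \<le> Suc m" for l
    using fs(3) that by (cases l) (auto simp: visited_Suc_Word simp del: visited.simps)
  then show ?case using fs
    by (intro bexI[of _ "Word a fs b"]) (auto simp: free_pow_Suc hom_free_cat)
qed

end

section \<open>Strings of arrows\<close>

text \<open>A list of arrows \<open>x\<^sub>1,\<dots>,x\<^sub>n\<close> along a list of objects \<open>\<alpha>\<^sub>0,\<dots>,\<alpha>\<^sub>n\<close>; \<open>R a b x\<close> means that \<open>x\<close> is
  an arrow from \<open>a\<close> to \<open>b\<close>.\<close>

definition typed_string :: "('a \<Rightarrow> 'a \<Rightarrow> 'x \<Rightarrow> bool) \<Rightarrow> 'a list \<Rightarrow> 'x list \<Rightarrow> bool" where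
  "typed_string R as xs \<longleftrightarrow> length as = Suc (length xs) \<and> (\<forall>j<length xs. R (as ! j) (as ! Suc j) (xs ! j))"

lemma typed_string_Cons: "typed_string R (a # b # as) (x # xs) \<longleftrightarrow> R a b x \<and> typed_string R (b # as) xs"
  by (auto simp: typed_string_def All_less_Suc2)

lemma typed_string_Nil: "typed_string R as [] \<longleftrightarrow> (\<exists>a. as = [a])"
  by (auto simp: typed_string_def length_Suc_conv)

lemma typed_string_ConsE:
  assumes "typed_string R as (x # xs)"
  obtains a b as' where "as = a # b # as'" "R a b x" "typed_string R (b # as') xs"
proof -
  obtain a b as' where "as = a # b # as'"
    using assms by (auto simp: typed_string_def length_Suc_conv)
  then show ?thesis using assms that by (auto simp: typed_string_Cons)
qed

lemma typed_string_snocE: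
  assumes "typed_string R as (xs @ [x])"
  obtains as' b where "as = as' @ [b]" "as' \<noteq> []" "R (last as') b x" "typed_string R as' xs"
proof -
  obtain as' b where as: "as = as' @ [b]" "as' \<noteq> []"
  proof (cases as rule: rev_cases)
    case Nil
    then show ?thesis using assms by (simp add: typed_string_def)
  next
    case (snoc ys y)
    then have "ys \<noteq> []" using assms by (auto simp: typed_string_def)
    then show ?thesis using that snoc by blast
  qed
  then have len: "length as' = Suc (length xs)" using assms by (simp add: typed_string_def)
  have "R (last as') b x"
    using assms as len by (auto simp: typed_string_def nth_append last_conv_nth dest!: spec[of _ "length xs"])
  moreover have "R (as' ! j) (as' ! Suc j) (xs ! j)" if "j < length xs" for j
  proof -
    have "j < length (xs @ [x])" using that by simp
    then have "R (as ! j) (as ! Suc j) ((xs @ [x]) ! j)" using assms unfolding typed_string_def by blast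
    then show ?thesis using that as len by (simp add: nth_append)
  qed
  ultimately show ?thesis using that as len by (simp add: typed_string_def)
qed

lemma length_face_objs: "length as = Suc (Suc n) \<Longrightarrow> i \<le> Suc n \<Longrightarrow> length (face_objs i as) = Suc n"
  by (simp add: face_objs_def)

lemma nth_face_objs:
  "length as = Suc (Suc n) \<Longrightarrow> i \<le> Suc n \<Longrightarrow> j \<le> n \<Longrightarrow>
     face_objs i as ! j = as ! (if j < i then j else Suc j)"
  by (simp add: face_objs_def nth_append)

lemma set_face_objs: "set (face_objs i as) \<subseteq> set as"
  using set_take_subset[of i as] set_drop_subset[of "Suc i" as] by (simp add: face_objs_def)

lemma length_degen_objs: "i < length as \<Longrightarrow> length (degen_objs i as) = Suc (length as)"
  by (simp add: degen_objs_def)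

lemma nth_degen_objs:
  "length as = Suc n \<Longrightarrow> i \<le> n \<Longrightarrow> j \<le> Suc n \<Longrightarrow> degen_objs i as ! j = as ! (if j \<le> i then j else j - 1)"
  by (auto simp: degen_objs_def nth_append)

lemma set_degen_objs: "i < length as \<Longrightarrow> set (degen_objs i as) = set as"
proof -
  assume "i < length as"
  have "set as = set (take i as) \<union> set (drop i as)" by (metis append_take_drop_id set_append)
  moreover have "set (take i as) \<subseteq> set (take (Suc i) as)" by (simp add: set_take_subset_set_take)
  moreover have "set (take (Suc i) as) \<subseteq> set as" by (rule set_take_subset)
  ultimately show ?thesis by (auto simp: degen_objs_def)
qed

lemma typed_string_face:
  assumes "typed_string R as xs" "length xs = Suc n" "i \<le> Suc n"
    and cmp: "\<And>a b c x y. R a b x \<Longrightarrow> R b c y \<Longrightarrow> R a c (cmp y x)"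
  shows "typed_string R (face_objs i as) (face_arrs cmp (Suc n) i xs)"
proof -
  have as: "length as = Suc (Suc n)" using assms by (simp add: typed_string_def)
  have R: "R (as ! j) (as ! Suc j) (xs ! j)" if "j \<le> n" for j
    using assms that by (simp add: typed_string_def)
  have len: "length (face_arrs cmp (Suc n) i xs) = n"
    using assms by (auto simp: face_arrs_def)
  have "R (face_objs i as ! j) (face_objs i as ! Suc j) (face_arrs cmp (Suc n) i xs ! j)" if j: "j < n" for j
  proof -
    consider "i = 0" | "i = Suc n" | "0 < i" "i \<le> n" using assms(3) by linarith
    then show ?thesis
    proof cases
      case 1
      then show ?thesis using j as assms(2) R[of "Suc j"] by (simp add: nth_face_objs face_arrs_def nth_tl)
    next
      case 2
      then show ?thesis using j as assms(2) R[of j] by (simp add: nth_face_objs face_arrs_def nth_butlast)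
    next
      case 3
      consider "Suc j < i" | "Suc j = i" | "i \<le> j" by linarith
      then show ?thesis
      proof cases
        case 1
        then have "j < i - 1" by simp
        then show ?thesis using 1 3 j as assms(2) R[of j]
          by (simp add: nth_face_objs face_arrs_def nth_append)
      next
        case 2
        then have "R (as ! j) (as ! Suc (Suc j)) (cmp (xs ! Suc j) (xs ! j))"
          using R[of j] R[of "Suc j"] j by (intro cmp) auto
        then show ?thesis using 2 3 j as assms(2)
          by (auto simp: nth_face_objs face_arrs_def nth_append)
      next
        case c: 3
        then obtain k where k: "j = i + k" using le_Suc_ex by blast
        have "face_arrs cmp (Suc n) i xs ! j = xs ! Suc j"
          using 3 j assms(2) k by (auto simp: face_arrs_def nth_append nth_Cons split: nat.split)
        then show ?thesis using c 3 j as R[of "Suc j"] by (simp add: nth_face_objs)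
      qed
    qed
  qed
  then show ?thesis using len as assms(3) by (simp add: typed_string_def length_face_objs)
qed

lemma typed_string_degen:
  assumes "typed_string R as xs" "length xs = n" "i \<le> n" and e: "R (as ! i) (as ! i) e"
  shows "typed_string R (degen_objs i as) (degen_arrs e i xs)"
proof -
  have as: "length as = Suc n" using assms by (simp add: typed_string_def)
  have R: "R (as ! j) (as ! Suc j) (xs ! j)" if "j < n" for j
    using assms that by (simp add: typed_string_def)
  have "R (degen_objs i as ! j) (degen_objs i as ! Suc j) (degen_arrs e i xs ! j)" if j: "j \<le> n" for j
  proof -
    consider "j < i" | "j = i" | "i < j" by linarith
    then show ?thesis
    proof cases
      case 1
      then show ?thesis using j as assms R[of j] by (simp add: nth_degen_objs degen_arrs_def nth_append)
    next
      case 2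
      then show ?thesis using j as assms by (simp add: nth_degen_objs degen_arrs_def nth_append)
    next
      case 3
      then obtain k where k: "j = Suc (i + k)" using less_iff_Suc_add by auto
      then have "degen_arrs e i xs ! j = xs ! (j - 1)"
        using j assms by (auto simp: degen_arrs_def nth_append nth_Cons)
      then show ?thesis using 3 j as assms(3) R[of "j - 1"] by (simp add: nth_degen_objs)
    qed
  qed
  then show ?thesis using as assms by (auto simp: typed_string_def length_degen_objs degen_arrs_def)
qed

section \<open>The nerve of a poset\<close>

abbreviation nerve_vertex :: "'o list \<times> 'm list \<Rightarrow> nat \<Rightarrow> 'o" where
  "nerve_vertex x i \<equiv> fst x ! i"

lemma Simp_nerve:
  "(as, fs) \<in> Simp (nerve C) n \<longleftrightarrow> length fs = n \<and> set as \<subseteq> Obj C \<and> typed_string (\<lambda>a b f. f \<in> hom_set C a b) as fs"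
  by (auto simp: nerve_def typed_string_def)

context poset_cat
begin

lemma vertexed_nerve: "vertexed_sset (nerve C) nerve_vertex (arr_le C)"
proof
  have cmp: "Comp C g f \<in> hom_set C a c" if "f \<in> hom_set C a b" "g \<in> hom_set C b c" for a b c f g
    using that cat by (auto simp: category_def hom_set_def)
  fix n i :: nat and x :: "'o list \<times> 'm list"
  obtain as fs where x: "x = (as, fs)" by (cases x)
  { assume A: "x \<in> topspace (SpTop (discrete_sspace (nerve C)) (Suc n))" "i \<le> Suc n"
    then have s: "length fs = Suc n" "length as = Suc (Suc n)" "set as \<subseteq> Obj C" "typed_string (\<lambda>a b f. f \<in> hom_set C a b) as fs"
      by (auto simp: discrete_sspace_def Simp_nerve x typed_string_def)
    have "typed_string (\<lambda>a b f. f \<in> hom_set C a b) (face_objs i as) (face_arrs (Comp C) (Suc n) i fs)"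
      by (rule typed_string_face[OF s(4) s(1) A(2)]) (rule cmp)
    then show "SpFace (discrete_sspace (nerve C)) (Suc n) i x \<in> topspace (SpTop (discrete_sspace (nerve C)) n)"
      using set_face_objs[of i as] s A(2) length_face_objs[OF s(2)]
      by (simp add: discrete_sspace_def nerve_def x) (auto simp: typed_string_def)
    show "nerve_vertex (SpFace (discrete_sspace (nerve C)) (Suc n) i x) j = nerve_vertex x (if j < i then j else Suc j)"
      if "j \<le> n" for j
      using nth_face_objs[OF s(2) A(2) that] by (simp add: discrete_sspace_def nerve_def x)
  }
  { assume A: "x \<in> topspace (SpTop (discrete_sspace (nerve C)) n)" "i \<le> n"
    then have s: "length fs = n" "length as = Suc n" "set as \<subseteq> Obj C" "typed_string (\<lambda>a b f. f \<in> hom_set C a b) as fs"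
      by (auto simp: discrete_sspace_def Simp_nerve x typed_string_def)
    have "as ! i \<in> Obj C" using s A(2) by (auto simp: subset_iff)
    then have "typed_string (\<lambda>a b f. f \<in> hom_set C a b) (degen_objs i as) (degen_arrs (Idn C (as ! i)) i fs)"
      using cat by (intro typed_string_degen[OF s(4) s(1) A(2)]) (auto simp: category_def)
    then show "SpDegen (discrete_sspace (nerve C)) n i x \<in> topspace (SpTop (discrete_sspace (nerve C)) (Suc n))"
      using set_degen_objs[of i as] s A(2) length_degen_objs[of i as]
      by (simp add: discrete_sspace_def nerve_def x) (auto simp: typed_string_def)
    show "nerve_vertex (SpDegen (discrete_sspace (nerve C)) n i x) j = nerve_vertex x (if j \<le> i then j else j - 1)"
      if "j \<le> Suc n" for j
      using nth_degen_objs[OF s(2) A(2) that] by (simp add: discrete_sspace_def nerve_def x)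
  }
  show "x \<in> Simp (nerve C) n \<Longrightarrow> i < n \<Longrightarrow> arr_le C (nerve_vertex x i) (nerve_vertex x (Suc i))"
    by (auto simp: x Simp_nerve typed_string_def arr_le_def)
next
  fix n and x y :: "'o list \<times> 'm list"
  assume x: "x \<in> Simp (nerve C) n" and y: "y \<in> Simp (nerve C) n"
    and v: "\<And>i. i \<le> n \<Longrightarrow> nerve_vertex x i = nerve_vertex y i"
  obtain as fs where xx: "x = (as, fs)" by (cases x)
  obtain bs gs where yy: "y = (bs, gs)" by (cases y)
  have tx: "length fs = n" "typed_string (\<lambda>a b f. f \<in> hom_set C a b) as fs"
    and ty: "length gs = n" "typed_string (\<lambda>a b f. f \<in> hom_set C a b) bs gs"
    using x y by (auto simp: xx yy Simp_nerve)
  have as: "as = bs"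
    using v tx ty by (intro nth_equalityI) (auto simp: xx yy typed_string_def)
  have "fs = gs"
  proof (rule nth_equalityI)
    show "fs ! j = gs ! j" if "j < length fs" for j
      using that tx ty by (intro arrow_unique[of _ "as ! j" "as ! Suc j"]) (auto simp: as typed_string_def)
  qed (use tx ty in simp)
  with as show "x = y" by (simp add: xx yy)
qed (use arr_le_trans arr_le_antisym in blast)+

end

section \<open>Strings of words\<close>

text \<open>The \<open>l\<close>-th member of the flag of a \<open>k\<close>-simplex of words along \<open>as\<close>. A \<open>k\<close>-simplex consists
  of words of depth \<open>k + 1\<close>, hence the shift to depth \<open>Suc l\<close>: the \<open>k + 1\<close> members are the visited sets of
  depths \<open>1,\<dots>,k + 1\<close>. The objects \<open>as\<close> are included for the sake of the string without arrows.\<close>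

definition flag :: "('o, 'm) cat \<Rightarrow> 'o list \<Rightarrow> ('o, 'm) word list \<Rightarrow> nat \<Rightarrow> 'o set" where
  "flag C as xs l = set as \<union> \<Union> (visited C (Suc l) ` set xs)"

lemma visited_mono: "visited C l x \<subseteq> visited C (Suc l) x"
proof (induction l arbitrary: x)
  case 0
  then show ?case by (cases x) auto
next
  case (Suc l)
  show ?case
  proof (cases x)
    case (Word c fs d)
    then show ?thesis using Suc.IH by auto
  qed simp
qed

abbreviation word_typed :: "('o, 'm) cat \<Rightarrow> nat \<Rightarrow> 'o \<Rightarrow> 'o \<Rightarrow> ('o, 'm) word \<Rightarrow> bool" where
  "word_typed C k \<equiv> \<lambda>a b x. x \<in> hom_set (free_pow (Suc k) C) a b"

lemma Simp_chain_sset: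
  "xs \<in> Simp (chain_sset (resolution C) as) k \<longleftrightarrow> typed_string (word_typed C k) as xs"
  by (simp add: chain_sset_def resolution_def typed_string_def)

lemma typed_string_map:
  assumes "typed_string R as xs" "\<And>a b x. R a b x \<Longrightarrow> R' (h a) (h b) (f x)"
  shows "typed_string R' (map h as) (map f xs)"
  using assms by (simp add: typed_string_def)

lemma typed_string_all: "typed_string R as xs \<Longrightarrow> x \<in> set xs \<Longrightarrow> \<exists>a b. R a b x"
  by (auto simp: typed_string_def in_set_conv_nth)

lemma Face_chain_sset:
  "length as = Suc (length xs) \<Longrightarrow> Face (chain_sset (resolution C) as) k i xs =
     map (AMap ((free_map ^^ i) (counit (free_pow (k - i) C)))) xs"
  by (auto simp: chain_sset_def resolution_def intro!: nth_equalityI)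

lemma Degen_chain_sset:
  "length as = Suc (length xs) \<Longrightarrow> Degen (chain_sset (resolution C) as) k i xs =
     map (AMap ((free_map ^^ i) (comult (free_pow (k - i) C)))) xs"
  by (auto simp: chain_sset_def resolution_def intro!: nth_equalityI)

lemma flag_acts_on_visited:
  assumes "acts_on_visited C D (Suc k) (Suc k') h \<sigma> \<phi>" "typed_string (word_typed C k) as xs"
    and "l \<le> k'" "\<sigma> (Suc l) = Suc l'"
  shows "flag D (map h as) (map \<phi> xs) l = h ` flag C as xs l'"
proof -
  have "visited D (Suc l) (\<phi> x) = h ` visited C (Suc l') x" if "x \<in> set xs" for x
    using typed_string_all[OF assms(2) that] assms(1,3,4) unfolding acts_on_visited_def
    by (metis One_nat_def Suc_le_mono le0)
  then show ?thesis by (auto simp: flag_def)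
qed

lemma typed_string_acts_on_visited:
  assumes "acts_on_visited C D (Suc k) (Suc k') h \<sigma> \<phi>" "typed_string (word_typed C k) as xs"
  shows "typed_string (word_typed D k') (map h as) (map \<phi> xs)"
  using assms(2) by (rule typed_string_map) (use assms(1) in \<open>auto simp: acts_on_visited_def\<close>)

context poset_cat
begin

lemma flag_Cons:
  assumes "typed_string (word_typed C k) (a # b # as) (x # xs)"
  shows "flag C (a # b # as) (x # xs) l = visited C (Suc l) x \<union> flag C (b # as) xs l"
proof -
  have "x \<in> hom_set (free_pow (Suc k) C) a b" using assms by (simp add: typed_string_Cons)
  then show ?thesis using visited_chain[of x "Suc k" a b "Suc l"] by (auto simp: flag_def chain_in_def)
qed

lemma flag_snoc:
  assumes "typed_string (word_typed C k) (as @ [b]) (xs @ [x])"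
  shows "flag C (as @ [b]) (xs @ [x]) l = flag C as xs l \<union> visited C (Suc l) x"
proof -
  have "x \<in> hom_set (free_pow (Suc k) C) (last as) b"
    using assms by (elim typed_string_snocE) auto
  then show ?thesis using visited_chain[of x "Suc k" "last as" b "Suc l"] by (auto simp: flag_def chain_in_def)
qed

lemma flag_chain:
  assumes "typed_string (word_typed C k) as xs" "set as \<subseteq> Obj C"
  shows "chain_in C (hd as) (last as) (flag C as xs l)"
  using assms
proof (induction xs arbitrary: as)
  case Nil
  then obtain a where "as = [a]" "a \<in> Obj C" by (auto simp: typed_string_Nil)
  then show ?case using chain_in_pair[of a a] arr_le_refl by (simp add: flag_def)
next
  case (Cons x xs)
  then obtain a b as' where as: "as = a # b # as'" "x \<in> hom_set (free_pow (Suc k) C) a b"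
    "typed_string (word_typed C k) (b # as') xs" by (elim typed_string_ConsE)
  have "chain_in C a b (visited C (Suc l) x)" using visited_chain[OF as(2)] .
  from chain_in_Un[OF this] have "chain_in C a (last (b # as')) (visited C (Suc l) x \<union> flag C (b # as') xs l)"
    using Cons.IH[OF as(3)] Cons.prems as by simp
  then show ?case using flag_Cons Cons.prems as by simp
qed

lemma flag_subset: "flag C as xs l \<subseteq> flag C as xs (Suc l)"
  unfolding flag_def using visited_mono[of C "Suc l"] by (intro Un_mono UN_mono) auto

lemma flag_inject:
  assumes "typed_string (word_typed C k) as xs" "typed_string (word_typed C k) as ys" "set as \<subseteq> Obj C"
    and "\<And>l. l \<le> k \<Longrightarrow> flag C as xs l = flag C as ys l"
  shows "xs = ys"
  using assms
proof (induction xs arbitrary: as ys)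
  case Nil
  then show ?case by (auto simp: typed_string_def)
next
  case (Cons x xs)
  from Cons.prems(1) obtain a b as' where as: "as = a # b # as'" "x \<in> hom_set (free_pow (Suc k) C) a b"
    "typed_string (word_typed C k) (b # as') xs" by (elim typed_string_ConsE)
  from Cons.prems(2) as obtain y ys' where ys: "ys = y # ys'" "y \<in> hom_set (free_pow (Suc k) C) a b"
    "typed_string (word_typed C k) (b # as') ys'"
    by (cases ys) (auto simp: typed_string_Cons typed_string_Nil)
  have sub: "set (b # as') \<subseteq> Obj C" using Cons.prems(3) as by simp
  have *: "visited C (Suc l) x = visited C (Suc l) y \<and> flag C (b # as') xs l = flag C (b # as') ys' l" if "l \<le> k" for l
  proof -
    have eq: "visited C (Suc l) x \<union> flag C (b # as') xs l = visited C (Suc l) y \<union> flag C (b # as') ys' l"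
      using Cons.prems(4)[OF that] flag_Cons[OF Cons.prems(1)[unfolded as]] flag_Cons[OF Cons.prems(2)[unfolded as ys]] as ys
      by metis
    note X = chain_split[OF visited_chain[OF as(2)] flag_chain[OF as(3) sub, simplified list.sel], of "Suc l" l]
    note Y = chain_split[OF visited_chain[OF ys(2)] flag_chain[OF ys(3) sub, simplified list.sel], of "Suc l" l]
    show ?thesis using X Y unfolding eq by metis
  qed
  have "x = y"
  proof (rule word_inject[OF as(2) ys(2)])
    show "visited C l x = visited C l y" if "1 \<le> l" "l \<le> Suc k" for l
      using *[of "l - 1"] that by simp
  qed
  moreover have "xs = ys'" by (rule Cons.IH[OF as(3) ys(3) sub]) (use * in blast)
  ultimately show ?case using ys by simp
qed

lemma flag_exists:
  assumes "as \<noteq> []" "\<And>l. l \<le> k \<Longrightarrow> chain_in C (hd as) (last as) (T l)" "set as \<subseteq> T 0"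
    and "\<And>l. l < k \<Longrightarrow> T l \<subseteq> T (Suc l)" "successively (arr_le C) as"
  shows "\<exists>xs. typed_string (word_typed C k) as xs \<and> (\<forall>l\<le>k. flag C as xs l = T l)"
  using assms
proof (induction as arbitrary: T rule: induct_list012)
  case (2 a)
  then have "T l = {a}" if "l \<le> k" for l using chain_in_self that by simp
  then show ?case by (intro exI[of _ "[]"]) (auto simp: typed_string_def flag_def)
next
  case (3 a b as)
  have bT: "b \<in> T l" if "l \<le> k" for l
    using that
  proof (induction l)
    case (Suc l)
    then show ?case using "3.prems"(4)[of l] by auto
  qed (use "3.prems"(3) in auto)
  have ch: "chain_in C a (last (b # as)) (T l)" if "l \<le> k" for l using "3.prems"(2)[OF that] by simp
  have ab: "arr_le C a b" using "3.prems"(5) by simp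
  have "\<exists>x\<in>hom_set (free_pow (Suc k) C) a b. \<forall>l. 1 \<le> l \<longrightarrow> l \<le> Suc k \<longrightarrow>
      visited C l x = {p \<in> T (l - 1). arr_le C p b}"
  proof (rule word_exists[OF ab])
    show "chain_in C a b {p \<in> T (l - 1). arr_le C p b}" if "1 \<le> l" "l \<le> Suc k" for l
      using chain_in_lower[OF ch[of "l - 1"] bT[of "l - 1"]] that by simp
    show "{p \<in> T (l - 1). arr_le C p b} \<subseteq> {p \<in> T (Suc l - 1). arr_le C p b}" if "1 \<le> l" "l < Suc k" for l
    proof -
      from that obtain l' where "l = Suc l'" "l' < k" by (cases l) auto
      then show ?thesis using "3.prems"(4)[of l'] by auto
    qed
  qed
  then obtain x where x: "x \<in> hom_set (free_pow (Suc k) C) a b"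
    "\<forall>l. 1 \<le> l \<longrightarrow> l \<le> Suc k \<longrightarrow> visited C l x = {p \<in> T (l - 1). arr_le C p b}" by blast
  have le: "arr_le C b p" if "p \<in> set (b # as)" for p
  proof -
    have "sorted_wrt (arr_le C) (b # as)"
      using "3.prems"(5) arr_le_trans by (subst (asm) successively_iff_sorted_wrt_strong) auto
    then show ?thesis using that arr_le_refl arr_le_Obj[OF ab] by auto
  qed
  have "\<exists>xs. typed_string (word_typed C k) (b # as) xs \<and> (\<forall>l\<le>k. flag C (b # as) xs l = {p \<in> T l. arr_le C b p})"
  proof (rule "3.IH"(2))
    show "chain_in C (hd (b # as)) (last (b # as)) {p \<in> T l. arr_le C b p}" if "l \<le> k" for l
      using chain_in_upper[OF ch[OF that] bT[OF that]] by simp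
  qed (use "3.prems" le in auto)
  then obtain xs where xs: "typed_string (word_typed C k) (b # as) xs"
    "\<forall>l\<le>k. flag C (b # as) xs l = {p \<in> T l. arr_le C b p}" by blast
  have t: "typed_string (word_typed C k) (a # b # as) (x # xs)" using x xs by (simp add: typed_string_Cons)
  moreover have "flag C (a # b # as) (x # xs) l = T l" if "l \<le> k" for l
  proof -
    have "{p \<in> T l. arr_le C p b} \<union> {p \<in> T l. arr_le C b p} = T l"
      using ch[OF that] bT[OF that] unfolding chain_in_def by auto
    then show ?thesis using flag_Cons[OF t] x(2) xs(2) that by simp
  qed
  ultimately show ?case by blast
qed simp

text \<open>The flag serves as the list of vertices: the space of words along \<open>as\<close> is the nerve of
  the poset of finite chains that refine \<open>as\<close>.\<close>

lemma vertexed_chain: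
  assumes "set as \<subseteq> Obj C"
  shows "vertexed_sset (chain_sset (resolution C) as) (flag C as) (\<subseteq>)"
proof
  fix k i :: nat and xs :: "('o, 'm) word list"
  { assume A: "xs \<in> topspace (SpTop (chain_space (resolution C) as) (Suc k))" "i \<le> Suc k"
    then have t: "typed_string (word_typed C (Suc k)) as xs"
      by (simp add: discrete_sspace_def Simp_chain_sset)
    note l = acts_on_visited_face[OF poset_cat_axioms A(2)]
    have len: "length as = Suc (length xs)" using t by (simp add: typed_string_def)
    show "SpFace (chain_space (resolution C) as) (Suc k) i xs \<in> topspace (SpTop (chain_space (resolution C) as) k)"
      using typed_string_acts_on_visited[OF l t] Face_chain_sset[OF len]
      by (simp add: discrete_sspace_def Simp_chain_sset)
    show "flag C as (SpFace (chain_space (resolution C) as) (Suc k) i xs) j = flag C as xs (if j < i then j else Suc j)"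
      if "j \<le> k" for j
      using flag_acts_on_visited[OF l t that, of "if j < i then j else Suc j"] Face_chain_sset[OF len]
      by (simp add: discrete_sspace_def)
  }
  { assume A: "xs \<in> topspace (SpTop (chain_space (resolution C) as) k)" "i \<le> k"
    then have t: "typed_string (word_typed C k) as xs"
      by (simp add: discrete_sspace_def Simp_chain_sset)
    note l = acts_on_visited_degen[OF poset_cat_axioms A(2)]
    have len: "length as = Suc (length xs)" using t by (simp add: typed_string_def)
    show "SpDegen (chain_space (resolution C) as) k i xs \<in> topspace (SpTop (chain_space (resolution C) as) (Suc k))"
      using typed_string_acts_on_visited[OF l t] Degen_chain_sset[OF len]
      by (simp add: discrete_sspace_def Simp_chain_sset)
    show "flag C as (SpDegen (chain_space (resolution C) as) k i xs) j = flag C as xs (if j \<le> i then j else j - 1)"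
      if "j \<le> Suc k" for j
      using flag_acts_on_visited[OF l t that, of "if j \<le> i then j else j - 1"] Degen_chain_sset[OF len]
      by (auto simp: discrete_sspace_def split: if_splits)
  }
  show "flag C as xs i \<subseteq> flag C as xs (Suc i)" by (rule flag_subset)
next
  fix k and xs ys :: "('o, 'm) word list"
  assume "xs \<in> Simp (chain_sset (resolution C) as) k" "ys \<in> Simp (chain_sset (resolution C) as) k"
    "\<And>l. l \<le> k \<Longrightarrow> flag C as xs l = flag C as ys l"
  then show "xs = ys" using flag_inject[of k as xs ys] assms by (simp add: Simp_chain_sset)
qed auto

text \<open>The effect of the \<open>i\<close>-th face of the bar direction on a member of the flag: inner faces
  compose and change nothing, the two outer ones drop what lies outside the shorter string.\<close>

definition cut_flag :: "nat \<Rightarrow> nat \<Rightarrow> 'o list \<Rightarrow> 'o set \<Rightarrow> 'o set" where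
  "cut_flag n i as S = (if i = 0 then {p \<in> S. arr_le C (as ! 1) p}
     else if i = n then {p \<in> S. arr_le C p (as ! (n - 1))} else S)"

lemma flag_face:
  assumes t: "typed_string (word_typed C k) as xs" and "length xs = Suc n" "i \<le> Suc n" "set as \<subseteq> Obj C" "l \<le> k"
  shows "flag C (face_objs i as) (face_arrs (Comp (free_pow (Suc k) C)) (Suc n) i xs) l
    = cut_flag (Suc n) i as (flag C as xs l)"
proof -
  consider "i = 0" | "i = Suc n" | "0 < i" "i \<le> n" using assms(3) by linarith
  then show ?thesis
  proof cases
    case 1
    obtain x xs' where xs: "xs = x # xs'" using assms(2) by (cases xs) auto
    from t[unfolded xs] obtain a b as' where as: "as = a # b # as'" "x \<in> hom_set (free_pow (Suc k) C) a b"
      "typed_string (word_typed C k) (b # as') xs'" by (elim typed_string_ConsE)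
    have "chain_in C b (last (b # as')) (flag C (b # as') xs' l)"
      using flag_chain[OF as(3)] assms(4) as(1) by simp
    from chain_split(2)[OF visited_chain[OF as(2)] this, of "Suc l"]
    show ?thesis using 1 xs as flag_Cons[OF t[unfolded xs as(1)]]
      by (simp add: face_objs_def face_arrs_def cut_flag_def)
  next
    case 2
    obtain x xs' where xs: "xs = xs' @ [x]" using assms(2) by (cases xs rule: rev_cases) auto
    from t[unfolded xs] obtain as' b where as: "as = as' @ [b]" "as' \<noteq> []"
      "x \<in> hom_set (free_pow (Suc k) C) (last as') b" "typed_string (word_typed C k) as' xs'" by (elim typed_string_snocE)
    have len: "length as' = Suc n" using as(4) xs assms(2) by (simp add: typed_string_def)
    have "chain_in C (hd as') (last as') (flag C as' xs' l)"
      using flag_chain[OF as(4)] assms(4) as(1) by simp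
    from chain_split(1)[OF this visited_chain[OF as(3)], of "Suc l"]
    show ?thesis using 2 xs as len flag_snoc[OF t[unfolded xs as(1)]]
      by (simp add: face_objs_def face_arrs_def cut_flag_def nth_append last_conv_nth)
  next
    case 3
    have len: "length as = Suc (Suc n)" using t assms(2) by (simp add: typed_string_def)
    have x: "xs ! (i - 1) \<in> hom_set (free_pow (Suc k) C) (as ! (i - 1)) (as ! i)"
      "xs ! i \<in> hom_set (free_pow (Suc k) C) (as ! i) (as ! Suc i)"
      using t 3 assms(2) unfolding typed_string_def by (metis One_nat_def Suc_pred diff_le_self le_imp_less_Suc le_trans, auto)
    let ?c = "Comp (free_pow (Suc k) C) (xs ! i) (xs ! (i - 1))"
    have c: "visited C (Suc l) ?c = visited C (Suc l) (xs ! (i - 1)) \<union> visited C (Suc l) (xs ! i)"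
      using Comp_free_pow(2)[OF x] assms(5) by simp
    have "as = take i as @ as ! i # drop (Suc i) as" using len 3 by (intro id_take_nth_drop) simp
    then have "set as = insert (as ! i) (set (face_objs i as))"
      unfolding face_objs_def by (metis Un_insert_right list.simps(15) set_append)
    moreover have "as ! i \<in> visited C (Suc l) ?c" using c visited_chain[OF x(1), of "Suc l"] by (simp add: chain_in_def)
    moreover have "xs = take (i - 1) xs @ xs ! (i - 1) # xs ! i # drop (Suc i) xs"
      using id_take_nth_drop[of "i - 1" xs] Cons_nth_drop_Suc[of i xs] 3 assms(2) by simp
    then have "set xs = {xs ! (i - 1), xs ! i} \<union> set (take (i - 1) xs) \<union> set (drop (Suc i) xs)"
      by (metis (no_types, lifting) Un_commute Un_insert_left Un_insert_right list.simps(15) set_append sup_bot_left)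
    ultimately show ?thesis using 3 c
      by (auto simp: flag_def cut_flag_def face_arrs_def)
  qed
qed

lemma flag_degen:
  assumes t: "typed_string (word_typed C k) as xs" and "length xs = n" "i \<le> n" "set as \<subseteq> Obj C"
  shows "flag C (degen_objs i as) (degen_arrs (Idn (free_pow (Suc k) C) (as ! i)) i xs) l = flag C as xs l"
proof -
  have len: "length as = Suc n" using assms by (simp add: typed_string_def)
  then have i: "as ! i \<in> set as" "as ! i \<in> Obj C" using assms(3,4) by (auto simp: subset_iff)
  have "visited C (Suc l) (Idn (free_pow (Suc k) C) (as ! i)) = {as ! i}"
    using chain_in_self[OF visited_chain[OF Idn_free_pow[OF i(2)]]] .
  moreover have "set xs = set (take i xs) \<union> set (drop i xs)"
    by (metis append_take_drop_id set_append)
  ultimately show ?thesis using i set_degen_objs[of i as] len assms(3)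
    by (auto simp: flag_def degen_arrs_def)
qed

end

section \<open>Weights on a finite chain\<close>

text \<open>The maximum with \<open>0\<close>, which gives the empty set the value \<open>0\<close>.\<close>

definition max0 :: "('a \<Rightarrow> real) \<Rightarrow> 'a set \<Rightarrow> real" where
  "max0 w A = Max (insert 0 (w ` A))"

lemma max0_empty [simp]: "max0 w {} = 0"
  by (simp add: max0_def)

lemma max0_insert: "finite A \<Longrightarrow> max0 w (insert a A) = max (w a) (max0 w A)"
  by (simp add: max0_def insert_commute[of 0] del: Max_insert) (simp add: Max_insert)

lemma max0_nonneg: "finite A \<Longrightarrow> 0 \<le> max0 w A"
  by (simp add: max0_def)

lemma max0_ge: "finite A \<Longrightarrow> a \<in> A \<Longrightarrow> w a \<le> max0 w A"
  by (simp add: max0_def)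

lemma max0_le: "finite A \<Longrightarrow> 0 \<le> b \<Longrightarrow> (\<And>a. a \<in> A \<Longrightarrow> w a \<le> b) \<Longrightarrow> max0 w A \<le> b"
  by (simp add: max0_def)

lemma max0_Un: "finite A \<Longrightarrow> finite S \<Longrightarrow> max0 w (A \<union> S) = max (max0 w A) (max0 w S)"
  by (induction A rule: finite_induct) (auto simp: max0_insert max.assoc max0_nonneg max_absorb2)

lemma max0_cong: "A = S \<Longrightarrow> (\<And>a. a \<in> S \<Longrightarrow> w a = w' a) \<Longrightarrow> max0 w A = max0 w' S"
  by (simp add: max0_def)

lemma max0_mono_neutral:
  assumes "finite S" "A \<subseteq> S" "\<And>b. b \<in> S - A \<Longrightarrow> w b \<le> 0"
  shows "max0 w A = max0 w S"
proof (rule antisym)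
  have A: "finite A" using assms finite_subset by blast
  show "max0 w A \<le> max0 w S" using assms A by (intro max0_le) (auto intro: max0_ge max0_nonneg)
  show "max0 w S \<le> max0 w A"
  proof (rule max0_le[OF assms(1) max0_nonneg[OF A]])
    fix b assume "b \<in> S"
    then show "w b \<le> max0 w A"
      using assms(3)[of b] max0_nonneg[OF A, of w] max0_ge[OF A, of b w] by (cases "b \<in> A") auto
  qed
qed

lemma max0_scale:
  assumes "finite A" "0 < k"
  shows "max0 (\<lambda>a. k * w a) A = k * max0 w A"
  using assms(1)
proof (induction A rule: finite_induct)
  case (insert a A)
  then show ?case using assms(2) max_mult_distrib_left[of k "w a" "max0 w A"] by (simp add: max0_insert)
qed simp

definition finite_chain :: "('a \<Rightarrow> 'a \<Rightarrow> bool) \<Rightarrow> 'a set \<Rightarrow> bool" where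
  "finite_chain lt T \<longleftrightarrow> finite T \<and> (\<forall>x\<in>T. \<not> lt x x) \<and>
     (\<forall>x\<in>T. \<forall>y\<in>T. \<forall>z\<in>T. lt x y \<longrightarrow> lt y z \<longrightarrow> lt x z) \<and>
     (\<forall>x\<in>T. \<forall>y\<in>T. x = y \<or> lt x y \<or> lt y x)"

lemma finite_chain_trans:
  assumes "finite_chain lt T" "x \<in> T" "y \<in> T" "z \<in> T" "lt x y" "lt y z"
  shows "lt x z"
proof -
  have "\<forall>x\<in>T. \<forall>y\<in>T. \<forall>z\<in>T. lt x y \<longrightarrow> lt y z \<longrightarrow> lt x z"
    using assms(1) unfolding finite_chain_def by (elim conjE)
  then show ?thesis using assms(2-) by blast
qed

lemma finite_chain_irrefl: "finite_chain lt T \<Longrightarrow> x \<in> T \<Longrightarrow> \<not> lt x x"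
  unfolding finite_chain_def by (elim conjE) (erule bspec)

lemma finite_chain_total:
  assumes "finite_chain lt T" "x \<in> T" "y \<in> T"
  shows "x = y \<or> lt x y \<or> lt y x"
proof -
  have "\<forall>x\<in>T. \<forall>y\<in>T. x = y \<or> lt x y \<or> lt y x"
    using assms(1) unfolding finite_chain_def by (elim conjE)
  then show ?thesis using assms(2-) by blast
qed

lemma finite_chain_finite: "finite_chain lt T \<Longrightarrow> finite T"
  unfolding finite_chain_def by (elim conjE)

lemma finite_chain_asym: "finite_chain lt T \<Longrightarrow> x \<in> T \<Longrightarrow> y \<in> T \<Longrightarrow> lt x y \<Longrightarrow> \<not> lt y x"
  using finite_chain_irrefl finite_chain_trans by metis

lemma finite_chain_subset:
  assumes T: "finite_chain lt T" and "S \<subseteq> T"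
  shows "finite_chain lt S"
  unfolding finite_chain_def
proof (intro conjI ballI impI)
  show "finite S" using finite_chain_finite[OF T] assms(2) by (rule finite_subset[rotated])
  show "lt x z" if "x \<in> S" "y \<in> S" "z \<in> S" "lt x y" "lt y z" for x y z
    using finite_chain_trans[OF T _ _ _ that(4,5)] that(1-3) assms(2) by blast
qed (use finite_chain_irrefl[OF T] finite_chain_total[OF T] assms(2) in blast)+

lemma finite_chain_dual:
  assumes "finite_chain lt T"
  shows "finite_chain (\<lambda>x y. lt y x) T"
  unfolding finite_chain_def
proof (intro conjI ballI impI)
  show "lt z x" if "x \<in> T" "y \<in> T" "z \<in> T" "lt y x" "lt z y" for x y z
    using finite_chain_trans[OF assms that(3,2,1,5,4)] .
qed (use finite_chain_finite[OF assms] finite_chain_irrefl[OF assms] finite_chain_total[OF assms] in blast)+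

lemma finite_chain_greatest:
  assumes "finite_chain lt T" "T \<noteq> {}"
  shows "\<exists>t\<in>T. \<forall>x\<in>T. x = t \<or> lt x t"
proof -
  have "finite T" using assms finite_chain_finite by blast
  then show ?thesis using assms(2,1)
  proof (induction T rule: finite_ne_induct)
    case (insert x F)
    then obtain t where t: "t \<in> F" "\<forall>y\<in>F. y = t \<or> lt y t"
      using finite_chain_subset by blast
    from finite_chain_total[OF insert.prems, of x t] t consider "lt x t" | "lt t x" | "x = t"
      by blast
    then show ?case
    proof cases
      case 2
      then have "y = x \<or> lt y x" if "y \<in> insert x F" for y
        using t that finite_chain_trans[OF insert.prems, of y t x] by auto
      then show ?thesis by blast
    qed (use t in auto)
  qed simp
qed

text \<open>Induction that adds elements from below to above.\<close>

lemma finite_chain_induct [consumes 1, case_names empty insert]: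
  assumes "finite_chain lt T" "P {}"
    and step: "\<And>t T. finite_chain lt (insert t T) \<Longrightarrow> t \<notin> T \<Longrightarrow> (\<And>x. x \<in> T \<Longrightarrow> lt x t) \<Longrightarrow> P T \<Longrightarrow> P (insert t T)"
  shows "P T"
  using assms(1)
proof (induction "card T" arbitrary: T)
  case 0
  then show ?case using assms(2) finite_chain_finite by fastforce
next
  case (Suc n)
  then have "T \<noteq> {}" by auto
  then obtain t where t: "t \<in> T" "\<forall>x\<in>T. x = t \<or> lt x t" using finite_chain_greatest Suc.prems by blast
  have "P (T - {t})"
    using Suc t by (intro Suc.hyps(1)) (auto intro: finite_chain_subset)
  then have "P (insert t (T - {t}))"
    using Suc.prems t by (intro step) (auto simp: insert_absorb)
  then show ?case using t by (simp add: insert_absorb)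
qed

text \<open>The increments of the running maximum telescope. The start value \<open>m\<close> stands for the maximum
  over the elements that precede the chain \<open>A\<close>.\<close>

lemma sum_increments:
  assumes "finite_chain lt A" "0 \<le> m"
  shows "(\<Sum>c\<in>A. max 0 (w c - max m (max0 w {e \<in> A. lt e c}))) = max 0 (max0 w A - m)"
  using assms(1)
proof (induction A rule: finite_chain_induct)
  case empty
  then show ?case using assms(2) by simp
next
  case (insert t A)
  have fin: "finite A" using insert.hyps finite_chain_finite finite_chain_irrefl by fastforce
  have tt: "\<not> lt t t" using insert.hyps finite_chain_finite finite_chain_irrefl by fastforce
  have 1: "{e \<in> insert t A. lt e c} = {e \<in> A. lt e c}" if "c \<in> A" for c
    using insert.hyps(1) insert.hyps(3)[OF that] finite_chain_asym[of lt "insert t A" c t] that by auto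
  have 2: "{e \<in> insert t A. lt e t} = A"
    using insert.hyps(3) tt by auto
  have "(\<Sum>c\<in>insert t A. max 0 (w c - max m (max0 w {e \<in> insert t A. lt e c}))) =
      max 0 (w t - max m (max0 w A)) + (\<Sum>c\<in>A. max 0 (w c - max m (max0 w {e \<in> A. lt e c})))"
    using fin insert.hyps(2) 1 2 by (simp cong: sum.cong)
  also have "\<dots> = max 0 (max0 w (insert t A) - m)"
    unfolding insert.IH max0_insert[OF fin] by linarith
  finally show ?case .
qed

subsection \<open>The combined weight\<close>

text \<open>The part of \<open>w(c)\<close> that exceeds all values at earlier elements of the same fibre of \<open>\<kappa>\<close>.\<close>

definition share :: "('a \<Rightarrow> 'b) \<Rightarrow> ('a \<Rightarrow> 'a \<Rightarrow> bool) \<Rightarrow> ('a \<Rightarrow> real) \<Rightarrow> 'a \<Rightarrow> real" where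
  "share \<kappa> lt w c = max 0 (w c - max0 w {e. w e \<noteq> 0 \<and> lt e c \<and> \<kappa> e = \<kappa> c})"

definition below :: "('a \<Rightarrow> 'b) \<Rightarrow> ('a \<Rightarrow> 'a \<Rightarrow> bool) \<Rightarrow> ('a \<Rightarrow> real) \<Rightarrow> 'a \<Rightarrow> real" where
  "below \<kappa> lt v c = sum v {e. v e \<noteq> 0 \<and> lt e c \<and> \<kappa> e \<noteq> \<kappa> c}"

definition above :: "('a \<Rightarrow> 'b) \<Rightarrow> ('a \<Rightarrow> 'a \<Rightarrow> bool) \<Rightarrow> ('a \<Rightarrow> real) \<Rightarrow> 'a \<Rightarrow> real" where
  "above \<kappa> lt v c = sum v {e. v e \<noteq> 0 \<and> lt c e \<and> \<kappa> e \<noteq> \<kappa> c}"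

text \<open>The unnormalised coordinate \<open>z(c)\<close> of the introduction. For injective \<open>\<kappa>\<close> it is
  \<open>v(c) + w(c) \<theta>(c)\<close>.\<close>

definition weight ::
  "('a \<Rightarrow> 'b) \<Rightarrow> ('a \<Rightarrow> 'a \<Rightarrow> bool) \<Rightarrow> ('a \<Rightarrow> real) \<Rightarrow> ('a \<Rightarrow> real) \<Rightarrow> 'a \<Rightarrow> real" where
  "weight \<kappa> lt v w c = v c + share \<kappa> lt w c * min (below \<kappa> lt v c) (above \<kappa> lt v c)"

text \<open>The coordinates \<open>(v,w)\<close> of a point of the bar construction, \<open>T\<close> being any finite chain that
  contains the supports.\<close>

locale weights =
  fixes lt :: "'a \<Rightarrow> 'a \<Rightarrow> bool" and T :: "'a set" and v w :: "'a \<Rightarrow> real"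
  assumes chain: "finite_chain lt T"
    and v_nonneg: "\<And>c. 0 \<le> v c" and w_nonneg: "\<And>c. 0 \<le> w c" and w_le_1: "\<And>c. w c \<le> 1"
    and w_1: "\<And>c. 0 < v c \<Longrightarrow> w c = 1"
    and w_T: "\<And>c. c \<notin> T \<Longrightarrow> w c = 0"
    and sum_v: "sum v T = 1"
begin

lemma fin: "finite T"
  using chain by (rule finite_chain_finite)

lemma v_T: "c \<notin> T \<Longrightarrow> v c = 0"
  using w_1[of c] w_T[of c] v_nonneg[of c] by fastforce

lemma share_eq: "share \<kappa> lt w c = max 0 (w c - max0 w {e \<in> T. lt e c \<and> \<kappa> e = \<kappa> c})"
proof -
  have "max0 w {e. w e \<noteq> 0 \<and> lt e c \<and> \<kappa> e = \<kappa> c} = max0 w {e \<in> T. lt e c \<and> \<kappa> e = \<kappa> c}"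
    using fin w_T by (intro max0_mono_neutral) auto
  then show ?thesis by (simp add: share_def)
qed

lemma below_eq: "below \<kappa> lt v c = sum v {e \<in> T. lt e c \<and> \<kappa> e \<noteq> \<kappa> c}"
  unfolding below_def using fin v_T by (intro sum.mono_neutral_left) auto

lemma above_eq: "above \<kappa> lt v c = sum v {e \<in> T. lt c e \<and> \<kappa> e \<noteq> \<kappa> c}"
  unfolding above_def using fin v_T by (intro sum.mono_neutral_left) auto

lemma below_nonneg: "0 \<le> below \<kappa> lt v c" and above_nonneg: "0 \<le> above \<kappa> lt v c"
  by (auto simp: below_def above_def v_nonneg intro: sum_nonneg)

lemma share_nonneg: "0 \<le> share \<kappa> lt w c"
  by (simp add: share_def)

lemma share_T: "c \<notin> T \<Longrightarrow> share \<kappa> lt w c = 0"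
  using max0_nonneg[of "{e \<in> T. lt e c \<and> \<kappa> e = \<kappa> c}" w] fin by (simp add: share_eq w_T)

lemma weight_T: "c \<notin> T \<Longrightarrow> weight \<kappa> lt v w c = 0"
  by (simp add: weight_def v_T share_T)

lemma weight_ge: "v c \<le> weight \<kappa> lt v w c"
  by (simp add: weight_def share_nonneg below_nonneg above_nonneg)

lemma weight_nonneg: "0 \<le> weight \<kappa> lt v w c"
  using weight_ge v_nonneg order_trans by blast

lemma sum_weight: "1 \<le> sum (weight \<kappa> lt v w) T"
  using sum_mono[of T v "weight \<kappa> lt v w", OF weight_ge] sum_v by simp

lemma weight_kernel:
  assumes "\<And>x y. x \<in> T \<Longrightarrow> y \<in> T \<Longrightarrow> \<kappa> x = \<kappa> y \<longleftrightarrow> \<kappa>' x = \<kappa>' y"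
  shows "weight \<kappa> lt v w c = weight \<kappa>' lt v w c"
proof (cases "c \<in> T")
  case True
  have 1: "{e \<in> T. lt e c \<and> \<kappa> e = \<kappa> c} = {e \<in> T. lt e c \<and> \<kappa>' e = \<kappa>' c}"
    "{e \<in> T. lt e c \<and> \<kappa> e \<noteq> \<kappa> c} = {e \<in> T. lt e c \<and> \<kappa>' e \<noteq> \<kappa>' c}"
    "{e \<in> T. lt c e \<and> \<kappa> e \<noteq> \<kappa> c} = {e \<in> T. lt c e \<and> \<kappa>' e \<noteq> \<kappa>' c}"
    using assms True by blast+
  show ?thesis by (simp add: weight_def share_eq below_eq above_eq 1)
qed (simp add: weight_T)

text \<open>Dropping the part of \<open>w\<close> below the support of \<open>v\<close> does not change \<open>z\<close>. Where \<open>w\<close> itself is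
  changed there is no mass below, so the factor of the share vanishes. Where only the running maximum of
  the fibre is changed, the fibre contains an element before \<open>a\<close>, hence by convexity also all the mass
  below \<open>c\<close>, and again the factor vanishes.\<close>

lemma weight_cut_lower:
  assumes a: "a \<in> T" and v_a: "\<And>e. 0 < v e \<Longrightarrow> e = a \<or> lt a e"
    and convex: "\<And>x y z. x \<in> T \<Longrightarrow> y \<in> T \<Longrightarrow> z \<in> T \<Longrightarrow> lt x y \<Longrightarrow> lt y z \<Longrightarrow> \<kappa> x = \<kappa> z \<Longrightarrow> \<kappa> y = \<kappa> x"
    and w': "\<And>c. w' c = (if c = a \<or> lt a c then w c else 0)"
  shows "weight \<kappa> lt v w' c = weight \<kappa> lt v w c"
proof (cases "c \<in> T")
  case False
  interpret W': weights lt T v w'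
    by unfold_locales (use chain v_nonneg w_nonneg w_le_1 w_1 w_T sum_v w' v_a in auto)
  show ?thesis using False by (simp add: weight_T W'.weight_T)
next
  case c: True
  interpret W': weights lt T v w'
    by unfold_locales (use chain v_nonneg w_nonneg w_le_1 w_1 w_T sum_v w' v_a in auto)
  have v0: "v e = 0" if "e \<in> T" "lt e a" for e
    using v_a[of e] v_nonneg[of e] that finite_chain_asym[OF chain that(1) a that(2)]
      finite_chain_irrefl[OF chain a] by fastforce
  have zero: "min (below \<kappa> lt v c) (above \<kappa> lt v c) = 0" if "below \<kappa> lt v c = 0"
    using that above_nonneg[of \<kappa> c] by simp
  (* In the last case no element of the fibre of c is cut off. *)
  consider "lt c a" | e where "c = a \<or> lt a c" "e \<in> T" "lt e a" "\<kappa> e = \<kappa> c"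
    | "c = a \<or> lt a c" "\<And>e. e \<in> T \<Longrightarrow> \<kappa> e = \<kappa> c \<Longrightarrow> \<not> lt e a"
    using finite_chain_total[OF chain a c] by blast
  then show ?thesis
  proof cases
    case 1
    have "below \<kappa> lt v c = 0"
      unfolding below_eq using v0 1 finite_chain_trans[OF chain _ c a] by (auto intro!: sum.neutral)
    then show ?thesis using zero by (simp add: weight_def)
  next
    case 2
    have ca: "\<kappa> a = \<kappa> c" using 2 convex[of e a c] a c by auto
    have "v e' = 0" if "e' \<in> T" "lt e' c" "\<kappa> e' \<noteq> \<kappa> c" for e'
    proof (rule ccontr)
      assume "v e' \<noteq> 0"
      then have "e' = a \<or> lt a e'" using v_a[of e'] v_nonneg[of e'] by linarith
      then show False using convex[of a e' c] that a c ca by auto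
    qed
    then have "below \<kappa> lt v c = 0" unfolding below_eq by (auto intro!: sum.neutral)
    then show ?thesis using zero by (simp add: weight_def)
  next
    case 3
    have "e = a \<or> lt a e" if "e \<in> T" "\<kappa> e = \<kappa> c" for e
      using 3(2)[OF that] finite_chain_total[OF chain a that(1)] by blast
    then have "max0 w' {e \<in> T. lt e c \<and> \<kappa> e = \<kappa> c} = max0 w {e \<in> T. lt e c \<and> \<kappa> e = \<kappa> c}"
      by (intro max0_cong) (auto simp: w')
    then show ?thesis using 3(1) by (simp add: weight_def share_eq W'.share_eq w')
  qed
qed

text \<open>The same on the other side is easier, as a share only looks downwards.\<close>

lemma weight_cut_upper:
  assumes b: "b \<in> T" and v_b: "\<And>e. 0 < v e \<Longrightarrow> e = b \<or> lt e b"
    and w': "\<And>c. w' c = (if c = b \<or> lt c b then w c else 0)"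
  shows "weight \<kappa> lt v w' c = weight \<kappa> lt v w c"
proof (cases "c \<in> T")
  case False
  interpret W': weights lt T v w'
    by unfold_locales (use chain v_nonneg w_nonneg w_le_1 w_1 w_T sum_v w' v_b in auto)
  show ?thesis using False by (simp add: weight_T W'.weight_T)
next
  case c: True
  interpret W': weights lt T v w'
    by unfold_locales (use chain v_nonneg w_nonneg w_le_1 w_1 w_T sum_v w' v_b in auto)
  have v0: "v e = 0" if "e \<in> T" "lt b e" for e
    using v_b[of e] v_nonneg[of e] that finite_chain_asym[OF chain b that(1) that(2)]
      finite_chain_irrefl[OF chain b] by fastforce
  show ?thesis
  proof (cases "c = b \<or> lt c b")
    case True
    then have "max0 w' {e \<in> T. lt e c \<and> \<kappa> e = \<kappa> c} = max0 w {e \<in> T. lt e c \<and> \<kappa> e = \<kappa> c}"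
      using finite_chain_trans[OF chain _ c b] by (intro max0_cong) (auto simp: w')
    then show ?thesis using True by (simp add: weight_def share_eq W'.share_eq w')
  next
    case False
    then have "lt b c" using finite_chain_total[OF chain b c] by blast
    then have "above \<kappa> lt v c = 0"
      unfolding above_eq using v0 finite_chain_trans[OF chain b c] by (auto intro!: sum.neutral)
    then show ?thesis using below_nonneg[of \<kappa> c] by (simp add: weight_def)
  qed
qed

text \<open>The excesses over the elements of a fibre of \<open>h\<close> telescope to the excess of the maximum
  \<open>w' d\<close>, while the masses below and above are the same for all elements of the fibre. This is the
  point of the definition of \<^const>\<open>share\<close>.\<close>

lemma weight_push:
  assumes chain': "finite_chain lt' (h ` T)"
    and mono: "\<And>x y. x \<in> T \<Longrightarrow> y \<in> T \<Longrightarrow> lt x y \<Longrightarrow> h x = h y \<or> lt' (h x) (h y)"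
    and v': "\<And>d. v' d = sum v {e \<in> T. h e = d}"
    and w': "\<And>d. w' d = max0 w {e \<in> T. h e = d}"
  shows "weights lt' (h ` T) v' w'"
    and "weight \<kappa>' lt' v' w' d = sum (weight (\<lambda>x. \<kappa>' (h x)) lt v w) {c \<in> T. h c = d}"
proof -
  have sub: "sum v' D = sum v {e \<in> T. h e \<in> D}" if "D \<subseteq> h ` T" for D
  proof -
    have "sum v' D = (\<Sum>d\<in>D. sum v {e \<in> {e \<in> T. h e \<in> D}. h e = d})"
      unfolding v' by (intro sum.cong refl arg_cong[where f = "sum v"]) auto
    also have "\<dots> = sum v {e \<in> T. h e \<in> D}"
      using fin finite_subset[OF that] by (intro sum.group) auto
    finally show ?thesis .
  qed
  show W': "weights lt' (h ` T) v' w'"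
  proof
    show "w' c \<le> 1" for c unfolding w' using fin w_le_1 by (intro max0_le) auto
    show "0 \<le> w' c" for c unfolding w' using fin by (intro max0_nonneg) auto
    show "w' c = 1" if "0 < v' c" for c
    proof -
      have "\<exists>e\<in>{e \<in> T. h e = c}. 0 < v e"
      proof (rule ccontr)
        assume "\<not> (\<exists>e\<in>{e \<in> T. h e = c}. 0 < v e)"
        then have "sum v {e \<in> T. h e = c} \<le> 0" by (intro sum_nonpos) (auto simp: not_less)
        then show False using that by (simp add: v')
      qed
      then obtain e where e: "e \<in> T" "h e = c" "0 < v e" by auto
      then have "1 \<le> w' c" unfolding w' using max0_ge[of "{e \<in> T. h e = c}" e w] fin w_1[of e] by simp
      then show ?thesis using \<open>w' c \<le> 1\<close> by simp
    qed
    show "w' c = 0" if "c \<notin> h ` T" for c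
    proof -
      have "{e \<in> T. h e = c} = {}" using that by auto
      then show ?thesis unfolding w' by (simp only: max0_empty)
    qed
    have "{e \<in> T. h e \<in> h ` T} = T" by auto
    then show "sum v' (h ` T) = 1" using sub[of "h ` T"] sum_v by simp
  qed (use chain' v_nonneg in \<open>auto simp: v' intro!: sum_nonneg\<close>)
  interpret W': weights lt' "h ` T" v' w' by (rule W')
  let ?\<kappa> = "\<lambda>x. \<kappa>' (h x)"
  show "weight \<kappa>' lt' v' w' d = sum (weight ?\<kappa> lt v w) {c \<in> T. h c = d}"
  proof (cases "d \<in> h ` T")
    case False
    then have e: "{c \<in> T. h c = d} = {}" by auto
    show ?thesis unfolding e using False by (simp add: W'.weight_T)
  next
    case d: True
    have lt_iff: "lt' (h x) (h y) \<longleftrightarrow> lt x y" if "x \<in> T" "y \<in> T" "h x \<noteq> h y" for x y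
    proof
      show "lt' (h x) (h y)" if "lt x y" using mono that \<open>x \<in> T\<close> \<open>y \<in> T\<close> \<open>h x \<noteq> h y\<close> by blast
      assume l: "lt' (h x) (h y)"
      show "lt x y"
      proof (rule ccontr)
        assume "\<not> lt x y"
        then have "lt y x" using that finite_chain_total[OF chain] by blast
        then have "lt' (h y) (h x)" using mono that by metis
        then show False using l finite_chain_asym[OF chain'] that by blast
      qed
    qed
    have irr: "\<not> lt' d d" using finite_chain_irrefl[OF chain' d] .
    have b: "below \<kappa>' lt' v' d = below ?\<kappa> lt v c" if "c \<in> T" "h c = d" for c
    proof -
      have "{e \<in> T. h e \<in> {e \<in> h ` T. lt' e d \<and> \<kappa>' e \<noteq> \<kappa>' d}} = {e \<in> T. lt e c \<and> ?\<kappa> e \<noteq> ?\<kappa> c}"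
      proof -
        have "lt' (h e) d \<and> \<kappa>' (h e) \<noteq> \<kappa>' d \<longleftrightarrow> lt e c \<and> ?\<kappa> e \<noteq> ?\<kappa> c" if e: "e \<in> T" for e
          using lt_iff[OF e \<open>c \<in> T\<close>] \<open>h c = d\<close> by (cases "h e = d") auto
        then show ?thesis by blast
      qed
      then show ?thesis unfolding W'.below_eq below_eq using sub[of "{e \<in> h ` T. lt' e d \<and> \<kappa>' e \<noteq> \<kappa>' d}"] by auto
    qed
    have a: "above \<kappa>' lt' v' d = above ?\<kappa> lt v c" if "c \<in> T" "h c = d" for c
    proof -
      have "{e \<in> T. h e \<in> {e \<in> h ` T. lt' d e \<and> \<kappa>' e \<noteq> \<kappa>' d}} = {e \<in> T. lt c e \<and> ?\<kappa> e \<noteq> ?\<kappa> c}"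
      proof -
        have "lt' d (h e) \<and> \<kappa>' (h e) \<noteq> \<kappa>' d \<longleftrightarrow> lt c e \<and> ?\<kappa> e \<noteq> ?\<kappa> c" if e: "e \<in> T" for e
          using lt_iff[OF \<open>c \<in> T\<close> e] \<open>h c = d\<close> by (cases "h e = d") auto
        then show ?thesis by blast
      qed
      then show ?thesis unfolding W'.above_eq above_eq using sub[of "{e \<in> h ` T. lt' d e \<and> \<kappa>' e \<noteq> \<kappa>' d}"] by auto
    qed
    define A where "A = {c \<in> T. h c = d}"
    (* L is the part of the fibre of the coarser map that precedes the fibre A of h. *)
    define L where "L = {e \<in> T. lt' (h e) d \<and> ?\<kappa> e = \<kappa>' d}"
    have finA: "finite A" "finite L" using fin by (auto simp: A_def L_def)
    have chA: "finite_chain lt A" using chain by (rule finite_chain_subset) (auto simp: A_def)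
    have mxL: "max0 w' {e \<in> h ` T. lt' e d \<and> \<kappa>' e = \<kappa>' d} = max0 w L"
    proof (rule antisym)
      have f: "finite {e \<in> h ` T. lt' e d \<and> \<kappa>' e = \<kappa>' d}" using fin by simp
      show "max0 w' {e \<in> h ` T. lt' e d \<and> \<kappa>' e = \<kappa>' d} \<le> max0 w L"
      proof (rule max0_le[OF f max0_nonneg[OF finA(2)]])
        fix e assume "e \<in> {e \<in> h ` T. lt' e d \<and> \<kappa>' e = \<kappa>' d}"
        then show "w' e \<le> max0 w L" unfolding w' using fin finA
          by (intro max0_le max0_nonneg) (auto intro!: max0_ge simp: L_def)
      qed
      show "max0 w L \<le> max0 w' {e \<in> h ` T. lt' e d \<and> \<kappa>' e = \<kappa>' d}"
      proof (rule max0_le[OF finA(2) max0_nonneg[OF f]])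
        fix e assume e: "e \<in> L"
        then have "w e \<le> w' (h e)" unfolding w' using fin by (intro max0_ge) (auto simp: L_def)
        also have "\<dots> \<le> max0 w' {e \<in> h ` T. lt' e d \<and> \<kappa>' e = \<kappa>' d}"
          using f e by (intro max0_ge) (auto simp: L_def)
        finally show "w e \<le> max0 w' {e \<in> h ` T. lt' e d \<and> \<kappa>' e = \<kappa>' d}" .
      qed
    qed
    have "share ?\<kappa> lt w c = max 0 (w c - max (max0 w L) (max0 w {e \<in> A. lt e c}))" if "c \<in> A" for c
    proof -
      have "{e \<in> T. lt e c \<and> ?\<kappa> e = ?\<kappa> c} = L \<union> {e \<in> A. lt e c}"
      proof -
        have c: "c \<in> T" "h c = d" using that by (auto simp: A_def)
        have "lt e c \<and> ?\<kappa> e = ?\<kappa> c \<longleftrightarrow> lt' (h e) d \<and> ?\<kappa> e = \<kappa>' d \<or> h e = d \<and> lt e c" if e: "e \<in> T" for e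
          using lt_iff[OF e c(1)] c irr by (cases "h e = d") auto
        then show ?thesis unfolding A_def L_def by blast
      qed
      then show ?thesis using finA by (simp add: share_eq max0_Un)
    qed
    then have "sum (share ?\<kappa> lt w) A = (\<Sum>c\<in>A. max 0 (w c - max (max0 w L) (max0 w {e \<in> A. lt e c})))"
      by (intro sum.cong) auto
    also have "\<dots> = max 0 (max0 w A - max0 w L)"
      by (rule sum_increments[OF chA max0_nonneg[OF finA(2)]])
    also have "\<dots> = share \<kappa>' lt' w' d"
      unfolding W'.share_eq mxL w' A_def by simp
    finally have s: "sum (share ?\<kappa> lt w) A = share \<kappa>' lt' w' d" .
    have "sum (weight ?\<kappa> lt v w) A =
        (\<Sum>c\<in>A. v c + share ?\<kappa> lt w c * min (below \<kappa>' lt' v' d) (above \<kappa>' lt' v' d))"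
      using a b by (intro sum.cong) (auto simp: weight_def A_def)
    also have "\<dots> = weight \<kappa>' lt' v' w' d"
      by (simp add: sum.distrib weight_def s flip: sum_distrib_right) (simp add: A_def v')
    finally show ?thesis by (simp add: A_def)
  qed
qed

lemma share_id: "share id lt w c = w c"
proof (cases "c \<in> T")
  case True
  then have e: "{e \<in> T. lt e c \<and> id e = id c} = {}" using finite_chain_irrefl[OF chain] by auto
  show ?thesis unfolding share_eq e using w_nonneg[of c] by simp
next
  case False
  then show ?thesis by (simp add: share_T w_T)
qed

lemma weight_id: "weight id lt v w c = v c + w c * min (below id lt v c) (above id lt v c)"
  by (simp add: weight_def share_id)

lemma below_id: "below id lt v c = sum v {e \<in> T. lt e c}" if "c \<in> T"
proof -
  have "{e \<in> T. lt e c \<and> id e \<noteq> id c} = {e \<in> T. lt e c}" using that finite_chain_irrefl[OF chain] by auto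
  then show ?thesis by (simp add: below_eq)
qed

lemma above_id: "above id lt v c = sum v {e \<in> T. lt c e}" if "c \<in> T"
proof -
  have "{e \<in> T. lt c e \<and> id e \<noteq> id c} = {e \<in> T. lt c e}" using that finite_chain_irrefl[OF chain] by auto
  then show ?thesis by (simp add: above_eq)
qed

lemma dual: "weights (\<lambda>x y. lt y x) T v w"
  using weights_axioms finite_chain_dual[OF chain] by (simp add: weights_def)

lemma weight_id_dual: "weight id (\<lambda>x y. lt y x) v w c = weight id lt v w c"
proof -
  interpret D: weights "\<lambda>x y. lt y x" T v w by (rule dual)
  show ?thesis unfolding D.weight_id weight_id by (simp add: below_def above_def min.commute)
qed

lemma max0_weight_le:
  assumes c: "c \<in> T"
  shows "max0 (weight id lt v w) {d \<in> T. lt d c} \<le> below id lt v c"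
proof (rule max0_le)
  fix d assume d: "d \<in> {d \<in> T. lt d c}"
  have "weight id lt v w d \<le> v d + below id lt v d"
    using w_le_1[of d] w_nonneg[of d] mult_left_le_one_le[of "min (below id lt v d) (above id lt v d)" "w d"]
      below_nonneg[of id d] above_nonneg[of id d] by (simp add: weight_id)
  also have "\<dots> = sum v (insert d {e \<in> T. lt e d})"
    using d fin finite_chain_irrefl[OF chain] by (subst sum.insert) (auto simp: below_id)
  also have "\<dots> \<le> sum v {e \<in> T. lt e c}"
    using d fin v_nonneg finite_chain_trans[OF chain _ _ c, of _ d] by (intro sum_mono2) auto
  also have "\<dots> = below id lt v c" using below_id[OF c] by simp
  finally show "weight id lt v w d \<le> below id lt v c" .
qed (use fin below_nonneg in auto)

text \<open>Let \<open>d\<close> be the last element below \<open>c\<close> that carries mass. All mass below \<open>c\<close> is at or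
  below \<open>d\<close>, so \<open>z(d)\<close> is at least the minimum in question.\<close>

lemma max0_weight_ge:
  assumes c: "c \<in> T"
  shows "min (below id lt v c) (above id lt v c) \<le> max0 (weight id lt v w) {d \<in> T. lt d c}"
proof (cases "below id lt v c = 0")
  case True
  then show ?thesis using max0_nonneg[of "{d \<in> T. lt d c}"] fin above_nonneg[of id c]
    by (simp add: min_def)
next
  case False
  define D where "D = {d \<in> T. lt d c \<and> 0 < v d}"
  have "\<exists>e\<in>{e \<in> T. lt e c}. v e \<noteq> 0"
    using False sum.neutral[of "{e \<in> T. lt e c}" v] unfolding below_id[OF c] by blast
  then have "D \<noteq> {}" using v_nonneg unfolding D_def by (auto simp: less_le)
  moreover have chD: "finite_chain lt D" using chain by (rule finite_chain_subset) (auto simp: D_def)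
  ultimately obtain d where d: "d \<in> D" "\<forall>x\<in>D. x = d \<or> lt x d" using finite_chain_greatest by blast
  then have dT: "d \<in> T" "lt d c" "0 < v d" by (auto simp: D_def)
  have "below id lt v c = sum v (insert d {e \<in> T. lt e d})"
    unfolding below_id[OF c]
  proof (rule sum.mono_neutral_right)
    show "\<forall>i\<in>{e \<in> T. lt e c} - insert d {e \<in> T. lt e d}. v i = 0"
    proof
      fix i assume i: "i \<in> {e \<in> T. lt e c} - insert d {e \<in> T. lt e d}"
      then have "i \<notin> D" using d(2) by (auto simp: D_def)
      then have "\<not> 0 < v i" using i by (auto simp: D_def)
      then show "v i = 0" using v_nonneg[of i] by linarith
    qed
    show "insert d {e \<in> T. lt e d} \<subseteq> {e \<in> T. lt e c}"
    proof -
      have "lt e c" if "e \<in> T" "lt e d" for e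
        using finite_chain_trans[OF chain that(1) dT(1) c that(2) dT(2)] .
      then show ?thesis using dT by blast
    qed
  qed (use fin in auto)
  also have "\<dots> = v d + below id lt v d"
    using dT fin finite_chain_irrefl[OF chain] by (subst sum.insert) (auto simp: below_id)
  finally have 1: "below id lt v c = v d + below id lt v d" .
  have "above id lt v c \<le> above id lt v d"
    unfolding above_id[OF c] above_id[OF dT(1)]
    using dT c fin v_nonneg finite_chain_trans[OF chain dT(1) c] by (intro sum_mono2) auto
  then have "min (below id lt v c) (above id lt v c) \<le> weight id lt v w d"
    using 1 w_1[OF dT(3)] dT(3) by (simp add: weight_id)
  also have "\<dots> \<le> max0 (weight id lt v w) {d \<in> T. lt d c}"
    using dT fin by (intro max0_ge) auto
  finally show ?thesis .
qed

text \<open>The factor \<open>\<theta>\<close> is a function of \<open>z\<close>, and homogeneous in it; this is the reason why \<open>(v,w)\<close> can be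
  recovered from \<open>z\<close> after normalisation.\<close>

lemma threshold:
  assumes c: "c \<in> T"
  shows "min (below id lt v c) (above id lt v c) =
    min (max0 (weight id lt v w) {d. weight id lt v w d \<noteq> 0 \<and> lt d c})
        (max0 (weight id lt v w) {d. weight id lt v w d \<noteq> 0 \<and> lt c d})"
proof -
  interpret D: weights "\<lambda>x y. lt y x" T v w by (rule dual)
  have b: "above id lt v c = below id (\<lambda>x y. lt y x) v c" "below id lt v c = above id (\<lambda>x y. lt y x) v c"
    by (simp_all add: below_def above_def)
  have w: "weight id (\<lambda>x y. lt y x) v w = weight id lt v w" using weight_id_dual by blast
  have 1: "max0 (weight id lt v w) {d. weight id lt v w d \<noteq> 0 \<and> lt d c} = max0 (weight id lt v w) {d \<in> T. lt d c}"
    using fin weight_T by (intro max0_mono_neutral) auto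
  have 2: "max0 (weight id lt v w) {d. weight id lt v w d \<noteq> 0 \<and> lt c d} = max0 (weight id lt v w) {d \<in> T. lt c d}"
    using fin weight_T by (intro max0_mono_neutral) auto
  show ?thesis unfolding 1 2
    using max0_weight_le[OF c] max0_weight_ge[OF c] D.max0_weight_le[OF c] D.max0_weight_ge[OF c]
    unfolding w by (simp add: b(1) b(2)[symmetric] min_def split: if_splits)
qed

end

text \<open>By \<open>threshold\<close> the factors \<open>\<theta>\<close> are proportional as well, hence so is \<open>v = max(0, z - \<theta>)\<close>, and
  the total mass \<open>1\<close> makes the constant \<open>1\<close>. Where \<open>v\<close> vanishes, \<open>w = z / \<theta>\<close>, unless \<open>\<theta>\<close> vanishes too;
  there \<open>c\<close> lies outside the hull of the mass, and the hull condition makes \<open>w\<close> vanish.\<close>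

lemma weights_unique:
  fixes lt :: "'a \<Rightarrow> 'a \<Rightarrow> bool"
  assumes "weights lt T v w" "weights lt T' v' w'" and k: "0 < k"
    and hull: "\<And>c. 0 < w c \<Longrightarrow> (\<exists>e. 0 < v e \<and> (e = c \<or> lt e c)) \<and> (\<exists>e. 0 < v e \<and> (e = c \<or> lt c e))"
    and hull': "\<And>c. 0 < w' c \<Longrightarrow> (\<exists>e. 0 < v' e \<and> (e = c \<or> lt e c)) \<and> (\<exists>e. 0 < v' e \<and> (e = c \<or> lt c e))"
    and eq: "\<And>c. weight id lt v w c = k * weight id lt v' w' c"
  shows "v = v'" "w = w'"
proof -
  interpret W: weights lt T v w by fact
  interpret W': weights lt T' v' w' by fact
  let ?Z = "weight id lt v w" and ?Z' = "weight id lt v' w'"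
  define th where "th c = min (below id lt v c) (above id lt v c)" for c
  define th' where "th' c = min (below id lt v' c) (above id lt v' c)" for c
  define N where "N = {c. ?Z c \<noteq> 0}"
  have N': "N = {c. ?Z' c \<noteq> 0}" unfolding N_def eq using k by simp
  have NT: "N \<subseteq> T" "N \<subseteq> T'" using W.weight_T W'.weight_T N' unfolding N_def by (blast, metis (mono_tags, lifting) mem_Collect_eq subsetI)
  have fN: "finite N" using NT W.fin finite_subset by blast
  have Zeq: "?Z = (\<lambda>c. k * ?Z' c)" using eq by blast
  have th: "th c = k * th' c" if "c \<in> N" for c
  proof -
    have 1: "max0 ?Z {d. ?Z d \<noteq> 0 \<and> P d} = k * max0 ?Z' {d. ?Z' d \<noteq> 0 \<and> P d}" for P
    proof -
      have "{d. ?Z d \<noteq> 0 \<and> P d} = {d. ?Z' d \<noteq> 0 \<and> P d}" using N' N_def by blast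
      moreover have "finite {d. ?Z' d \<noteq> 0 \<and> P d}" using fN unfolding N' by (rule finite_subset[rotated]) auto
      ultimately show ?thesis unfolding Zeq by (simp add: max0_scale[OF _ k])
    qed
    show ?thesis unfolding th_def th'_def
      using W.threshold[of c] W'.threshold[of c] NT that k unfolding 1
      by (simp add: subsetD min_mult_distrib_left)
  qed
  have vmax: "v c = max 0 (?Z c - th c)" for c
    using W.w_1[of c] W.v_nonneg[of c] W.w_le_1[of c] W.below_nonneg[of id c] W.above_nonneg[of id c]
      mult_left_le_one_le[of "th c" "w c"] W.w_nonneg[of c]
    by (cases "v c = 0") (auto simp: W.weight_id th_def less_le)
  have vmax': "v' c = max 0 (?Z' c - th' c)" for c
    using W'.w_1[of c] W'.v_nonneg[of c] W'.w_le_1[of c] W'.below_nonneg[of id c] W'.above_nonneg[of id c]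
      mult_left_le_one_le[of "th' c" "w' c"] W'.w_nonneg[of c]
    by (cases "v' c = 0") (auto simp: W'.weight_id th'_def less_le)
  have v0: "v c = 0" "v' c = 0" if "c \<notin> N" for c
    using that W.weight_ge[of c id] W.v_nonneg[of c] W'.weight_ge[of c id] W'.v_nonneg[of c]
    using k unfolding N_def by (auto simp: eq)
  have vk: "v c = k * v' c" for c
  proof (cases "c \<in> N")
    case True
    then show ?thesis
      unfolding vmax[of c] vmax'[of c] th[OF True] eq using k max_mult_distrib_left[of k 0 "?Z' c - th' c"]
      by (simp add: right_diff_distrib)
  qed (simp add: v0)
  have "sum v N = 1" using W.sum_v sum.mono_neutral_left[of T N v] NT W.fin v0 by auto
  moreover have "sum v' N = 1" using W'.sum_v sum.mono_neutral_left[of T' N v'] NT W'.fin v0 by auto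
  moreover have "sum v N = k * sum v' N" unfolding vk by (simp add: sum_distrib_left)
  ultimately have k1: "k = 1" by simp
  show v: "v = v'" using vk k1 by auto
  have "w c = w' c" for c
  proof (cases "0 < v c")
    case True
    then show ?thesis using W.w_1[of c] W'.w_1[of c] v by simp
  next
    case v0: False
    show ?thesis
    proof (cases "th c = 0")
      case True
      have *: "\<not> ((\<exists>e. 0 < v e \<and> (e = c \<or> lt e c)) \<and> (\<exists>e. 0 < v e \<and> (e = c \<or> lt c e)))"
        if "weights lt S v u" and cS: "c \<in> S" for S u
      proof
        interpret V: weights lt S v u by fact
        assume "(\<exists>e. 0 < v e \<and> (e = c \<or> lt e c)) \<and> (\<exists>e. 0 < v e \<and> (e = c \<or> lt c e))"
        then obtain e e' where e: "0 < v e" "lt e c" "0 < v e'" "lt c e'" using v0 by auto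
        have eS: "e \<in> S" "e' \<in> S" using e V.v_T by (metis less_irrefl)+
        have "v e \<le> below id lt v c"
          unfolding V.below_id[OF cS] using eS e V.fin V.v_nonneg by (intro member_le_sum) auto
        moreover have "v e' \<le> above id lt v c"
          unfolding V.above_id[OF cS] using eS e V.fin V.v_nonneg by (intro member_le_sum) auto
        ultimately show False using e True by (auto simp: th_def min_def split: if_splits)
      qed
      have W'': "weights lt T' v w'" using W'.weights_axioms v by simp
      have "w c = 0" using *[OF W.weights_axioms] hull[of c] W.w_nonneg[of c] W.w_T[of c] by (cases "c \<in> T") (auto simp: less_le)
      moreover have "w' c = 0" using *[OF W''] hull'[of c] v W'.w_nonneg[of c] W'.w_T[of c] by (cases "c \<in> T'") (auto simp: less_le)
      ultimately show ?thesis by simp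
    next
      case False
      have "v c = 0" using v0 W.v_nonneg[of c] by simp
      then have "w c * th c = w' c * th c"
        using eq[of c] k1 v unfolding W.weight_id W'.weight_id th_def by simp
      then show ?thesis using False by simp
    qed
  qed
  then show "w = w'" by blast
qed

text \<open>Before the peak \<open>p\<close> of \<open>z\<close> the threshold is the running maximum, so the masses are its
  increments and telescope.\<close>

lemma sum_below_threshold:
  assumes ch: "finite_chain lt T" and p: "p \<in> T" "\<And>c. c \<in> T \<Longrightarrow> z c \<le> z p" and z: "\<And>c. c \<in> T \<Longrightarrow> 0 \<le> z c"
    and v: "\<And>c. c \<in> T \<Longrightarrow> v c = max 0 (z c - min (max0 z {d \<in> T. lt d c}) (max0 z {d \<in> T. lt c d}))"
    and c: "c \<in> T" "c = p \<or> lt c p"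
  shows "sum v {e \<in> T. lt e c} = max0 z {e \<in> T. lt e c}"
proof -
  let ?A = "{e \<in> T. lt e c}"
  have fin: "finite T" using finite_chain_finite[OF ch] .
  have "sum v ?A = (\<Sum>e\<in>?A. max 0 (z e - max 0 (max0 z {d \<in> ?A. lt d e})))"
  proof (rule sum.cong[OF refl])
    fix e assume e: "e \<in> ?A"
    then have ep: "lt e p" using c finite_chain_trans[OF ch _ c(1) p(1)] by auto
    have "{d \<in> ?A. lt d e} = {d \<in> T. lt d e}"
      using e c(1) finite_chain_trans[OF ch _ _ c(1), of _ e] by auto
    moreover have "z p \<le> max0 z {d \<in> T. lt e d}" using fin p ep by (intro max0_ge) auto
    moreover have "max0 z {d \<in> T. lt d e} \<le> z p" using fin p z by (intro max0_le) auto
    moreover have "0 \<le> max0 z {d \<in> T. lt d e}" "0 \<le> max0 z {d \<in> T. lt e d}" using fin by (auto intro: max0_nonneg)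
    ultimately show "v e = max 0 (z e - max 0 (max0 z {d \<in> ?A. lt d e}))"
      using v[of e] e by (simp add: min_def max_def)
  qed
  also have "\<dots> = max0 z ?A"
    using sum_increments[OF finite_chain_subset[OF ch, of ?A], of 0 z] max0_nonneg[of ?A z] fin by auto
  finally show ?thesis .
qed

text \<open>For \<open>c\<close> before the peak \<open>p\<close> the mass below is the running maximum, which is at most \<open>z p\<close>; and
  \<open>z p\<close> is at most the mass above \<open>c\<close>, which contains that of \<open>p\<close> and of everything after \<open>p\<close>. For
  \<open>c\<close> after the peak one passes to the dual order.\<close>

lemma threshold_realized:
  assumes ch: "finite_chain lt T" and p: "p \<in> T" "\<And>c. c \<in> T \<Longrightarrow> z c \<le> z p" and z: "\<And>c. c \<in> T \<Longrightarrow> 0 \<le> z c"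
    and v: "\<And>c. c \<in> T \<Longrightarrow> v c = max 0 (z c - min (max0 z {d \<in> T. lt d c}) (max0 z {d \<in> T. lt c d}))"
    and c: "c \<in> T" "c = p \<or> lt c p"
  shows "min (sum v {e \<in> T. lt e c}) (sum v {e \<in> T. lt c e}) =
    min (max0 z {d \<in> T. lt d c}) (max0 z {d \<in> T. lt c d})"
proof -
  have fin: "finite T" using finite_chain_finite[OF ch] .
  have b: "sum v {e \<in> T. lt e c} = max0 z {e \<in> T. lt e c}"
    by (rule sum_below_threshold[OF ch p z v c])
  have ap: "sum v {e \<in> T. lt p e} = max0 z {e \<in> T. lt p e}"
    by (rule sum_below_threshold[where lt = "\<lambda>x y. lt y x" and T = T and z = z and v = v and c = p and p = p])
      (use finite_chain_dual[OF ch] p z v in \<open>auto simp: min.commute\<close>)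
  show ?thesis
  proof (cases "c = p")
    case True
    then show ?thesis using b ap by simp
  next
    case False
    then have cp: "lt c p" using c by simp
    have v0: "0 \<le> v e" if "e \<in> T" for e using v[OF that] by simp
    have zc: "max0 z {d \<in> T. lt d c} \<le> z p"
      using fin p z by (intro max0_le) auto
    have "z p \<le> max0 z {d \<in> T. lt c d}" using fin p cp by (intro max0_ge) auto
    moreover have "z p \<le> sum v {e \<in> T. lt c e}"
    proof -
      have "z p \<le> v p + max0 z {e \<in> T. lt p e}"
        unfolding v[OF p(1)] by (simp add: min_def max_def)
      also have "\<dots> = sum v (insert p {e \<in> T. lt p e})"
        using fin finite_chain_irrefl[OF ch p(1)] by (simp add: ap)
      also have "\<dots> \<le> sum v {e \<in> T. lt c e}"
        using fin p cp v0 finite_chain_trans[OF ch c(1) p(1) _ cp] by (intro sum_mono2) auto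
      finally show ?thesis .
    qed
    ultimately show ?thesis using b zc by (simp add: min_def)
  qed
qed

text \<open>The thresholds of \<open>z\<close> define \<open>v\<close> and \<open>w\<close>, and \<open>threshold_realized\<close> shows that their factor \<open>\<theta>\<close> is
  this threshold. The least and the greatest element have threshold \<open>0\<close> and carry mass, so the hull
  of the mass is all of \<open>T\<close>.\<close>

lemma weights_exist:
  fixes z :: "'a \<Rightarrow> real"
  assumes ch: "finite_chain lt T" and ne: "T \<noteq> {}" and z: "\<And>c. c \<in> T \<Longrightarrow> 0 < z c"
  obtains v w k where "weights lt T v w" "0 < k" "\<And>c. c \<in> T \<Longrightarrow> weight id lt v w c = k * z c"
    "\<And>c. c \<in> T \<Longrightarrow> 0 < w c"
    "\<And>c. c \<in> T \<Longrightarrow> (\<exists>e\<in>T. 0 < v e \<and> (e = c \<or> lt e c)) \<and> (\<exists>e\<in>T. 0 < v e \<and> (e = c \<or> lt c e))"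
proof -
  have fin: "finite T" using finite_chain_finite[OF ch] .
  (* v0 is not yet normalised: dividing by V makes the total mass 1 and contributes the factor k. *)
  define th where "th c = min (max0 z {d \<in> T. lt d c}) (max0 z {d \<in> T. lt c d})" for c
  define v0 where "v0 c = max 0 (z c - th c)" for c
  define V where "V = sum v0 T"
  define v where "v c = (if c \<in> T then v0 c / V else 0)" for c
  define w where "w c = (if c \<in> T then if z c < th c then z c / th c else 1 else 0)" for c
  have th0: "0 \<le> th c" for c using fin by (simp add: th_def max0_nonneg)
  have "Max (z ` T) \<in> z ` T" using fin ne by (intro Max_in) auto
  then obtain p where p: "p \<in> T" "z p = Max (z ` T)" by auto
  have p: "p \<in> T" "\<And>c. c \<in> T \<Longrightarrow> z c \<le> z p" using p fin by auto
  obtain t where t: "t \<in> T" "\<forall>x\<in>T. x = t \<or> lt x t" using finite_chain_greatest[OF ch ne] by blast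
  obtain s where s: "s \<in> T" "\<forall>x\<in>T. x = s \<or> lt s x"
    using finite_chain_greatest[OF finite_chain_dual[OF ch] ne] by blast
  have t0: "{d \<in> T. lt t d} = {}"
    using t(2) finite_chain_asym[OF ch t(1)] finite_chain_irrefl[OF ch t(1)] by fastforce
  have "v0 t = z t"
    unfolding v0_def th_def t0 using z[OF t(1)] fin max0_nonneg[of "{d \<in> T. lt d t}" z] by simp
  have s0: "{d \<in> T. lt d s} = {}"
    using s(2) finite_chain_asym[OF ch s(1)] finite_chain_irrefl[OF ch s(1)] by fastforce
  have "v0 s = z s"
    unfolding v0_def th_def s0 using z[OF s(1)] fin max0_nonneg[of "{d \<in> T. lt s d}" z] by simp
  have "v0 t \<le> V" unfolding V_def using t fin by (intro member_le_sum) (auto simp: v0_def)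
  then have V: "0 < V" using z[OF t(1)] \<open>v0 t = z t\<close> by simp
  have vs: "0 < v s" "0 < v t"
    using s t z V \<open>v0 s = z s\<close> \<open>v0 t = z t\<close> by (auto simp: v_def)
  have W: "weights lt T v w"
  proof
    show "sum v T = 1" using V by (simp add: v_def V_def flip: sum_divide_distrib)
    show "w c = 1" if "0 < v c" for c
      using that V th0[of c] by (auto simp: v_def v0_def w_def zero_less_divide_iff split: if_splits)
    show "w c \<le> 1" for c using th0[of c] z[of c] by (auto simp: w_def divide_le_eq)
    show "0 \<le> w c" for c using th0[of c] z[of c] by (auto simp: w_def)
  qed (use ch V in \<open>auto simp: v_def v0_def w_def\<close>)
  interpret weights lt T v w by (rule W)
  have th: "min (sum v0 {e \<in> T. lt e c}) (sum v0 {e \<in> T. lt c e}) = th c" if c: "c \<in> T" for c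
  proof -
    consider "c = p \<or> lt c p" | "c = p \<or> lt p c" using finite_chain_total[OF ch c p(1)] by blast
    then show ?thesis
    proof cases
      case 1
      show ?thesis unfolding th_def
        by (rule threshold_realized[where z = z, OF ch p _ _ c 1]) (use z in \<open>auto simp: v0_def th_def less_imp_le\<close>)
    next
      case 2
      have "min (sum v0 {e \<in> T. lt c e}) (sum v0 {e \<in> T. lt e c}) =
        min (max0 z {d \<in> T. lt c d}) (max0 z {d \<in> T. lt d c})"
        by (rule threshold_realized[where z = z, OF finite_chain_dual[OF ch] p _ _ c 2])
           (use z in \<open>auto simp: v0_def th_def less_imp_le min.commute\<close>)
      then show ?thesis by (simp add: th_def min.commute)
    qed
  qed
  have "weight id lt v w c = (1 / V) * z c" if c: "c \<in> T" for c
  proof -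
    have "sum v {e \<in> T. P e} = sum v0 {e \<in> T. P e} / V" for P
      unfolding sum_divide_distrib by (intro sum.cong) (auto simp: v_def)
    then have "min (below id lt v c) (above id lt v c) = th c / V"
      unfolding below_id[OF c] above_id[OF c] th[OF c, symmetric] using V
      by (simp add: min_divide_distrib_right)
    then show ?thesis using c V th0[of c] z[OF c] by (auto simp: weight_id v_def v0_def w_def field_simps)
  qed
  moreover have "0 < w c" if "c \<in> T" for c
    using that z[OF that] th0[of c] by (auto simp: w_def intro!: divide_pos_pos)
  moreover have "(\<exists>e\<in>T. 0 < v e \<and> (e = c \<or> lt e c)) \<and> (\<exists>e\<in>T. 0 < v e \<and> (e = c \<or> lt c e))" if "c \<in> T" for c
    using s t vs that by metis
  ultimately show ?thesis using that[OF W, of "1 / V"] V by simp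
qed

section \<open>Layers\<close>

lemma nested_sum:
  fixes S :: "nat \<Rightarrow> 'a set" and u :: "nat \<Rightarrow> real"
  assumes mono: "\<And>i j. i \<le> j \<Longrightarrow> j \<le> k \<Longrightarrow> S i \<subseteq> S j" and m: "p \<in> S m" "m \<le> k" "\<And>l. l < m \<Longrightarrow> p \<notin> S l"
  shows "(\<Sum>l\<le>k. of_bool (p \<in> S l) * u l) = sum u {m..k}"
proof -
  have "(\<Sum>l\<le>k. of_bool (p \<in> S l) * u l) = (\<Sum>l\<in>{m..k}. of_bool (p \<in> S l) * u l)"
    using m by (intro sum.mono_neutral_right) auto
  also have "\<dots> = sum u {m..k}"
    using mono[of m] m(1) by (intro sum.cong) auto
  finally show ?thesis .
qed

text \<open>A function on a finite set is in a unique way a positive combination of indicators of a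
  strictly increasing sequence of nonempty sets: the sets are its superlevel sets, the partial sums of the
  coefficients are its positive values.\<close>

lemma layers_unique:
  fixes S S' :: "nat \<Rightarrow> 'a set" and u u' :: "nat \<Rightarrow> real"
  assumes S: "\<And>i j. i < j \<Longrightarrow> j \<le> k \<Longrightarrow> S i \<subset> S j" "S 0 \<noteq> {}" "\<And>l. l \<le> k \<Longrightarrow> 0 < u l"
    and S': "\<And>i j. i < j \<Longrightarrow> j \<le> k' \<Longrightarrow> S' i \<subset> S' j" "S' 0 \<noteq> {}" "\<And>l. l \<le> k' \<Longrightarrow> 0 < u' l"
    and eq: "\<And>p. (\<Sum>l\<le>k. of_bool (p \<in> S l) * u l) = (\<Sum>l\<le>k'. of_bool (p \<in> S' l) * u' l)"
  shows "k = k'" "l \<le> k \<Longrightarrow> S l = S' l" "l \<le> k \<Longrightarrow> u l = u' l"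
proof -
  have key: "(\<lambda>p. \<Sum>l\<le>k. of_bool (p \<in> S l) * u l) ` UNIV - {0} = (\<lambda>l. sum u {l..k}) ` {..k} \<and>
      (\<forall>i j. i < j \<longrightarrow> j \<le> k \<longrightarrow> sum u {i..k} > sum u {j..k}) \<and>
      (\<forall>l\<le>k. S l = {p. sum u {l..k} \<le> (\<Sum>l\<le>k. of_bool (p \<in> S l) * u l)})"
    if S: "\<And>i j. i < j \<Longrightarrow> j \<le> k \<Longrightarrow> S i \<subset> S j" "S 0 \<noteq> {}" "\<And>l. l \<le> k \<Longrightarrow> 0 < u l"
    for S :: "nat \<Rightarrow> 'a set" and u :: "nat \<Rightarrow> real" and k
  proof -
    let ?W = "\<lambda>p. \<Sum>l\<le>k. of_bool (p \<in> S l) * u l"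
    have mono: "S i \<subseteq> S j" if "i \<le> j" "j \<le> k" for i j
      using S(1)[of i j] that by (cases "i = j") auto
    have W: "?W p = sum u {m..k}" if "p \<in> S m" "m \<le> k" "\<And>l. l < m \<Longrightarrow> p \<notin> S l" for p m
      by (rule nested_sum[OF mono]) (use that in auto)
    have dec: "sum u {j..k} < sum u {i..k}" if "i < j" "j \<le> k" for i j
    proof (rule sum_strict_mono2)
      show "i \<in> {i..k} - {j..k}" "0 < u i" using that S(3) by auto
    qed (use that S(3) in \<open>auto simp: less_imp_le\<close>)
    have cases: "(p \<notin> S k \<and> ?W p = 0) \<or> (\<exists>m\<le>k. p \<in> S m \<and> (\<forall>l<m. p \<notin> S l) \<and> ?W p = sum u {m..k})" for p
    proof (cases "p \<in> S k")
      case True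
      define m where "m = (LEAST m. p \<in> S m)"
      have "p \<in> S m" "m \<le> k" unfolding m_def using True by (auto intro: LeastI Least_le)
      moreover have "\<forall>l<m. p \<notin> S l" unfolding m_def using not_less_Least by blast
      ultimately show ?thesis using W by blast
    next
      case False
      then have "\<forall>l\<le>k. p \<notin> S l" using mono by blast
      then have "?W p = 0" by (intro sum.neutral) auto
      with False show ?thesis by simp
    qed
    have pos: "0 < sum u {l..k}" if "l \<le> k" for l
      using S(3) that by (intro sum_pos) auto
    have "?W ` UNIV - {0} = (\<lambda>l. sum u {l..k}) ` {..k}"
    proof (intro equalityI subsetI)
      fix x assume "x \<in> ?W ` UNIV - {0}"
      then obtain p where "x = ?W p" "?W p \<noteq> 0" by auto
      then show "x \<in> (\<lambda>l. sum u {l..k}) ` {..k}" using cases[of p] by blast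
    next
      fix x assume "x \<in> (\<lambda>l. sum u {l..k}) ` {..k}"
      then obtain l where l: "l \<le> k" "x = sum u {l..k}" by auto
      obtain p where p: "p \<in> S l" "\<And>i. i < l \<Longrightarrow> p \<notin> S i"
      proof (cases l)
        case 0
        then show ?thesis using S(2) that by auto
      next
        case (Suc l')
        then obtain p where "p \<in> S l" "p \<notin> S l'" using S(1)[of l' l] l by auto
        moreover have "p \<notin> S i" if "i < l" for i using mono[of i l'] Suc l that \<open>p \<notin> S l'\<close> by auto
        ultimately show ?thesis using that by blast
      qed
      then have px: "?W p = x" using W l by blast
      have im: "x \<in> ?W ` UNIV" unfolding px[symmetric] by (rule imageI[OF UNIV_I])
      have x0: "x \<noteq> 0" using pos[OF l(1)] l by simp
      show "x \<in> ?W ` UNIV - {0}" by (rule DiffI[OF im]) (simp add: x0)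
    qed
    moreover have "S l = {p. sum u {l..k} \<le> ?W p}" if l: "l \<le> k" for l
    proof (intro equalityI subsetI CollectI)
      fix p assume p: "p \<in> S l"
      then have "p \<in> S k" using mono l by blast
      then obtain m where m: "m \<le> k" "p \<in> S m" "\<forall>i<m. p \<notin> S i" "?W p = sum u {m..k}" using cases by blast
      then have "m \<le> l" using p by (meson not_le_imp_less)
      then show "sum u {l..k} \<le> ?W p" using m(4) dec[of m l] l by (cases "m = l") auto
    next
      fix p assume "p \<in> {p. sum u {l..k} \<le> ?W p}"
      then have le: "sum u {l..k} \<le> ?W p" by simp
      have "?W p \<noteq> 0" using le pos[OF l] by linarith
      then obtain m where m: "m \<le> k" "p \<in> S m" "?W p = sum u {m..k}" using cases[of p] by blast
      then have "\<not> l < m" using le dec[of l m] by linarith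
      then show "p \<in> S l" using mono[of m l] m l by auto
    qed
    ultimately show ?thesis using dec by blast
  qed
  note K = key[of k S u, OF S] and K' = key[of k' S' u', OF S']
  have im: "(\<lambda>l. sum u {l..k}) ` {..k} = (\<lambda>l. sum u' {l..k'}) ` {..k'}"
    using K K' eq by (metis (no_types, lifting) image_cong)
  have "k = k' \<and> (\<forall>l\<le>k. sum u {l..k} = sum u' {l..k'})"
    by (rule strictly_increasing_enumeration_unique[of "(>)", OF _ _ _ im]) (use K K' in auto)
  then have k: "k = k'" and t: "\<And>l. l \<le> k \<Longrightarrow> sum u {l..k} = sum u' {l..k}" by auto
  show "k = k'" by (rule k)
  show "S l = S' l" if "l \<le> k"
  proof -
    have "S l = {p. sum u {l..k} \<le> (\<Sum>l\<le>k. of_bool (p \<in> S l) * u l)}"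
      using K that by blast
    also have "\<dots> = {p. sum u' {l..k'} \<le> (\<Sum>l\<le>k'. of_bool (p \<in> S' l) * u' l)}"
      by (simp only: eq t[OF that] k[symmetric])
    also have "\<dots> = S' l" using K' that k by blast
    finally show ?thesis .
  qed
  show "u l = u' l" if "l \<le> k"
  proof -
    have "sum u {Suc l..k} = sum u' {Suc l..k}" using t[of "Suc l"] that by (cases "l = k") auto
    then show ?thesis using t[OF that] sum.atLeast_Suc_atMost[OF that, of u] sum.atLeast_Suc_atMost[OF that, of u'] by simp
  qed
qed

text \<open>The superlevel sets of \<open>w\<close>, in the order of decreasing values, with the differences of
  consecutive values as coefficients.\<close>

lemma layers_exist:
  fixes w :: "'a \<Rightarrow> real"
  assumes fin: "finite T" and pos: "\<And>p. p \<in> T \<Longrightarrow> 0 < w p" and le: "\<And>p. p \<in> T \<Longrightarrow> w p \<le> 1"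
    and one: "q \<in> T" "w q = 1" and zero: "\<And>p. p \<notin> T \<Longrightarrow> w p = 0"
  obtains k S u where "u \<in> standard_simplex k" "Suc k \<le> card T" "S 0 = {p. w p = 1}" "S k = T"
    "\<And>l. l < k \<Longrightarrow> S l \<subseteq> S (Suc l)" "\<And>l. l \<le> k \<Longrightarrow> S l \<subseteq> T"
    "\<And>p. w p = (\<Sum>l\<le>k. of_bool (p \<in> S l) * u l)"
proof -
  (* The additional value 0 closes the telescope. *)
  define R where "R = insert 0 (w ` T)"
  define rs where "rs = rev (sorted_list_of_set R)"
  have finR: "finite R" using fin by (simp add: R_def)
  have rs: "set rs = R" "sorted_wrt (>) rs" "length rs = card R"
    using finR by (auto simp: rs_def sorted_wrt_rev)
  have z: "0 \<notin> w ` T" using pos by force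
  have cR: "card R = Suc (card (w ` T))" using fin z by (simp add: R_def)
  have "card (w ` T) \<noteq> 0" using fin one by auto
  then obtain k where k: "card (w ` T) = Suc k" using not0_implies_Suc by blast
  have len: "length rs = Suc (Suc k)" using rs cR k by simp
  have dec: "rs ! j < rs ! i" if "i < j" "j \<le> Suc k" for i j
    using rs(2) len that by (simp add: sorted_wrt_iff_nth_less)
  have dec_iff: "rs ! j \<le> rs ! i \<longleftrightarrow> i \<le> j" if "i \<le> Suc k" "j \<le> Suc k" for i j
    using dec[of i j] dec[of j i] that by (cases i j rule: linorder_cases) auto
  have mem: "\<exists>i\<le>Suc k. x = rs ! i" if "x \<in> R" for x
    using that rs(1) len by (metis in_set_conv_nth less_Suc_eq_le)
  have inR: "rs ! i \<in> R" if "i \<le> Suc k" for i using rs(1) len that by (metis less_Suc_eq_le nth_mem)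
  have last: "rs ! Suc k = 0"
  proof -
    obtain i where i: "i \<le> Suc k" "0 = rs ! i" using mem[of 0] by (auto simp: R_def)
    have "0 \<le> rs ! Suc k" using inR[of "Suc k"] pos by (auto simp: R_def less_imp_le)
    then show ?thesis using i dec_iff[of i "Suc k"] by simp
  qed
  have first: "rs ! 0 = 1"
  proof -
    obtain i where i: "i \<le> Suc k" "1 = rs ! i" using mem[of 1] one by (force simp: R_def)
    have "rs ! 0 \<le> 1" using inR[of 0] le by (auto simp: R_def)
    then show ?thesis using i dec_iff[of 0 i] by simp
  qed
  define u where "u l = (if l \<le> k then rs ! l - rs ! Suc l else 0)" for l
  define S where "S l = {p \<in> T. rs ! l \<le> w p}" for l
  have tele: "sum u {m..k} = rs ! m" if "m \<le> k" for m
  proof -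
    have "sum u {m..k} = (\<Sum>l=m..k. rs ! l - rs ! Suc l)" by (intro sum.cong) (auto simp: u_def)
    also have "\<dots> = rs ! m - rs ! Suc k"
      using sum_Suc_diff[of m k "\<lambda>l. - rs ! l"] that by simp
    finally show ?thesis using last by simp
  qed
  have "u \<in> standard_simplex k"
    unfolding standard_simplex_iff using tele[of 0] first dec[of _ "Suc _"]
    by (auto simp: u_def less_imp_le atMost_atLeast0)
  moreover have "Suc k \<le> card T" using k card_image_le[OF fin, of w] by simp
  moreover have "S 0 = {p. w p = 1}" using first le zero by (force simp: S_def)
  moreover have "S k = T"
  proof -
    have "rs ! k \<le> w p" if "p \<in> T" for p
    proof -
      from that mem[of "w p"] obtain i where i: "i \<le> Suc k" "w p = rs ! i" by (auto simp: R_def)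
      then have "i \<noteq> Suc k" using last pos[OF that] by auto
      then show ?thesis using i dec_iff[of i k] by simp
    qed
    then show ?thesis by (auto simp: S_def)
  qed
  moreover have "S l \<subseteq> S (Suc l)" if "l < k" for l
    using dec[of l "Suc l"] that by (auto simp: S_def)
  moreover have "S l \<subseteq> T" if "l \<le> k" for l
    by (auto simp: S_def)
  moreover have "w p = (\<Sum>l\<le>k. of_bool (p \<in> S l) * u l)" for p
  proof (cases "p \<in> T")
    case True
    obtain i where i: "i \<le> Suc k" "w p = rs ! i" using mem[of "w p"] True by (auto simp: R_def)
    then have "i \<noteq> Suc k" using last pos[OF True] by auto
    then have ik: "i \<le> k" using i by simp
    have "(\<Sum>l\<le>k. of_bool (p \<in> S l) * u l) = sum u {i..k}"
    proof (rule nested_sum)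
      show "S a \<subseteq> S b" if "a \<le> b" "b \<le> k" for a b
        using dec_iff[of a b] that by (auto simp: S_def)
    qed (use True i ik dec in \<open>auto simp: S_def not_le\<close>)
    then show ?thesis using tele[OF ik] i by simp
  qed (simp add: zero S_def)
  ultimately show ?thesis by (rule that)
qed

section \<open>Barycentric coordinates on the nerve of a poset\<close>

definition arr_less :: "('o, 'm) cat \<Rightarrow> 'o \<Rightarrow> 'o \<Rightarrow> bool" where
  "arr_less C x y \<longleftrightarrow> arr_le C x y \<and> x \<noteq> y"

definition chain_set :: "('o, 'm) cat \<Rightarrow> 'o set \<Rightarrow> bool" where
  "chain_set C T \<longleftrightarrow> finite T \<and> T \<subseteq> Obj C \<and> (\<forall>p\<in>T. \<forall>q\<in>T. arr_le C p q \<or> arr_le C q p)"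

text \<open>The simplex spanned by a finite set of objects, described by barycentric coordinates.\<close>

definition Delta :: "'o set \<Rightarrow> ('o \<Rightarrow> real) set" where
  "Delta T = {z. (\<forall>p. 0 \<le> z p) \<and> (\<forall>p. p \<notin> T \<longrightarrow> z p = 0) \<and> sum z T = 1}"

abbreviation Delta_topology :: "'o set \<Rightarrow> ('o \<Rightarrow> real) topology" where
  "Delta_topology T \<equiv> subtopology (powertop_real UNIV) (Delta T)"

definition bary :: "('o list \<times> 'm list) rpoint set \<Rightarrow> 'o \<Rightarrow> real" where
  "bary c p = vertex_coord nerve_vertex (\<lambda>q. of_bool (q = p)) c"

abbreviation nerve_space :: "('o, 'm) cat \<Rightarrow> ('o list \<times> 'm list) sspace" where
  "nerve_space C \<equiv> discrete_sspace (nerve C)"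

abbreviation nerve_real :: "('o, 'm) cat \<Rightarrow> ('o list \<times> 'm list) rpoint set topology" where
  "nerve_real C \<equiv> realization (nerve_space C)"

definition bary_point :: "('o, 'm) cat \<Rightarrow> ('o \<Rightarrow> real) \<Rightarrow> ('o list \<times> 'm list) rpoint set" where
  "bary_point C z = (SOME c. c \<in> topspace (nerve_real C) \<and> bary c = z)"

lemma SpTop_discrete_sspace: "SpTop (discrete_sspace X) n = discrete_topology (Simp X n)"
  by (simp add: discrete_sspace_def)

lemma topspace_discrete_realization:
  "topspace (realization (discrete_sspace X)) = {rclass (discrete_sspace X) (n, x, u) | n x u. x \<in> Simp X n \<and> u \<in> standard_simplex n}"
  by (subst topspace_realization, rule k_space_discrete_sspace) (auto simp: valid_point_def discrete_sspace_def image_def)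

lemma continuous_map_powertop_sub:
  "continuous_map X (subtopology (powertop_real UNIV) A) f \<longleftrightarrow>
     (\<forall>i. continuous_map X euclideanreal (\<lambda>x. f x i)) \<and> f \<in> topspace X \<rightarrow> A"
  by (auto simp: continuous_map_in_subtopology continuous_map_componentwise_UNIV image_subset_iff_funcset)

lemma continuous_map_coordinate:
  "continuous_map (subtopology (powertop_real UNIV) A) euclideanreal (\<lambda>u. u i)"
  by (intro continuous_map_from_subtopology continuous_map_product_projection) simp

text \<open>An object may occur repeatedly in \<open>as\<close>; its coordinate collects the weights of all its
  positions.\<close>

lemma sum_positions_push:
  fixes u :: "nat \<Rightarrow> real"
  assumes "\<And>i. i \<le> n \<Longrightarrow> as ! i \<in> T" "finite T"
  shows "(\<Sum>p\<in>{p \<in> T. h p = q}. \<Sum>i\<le>n. of_bool (as ! i = p) * u i) = (\<Sum>i\<le>n. of_bool (h (as ! i) = q) * u i)"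
proof -
  have "(\<Sum>p\<in>{p \<in> T. h p = q}. \<Sum>i\<le>n. of_bool (as ! i = p) * u i) =
      (\<Sum>i\<le>n. \<Sum>p\<in>{p \<in> T. h p = q}. of_bool (as ! i = p) * u i)"
    by (rule sum.swap)
  also have "\<dots> = (\<Sum>i\<le>n. of_bool (h (as ! i) = q) * u i)"
  proof (rule sum.cong[OF refl])
    fix i assume "i \<in> {..n}"
    then have i: "as ! i \<in> T" using assms by simp
    have "(\<Sum>p\<in>{p \<in> T. h p = q}. of_bool (as ! i = p) * u i) = (\<Sum>p\<in>{p \<in> T. h p = q}. if as ! i = p then u i else 0)"
      by (intro sum.cong) auto
    also have "\<dots> = of_bool (h (as ! i) = q) * u i" using assms i by simp
    finally show "(\<Sum>p\<in>{p \<in> T. h p = q}. of_bool (as ! i = p) * u i) = of_bool (h (as ! i) = q) * u i" .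
  qed
  finally show ?thesis .
qed

lemma sum_positions:
  fixes u :: "nat \<Rightarrow> real"
  assumes "\<And>i. i \<le> n \<Longrightarrow> as ! i \<in> T" "finite T"
  shows "(\<Sum>p\<in>T. \<Sum>i\<le>n. of_bool (as ! i = p) * u i) = sum u {..n}"
  using sum_positions_push[OF assms, where h = "\<lambda>_. ()" and q = "()"] by simp

lemma list_coordinates:
  assumes es: "distinct es" "length es = Suc n" and z: "z \<in> Delta (set es)"
  defines "u \<equiv> \<lambda>i. if i \<le> n then z (es ! i) else 0"
  shows "u \<in> standard_simplex n" "(\<Sum>i\<le>n. of_bool (es ! i = p) * u i) = z p"
proof -
  have inj: "inj_on ((!) es) {..n}" using es by (auto simp: inj_on_def nth_eq_iff_index_eq)
  have im: "(!) es ` {..n} = set es" using es(2) by (auto simp: set_conv_nth less_Suc_eq_le image_def)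
  have "sum u {..n} = sum z (set es)"
    using sum.reindex[OF inj, of z] unfolding im by (simp add: u_def)
  then show "u \<in> standard_simplex n"
    using z by (auto simp: standard_simplex_iff u_def Delta_def)
  show "(\<Sum>i\<le>n. of_bool (es ! i = p) * u i) = z p"
  proof (cases "p \<in> set es")
    case True
    then obtain j where j: "j \<le> n" "p = es ! j" unfolding im[symmetric] by auto
    have "(\<Sum>i\<le>n. of_bool (es ! i = p) * u i) = (\<Sum>i\<le>n. if i = j then z p else 0)"
      using j es by (intro sum.cong) (auto simp: nth_eq_iff_index_eq u_def)
    then show ?thesis using j by simp
  next
    case False
    then show ?thesis using z es(2)
      by (auto simp: Delta_def in_set_conv_nth less_Suc_eq_le intro!: sum.neutral)
  qed
qed

lemma finite_chain_list:
  assumes "finite_chain lt T"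
  shows "\<exists>es. set es = T \<and> sorted_wrt lt es \<and> distinct es"
  using assms
proof (induction T rule: finite_chain_induct)
  case (insert t T)
  then obtain es where "set es = T" "sorted_wrt lt es" "distinct es" by blast
  then show ?case using insert.hyps by (intro exI[of _ "es @ [t]"]) (auto simp: sorted_wrt_append)
qed simp

context poset_cat
begin

lemma chain_set_finite_chain: "chain_set C T \<Longrightarrow> finite_chain (arr_less C) T"
  unfolding finite_chain_def chain_set_def arr_less_def using arr_le_trans arr_le_antisym by blast

lemma chain_in_chain_set: "chain_in C a b S \<Longrightarrow> chain_set C S"
  by (auto simp: chain_in_def chain_set_def)

lemma chain_set_subset: "chain_set C T \<Longrightarrow> S \<subseteq> T \<Longrightarrow> chain_set C S"
  unfolding chain_set_def by (meson finite_subset subset_iff subset_trans)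

interpretation N: vertexed_sset "nerve C" nerve_vertex "arr_le C"
  by (rule vertexed_nerve)

lemma bary_rclass: "bary (rclass (nerve_space C) (n, x, u)) p = (\<Sum>i\<le>n. of_bool (nerve_vertex x i = p) * u i)"
  unfolding bary_def N.vertex_coord_rclass by (simp add: vertex_sum_def)

lemma bary_inject:
  assumes "c \<in> topspace (nerve_real C)" "c' \<in> topspace (nerve_real C)" "bary c = bary c'"
  shows "c = c'"
proof -
  from assms obtain n x u m y v where c: "c = rclass (nerve_space C) (n, x, u)" "x \<in> Simp (nerve C) n" "u \<in> standard_simplex n"
    "c' = rclass (nerve_space C) (m, y, v)" "y \<in> Simp (nerve C) m" "v \<in> standard_simplex m"
    unfolding topspace_discrete_realization by blast
  show ?thesis unfolding c(1,4)
  proof (rule N.rclass_eqI)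
    show "vertex_sum nerve_vertex (\<lambda>q. of_bool (q = p)) (n, x, u) = vertex_sum nerve_vertex (\<lambda>q. of_bool (q = p)) (m, y, v)" for p
      using fun_cong[OF assms(3), of p] unfolding c(1,4) bary_def N.vertex_coord_rclass .
  qed (use c in \<open>auto simp: discrete_sspace_def\<close>)
qed

lemma rclass_in_nerve_real:
  "x \<in> Simp (nerve C) n \<Longrightarrow> u \<in> standard_simplex n \<Longrightarrow> rclass (nerve_space C) (n, x, u) \<in> topspace (nerve_real C)"
  unfolding topspace_discrete_realization by blast

lemma Simp_nerve_chain_set:
  assumes "(as, fs) \<in> Simp (nerve C) n"
  shows "chain_set C (set as)" "length as = Suc n"
proof -
  have s: "length fs = n" "set as \<subseteq> Obj C" "typed_string (\<lambda>a b f. f \<in> hom_set C a b) as fs"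
    using assms by (auto simp: Simp_nerve)
  show len: "length as = Suc n" using s by (simp add: typed_string_def)
  have le: "arr_le C (as ! i) (as ! j)" if "i \<le> j" "j \<le> n" for i j
  proof (cases "i = j")
    case True
    then show ?thesis using s(2) that len by (auto intro!: arr_le_refl simp: subset_iff)
  next
    case False
    then show ?thesis using N.le_V_le[of "(as, fs)" n i j] assms that by (simp add: discrete_sspace_def)
  qed
  have "arr_le C p q \<or> arr_le C q p" if pq: "p \<in> set as" "q \<in> set as" for p q
  proof -
    obtain i j where "p = as ! i" "q = as ! j" "i \<le> n" "j \<le> n"
      using pq len by (metis in_set_conv_nth less_Suc_eq_le)
    then show ?thesis using le[of i j] le[of j i] by (meson nat_le_linear)
  qed
  then show "chain_set C (set as)" using s(2) by (auto simp: chain_set_def)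
qed

lemma bary_Delta:
  assumes "(as, fs) \<in> Simp (nerve C) n" "u \<in> standard_simplex n"
  shows "bary (rclass (nerve_space C) (n, (as, fs), u)) \<in> Delta (set as)"
proof -
  have len: "length as = Suc n" using Simp_nerve_chain_set[OF assms(1)] by simp
  have u: "0 \<le> u i" for i using assms(2) by (simp add: standard_simplex_iff)
  have "(\<Sum>p\<in>set as. \<Sum>i\<le>n. of_bool (as ! i = p) * u i) = 1"
    using sum_positions[of n as "set as" u] len assms(2) by (simp add: standard_simplex_iff)
  moreover have "(\<Sum>i\<le>n. of_bool (as ! i = p) * u i) = 0" if "p \<notin> set as" for p
    using that len by (intro sum.neutral) (auto simp: in_set_conv_nth less_Suc_eq_le)
  ultimately show ?thesis
    using u by (auto simp: Delta_def bary_rclass intro!: sum_nonneg)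
qed

lemma continuous_bary_cell:
  assumes "(as, fs) \<in> Simp (nerve C) n"
  shows "continuous_map (simplex_topology n) (Delta_topology (set as))
     (\<lambda>u. bary (rclass (nerve_space C) (n, (as, fs), u)))"
  unfolding continuous_map_powertop_sub
  using bary_Delta[OF assms]
  by (auto simp: bary_rclass intro!: continuous_map_sum continuous_map_real_mult continuous_map_coordinate)

lemma chain_cell:
  assumes "chain_set C T" "T \<noteq> {}"
  obtains n es fs where "(es, fs) \<in> Simp (nerve C) n" "set es = T" "distinct es" "length es = Suc n"
proof -
  obtain es where es: "set es = T" "sorted_wrt (arr_less C) es" "distinct es"
    using finite_chain_list[OF chain_set_finite_chain[OF assms(1)]] by blast
  define n where "n = length es - 1"
  have len: "length es = Suc n" using es assms(2) by (cases es) (auto simp: n_def)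
  define fs where "fs = map (\<lambda>j. SOME f. f \<in> hom_set C (es ! j) (es ! Suc j)) [0..<n]"
  have "fs ! j \<in> hom_set C (es ! j) (es ! Suc j)" if "j < n" for j
  proof -
    have "arr_less C (es ! j) (es ! Suc j)" using es(2) len that by (simp add: sorted_wrt_iff_nth_less)
    then show ?thesis using that some_in_eq[of "hom_set C (es ! j) (es ! Suc j)"] by (simp add: fs_def arr_less_def arr_le_def)
  qed
  then have "(es, fs) \<in> Simp (nerve C) n"
    using len es assms(1) by (auto simp: Simp_nerve typed_string_def fs_def chain_set_def)
  then show ?thesis using that es len by blast
qed

lemma Delta_nonempty: "z \<in> Delta T \<Longrightarrow> T \<noteq> {}"
  by (auto simp: Delta_def)

lemma chain_cell_coord:
  assumes es: "(es, fs) \<in> Simp (nerve C) n" "distinct es" "length es = Suc n" and z: "z \<in> Delta (set es)"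
  defines "u \<equiv> \<lambda>i. if i \<le> n then z (es ! i) else 0"
  shows "u \<in> standard_simplex n" "bary (rclass (nerve_space C) (n, (es, fs), u)) = z"
proof -
  show "u \<in> standard_simplex n" unfolding u_def by (rule list_coordinates(1)[OF es(2,3) z])
  show "bary (rclass (nerve_space C) (n, (es, fs), u)) = z"
    using list_coordinates(2)[OF es(2,3) z] by (intro ext) (simp add: bary_rclass u_def)
qed

lemma bary_point:
  assumes "chain_set C T" "z \<in> Delta T"
  shows "bary_point C z \<in> topspace (nerve_real C)" "bary (bary_point C z) = z"
proof -
  obtain n es fs where es: "(es, fs) \<in> Simp (nerve C) n" "set es = T" "distinct es" "length es = Suc n"
    by (rule chain_cell[OF assms(1) Delta_nonempty[OF assms(2)]])
  then have z: "z \<in> Delta (set es)" using assms by simp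
  note c = chain_cell_coord[OF es(1,3,4) z]
  have "\<exists>c. c \<in> topspace (nerve_real C) \<and> bary c = z"
    using c es(1) unfolding topspace_discrete_realization by blast
  then have "bary_point C z \<in> topspace (nerve_real C) \<and> bary (bary_point C z) = z"
    unfolding bary_point_def by (rule someI_ex)
  then show "bary_point C z \<in> topspace (nerve_real C)" "bary (bary_point C z) = z" by auto
qed

lemma bary_point_bary: "c \<in> topspace (nerve_real C) \<Longrightarrow> bary_point C (bary c) = c"
  unfolding bary_point_def using bary_inject by (metis (mono_tags, lifting) someI_ex)

lemma topspace_nerve_real_coord:
  assumes "c \<in> topspace (nerve_real C)"
  obtains T where "chain_set C T" "bary c \<in> Delta T"
proof -
  from assms obtain n as fs u where "c = rclass (nerve_space C) (n, (as, fs), u)" "(as, fs) \<in> Simp (nerve C) n" "u \<in> standard_simplex n"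
    unfolding topspace_discrete_realization by auto
  then show ?thesis using that Simp_nerve_chain_set(1) bary_Delta by blast
qed

text \<open>After sorting \<open>T\<close>, the map is the characteristic map of one simplex of the nerve, up to the
  identification of \<^const>\<open>Delta\<close> with a standard simplex.\<close>

lemma continuous_bary_point:
  assumes "chain_set C T"
  shows "continuous_map (Delta_topology T) (nerve_real C) (bary_point C)"
proof (cases "T = {}")
  case True
  then show ?thesis using Delta_nonempty by (auto simp: continuous_map_def Delta_def)
next
  case False
  obtain n es fs where es: "(es, fs) \<in> Simp (nerve C) n" "set es = T" "distinct es" "length es = Suc n"
    by (rule chain_cell[OF assms False])
  let ?u = "\<lambda>z i. if i \<le> n then z (es ! i) else (0 :: real)"
  have "continuous_map (Delta_topology T) (simplex_topology n) ?u"
    unfolding continuous_map_powertop_sub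
    using chain_cell_coord(1)[OF es(1,3,4)] es(2) by (auto intro: continuous_map_coordinate)
  then have "continuous_map (Delta_topology T) (prod_topology (SpTop (nerve_space C) n) (simplex_topology n)) (\<lambda>z. ((es, fs), ?u z))"
    using es(1) by (auto simp: continuous_map_paired discrete_sspace_def)
  from continuous_map_compose[OF this continuous_map_rclass]
  have "continuous_map (Delta_topology T) (nerve_real C) (\<lambda>z. rclass (nerve_space C) (n, (es, fs), ?u z))"
    by (simp add: o_def)
  then show ?thesis
  proof (rule continuous_map_eq)
    fix z assume "z \<in> topspace (Delta_topology T)"
    then have z: "z \<in> Delta (set es)" using es(2) by simp
    note c = chain_cell_coord[OF es(1,3,4) z]
    show "rclass (nerve_space C) (n, (es, fs), ?u z) = bary_point C z"
      using bary_point_bary[OF rclass_in_nerve_real[OF es(1) c(1)]] c(2) by simp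
  qed
qed

text \<open>The nerve carries the weak topology of the simplices \<open>Delta T\<close>: degenerate simplices, or those
  with repeated vertices, factor through these by \<open>continuous_bary_cell\<close>.\<close>

lemma closedin_nerve_real:
  assumes A: "A \<subseteq> topspace (nerve_real C)"
    and cl: "\<And>T. chain_set C T \<Longrightarrow> closedin (Delta_topology T) {z \<in> Delta T. bary_point C z \<in> A}"
  shows "closedin (nerve_real C) A"
proof -
  let ?S = "sum_topology (\<lambda>n. prod_topology (SpTop (nerve_space C) n) (simplex_topology n)) UNIV"
  have op: "openin (prod_topology (discrete_topology D) (Z :: 'z topology)) U"
    if "U \<subseteq> D \<times> topspace Z" "\<And>d. d \<in> D \<Longrightarrow> openin Z {z. (d, z) \<in> U}" for D :: "'d set" and Z :: "'z topology" and U
    unfolding openin_prod_topology_alt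
  proof (intro allI impI)
    fix d z assume "(d, z) \<in> U"
    then show "\<exists>V W. openin (discrete_topology D) V \<and> openin Z W \<and> d \<in> V \<and> z \<in> W \<and> V \<times> W \<subseteq> U"
      using that by (intro exI[of _ "{d}"] exI[of _ "{z. (d, z) \<in> U}"]) auto
  qed
  have q: "quotient_map ?S (nerve_real C) (rclass (nerve_space C))"
    by (rule quotient_map_rclass) simp
  have "openin ?S {x \<in> topspace ?S. rclass (nerve_space C) x \<in> topspace (nerve_real C) - A}"
    unfolding openin_sum_topology
  proof (intro conjI ballI)
    fix n
    let ?U = "{x. (n, x) \<in> {x \<in> topspace ?S. rclass (nerve_space C) x \<in> topspace (nerve_real C) - A}}"
    have "openin (prod_topology (discrete_topology (Simp (nerve C) n)) (simplex_topology n)) ?U"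
    proof (rule op)
      fix x assume x: "x \<in> Simp (nerve C) n"
      obtain as fs where xx: "x = (as, fs)" by (cases x)
      have s: "(as, fs) \<in> Simp (nerve C) n" using x xx by simp
      let ?b = "\<lambda>u. bary (rclass (nerve_space C) (n, (as, fs), u))"
      have cl': "closedin (simplex_topology n) {u \<in> topspace (simplex_topology n). ?b u \<in> {z \<in> Delta (set as). bary_point C z \<in> A}}"
        by (rule closedin_continuous_map_preimage[OF continuous_bary_cell[OF s] cl[OF Simp_nerve_chain_set(1)[OF s]]])
      have "bary_point C (?b u) = rclass (nerve_space C) (n, (as, fs), u)" "rclass (nerve_space C) (n, (as, fs), u) \<in> topspace (nerve_real C)"
        if "u \<in> standard_simplex n" for u
        using bary_point_bary rclass_in_nerve_real[OF s that] by auto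
      then have "{u. (x, u) \<in> ?U} =
          topspace (simplex_topology n) - {u \<in> topspace (simplex_topology n). ?b u \<in> {z \<in> Delta (set as). bary_point C z \<in> A}}"
        using x bary_Delta[OF s] by (auto simp: xx SpTop_discrete_sspace)
      then show "openin (simplex_topology n) {u. (x, u) \<in> ?U}"
        using cl' unfolding closedin_def by simp
    qed (auto simp: SpTop_discrete_sspace)
    then show "openin (prod_topology (SpTop (nerve_space C) n) (simplex_topology n)) ?U"
      by (simp add: SpTop_discrete_sspace)
  qed auto
  then have "openin (nerve_real C) (topspace (nerve_real C) - A)"
    using q unfolding quotient_map_def by blast
  then show ?thesis using A by (simp add: closedin_def)
qed

end

section \<open>Coordinates on the bar construction\<close>

abbreviation word_space :: "('o, 'm) cat \<Rightarrow> 'o list \<Rightarrow> ('o, 'm) word list sspace" where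
  "word_space C as \<equiv> chain_space (resolution C) as"

abbreviation bar_space :: "('o, 'm) cat \<Rightarrow> ('o, ('o, 'm) word) bar_point sspace" where
  "bar_space C \<equiv> bar (resolution C)"

abbreviation bar_real :: "('o, 'm) cat \<Rightarrow> ('o, ('o, 'm) word) bar_point rpoint set topology" where
  "bar_real C \<equiv> realization (bar_space C)"

abbreviation bar_vertex :: "('o, ('o, 'm) word) bar_point \<Rightarrow> nat \<Rightarrow> 'o" where
  "bar_vertex x i \<equiv> fst x ! i"

text \<open>The weight function \<open>w\<close> of a point of the realized space of words: the total weight of the members
  of the flag that contain \<open>p\<close>.\<close>

definition flag_coord :: "('o, 'm) cat \<Rightarrow> ('o, ('o, 'm) word) bar_point \<Rightarrow> 'o \<Rightarrow> real" where
  "flag_coord C x p = vertex_coord (flag C (fst x)) (\<lambda>S. of_bool (p \<in> S)) (snd x)"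

definition vertex_wt :: "('o, ('o, 'm) word) bar_point rpoint \<Rightarrow> 'o \<Rightarrow> real" where
  "vertex_wt a p = vertex_sum bar_vertex (\<lambda>q. of_bool (q = p)) a"

definition flag_wt :: "('o, 'm) cat \<Rightarrow> ('o, ('o, 'm) word) bar_point rpoint \<Rightarrow> 'o \<Rightarrow> real" where
  "flag_wt C a = flag_coord C (fst (snd a))"

definition comb_wt :: "('o, 'm) cat \<Rightarrow> ('o \<Rightarrow> 'o) \<Rightarrow> ('o, ('o, 'm) word) bar_point rpoint \<Rightarrow> 'o \<Rightarrow> real" where
  "comb_wt C \<kappa> a = weight \<kappa> (arr_less C) (vertex_wt a) (flag_wt C a)"

text \<open>The sum is over the support so that the definition does not refer to a chosen chain.\<close>

definition comb_bary :: "('o, 'm) cat \<Rightarrow> ('o \<Rightarrow> 'o) \<Rightarrow> ('o, ('o, 'm) word) bar_point rpoint \<Rightarrow> 'o \<Rightarrow> real" where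
  "comb_bary C \<kappa> a p = comb_wt C \<kappa> a p / sum (comb_wt C \<kappa> a) {p. comb_wt C \<kappa> a p \<noteq> 0}"

text \<open>The map \<open>T\<^sub>\<kappa>\<close> of the introduction.\<close>

definition comparison :: "('o, 'm) cat \<Rightarrow> ('o \<Rightarrow> 'o) \<Rightarrow> ('o, ('o, 'm) word) bar_point rpoint set \<Rightarrow> ('o list \<times> 'm list) rpoint set" where
  "comparison C \<kappa> c = bary_point C (comb_bary C \<kappa> (SOME a. a \<in> c))"

definition convex_fibres :: "('o, 'm) cat \<Rightarrow> ('o \<Rightarrow> 'o) \<Rightarrow> bool" where
  "convex_fibres C \<kappa> \<longleftrightarrow> (\<forall>x y z. arr_le C x y \<longrightarrow> arr_le C y z \<longrightarrow> \<kappa> x = \<kappa> z \<longrightarrow> \<kappa> y = \<kappa> x)"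

lemma vertex_wt_eq: "vertex_wt (n, (as, c), u) p = (\<Sum>i\<le>n. of_bool (as ! i = p) * u i)"
  by (simp add: vertex_wt_def vertex_sum_def)

lemma flag_wt_eq: "flag_wt C (n, x, u) = flag_coord C x"
  by (simp add: flag_wt_def)

lemma k_space_bar [simp]: "k_space (SpTop (bar E) n)"
  unfolding bar_def sspace.select_convs by (intro k_space_sum_topology k_space_realization) simp

lemma bar_points:
  "(as, c) \<in> topspace (SpTop (bar_space C) n) \<longleftrightarrow>
     length as = Suc n \<and> set as \<subseteq> Obj C \<and> c \<in> topspace (realization (word_space C as))"
  by (auto simp: bar_def resolution_def)

lemma word_space_points:
  "topspace (realization (word_space C as)) =
     {rclass (word_space C as) (k, xs, u) | k xs u. typed_string (word_typed C k) as xs \<and> u \<in> standard_simplex k}"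
  unfolding topspace_discrete_realization Simp_chain_sset by simp

lemma bar_pointE:
  assumes "x \<in> topspace (SpTop (bar_space C) n)"
  obtains as k xs u where "x = (as, rclass (word_space C as) (k, xs, u))" "length as = Suc n" "length xs = n"
    "set as \<subseteq> Obj C" "typed_string (word_typed C k) as xs" "u \<in> standard_simplex k"
proof -
  obtain as c where x: "x = (as, c)" by (cases x)
  then have as: "length as = Suc n" "set as \<subseteq> Obj C" "c \<in> topspace (realization (word_space C as))"
    using assms by (auto simp: bar_points)
  have "\<exists>k xs u. c = rclass (word_space C as) (k, xs, u) \<and> typed_string (word_typed C k) as xs \<and> u \<in> standard_simplex k"
    using as(3) unfolding word_space_points mem_Collect_eq .
  then obtain k xs u where c: "c = rclass (word_space C as) (k, xs, u)" "typed_string (word_typed C k) as xs" "u \<in> standard_simplex k"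
    by (elim exE conjE)
  have "length xs = n" using c(2) as(1) unfolding typed_string_def by simp
  then show ?thesis using x c as by (intro that[of as k xs u]) simp_all
qed

lemma bar_point_in:
  "length as = Suc n \<Longrightarrow> set as \<subseteq> Obj C \<Longrightarrow> typed_string (word_typed C k) as xs \<Longrightarrow> u \<in> standard_simplex k \<Longrightarrow>
     (as, rclass (word_space C as) (k, xs, u)) \<in> topspace (SpTop (bar_space C) n)"
  unfolding bar_points word_space_points by blast

context poset_cat
begin

lemma flag_coord_rclass:
  assumes "set as \<subseteq> Obj C"
  shows "flag_coord C (as, rclass (word_space C as) (k, xs, u)) p = (\<Sum>l\<le>k. of_bool (p \<in> flag C as xs l) * u l)"
proof -
  interpret W: vertexed_sset "chain_sset (resolution C) as" "flag C as" "(\<subseteq>)" by (rule vertexed_chain[OF assms])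
  show ?thesis by (simp add: flag_coord_def W.vertex_coord_rclass vertex_sum_def)
qed

text \<open>Reduced representatives have strictly increasing flags, to which uniqueness of layers
  applies.\<close>

lemma flag_coord_inject:
  assumes as: "set as \<subseteq> Obj C" "as \<noteq> []"
    and c: "c \<in> topspace (realization (word_space C as))" "c' \<in> topspace (realization (word_space C as))"
    and eq: "\<And>p. flag_coord C (as, c) p = flag_coord C (as, c') p"
  shows "c = c'"
proof -
  interpret W: vertexed_sset "chain_sset (resolution C) as" "flag C as" "(\<subseteq>)" by (rule vertexed_chain[OF as(1)])
  have red: "\<exists>k xs u. W.reduced (k, xs, u) \<and> c = rclass (word_space C as) (k, xs, u)"
    if c: "c \<in> topspace (realization (word_space C as))" for c
  proof -
    obtain a where "valid_point (word_space C as) a" "c = rclass (word_space C as) a"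
      using c by (subst (asm) topspace_realization, simp) auto
    then show ?thesis using W.exists_reduced[of a] by (metis prod_cases3)
  qed
  obtain k xs u where r: "W.reduced (k, xs, u)" "c = rclass (word_space C as) (k, xs, u)" using red[OF c(1)] by blast
  obtain k' xs' u' where r': "W.reduced (k', xs', u')" "c' = rclass (word_space C as) (k', xs', u')" using red[OF c(2)] by blast
  have ne: "flag C as ys 0 \<noteq> {}" for ys using as(2) by (auto simp: flag_def)
  have L: "k = k'" "\<And>l. l \<le> k \<Longrightarrow> flag C as xs l = flag C as xs' l" "\<And>l. l \<le> k \<Longrightarrow> u l = u' l"
  proof -
    have 1: "i < j \<Longrightarrow> j \<le> k \<Longrightarrow> flag C as xs i \<subset> flag C as xs j" for i j
      using W.reduced_strict[OF r(1), of i j] by blast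
    have 2: "i < j \<Longrightarrow> j \<le> k' \<Longrightarrow> flag C as xs' i \<subset> flag C as xs' j" for i j
      using W.reduced_strict[OF r'(1), of i j] by blast
    have 3: "l \<le> k \<Longrightarrow> 0 < u l" "l \<le> k' \<Longrightarrow> 0 < u' l" for l
      using r r' by (auto simp: W.reduced_def)
    have 4: "(\<Sum>l\<le>k. of_bool (p \<in> flag C as xs l) * u l) = (\<Sum>l\<le>k'. of_bool (p \<in> flag C as xs' l) * u' l)" for p
      using eq[of p] unfolding r(2) r'(2) flag_coord_rclass[OF as(1)] .
    show "k = k'" by (rule layers_unique(1)[where S = "flag C as xs" and S' = "flag C as xs'", OF 1 ne 3(1) 2 ne 3(2) 4])
    show "flag C as xs l = flag C as xs' l" if "l \<le> k" for l
      by (rule layers_unique(2)[where S = "flag C as xs" and S' = "flag C as xs'", OF 1 ne 3(1) 2 ne 3(2) 4 that])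
    show "u l = u' l" if "l \<le> k" for l
      by (rule layers_unique(3)[where S = "flag C as xs" and S' = "flag C as xs'", OF 1 ne 3(1) 2 ne 3(2) 4 that])
  qed
  have "xs = xs'"
    using r(1) r'(1) L(1,2) unfolding W.reduced_def
    by (intro W.V_inject[of _ k]) (auto simp: SpTop_discrete_sspace)
  moreover have "u l = u' l" for l
    using L(1,3) r(1) r'(1) by (cases "l \<le> k") (auto simp: W.reduced_def standard_simplex_iff)
  ultimately show ?thesis using r r' L(1) by (metis ext)
qed

definition cut_weight :: "nat \<Rightarrow> nat \<Rightarrow> 'o list \<Rightarrow> ('o \<Rightarrow> real) \<Rightarrow> 'o \<Rightarrow> real" where
  "cut_weight n i as w p = (if i = 0 then if arr_le C (as ! 1) p then w p else 0
     else if i = n then if arr_le C p (as ! (n - 1)) then w p else 0 else w p)"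

lemma face_arrs_simplicial:
  assumes "length as = Suc (Suc n)" "set as \<subseteq> Obj C" "i \<le> Suc n"
  shows "simplicial_map (word_space C as) (word_space C (face_objs i as))
     (\<lambda>k. face_arrs (Comp (free_pow (Suc k) C)) (Suc n) i)"
    and "typed_string (word_typed C k) as xs \<Longrightarrow>
      typed_string (word_typed C k) (face_objs i as) (face_arrs (Comp (free_pow (Suc k) C)) (Suc n) i xs)"
proof -
  have sub: "set (face_objs i as) \<subseteq> Obj C" using set_face_objs[of i as] assms(2) by blast
  have len: "length xs = Suc n" if "typed_string (word_typed C k) as xs" for k xs
    using that assms(1) by (simp add: typed_string_def)
  show t: "typed_string (word_typed C k) (face_objs i as) (face_arrs (Comp (free_pow (Suc k) C)) (Suc n) i xs)"
    if "typed_string (word_typed C k) as xs" for k xs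
    by (rule typed_string_face[OF that len[OF that] assms(3)]) (rule Comp_free_pow(1))
  show "simplicial_map (word_space C as) (word_space C (face_objs i as))
     (\<lambda>k. face_arrs (Comp (free_pow (Suc k) C)) (Suc n) i)"
    by (rule simplicial_map_vertexwise[OF vertexed_chain[OF assms(2)] vertexed_chain[OF sub], where h = "cut_flag (Suc n) i as"])
       (use t flag_face len assms in \<open>auto simp: Simp_chain_sset\<close>)
qed

lemma degen_arrs_simplicial:
  assumes "length as = Suc n" "set as \<subseteq> Obj C" "i \<le> n"
  shows "simplicial_map (word_space C as) (word_space C (degen_objs i as))
     (\<lambda>k. degen_arrs (Idn (free_pow (Suc k) C) (as ! i)) i)"
    and "typed_string (word_typed C k) as xs \<Longrightarrow>
      typed_string (word_typed C k) (degen_objs i as) (degen_arrs (Idn (free_pow (Suc k) C) (as ! i)) i xs)"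
proof -
  have sub: "set (degen_objs i as) \<subseteq> Obj C" using set_degen_objs[of i as] assms by simp
  have ai: "as ! i \<in> Obj C" using assms by (auto simp: subset_iff)
  have len: "length xs = n" if "typed_string (word_typed C k) as xs" for k xs
    using that assms(1) by (simp add: typed_string_def)
  show t: "typed_string (word_typed C k) (degen_objs i as) (degen_arrs (Idn (free_pow (Suc k) C) (as ! i)) i xs)"
    if "typed_string (word_typed C k) as xs" for k xs
    by (rule typed_string_degen[OF that len[OF that] assms(3)]) (rule Idn_free_pow[OF ai])
  show "simplicial_map (word_space C as) (word_space C (degen_objs i as))
     (\<lambda>k. degen_arrs (Idn (free_pow (Suc k) C) (as ! i)) i)"
    by (rule simplicial_map_vertexwise[OF vertexed_chain[OF assms(2)] vertexed_chain[OF sub], where h = id])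
       (use t flag_degen len assms in \<open>auto simp: Simp_chain_sset\<close>)
qed

lemma SpFace_bar:
  assumes "length as = Suc (Suc n)" "set as \<subseteq> Obj C" "i \<le> Suc n"
  shows "SpFace (bar_space C) (Suc n) i (as, rclass (word_space C as) (k, xs, u)) =
    (face_objs i as, rclass (word_space C (face_objs i as)) (k, face_arrs (Comp (free_pow (Suc k) C)) (Suc n) i xs, u))"
  using realization_map_rclass[OF face_arrs_simplicial(1)[OF assms]]
  by (simp add: bar_def resolution_def)

lemma SpDegen_bar:
  assumes "length as = Suc n" "set as \<subseteq> Obj C" "i \<le> n"
  shows "SpDegen (bar_space C) n i (as, rclass (word_space C as) (k, xs, u)) =
    (degen_objs i as, rclass (word_space C (degen_objs i as)) (k, degen_arrs (Idn (free_pow (Suc k) C) (as ! i)) i xs, u))"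
  using realization_map_rclass[OF degen_arrs_simplicial(1)[OF assms]]
  by (simp add: bar_def resolution_def)

lemma flag_coord_face:
  assumes "(as, c) \<in> topspace (SpTop (bar_space C) (Suc n))" "i \<le> Suc n"
  shows "flag_coord C (SpFace (bar_space C) (Suc n) i (as, c)) = cut_weight (Suc n) i as (flag_coord C (as, c))"
proof -
  from assms(1) obtain k xs u where x: "c = rclass (word_space C as) (k, xs, u)" "length as = Suc (Suc n)" "length xs = Suc n"
    "set as \<subseteq> Obj C" "typed_string (word_typed C k) as xs" "u \<in> standard_simplex k"
    by (auto elim: bar_pointE)
  have sub: "set (face_objs i as) \<subseteq> Obj C" using set_face_objs[of i as] x(4) by blast
  have "flag_coord C (SpFace (bar_space C) (Suc n) i (as, c)) p = cut_weight (Suc n) i as (flag_coord C (as, c)) p" for p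
  proof -
    have "flag_coord C (SpFace (bar_space C) (Suc n) i (as, c)) p =
        (\<Sum>l\<le>k. of_bool (p \<in> cut_flag (Suc n) i as (flag C as xs l)) * u l)"
      unfolding x(1) SpFace_bar[OF x(2,4) assms(2)] flag_coord_rclass[OF sub]
      using flag_face[OF x(5,3) assms(2) x(4)] by (intro sum.cong) auto
    also have "\<dots> = cut_weight (Suc n) i as (flag_coord C (as, c)) p"
      unfolding x(1) flag_coord_rclass[OF x(4), THEN ext] by (auto simp: cut_flag_def cut_weight_def)
    finally show ?thesis .
  qed
  then show ?thesis by blast
qed

lemma flag_coord_degen:
  assumes "(as, c) \<in> topspace (SpTop (bar_space C) n)" "i \<le> n"
  shows "flag_coord C (SpDegen (bar_space C) n i (as, c)) = flag_coord C (as, c)"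
proof -
  from assms(1) obtain k xs u where x: "c = rclass (word_space C as) (k, xs, u)" "length as = Suc n" "length xs = n"
    "set as \<subseteq> Obj C" "typed_string (word_typed C k) as xs" "u \<in> standard_simplex k"
    by (auto elim: bar_pointE)
  have sub: "set (degen_objs i as) \<subseteq> Obj C" using set_degen_objs[of i as] x(2,4) assms(2) by simp
  have "flag_coord C (SpDegen (bar_space C) n i (as, c)) p = flag_coord C (as, c) p" for p
    unfolding x(1) SpDegen_bar[OF x(2,4) assms(2)] flag_coord_rclass[OF sub] flag_coord_rclass[OF x(4)]
    using flag_degen[OF x(5,3) assms(2) x(4)] by (intro sum.cong) auto
  then show ?thesis by blast
qed

lemma word_typed_arr_le: "typed_string (word_typed C k) as xs \<Longrightarrow> i < length xs \<Longrightarrow> arr_le C (as ! i) (as ! Suc i)"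
  using hom_arr_le by (auto simp: typed_string_def)

text \<open>The realized words along a string with \<open>\<alpha>\<^sub>i = \<alpha>\<^bsub>i+1\<^esub>\<close> contain an identity at this place, because a
  poset has no other endomorphisms. So the point is the \<open>i\<close>-th degeneracy of its \<open>i\<close>-th face; this is seen
  on flags.\<close>

lemma vertexed_bar: "vertexed_poset (bar_space C) bar_vertex (arr_le C)"
proof
  fix n i and x :: "('o, ('o, 'm) word) bar_point"
  { assume A: "x \<in> topspace (SpTop (bar_space C) (Suc n))" "i \<le> Suc n"
    then obtain as k xs u where x: "x = (as, rclass (word_space C as) (k, xs, u))" "length as = Suc (Suc n)" "length xs = Suc n"
      "set as \<subseteq> Obj C" "typed_string (word_typed C k) as xs" "u \<in> standard_simplex k"
      by (auto elim: bar_pointE)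
    show "SpFace (bar_space C) (Suc n) i x \<in> topspace (SpTop (bar_space C) n)"
      unfolding x(1) SpFace_bar[OF x(2,4) A(2)]
      using face_arrs_simplicial(2)[OF x(2,4) A(2) x(5)] set_face_objs[of i as] x A(2)
      by (intro bar_point_in) (auto simp: length_face_objs)
    show "bar_vertex (SpFace (bar_space C) (Suc n) i x) j = bar_vertex x (if j < i then j else Suc j)" if "j \<le> n" for j
      unfolding x(1) SpFace_bar[OF x(2,4) A(2)] using nth_face_objs[OF x(2) A(2) that] by simp
  }
  { assume A: "x \<in> topspace (SpTop (bar_space C) n)" "i \<le> n"
    then obtain as k xs u where x: "x = (as, rclass (word_space C as) (k, xs, u))" "length as = Suc n" "length xs = n"
      "set as \<subseteq> Obj C" "typed_string (word_typed C k) as xs" "u \<in> standard_simplex k"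
      by (auto elim: bar_pointE)
    show "SpDegen (bar_space C) n i x \<in> topspace (SpTop (bar_space C) (Suc n))"
      unfolding x(1) SpDegen_bar[OF x(2,4) A(2)]
      using degen_arrs_simplicial(2)[OF x(2,4) A(2) x(5)] set_degen_objs[of i as] x A(2)
      by (intro bar_point_in) (auto simp: length_degen_objs)
    show "bar_vertex (SpDegen (bar_space C) n i x) j = bar_vertex x (if j \<le> i then j else j - 1)" if "j \<le> Suc n" for j
      unfolding x(1) SpDegen_bar[OF x(2,4) A(2)] using nth_degen_objs[OF x(2) A(2) that] by simp
  }
  { assume A: "x \<in> topspace (SpTop (bar_space C) n)" "i < n"
    then show "arr_le C (bar_vertex x i) (bar_vertex x (Suc i))"
      using word_typed_arr_le by (elim bar_pointE) auto
  }
  { assume A: "x \<in> topspace (SpTop (bar_space C) (Suc n))" "i \<le> n" and eq: "bar_vertex x i = bar_vertex x (Suc i)"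
    then obtain as k xs u where x: "x = (as, rclass (word_space C as) (k, xs, u))" "length as = Suc (Suc n)" "length xs = Suc n"
      "set as \<subseteq> Obj C" "typed_string (word_typed C k) as xs" "u \<in> standard_simplex k"
      by (auto elim: bar_pointE)
    have i: "i \<le> Suc n" using A by simp
    let ?as = "face_objs i as"
    let ?xs = "face_arrs (Comp (free_pow (Suc k) C)) (Suc n) i xs"
    let ?ys = "degen_arrs (Idn (free_pow (Suc k) C) (?as ! i)) i ?xs"
    have as: "length ?as = Suc n" "set ?as \<subseteq> Obj C" using length_face_objs[OF x(2) i] set_face_objs[of i as] x(4) by auto
    have xs: "typed_string (word_typed C k) ?as ?xs" using face_arrs_simplicial(2)[OF x(2,4) i x(5)] .
    have len: "length ?xs = n" using xs as by (simp add: typed_string_def)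
    have d: "degen_objs i ?as = as"
    proof (rule nth_equalityI)
      show "degen_objs i ?as ! j = as ! j" if "j < length (degen_objs i ?as)" for j
      proof -
        have j: "j \<le> Suc n" using that as A(2) by (simp add: length_degen_objs)
        have "(if j \<le> i then j else j - 1) \<le> n" using j A(2) by auto
        then have "degen_objs i ?as ! j = as ! (if (if j \<le> i then j else j - 1) < i then (if j \<le> i then j else j - 1)
           else Suc (if j \<le> i then j else j - 1))"
          using nth_degen_objs[OF as(1) A(2) j] nth_face_objs[OF x(2) i, of "if j \<le> i then j else j - 1"] by simp
        then show ?thesis using eq x(1) by (cases j i rule: linorder_cases) auto
      qed
    qed (use as x(2) A(2) in \<open>simp add: length_degen_objs\<close>)
    have ys: "typed_string (word_typed C k) as ?ys"
      using degen_arrs_simplicial(2)[OF as A(2) xs] d by simp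
    have "?ys = xs"
    proof (rule flag_inject[OF ys x(5,4)])
      fix l assume l: "l \<le> k"
      have "flag C as ?ys l = cut_flag (Suc n) i as (flag C as xs l)"
        using flag_degen[OF xs len A(2) as(2), of l] flag_face[OF x(5,3) i x(4) l] d by simp
      also have "\<dots> = flag C as xs l"
      proof (cases "i = 0")
        case True
        have "hd as = as ! 1" using eq x(1,2) True by (cases as) auto
        then show ?thesis using True flag_chain[OF x(5,4), of l] by (auto simp: cut_flag_def chain_in_def)
      next
        case False
        then show ?thesis using A(2) by (simp add: cut_flag_def)
      qed
      finally show "flag C as ?ys l = flag C as xs l" .
    qed
    then have "x = SpDegen (bar_space C) n i (SpFace (bar_space C) (Suc n) i x)"
      unfolding x(1) SpFace_bar[OF x(2,4) i] SpDegen_bar[OF as A(2)] d by simp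
    moreover have "SpFace (bar_space C) (Suc n) i x \<in> topspace (SpTop (bar_space C) n)"
      unfolding x(1) SpFace_bar[OF x(2,4) i]
      by (rule bar_point_in[OF as xs x(6)])
    ultimately show "\<exists>y\<in>topspace (SpTop (bar_space C) n). x = SpDegen (bar_space C) n i y" by blast
  }
qed (use arr_le_trans arr_le_antisym in blast)+

lemma bar_le:
  assumes "x \<in> topspace (SpTop (bar_space C) n)" "i \<le> j" "j \<le> n"
  shows "arr_le C (bar_vertex x i) (bar_vertex x j)"
proof -
  interpret vertexed_poset "bar_space C" bar_vertex "arr_le C" by (rule vertexed_bar)
  have "bar_vertex x j \<in> Obj C" using assms by (elim bar_pointE) (auto simp: subset_iff)
  then show ?thesis using le_V_le[OF assms(1), of i j] assms arr_le_refl by (cases "i = j") auto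
qed

lemma flag_mono: "l \<le> l' \<Longrightarrow> flag C as xs l \<subseteq> flag C as xs l'"
  by (rule lift_Suc_mono_le[of "flag C as xs", OF flag_subset])

text \<open>The finest member of the flag serves as the chain. Objects with \<open>v > 0\<close> occur in the string and
  so in all members of the flag, whence \<open>w = 1\<close> there.\<close>

lemma weights_bar:
  assumes "length as = Suc n" "set as \<subseteq> Obj C" "typed_string (word_typed C k) as xs" "u' \<in> standard_simplex k" "u \<in> standard_simplex n"
  defines "a \<equiv> (n, (as, rclass (word_space C as) (k, xs, u')), u)"
  shows "weights (arr_less C) (flag C as xs k) (vertex_wt a) (flag_wt C a)" "chain_set C (flag C as xs k)"
proof -
  show ch: "chain_set C (flag C as xs k)" using chain_in_chain_set[OF flag_chain[OF assms(3,2)]] .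
  have u: "\<And>i. 0 \<le> u i" "sum u {..n} = 1" and u': "\<And>i. 0 \<le> u' i" "sum u' {..k} = 1"
    using assms by (auto simp: standard_simplex_iff)
  have w: "flag_wt C a p = (\<Sum>l\<le>k. of_bool (p \<in> flag C as xs l) * u' l)" for p
    by (simp add: a_def flag_wt_eq flag_coord_rclass assms(2))
  have v: "vertex_wt a p = (\<Sum>i\<le>n. of_bool (as ! i = p) * u i)" for p
    by (simp add: a_def vertex_wt_eq)
  have asf: "as ! i \<in> flag C as xs l" if "i \<le> n" for i l
    using that assms(1) by (auto simp: flag_def)
  show "weights (arr_less C) (flag C as xs k) (vertex_wt a) (flag_wt C a)"
  proof
    show "flag_wt C a p \<le> 1" for p
      unfolding w u'(2)[symmetric] using u'(1) by (intro sum_mono) auto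
    show "flag_wt C a p = 1" if "0 < vertex_wt a p" for p
    proof -
      have "\<exists>i\<in>{..n}. of_bool (as ! i = p) * u i \<noteq> 0"
        using that sum.neutral[of "{..n}" "\<lambda>i. of_bool (as ! i = p) * u i"] unfolding v by fastforce
      then obtain i where "i \<le> n" "as ! i = p" by auto
      then have "p \<in> flag C as xs l" for l using asf by blast
      then show ?thesis unfolding w using u'(2) by simp
    qed
    show "flag_wt C a p = 0" if "p \<notin> flag C as xs k" for p
      unfolding w using flag_mono[of _ k as xs] that by (intro sum.neutral) auto
    show "sum (vertex_wt a) (flag C as xs k) = 1"
      using sum_positions[of n as "flag C as xs k" u] asf ch u(2) unfolding v[THEN ext] chain_set_def by simp
  qed (use chain_set_finite_chain[OF ch] u u' in \<open>auto simp: v w intro!: sum_nonneg\<close>)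
qed

text \<open>Only outer faces change \<open>w\<close>. They are glued along points whose first (or last) coordinate is
  \<open>0\<close>, so \<open>v\<close> lives on the shorter string and the two cutting lemmas apply.\<close>

lemma comb_wt_glue:
  assumes "glue (bar_space C) a b" and convex: "convex_fibres C \<kappa>"
  shows "comb_wt C \<kappa> a = comb_wt C \<kappa> b"
proof -
  interpret V: vertexed_poset "bar_space C" bar_vertex "arr_le C" by (rule vertexed_bar)
  have v: "vertex_wt a = vertex_wt b" unfolding vertex_wt_def using V.vertex_sum_glue[OF assms(1)] by blast
  show ?thesis
    using assms(1)
  proof cases
    case (face x n u i)
    obtain as k xs u' where x: "x = (as, rclass (word_space C as) (k, xs, u'))" "length as = Suc (Suc n)" "length xs = Suc n"
      "set as \<subseteq> Obj C" "typed_string (word_typed C k) as xs" "u' \<in> standard_simplex k"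
      using face(3) by (rule bar_pointE)
    have us: "simplical_face i u \<in> standard_simplex (Suc n)"
      using face by (intro simplical_face_in_standard_simplex) auto
    let ?T = "flag C as xs k"
    have W: "weights (arr_less C) ?T (vertex_wt b) (flag_wt C b)" and ch: "chain_set C ?T"
      unfolding face x(1) using weights_bar[OF x(2,4,5,6) us] by auto
    have w: "flag_wt C a = cut_weight (Suc n) i as (flag_wt C b)"
      using flag_coord_face[of as "rclass (word_space C as) (k, xs, u')" n i] face x(1) by (simp add: flag_wt_eq)
    have asT: "as ! j \<in> ?T" if "j \<le> Suc n" for j using that x(2) by (auto simp: flag_def)
    have asO: "as ! j \<in> Obj C" if "j \<le> Suc n" for j using that x(2,4) by (auto simp: subset_iff)
    have hl: "(q = p \<or> arr_less C q p) \<longleftrightarrow> arr_le C q p" if "q \<in> Obj C \<or> p \<in> Obj C" for p q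
      using that arr_le_refl by (auto simp: arr_less_def)
    have le: "arr_le C (as ! j) (as ! j')" if "j \<le> j'" "j' \<le> Suc n" for j j'
      using bar_le[OF face(3) that] x(1) by simp
    have supp: "\<exists>j\<le>n. as ! (if j < i then j else Suc j) = e" if "0 < vertex_wt b e" for e
    proof -
      have "0 < (\<Sum>j\<le>n. of_bool (face_objs i as ! j = e) * u j)"
      proof -
        have "0 < vertex_wt a e" using that v by simp
        then show ?thesis unfolding face(1) x(1) SpFace_bar[OF x(2,4) face(5)] vertex_wt_eq .
      qed
      then have "\<exists>j\<in>{..n}. of_bool (face_objs i as ! j = e) * u j \<noteq> 0"
        using sum.neutral[of "{..n}" "\<lambda>j. of_bool (face_objs i as ! j = e) * u j"] by fastforce
      then obtain j where "j \<le> n" "face_objs i as ! j = e" by auto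
      then show ?thesis using nth_face_objs[OF x(2) face(5)] by auto
    qed
    consider "i = 0" | "i = Suc n" "i \<noteq> 0" | "i \<noteq> 0" "i \<noteq> Suc n" by blast
    then have "weight \<kappa> (arr_less C) (vertex_wt b) (flag_wt C a) p = weight \<kappa> (arr_less C) (vertex_wt b) (flag_wt C b) p" for p
    proof cases
      case 1
      show ?thesis
      proof (rule weights.weight_cut_lower[OF W, where a = "as ! 1"])
        show "e = as ! 1 \<or> arr_less C (as ! 1) e" if "0 < vertex_wt b e" for e
          using supp[OF that] le[of 1] hl[of "as ! 1" e] asO[of 1] 1 by auto
        show "\<kappa> y = \<kappa> x" if "arr_less C x y" "arr_less C y z" "\<kappa> x = \<kappa> z" for x y z
          using convex that unfolding convex_fibres_def arr_less_def by blast
        show "flag_wt C a c = (if c = as ! 1 \<or> arr_less C (as ! 1) c then flag_wt C b c else 0)" for c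
          using hl[of "as ! 1" c] asO[of 1] 1 unfolding w by (auto simp: cut_weight_def)
      qed (use asT in auto)
    next
      case 2
      show ?thesis
      proof (rule weights.weight_cut_upper[OF W, where b = "as ! n"])
        show "e = as ! n \<or> arr_less C e (as ! n)" if "0 < vertex_wt b e" for e
          using supp[OF that] le[of _ n] hl[of e "as ! n"] asO[of n] 2 by auto
        show "flag_wt C a c = (if c = as ! n \<or> arr_less C c (as ! n) then flag_wt C b c else 0)" for c
          using hl[of c "as ! n"] asO[of n] 2 unfolding w by (auto simp: cut_weight_def)
      qed (use asT in auto)
    next
      case 3
      then have "flag_wt C a = flag_wt C b" unfolding w by (auto simp: cut_weight_def)
      then show ?thesis by simp
    qed
    then show ?thesis unfolding comb_wt_def v by blast
  next
    case (degen x n u i)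
    obtain as c where x: "x = (as, c)" by (cases x)
    have "flag_wt C a = flag_wt C b"
      using flag_coord_degen[of as c n i] degen x by (simp add: flag_wt_eq)
    then show ?thesis unfolding comb_wt_def v by simp
  qed
qed

lemma comb_wt_equivclp:
  assumes "equivclp (glue (bar_space C)) a b" "convex_fibres C \<kappa>"
  shows "comb_wt C \<kappa> a = comb_wt C \<kappa> b"
  using assms(1)
proof (induction rule: equivclp_induct)
  case (step y z)
  then show ?case using comb_wt_glue assms(2) by metis
qed simp

lemma comparison_rclass:
  assumes "convex_fibres C \<kappa>"
  shows "comparison C \<kappa> (rclass (bar_space C) a) = bary_point C (comb_bary C \<kappa> a)"
proof -
  have "(SOME b. b \<in> rclass (bar_space C) a) \<in> rclass (bar_space C) a"
    using rclass_self by (rule someI)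
  then have "equivclp (glue (bar_space C)) a (SOME b. b \<in> rclass (bar_space C) a)"
    by (simp add: rclass_def)
  from comb_wt_equivclp[OF this assms] show ?thesis by (simp add: comparison_def comb_bary_def[THEN ext])
qed

lemma comb_bary_eq:
  assumes W: "weights (arr_less C) T (vertex_wt a) (flag_wt C a)"
  shows "comb_bary C \<kappa> a p = comb_wt C \<kappa> a p / sum (comb_wt C \<kappa> a) T" "comb_bary C \<kappa> a \<in> Delta T"
proof -
  interpret weights "arr_less C" T "vertex_wt a" "flag_wt C a" by (rule W)
  have "sum (comb_wt C \<kappa> a) {p. comb_wt C \<kappa> a p \<noteq> 0} = sum (comb_wt C \<kappa> a) T"
    using fin weight_T[of _ \<kappa>] by (intro sum.mono_neutral_left) (auto simp: comb_wt_def)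
  then show *: "comb_bary C \<kappa> a p = comb_wt C \<kappa> a p / sum (comb_wt C \<kappa> a) T" for p
    by (simp add: comb_bary_def)
  have "1 \<le> sum (comb_wt C \<kappa> a) T" using sum_weight[of \<kappa>] by (simp add: comb_wt_def)
  moreover have "0 \<le> comb_wt C \<kappa> a p" for p using weight_nonneg[of \<kappa> p] by (simp add: comb_wt_def)
  moreover have "p \<notin> T \<Longrightarrow> comb_wt C \<kappa> a p = 0" for p using weight_T[of p \<kappa>] by (simp add: comb_wt_def)
  ultimately show "comb_bary C \<kappa> a \<in> Delta T"
    unfolding Delta_def * by (auto simp flip: sum_divide_distrib)
qed

section \<open>Continuity through cells\<close>

text \<open>The point with coordinates \<open>u'\<close> in the direction of the resolution and \<open>u\<close> in the bar direction.\<close>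

definition bar_cell :: "'o list \<Rightarrow> nat \<Rightarrow> ('o, 'm) word list \<Rightarrow> (nat \<Rightarrow> real) \<times> (nat \<Rightarrow> real) \<Rightarrow>
    ('o, ('o, 'm) word) bar_point rpoint" where
  "bar_cell as k xs = (\<lambda>(u', u). (length as - 1, (as, rclass (word_space C as) (k, xs, u')), u))"

definition is_bar_cell :: "'o list \<Rightarrow> nat \<Rightarrow> ('o, 'm) word list \<Rightarrow> bool" where
  "is_bar_cell as k xs \<longleftrightarrow> set as \<subseteq> Obj C \<and> typed_string (word_typed C k) as xs"

abbreviation bar_cell_topology :: "'o list \<Rightarrow> nat \<Rightarrow> ((nat \<Rightarrow> real) \<times> (nat \<Rightarrow> real)) topology" where
  "bar_cell_topology as k \<equiv> prod_topology (simplex_topology k) (simplex_topology (length as - 1))"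

lemma is_bar_cell_length: "is_bar_cell as k xs \<Longrightarrow> length as = Suc (length as - 1)"
  by (simp add: is_bar_cell_def typed_string_def)

lemma continuous_bar_cell:
  assumes "is_bar_cell as k xs"
  shows "continuous_map (bar_cell_topology as k) (bar_real C) (\<lambda>p. rclass (bar_space C) (bar_cell as k xs p))"
proof -
  let ?n = "length as - 1"
  have s: "xs \<in> Simp (chain_sset (resolution C) as) k" using assms by (simp add: is_bar_cell_def Simp_chain_sset)
  have "continuous_map (simplex_topology k) (prod_topology (SpTop (word_space C as) k) (simplex_topology k)) (\<lambda>u. (xs, u))"
    using s by (auto simp: continuous_map_paired SpTop_discrete_sspace)
  from continuous_map_compose[OF this continuous_map_rclass]
  have 1: "continuous_map (simplex_topology k) (realization (word_space C as)) (\<lambda>u. rclass (word_space C as) (k, xs, u))"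
    by (simp add: o_def)
  have "as \<in> {as. length as = Suc ?n \<and> set as \<subseteq> EObj (resolution C)}"
    using assms is_bar_cell_length[OF assms] by (auto simp: is_bar_cell_def resolution_def)
  then have "continuous_map (realization (word_space C as)) (SpTop (bar_space C) ?n) (Pair as)"
    unfolding bar_def sspace.select_convs
    using continuous_map_component_injection[of as _ "\<lambda>as. realization (word_space C as)"] by auto
  from continuous_map_compose[OF 1 this]
  have 2: "continuous_map (simplex_topology k) (SpTop (bar_space C) ?n) (\<lambda>u. (as, rclass (word_space C as) (k, xs, u)))"
    by (simp add: o_def)
  have "continuous_map (bar_cell_topology as k) (prod_topology (SpTop (bar_space C) ?n) (simplex_topology ?n))
     (\<lambda>p. ((as, rclass (word_space C as) (k, xs, fst p)), snd p))"
    unfolding continuous_map_paired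
    using continuous_map_compose[OF continuous_map_fst 2] by (auto simp: o_def continuous_map_snd)
  from continuous_map_compose[OF this continuous_map_rclass]
  show ?thesis by (simp add: o_def bar_cell_def case_prod_unfold)
qed

text \<open>Two quotient maps are peeled off: that of the bar direction, and that of the resolution times
  the simplex of the bar direction.\<close>

lemma continuous_from_bar_real:
  assumes *: "\<And>as k xs. is_bar_cell as k xs \<Longrightarrow>
     continuous_map (bar_cell_topology as k) Y (\<lambda>p. g (rclass (bar_space C) (bar_cell as k xs p)))"
  shows "continuous_map (bar_real C) Y g"
proof (rule continuous_map_from_realization)
  fix n
  have lc: "locally_compact_space (simplex_topology n)" "Hausdorff_space (simplex_topology n)"
    using compact_space_simplex Hausdorff_space_simplex compact_imp_locally_compact_space by auto
  show "continuous_map (prod_topology (SpTop (bar_space C) n) (simplex_topology n)) Y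
        (\<lambda>(x, u). g (rclass (bar_space C) (n, x, u)))"
    unfolding bar_def[of "resolution C", unfolded sspace.defs] sspace.select_convs
    unfolding bar_def[of "resolution C", unfolded sspace.defs, symmetric]
  proof (rule continuous_map_from_sum_prod)
    fix as assume "as \<in> {as. length as = Suc n \<and> set as \<subseteq> EObj (resolution C)}"
    then have as: "length as = Suc n" "set as \<subseteq> Obj C" by (auto simp: resolution_def)
    have "continuous_map (prod_topology (realization (word_space C as)) (simplex_topology n)) Y
         (\<lambda>p. g (rclass (bar_space C) (n, (as, fst p), snd p)))"
    proof (rule continuous_map_from_discrete_realization_prod[OF lc])
      fix k xs assume "xs \<in> Simp (chain_sset (resolution C) as) k"
      then have "is_bar_cell as k xs" using as by (simp add: is_bar_cell_def Simp_chain_sset)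
      from *[OF this] as show "continuous_map (prod_topology (simplex_topology k) (simplex_topology n)) Y
          (\<lambda>(u, z). g (rclass (bar_space C) (n, (as, fst (rclass (word_space C as) (k, xs, u), z)), snd (rclass (word_space C as) (k, xs, u), z))))"
        by (simp add: bar_cell_def case_prod_unfold)
    qed
    then show "continuous_map (prod_topology (realization (word_space C as)) (simplex_topology n)) Y
         (\<lambda>(x, z). case ((as, x), z) of (x, u) \<Rightarrow> g (rclass (bar_space C) (n, x, u)))"
      by (simp add: case_prod_unfold)
  qed
qed simp

lemma topspace_bar_real:
  "topspace (bar_real C) = {rclass (bar_space C) (bar_cell as k xs (u', u)) | as k xs u' u.
     is_bar_cell as k xs \<and> u' \<in> standard_simplex k \<and> u \<in> standard_simplex (length as - 1)}"
    (is "?L = ?R")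
proof (intro equalityI subsetI)
  fix c assume "c \<in> ?L"
  then obtain n x u where c: "c = rclass (bar_space C) (n, x, u)" "x \<in> topspace (SpTop (bar_space C) n)" "u \<in> standard_simplex n"
    by (subst (asm) topspace_realization, simp) (auto simp: valid_point_def)
  from c(2) obtain as k xs u' where "x = (as, rclass (word_space C as) (k, xs, u'))" "length as = Suc n" "length xs = n"
      "set as \<subseteq> Obj C" "typed_string (word_typed C k) as xs" "u' \<in> standard_simplex k" by (rule bar_pointE)
  then have "c = rclass (bar_space C) (bar_cell as k xs (u', u))" "is_bar_cell as k xs" "u' \<in> standard_simplex k"
    "u \<in> standard_simplex (length as - 1)"
    using c by (auto simp: bar_cell_def is_bar_cell_def)
  then show "c \<in> ?R" by blast
next
  fix c assume "c \<in> ?R"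
  then obtain as k xs u' u where c: "c = rclass (bar_space C) (bar_cell as k xs (u', u))" "is_bar_cell as k xs"
    "u' \<in> standard_simplex k" "u \<in> standard_simplex (length as - 1)" by blast
  then show "c \<in> ?L"
    using continuous_map_funspace[OF continuous_bar_cell[OF c(2)]] by (auto simp: Pi_iff)
qed

lemma weights_bar_cell:
  assumes "is_bar_cell as k xs" "u' \<in> standard_simplex k" "u \<in> standard_simplex (length as - 1)"
  shows "weights (arr_less C) (flag C as xs k) (vertex_wt (bar_cell as k xs (u', u))) (flag_wt C (bar_cell as k xs (u', u)))"
    "chain_set C (flag C as xs k)"
  using weights_bar[OF is_bar_cell_length[OF assms(1)] _ _ assms(2,3), where xs = xs] assms(1)
  by (auto simp: is_bar_cell_def bar_cell_def)

lemma continuous_map_max0: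
  assumes "finite A" "\<And>e. e \<in> A \<Longrightarrow> continuous_map X euclideanreal (\<lambda>x. f x e)"
  shows "continuous_map X euclideanreal (\<lambda>x. max0 (f x) A)"
  using assms by (induction A rule: finite_induct) (auto simp: max0_insert intro!: continuous_map_real_max)

text \<open>On a cell, \<open>v\<close> and \<open>w\<close> are linear in the two sets of coordinates, and the combined weight is made of
  finitely many sums, products, minima and maxima; its total is at least \<open>1\<close>, so normalising is
  harmless.\<close>

lemma continuous_comb_bary_cell:
  assumes "is_bar_cell as k xs"
  shows "continuous_map (bar_cell_topology as k) (Delta_topology (flag C as xs k)) (\<lambda>p. comb_bary C \<kappa> (bar_cell as k xs p))"
proof -
  let ?T = "flag C as xs k" and ?X = "bar_cell_topology as k"
  have W: "weights (arr_less C) ?T (vertex_wt (bar_cell as k xs p)) (flag_wt C (bar_cell as k xs p))" if "p \<in> topspace ?X" for p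
    using weights_bar_cell(1)[OF assms] that by (cases p) auto
  have as: "set as \<subseteq> Obj C" using assms by (simp add: is_bar_cell_def)
  have fin: "finite ?T" using flag_chain[of k as xs k] assms by (auto simp: is_bar_cell_def chain_in_def)
  have f: "continuous_map ?X euclideanreal (\<lambda>p. fst p i)" "continuous_map ?X euclideanreal (\<lambda>p. snd p i)" for i
    using continuous_map_compose[OF continuous_map_fst continuous_map_coordinate]
      continuous_map_compose[OF continuous_map_snd continuous_map_coordinate] by (auto simp: o_def)
  have v: "continuous_map ?X euclideanreal (\<lambda>p. vertex_wt (bar_cell as k xs p) e)" for e
    unfolding bar_cell_def case_prod_unfold vertex_wt_eq by (intro continuous_map_sum continuous_map_real_mult f) auto
  have w: "continuous_map ?X euclideanreal (\<lambda>p. flag_wt C (bar_cell as k xs p) e)" for e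
    unfolding bar_cell_def case_prod_unfold flag_wt_eq flag_coord_rclass[OF as]
    by (intro continuous_map_sum continuous_map_real_mult f) auto
  have z: "continuous_map ?X euclideanreal (\<lambda>p. comb_wt C \<kappa> (bar_cell as k xs p) e)" for e
  proof (rule continuous_map_eq)
    show "continuous_map ?X euclideanreal (\<lambda>p. vertex_wt (bar_cell as k xs p) e +
      max 0 (flag_wt C (bar_cell as k xs p) e - max0 (flag_wt C (bar_cell as k xs p)) {d \<in> ?T. arr_less C d e \<and> \<kappa> d = \<kappa> e}) *
      min (sum (vertex_wt (bar_cell as k xs p)) {d \<in> ?T. arr_less C d e \<and> \<kappa> d \<noteq> \<kappa> e})
          (sum (vertex_wt (bar_cell as k xs p)) {d \<in> ?T. arr_less C e d \<and> \<kappa> d \<noteq> \<kappa> e}))"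
      using fin by (intro continuous_map_add continuous_map_real_mult continuous_map_real_max continuous_map_real_min
        continuous_map_diff continuous_map_max0 continuous_map_sum v w) auto
    fix p assume "p \<in> topspace ?X"
    then interpret weights "arr_less C" ?T "vertex_wt (bar_cell as k xs p)" "flag_wt C (bar_cell as k xs p)" by (rule W)
    show "vertex_wt (bar_cell as k xs p) e +
      max 0 (flag_wt C (bar_cell as k xs p) e - max0 (flag_wt C (bar_cell as k xs p)) {d \<in> ?T. arr_less C d e \<and> \<kappa> d = \<kappa> e}) *
      min (sum (vertex_wt (bar_cell as k xs p)) {d \<in> ?T. arr_less C d e \<and> \<kappa> d \<noteq> \<kappa> e})
          (sum (vertex_wt (bar_cell as k xs p)) {d \<in> ?T. arr_less C e d \<and> \<kappa> d \<noteq> \<kappa> e}) = comb_wt C \<kappa> (bar_cell as k xs p) e"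
      by (simp add: comb_wt_def weight_def share_eq below_eq above_eq)
  qed
  have "continuous_map ?X euclideanreal (\<lambda>p. comb_bary C \<kappa> (bar_cell as k xs p) e)" for e
  proof (rule continuous_map_eq)
    show "continuous_map ?X euclideanreal (\<lambda>p. comb_wt C \<kappa> (bar_cell as k xs p) e / sum (comb_wt C \<kappa> (bar_cell as k xs p)) ?T)"
    proof (intro continuous_map_real_divide z continuous_map_sum)
      fix p assume "p \<in> topspace ?X"
      then interpret weights "arr_less C" ?T "vertex_wt (bar_cell as k xs p)" "flag_wt C (bar_cell as k xs p)" by (rule W)
      show "sum (comb_wt C \<kappa> (bar_cell as k xs p)) ?T \<noteq> 0"
        using sum_weight[of \<kappa>] by (simp add: comb_wt_def)
    qed (use fin in auto)
  qed (use comb_bary_eq(1)[OF W] in auto)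
  then show ?thesis
    unfolding continuous_map_powertop_sub using comb_bary_eq(2)[OF W] by blast
qed

lemma continuous_comparison:
  assumes "convex_fibres C \<kappa>"
  shows "continuous_map (bar_real C) (nerve_real C) (comparison C \<kappa>)"
proof (rule continuous_from_bar_real)
  fix as k xs assume c: "is_bar_cell as k xs"
  have ch: "chain_set C (flag C as xs k)"
    using c chain_in_chain_set[OF flag_chain] by (auto simp: is_bar_cell_def)
  show "continuous_map (bar_cell_topology as k) (nerve_real C) (\<lambda>p. comparison C \<kappa> (rclass (bar_space C) (bar_cell as k xs p)))"
    using continuous_map_compose[OF continuous_comb_bary_cell[OF c] continuous_bary_point[OF ch]]
    by (simp add: comparison_rclass[OF assms] o_def)
qed

end

context poset_cat
begin

lemma convex_id: "convex_fibres C id"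
  unfolding convex_fibres_def using arr_le_antisym by auto

lemma bar_cell_in: "is_bar_cell as k xs \<Longrightarrow> u' \<in> standard_simplex k \<Longrightarrow> u \<in> standard_simplex (length as - 1) \<Longrightarrow>
    rclass (bar_space C) (bar_cell as k xs (u', u)) \<in> topspace (bar_real C)"
  unfolding topspace_bar_real by blast

lemma comparison_in: "convex_fibres C \<kappa> \<Longrightarrow> c \<in> topspace (bar_real C) \<Longrightarrow> comparison C \<kappa> c \<in> topspace (nerve_real C)"
  using continuous_map_funspace[OF continuous_comparison] by blast

lemma bary_comparison:
  assumes "convex_fibres C \<kappa>" "is_bar_cell as k xs" "u' \<in> standard_simplex k" "u \<in> standard_simplex (length as - 1)"
  shows "bary (comparison C \<kappa> (rclass (bar_space C) (bar_cell as k xs (u', u)))) = comb_bary C \<kappa> (bar_cell as k xs (u', u))"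
  unfolding comparison_rclass[OF assms(1)]
  by (rule bary_point(2)[OF weights_bar_cell(2)[OF assms(2-4)] comb_bary_eq(2)[OF weights_bar_cell(1)[OF assms(2-4)]]])

text \<open>For a reduced point the first and the last object of the string carry mass, and \<open>w\<close> is
  supported between them.\<close>

lemma reduced_hull:
  assumes "vertexed_poset.reduced (bar_space C) bar_vertex (n, x, u)"
  shows "\<exists>T. weights (arr_less C) T (vertex_wt (n, x, u)) (flag_wt C (n, x, u))"
    and "0 < flag_wt C (n, x, u) p \<Longrightarrow> (\<exists>e. 0 < vertex_wt (n, x, u) e \<and> (e = p \<or> arr_less C e p)) \<and>
       (\<exists>e. 0 < vertex_wt (n, x, u) e \<and> (e = p \<or> arr_less C p e))"
proof -
  interpret V: vertexed_poset "bar_space C" bar_vertex "arr_le C" by (rule vertexed_bar)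
  have r: "x \<in> topspace (SpTop (bar_space C) n)" "u \<in> standard_simplex n" "\<forall>i\<le>n. 0 < u i"
    using assms by (auto simp: V.reduced_def)
  from r(1) obtain as k xs u' where x: "x = (as, rclass (word_space C as) (k, xs, u'))" "length as = Suc n" "length xs = n"
    "set as \<subseteq> Obj C" "typed_string (word_typed C k) as xs" "u' \<in> standard_simplex k" by (rule bar_pointE)
  have W: "weights (arr_less C) (flag C as xs k) (vertex_wt (n, x, u)) (flag_wt C (n, x, u))"
    unfolding x(1) by (rule weights_bar(1)[OF x(2,4,5,6) r(2)])
  interpret weights "arr_less C" "flag C as xs k" "vertex_wt (n, x, u)" "flag_wt C (n, x, u)" by (rule W)
  have v: "0 < vertex_wt (n, x, u) (as ! i)" if "i \<le> n" for i
    using V.vertex_sum_reduced[OF assms that] r(3) that x(1) by (simp add: vertex_wt_def)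
  have "as \<noteq> []" using x(2) by auto
  from hd_conv_nth[OF this] last_conv_nth[OF this] have hd: "hd as = as ! 0" "last as = as ! n" using x(2) by simp_all
  show "\<exists>T. weights (arr_less C) T (vertex_wt (n, x, u)) (flag_wt C (n, x, u))" using W by (rule exI)
  show "(\<exists>e. 0 < vertex_wt (n, x, u) e \<and> (e = p \<or> arr_less C e p)) \<and> (\<exists>e. 0 < vertex_wt (n, x, u) e \<and> (e = p \<or> arr_less C p e))"
    if "0 < flag_wt C (n, x, u) p"
  proof -
    from that have "p \<in> flag C as xs k" using w_T[of p] by fastforce
    then have "arr_le C (as ! 0) p \<and> arr_le C p (as ! n)"
      using flag_chain[OF x(5,4), of k] unfolding chain_in_def hd by blast
    then show "(\<exists>e. 0 < vertex_wt (n, x, u) e \<and> (e = p \<or> arr_less C e p)) \<and>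
       (\<exists>e. 0 < vertex_wt (n, x, u) e \<and> (e = p \<or> arr_less C p e))"
      using v[of 0] v[of n] unfolding arr_less_def by blast
  qed
qed

text \<open>For reduced representatives \<open>weights_unique\<close> recovers \<open>v\<close> and \<open>w\<close> from the image. Then \<open>v\<close> gives
  the string and the bar coordinates, and \<open>w\<close> the point in the realized space of words.\<close>

lemma inj_on_comparison_id: "inj_on (comparison C id) (topspace (bar_real C))"
proof (rule inj_onI)
  interpret V: vertexed_poset "bar_space C" bar_vertex "arr_le C" by (rule vertexed_bar)
  fix c c' assume c: "c \<in> topspace (bar_real C)" "c' \<in> topspace (bar_real C)" and eq: "comparison C id c = comparison C id c'"
  have red: "\<exists>n x u. V.reduced (n, x, u) \<and> c = rclass (bar_space C) (n, x, u)" if c: "c \<in> topspace (bar_real C)" for c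
  proof -
    obtain a where "valid_point (bar_space C) a" "c = rclass (bar_space C) a"
      using c by (subst (asm) topspace_realization, simp) auto
    then show ?thesis using V.exists_reduced[of a] by (metis prod_cases3)
  qed
  obtain n x u where a: "V.reduced (n, x, u)" "c = rclass (bar_space C) (n, x, u)" using red[OF c(1)] by blast
  obtain m y v where b: "V.reduced (m, y, v)" "c' = rclass (bar_space C) (m, y, v)" using red[OF c(2)] by blast
  let ?a = "(n, x, u)" and ?b = "(m, y, v)"
  obtain T where T: "weights (arr_less C) T (vertex_wt ?a) (flag_wt C ?a)" using reduced_hull(1)[OF a(1)] by (elim exE)
  obtain T' where T': "weights (arr_less C) T' (vertex_wt ?b) (flag_wt C ?b)" using reduced_hull(1)[OF b(1)] by (elim exE)
  interpret W: weights "arr_less C" T "vertex_wt ?a" "flag_wt C ?a" by (rule T)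
  interpret W': weights "arr_less C" T' "vertex_wt ?b" "flag_wt C ?b" by (rule T')
  have coord: "bary (comparison C id (rclass (bar_space C) a)) = comb_bary C id a"
    if W: "weights (arr_less C) T (vertex_wt a) (flag_wt C a)" and "a = (n, x, u)" "V.reduced a" for T a n x u
  proof -
    have r: "x \<in> topspace (SpTop (bar_space C) n)" "u \<in> standard_simplex n" using that by (auto simp: V.reduced_def)
    from r(1) obtain as k xs u' where xx: "x = (as, rclass (word_space C as) (k, xs, u'))" "length as = Suc n" "length xs = n"
      "set as \<subseteq> Obj C" "typed_string (word_typed C k) as xs" "u' \<in> standard_simplex k" by (rule bar_pointE)
    have "a = bar_cell as k xs (u', u)" using that xx by (simp add: bar_cell_def)
    then show ?thesis using bary_comparison[OF convex_id, of as k xs u' u] xx r by (simp add: is_bar_cell_def)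
  qed
  have z: "comb_bary C id ?a p = comb_bary C id ?b p" for p
    using coord[OF T refl a(1)] coord[OF T' refl b(1)] a(2) b(2) eq by metis
  define N where "N = sum (comb_wt C id ?a) T"
  define N' where "N' = sum (comb_wt C id ?b) T'"
  have N: "0 < N" "0 < N'" using W.sum_weight[of id] W'.sum_weight[of id] by (auto simp: N_def N'_def comb_wt_def)
  have zz: "comb_wt C id ?a p = (N / N') * comb_wt C id ?b p" for p
    using z[of p] N unfolding comb_bary_eq(1)[OF T] comb_bary_eq(1)[OF T'] N_def[symmetric] N'_def[symmetric]
    by (simp add: field_simps)
  have k: "0 < N / N'" using N by simp
  have eqs: "vertex_wt ?a = vertex_wt ?b" "flag_wt C ?a = flag_wt C ?b"
    by (rule weights_unique[OF T T' k reduced_hull(2)[OF a(1)] reduced_hull(2)[OF b(1)]]; use zz in \<open>simp add: comb_wt_def\<close>)+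
  have vs: "vertex_sum bar_vertex (\<lambda>q. of_bool (q = p)) ?a = vertex_sum bar_vertex (\<lambda>q. of_bool (q = p)) ?b" for p
    using fun_cong[OF eqs(1), of p] by (simp add: vertex_wt_def)
  note u = V.reduced_unique[OF a(1) b(1) vs]
  obtain as d bs e where x: "x = (as, d)" "y = (bs, e)" by (cases x; cases y)
  have pts: "(as, d) \<in> topspace (SpTop (bar_space C) n)" "(bs, e) \<in> topspace (SpTop (bar_space C) m)"
    using a(1) b(1) x by (auto simp: V.reduced_def)
  have as: "as = bs"
    using u(1) u(2) pts x by (intro nth_equalityI) (auto simp: bar_points)
  have "d = e"
    by (rule flag_coord_inject[of as]) (use pts as fun_cong[OF eqs(2)] x in \<open>auto simp: bar_points flag_wt_eq\<close>)
  then show "c = c'" using a(2) b(2) u(1,3) x as by simp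
qed

lemma Delta_mono: "finite T \<Longrightarrow> S \<subseteq> T \<Longrightarrow> Delta S \<subseteq> Delta T"
  unfolding Delta_def using sum.mono_neutral_left[of T S] by (auto simp: subset_iff)

text \<open>Solve for \<open>v\<close> and \<open>w\<close> on the support of \<open>z\<close>; the objects with mass form the string, the layers of
  \<open>w\<close> a flag, and a flag comes from words by \<open>flag_exists\<close>. The bounds on the lengths leave only
  finitely many cells for a given \<open>T\<close>.\<close>

lemma cover:
  assumes T: "chain_set C T" and z: "z \<in> Delta T"
  obtains as k xs u' u where "is_bar_cell as k xs" "u' \<in> standard_simplex k" "u \<in> standard_simplex (length as - 1)"
    "flag C as xs k \<subseteq> T" "length as \<le> card T" "k \<le> card T" "comb_bary C id (bar_cell as k xs (u', u)) = z"
proof -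
  define T0 where "T0 = {p. 0 < z p}"
  have T0: "T0 \<subseteq> T" using z by (force simp: T0_def Delta_def)
  have finT: "finite T" using T by (simp add: chain_set_def)
  have cT0: "chain_set C T0" using chain_set_subset[OF T T0] .
  have z0: "z p = 0" if "p \<notin> T0" for p using z that by (force simp: T0_def Delta_def intro: antisym)
  have sz: "sum z T0 = 1" using z sum.mono_neutral_left[OF finT T0, of z] z0 by (auto simp: Delta_def)
  then have ne: "T0 \<noteq> {}" by auto
  obtain v w K where W: "weights (arr_less C) T0 v w" "0 < K" "\<And>c. c \<in> T0 \<Longrightarrow> weight id (arr_less C) v w c = K * z c"
    "\<And>c. c \<in> T0 \<Longrightarrow> 0 < w c"
    "\<And>c. c \<in> T0 \<Longrightarrow> (\<exists>e\<in>T0. 0 < v e \<and> (e = c \<or> arr_less C e c)) \<and> (\<exists>e\<in>T0. 0 < v e \<and> (e = c \<or> arr_less C c e))"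
    by (rule weights_exist[OF chain_set_finite_chain[OF cT0] ne, of z]) (auto simp: T0_def)
  interpret weights "arr_less C" T0 v w by (rule W(1))
  define D where "D = {p \<in> T0. 0 < v p}"
  have D: "D \<noteq> {}" using W(5) ne by (auto simp: D_def)
  have cD: "chain_set C D" using chain_set_subset[OF cT0] by (auto simp: D_def)
  obtain as where as: "set as = D" "sorted_wrt (arr_less C) as" "distinct as"
    using finite_chain_list[OF chain_set_finite_chain[OF cD]] by blast
  have asne: "as \<noteq> []" using as D by auto
  define n where "n = length as - 1"
  have len: "length as = Suc n" using asne by (cases as) (auto simp: n_def)
  define u where "u i = (if i \<le> n then v (as ! i) else 0)" for i
  have asO: "set as \<subseteq> Obj C" using as cD by (simp add: chain_set_def)
  have im: "(!) as ` {..n} = D" using as(1) len by (auto simp: set_conv_nth less_Suc_eq_le image_def)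
  have vD: "v p = 0" if "p \<notin> D" for p using v_T[of p] v_nonneg[of p] that by (auto simp: D_def less_le)
  have "sum v D = sum v T0"
    using vD by (intro sum.mono_neutral_left[OF fin]) (auto simp: D_def)
  then have "v \<in> Delta (set as)" using vD v_nonneg sum_v as(1) by (simp add: Delta_def)
  note coords = list_coordinates[OF as(3) len this]
  have u: "u \<in> standard_simplex n" using coords(1) unfolding u_def[abs_def] .
  obtain q where q: "q \<in> D" using D by blast
  obtain k S u' where L: "u' \<in> standard_simplex k" "Suc k \<le> card T0" "S 0 = {p. w p = 1}" "S k = T0"
    "\<And>l. l < k \<Longrightarrow> S l \<subseteq> S (Suc l)" "\<And>l. l \<le> k \<Longrightarrow> S l \<subseteq> T0"
    "\<And>p. w p = (\<Sum>l\<le>k. of_bool (p \<in> S l) * u' l)"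
    by (rule layers_exist[of T0 w q]) (use fin W(4) w_le_1 w_T w_1 q in \<open>auto simp: D_def\<close>)
  have DS: "D \<subseteq> S l" if "l \<le> k" for l
    using that
  proof (induction l)
    case 0
    then show ?case using L(3) w_1 by (auto simp: D_def)
  next
    case (Suc l)
    then show ?case using L(5)[of l] by auto
  qed
  have sorted: "as ! i = as ! j \<or> arr_less C (as ! i) (as ! j)" if "i \<le> j" "j \<le> n" for i j
    using as(2) that len by (cases "i = j") (auto simp: sorted_wrt_iff_nth_less)
  have T0O: "T0 \<subseteq> Obj C" using cT0 unfolding chain_set_def by blast
  have hl: "arr_le C p q" if "p = q \<or> arr_less C p q" "p \<in> T0" for p q
    using that(1) arr_le_refl[OF subsetD[OF T0O that(2)]] by (auto simp: arr_less_def)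
  have ends: "arr_le C (hd as) e \<and> arr_le C e (last as)" if e: "e \<in> D" for e
  proof -
    obtain j where j: "j \<le> n" "e = as ! j" using e unfolding im[symmetric] by auto
    have "as ! 0 \<in> D" unfolding im[symmetric] by auto
    then have "as ! 0 \<in> T0" "e \<in> T0" using e unfolding D_def by blast+
    then show ?thesis
      using hl[of "as ! 0" e] hl[of e "as ! n"] sorted[of 0 j] sorted[of j n] j len
        hd_conv_nth[OF asne] last_conv_nth[OF asne] by simp
  qed
  have chS: "chain_in C (hd as) (last as) (S l)" if "l \<le> k" for l
  proof -
    have "arr_le C (hd as) p \<and> arr_le C p (last as)" if p: "p \<in> T0" for p
    proof -
      obtain e e' where "e \<in> D" "e = p \<or> arr_less C e p" "e' \<in> D" "e' = p \<or> arr_less C p e'"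
        using W(5)[OF p] by (auto simp: D_def)
      then show ?thesis using ends arr_le_trans unfolding arr_less_def by metis
    qed
    moreover have "hd as \<in> S l" "last as \<in> S l" using DS[OF that] as(1) asne by auto
    ultimately show ?thesis using L(6)[OF that] cT0 finite_subset[OF L(6)[OF that] fin]
      unfolding chain_in_def chain_set_def by blast
  qed
  have "successively (arr_le C) as"
    using as(2) by (intro successively_if_sorted_wrt) (auto elim!: sorted_wrt_mono_rel[rotated] simp: arr_less_def)
  then obtain xs where xs: "typed_string (word_typed C k) as xs" "\<forall>l\<le>k. flag C as xs l = S l"
    using flag_exists[of as k S] asne chS DS[of 0] L(5) as(1) by blast
  have cell: "is_bar_cell as k xs" using xs asO by (simp add: is_bar_cell_def)
  let ?a = "bar_cell as k xs (u', u)"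
  have v: "vertex_wt ?a = v"
  proof
    fix p
    have "(\<Sum>i\<le>n. of_bool (as ! i = p) * u i) = v p" using coords(2) unfolding u_def[abs_def] .
    then show "vertex_wt ?a p = v p" by (simp add: bar_cell_def vertex_wt_eq n_def)
  qed
  have w: "flag_wt C ?a = w"
  proof
    fix p
    have "flag_wt C ?a p = (\<Sum>l\<le>k. of_bool (p \<in> flag C as xs l) * u' l)"
      by (simp add: bar_cell_def flag_wt_eq flag_coord_rclass[OF asO])
    also have "\<dots> = (\<Sum>l\<le>k. of_bool (p \<in> S l) * u' l)" using xs(2) by (intro sum.cong) auto
    also have "\<dots> = w p" by (rule L(7)[symmetric])
    finally show "flag_wt C ?a p = w p" .
  qed
  have W': "weights (arr_less C) T0 (vertex_wt ?a) (flag_wt C ?a)" using W(1) v w by simp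
  have zc: "comb_wt C id ?a p = K * z p" for p
    using W(3)[of p] weight_T[of p id] z0[of p] by (cases "p \<in> T0") (auto simp: comb_wt_def v w)
  have "comb_bary C id ?a p = z p" for p
    unfolding comb_bary_eq(1)[OF W'] zc using W(2) sz by (simp flip: sum_distrib_left)
  then have zz: "comb_bary C id ?a = z" by blast
  show ?thesis
  proof (rule that[OF cell L(1) _ _ _ _ zz])
    show "u \<in> standard_simplex (length as - 1)" using u by (simp add: n_def)
    show "flag C as xs k \<subseteq> T" using xs(2) L(4) T0 by simp
    have "card T0 \<le> card T" using card_mono[OF finT T0] .
    then show "k \<le> card T" using L(2) by simp
    have "length as = card D" using as by (metis distinct_card)
    also have "\<dots> \<le> card T" using T0 finT by (intro card_mono) (auto simp: D_def)
    finally show "length as \<le> card T" .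
  qed
qed

text \<open>Words along a given string are determined by their flag, of which there are finitely many
  inside \<open>T\<close>.\<close>

lemma finite_cells:
  assumes "finite T"
  shows "finite {(as, k, xs). is_bar_cell as k xs \<and> flag C as xs k \<subseteq> T \<and> length as \<le> N \<and> k \<le> N}" (is "finite ?A")
proof -
  have "finite {xs. is_bar_cell as k xs \<and> flag C as xs k \<subseteq> T}" for as k
  proof (rule inj_on_finite[where f = "\<lambda>xs. restrict (flag C as xs) {..k}" and B = "PiE {..k} (\<lambda>_. Pow T)"])
    show "inj_on (\<lambda>xs. restrict (flag C as xs) {..k}) {xs. is_bar_cell as k xs \<and> flag C as xs k \<subseteq> T}"
    proof (rule inj_onI)
      fix xs ys assume a: "xs \<in> {xs. is_bar_cell as k xs \<and> flag C as xs k \<subseteq> T}" "ys \<in> {xs. is_bar_cell as k xs \<and> flag C as xs k \<subseteq> T}"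
        and e: "restrict (flag C as xs) {..k} = restrict (flag C as ys) {..k}"
      have "flag C as xs l = flag C as ys l" if "l \<le> k" for l
        using fun_cong[OF e, of l] that by simp
      then show "xs = ys" using flag_inject[of k as xs ys] a by (simp add: is_bar_cell_def)
    qed
    show "(\<lambda>xs. restrict (flag C as xs) {..k}) ` {xs. is_bar_cell as k xs \<and> flag C as xs k \<subseteq> T} \<subseteq> PiE {..k} (\<lambda>_. Pow T)"
      using flag_mono[of _ k as] by (auto simp: restrict_def PiE_def Pi_def extensional_def) blast
    show "finite (PiE {..k} (\<lambda>_. Pow T))" using assms by (intro finite_PiE) auto
  qed
  then have "finite (SIGMA as:{as. set as \<subseteq> T \<and> length as \<le> N}. SIGMA k:{..N}. {xs. is_bar_cell as k xs \<and> flag C as xs k \<subseteq> T})"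
    by (intro finite_SigmaI finite_lists_length_le assms) auto
  then show ?thesis
    by (rule finite_subset[rotated]) (auto simp: flag_def)
qed

text \<open>The trace of \<open>A\<close> on a simplex is the union of the images of its traces on the finitely many
  cells that cover the simplex. Each of these is compact.\<close>

lemma closedin_nerve_real_from_bar_real:
  assumes A: "A \<subseteq> topspace (nerve_real C)" and cl: "closedin (bar_real C) {c \<in> topspace (bar_real C). comparison C id c \<in> A}"
  shows "closedin (nerve_real C) A"
proof (rule closedin_nerve_real[OF A])
  fix T assume T: "chain_set C T"
  have finT: "finite T" using T by (simp add: chain_set_def)
  define N where "N = card T"
  define Cells where "Cells = {(as, k, xs). is_bar_cell as k xs \<and> flag C as xs k \<subseteq> T \<and> length as \<le> N \<and> k \<le> N}"
  have fin: "finite Cells" unfolding Cells_def by (rule finite_cells[OF finT])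
  let ?g = "\<lambda>(as, k, xs). comb_bary C id ` {p \<in> bar_cell as k xs ` topspace (bar_cell_topology as k).
      rclass (bar_space C) p \<in> {c \<in> topspace (bar_real C). comparison C id c \<in> A}}"
  have haus: "Hausdorff_space (Delta_topology T)"
    by (simp add: Hausdorff_space_subtopology Hausdorff_space_product_topology)
  have cc: "closedin (Delta_topology T) (?g P)" if P: "P \<in> Cells" for P
  proof -
    obtain as k xs where p: "P = (as, k, xs)" by (cases P)
    have cell: "is_bar_cell as k xs" and sub: "flag C as xs k \<subseteq> T" using P p by (auto simp: Cells_def)
    let ?X = "bar_cell_topology as k"
    let ?K = "{p \<in> topspace ?X. rclass (bar_space C) (bar_cell as k xs p) \<in> {c \<in> topspace (bar_real C). comparison C id c \<in> A}}"
    have "closedin ?X ?K"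
      by (rule closedin_continuous_map_preimage[OF continuous_bar_cell[OF cell] cl])
    moreover have "compact_space ?X"
      using compact_space_simplex by (simp add: compact_space_prod_topology)
    ultimately have K: "compactin ?X ?K" by (rule closedin_compact_space[rotated])
    have "continuous_map ?X (Delta_topology T) (\<lambda>p. comb_bary C id (bar_cell as k xs p))"
      using continuous_comb_bary_cell[OF cell, of id] Delta_mono[OF finT sub]
      unfolding continuous_map_powertop_sub by (auto simp: Pi_iff)
    from image_compactin[OF K this] haus
    have "closedin (Delta_topology T) ((\<lambda>p. comb_bary C id (bar_cell as k xs p)) ` ?K)"
      by (rule compactin_imp_closedin[rotated])
    moreover have "?g P = (\<lambda>p. comb_bary C id (bar_cell as k xs p)) ` ?K" unfolding p by auto
    ultimately show ?thesis by simp
  qed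
  have eq: "{z \<in> Delta T. bary_point C z \<in> A} = (\<Union>P\<in>Cells. ?g P)"
  proof (intro equalityI subsetI)
    fix z assume z: "z \<in> {z \<in> Delta T. bary_point C z \<in> A}"
    then obtain as k xs u' u where c: "is_bar_cell as k xs" "u' \<in> standard_simplex k" "u \<in> standard_simplex (length as - 1)"
      "flag C as xs k \<subseteq> T" "length as \<le> card T" "k \<le> card T" "comb_bary C id (bar_cell as k xs (u', u)) = z"
      using cover[OF T, of z] by (metis (no_types, lifting) mem_Collect_eq)
    have "comparison C id (rclass (bar_space C) (bar_cell as k xs (u', u))) \<in> A"
      using z by (simp add: comparison_rclass[OF convex_id] c(7))
    then have "bar_cell as k xs (u', u) \<in> {p \<in> bar_cell as k xs ` topspace (bar_cell_topology as k).
      rclass (bar_space C) p \<in> {c \<in> topspace (bar_real C). comparison C id c \<in> A}}"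
      using c(2,3) bar_cell_in[OF c(1-3)] by auto
    then have "comb_bary C id (bar_cell as k xs (u', u)) \<in> ?g (as, k, xs)" unfolding prod.case by (rule imageI)
    then have "z \<in> ?g (as, k, xs)" by (simp only: c(7))
    moreover have "(as, k, xs) \<in> Cells" using c by (auto simp: Cells_def N_def)
    ultimately show "z \<in> (\<Union>P\<in>Cells. ?g P)" by blast
  next
    fix z assume "z \<in> (\<Union>P\<in>Cells. ?g P)"
    then obtain as k xs u' u where c: "is_bar_cell as k xs" "flag C as xs k \<subseteq> T" "u' \<in> standard_simplex k"
      "u \<in> standard_simplex (length as - 1)" "z = comb_bary C id (bar_cell as k xs (u', u))"
      "comparison C id (rclass (bar_space C) (bar_cell as k xs (u', u))) \<in> A"
      by (auto simp: Cells_def)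
    have "z \<in> Delta T"
      using comb_bary_eq(2)[OF weights_bar_cell(1)[OF c(1,3,4)], of id] Delta_mono[OF finT c(2)] c(5) by blast
    then show "z \<in> {z \<in> Delta T. bary_point C z \<in> A}"
      using c(6) by (simp add: comparison_rclass[OF convex_id] c(5))
  qed
  show "closedin (Delta_topology T) {z \<in> Delta T. bary_point C z \<in> A}"
    unfolding eq
  proof (rule closedin_Union)
    show "finite (?g ` Cells)" using fin by (rule finite_imageI)
    show "closedin (Delta_topology T) S" if "S \<in> ?g ` Cells" for S
      using that cc by (elim imageE) (simp only:)
  qed
qed

theorem homeomorphic_map_comparison: "homeomorphic_map (bar_real C) (nerve_real C) (comparison C id)"
proof -
  have "comparison C id ` topspace (bar_real C) = topspace (nerve_real C)"
  proof (intro equalityI subsetI)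
    fix c assume c: "c \<in> topspace (nerve_real C)"
    obtain T where T: "chain_set C T" "bary c \<in> Delta T" by (rule topspace_nerve_real_coord[OF c])
    obtain as k xs u' u where r: "is_bar_cell as k xs" "u' \<in> standard_simplex k" "u \<in> standard_simplex (length as - 1)"
      "flag C as xs k \<subseteq> T" "length as \<le> card T" "k \<le> card T" "comb_bary C id (bar_cell as k xs (u', u)) = bary c"
      by (rule cover[OF T])
    have "comparison C id (rclass (bar_space C) (bar_cell as k xs (u', u))) = c"
      by (simp add: comparison_rclass[OF convex_id] r(7) bary_point_bary[OF c])
    then show "c \<in> comparison C id ` topspace (bar_real C)" using bar_cell_in[OF r(1-3)] by blast
  qed (use comparison_in[OF convex_id] in auto)
  moreover have "closedin (bar_real C) {x \<in> topspace (bar_real C). comparison C id x \<in> U} \<longleftrightarrow> closedin (nerve_real C) U"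
    if "U \<subseteq> topspace (nerve_real C)" for U
    using closedin_nerve_real_from_bar_real[OF that] closedin_continuous_map_preimage[OF continuous_comparison[OF convex_id]] by blast
  ultimately have "quotient_map (bar_real C) (nerve_real C) (comparison C id)"
    unfolding quotient_map_closedin by blast
  then show ?thesis using inj_on_comparison_id by (simp add: homeomorphic_map_def)
qed

end

section \<open>Maps induced by functors of posets\<close>

text \<open>Both categories share their types, as the arrows of the category of small categories
  do.\<close>

locale poset_functor =
  C: poset_cat C + D: poset_cat D for C D :: "('o, 'm) cat" +
  fixes H :: "('o, 'm, 'o, 'm) funct"
  assumes H: "is_functor H" and Src [simp]: "Src H = C" and Tgt [simp]: "Tgt H = D"
begin

abbreviation h :: "'o \<Rightarrow> 'o" where "h \<equiv> OMap H"

abbreviation nerve_push :: "('o list \<times> 'm list) rpoint set \<Rightarrow> ('o list \<times> 'm list) rpoint set" where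
  "nerve_push \<equiv> realization_map (nerve_space D) (nerve_map H)"

abbreviation bar_push :: "('o, ('o, 'm) word) bar_point rpoint set \<Rightarrow> ('o, ('o, 'm) word) bar_point rpoint set" where
  "bar_push \<equiv> realization_map (bar_space D) (bar_map H)"

lemma h_Obj: "x \<in> Obj C \<Longrightarrow> h x \<in> Obj D"
  using H by (simp add: is_functor_def)

lemma H_hom: "f \<in> hom_set C x y \<Longrightarrow> AMap H f \<in> hom_set D (h x) (h y)"
  using H by (auto simp: is_functor_def hom_set_def)

lemma h_mono: "arr_le C x y \<Longrightarrow> arr_le D (h x) (h y)"
  using H_hom by (fastforce simp: arr_le_def)

lemma h_set: "S \<subseteq> Obj C \<Longrightarrow> h ` S \<subseteq> Obj D"
  using h_Obj by blast

lemma convex_comp: "convex_fibres D \<kappa> \<Longrightarrow> convex_fibres C (\<lambda>x. \<kappa> (h x))"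
  using h_mono unfolding convex_fibres_def by blast

lemma convex_h: "convex_fibres C h"
  using convex_comp[OF D.convex_id] by simp

lemma image_chain_set: "chain_set C T \<Longrightarrow> chain_set D (h ` T)"
  using h_mono h_Obj unfolding chain_set_def by blast

subsection \<open>The nerve\<close>

lemma nerve_map_in: "x \<in> Simp (nerve C) n \<Longrightarrow> nerve_map H n x \<in> Simp (nerve D) n"
  using H_hom h_Obj by (cases x) (auto simp: nerve_map_def Simp_nerve intro: typed_string_map)

lemma nerve_map_simplicial: "simplicial_map (nerve_space C) (nerve_space D) (nerve_map H)"
proof (rule simplicial_map_vertexwise[OF C.vertexed_nerve D.vertexed_nerve nerve_map_in, where h = h])
  show "nerve_vertex (nerve_map H n x) i = h (nerve_vertex x i)" if "x \<in> Simp (nerve C) n" "i \<le> n" for n x i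
    using that by (cases x) (auto simp: nerve_map_def Simp_nerve typed_string_def)
qed

lemmas nerve_push_rclass = realization_map_rclass[OF nerve_map_simplicial]

lemma continuous_nerve_push: "continuous_map (nerve_real C) (nerve_real D) nerve_push"
proof (rule continuous_map_from_discrete_realization)
  fix n x assume x: "x \<in> Simp (nerve C) n"
  have "continuous_map (simplex_topology n) (prod_topology (SpTop (nerve_space D) n) (simplex_topology n)) (\<lambda>u. (nerve_map H n x, u))"
    using nerve_map_in[OF x] by (auto simp: continuous_map_paired SpTop_discrete_sspace)
  from continuous_map_compose[OF this continuous_map_rclass]
  show "continuous_map (simplex_topology n) (nerve_real D) (\<lambda>u. nerve_push (rclass (nerve_space C) (n, x, u)))"
    by (simp add: o_def nerve_push_rclass)
qed

lemma nerve_push_in: "c \<in> topspace (nerve_real C) \<Longrightarrow> nerve_push c \<in> topspace (nerve_real D)"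
  using continuous_map_funspace[OF continuous_nerve_push] by blast

lemma bary_nerve_push:
  assumes c: "c \<in> topspace (nerve_real C)" and T: "finite T" "bary c \<in> Delta T"
  shows "bary (nerve_push c) q = sum (bary c) {p \<in> T. h p = q}"
proof -
  obtain n as fs u where x: "c = rclass (nerve_space C) (n, (as, fs), u)" "(as, fs) \<in> Simp (nerve C) n" "u \<in> standard_simplex n"
    using c unfolding topspace_discrete_realization by auto
  have len: "length as = Suc n" using C.Simp_nerve_chain_set(2)[OF x(2)] .
  have fin: "finite (set as \<union> T)" using T(1) by simp
  have d: "bary c \<in> Delta (set as)" using C.bary_Delta[OF x(2,3)] x(1) by simp
  have "sum (bary c) {p \<in> T. h p = q} = sum (bary c) {p \<in> set as \<union> T. h p = q}"
    using T d by (intro sum.mono_neutral_left) (auto simp: Delta_def)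
  also have "\<dots> = (\<Sum>p\<in>{p \<in> set as \<union> T. h p = q}. \<Sum>i\<le>n. of_bool (as ! i = p) * u i)"
    unfolding x(1) by (simp add: C.bary_rclass)
  also have "\<dots> = (\<Sum>i\<le>n. of_bool (h (as ! i) = q) * u i)"
    using len fin by (intro sum_positions_push) auto
  also have "\<dots> = bary (nerve_push c) q"
    unfolding x(1) nerve_push_rclass D.bary_rclass using len by (intro sum.cong) (auto simp: nerve_map_def)
  finally show ?thesis by simp
qed

subsection \<open>The bar construction\<close>

lemma resolution_map_acts: "acts_on_visited C D (Suc k) (Suc k) h id (resolution_map H k)"
  by (rule acts_on_visited_resolution_map[OF C.poset_cat_axioms D.poset_cat_axioms H Src Tgt])

lemma resolution_map_typed: "typed_string (word_typed C k) as xs \<Longrightarrow> typed_string (word_typed D k) (map h as) (map (resolution_map H k) xs)"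
  by (rule typed_string_acts_on_visited[OF resolution_map_acts])

lemma flag_resolution_map:
  "typed_string (word_typed C k) as xs \<Longrightarrow> l \<le> k \<Longrightarrow>
     flag D (map h as) (map (resolution_map H k) xs) l = h ` flag C as xs l"
  by (rule flag_acts_on_visited[OF resolution_map_acts]) auto

lemma words_simplicial:
  assumes "set as \<subseteq> Obj C"
  shows "simplicial_map (word_space C as) (word_space D (map h as)) (\<lambda>k. map (resolution_map H k))"
proof (rule simplicial_map_vertexwise[OF C.vertexed_chain[OF assms], where h = "(`) h"])
  show "vertexed_sset (chain_sset (resolution D) (map h as)) (flag D (map h as)) (\<subseteq>)"
    using h_set[OF assms] by (intro D.vertexed_chain) simp
qed (use resolution_map_typed flag_resolution_map in \<open>auto simp: Simp_chain_sset\<close>)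

lemma bar_map_point:
  assumes "set as \<subseteq> Obj C"
  shows "bar_map H n (as, rclass (word_space C as) (k, xs, u)) =
    (map h as, rclass (word_space D (map h as)) (k, map (resolution_map H k) xs, u))"
  using realization_map_rclass[OF words_simplicial[OF assms]] by (simp add: bar_map_def)

text \<open>Cutting commutes with a monotone map \<open>h\<close>: an element below the cut whose image is not below
  the image of the cut has the same image as the object at the cut, which is a member of the chain.\<close>

lemma image_cut_flag:
  assumes "typed_string (word_typed C k) as xs" "length as = Suc (Suc n)" "set as \<subseteq> Obj C" "i \<le> Suc n"
  shows "h ` C.cut_flag (Suc n) i as (flag C as xs l) = D.cut_flag (Suc n) i (map h as) (h ` flag C as xs l)"
proof -
  let ?S = "flag C as xs l"
  have ch: "arr_le C p q \<or> arr_le C q p" if "p \<in> ?S" "q \<in> ?S" for p q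
    using C.flag_chain[OF assms(1,3), of l] that unfolding chain_in_def by blast
  have a: "as ! j \<in> ?S" "as ! j \<in> Obj C" if "j \<le> Suc n" for j
    using that assms(2,3) by (auto simp: flag_def subset_iff)
  consider "i = 0" | "i = Suc n" "i \<noteq> 0" | "i \<noteq> 0" "i \<noteq> Suc n" by blast
  then show ?thesis
  proof cases
    case 1
    have "h p \<in> h ` {p \<in> ?S. arr_le C (as ! 1) p}" if p: "p \<in> ?S" "arr_le D (h (as ! 1)) (h p)" for p
    proof (cases "arr_le C (as ! 1) p")
      case False
      then have "arr_le C p (as ! 1)" using ch p a(1)[of 1] by auto
      then have "h p = h (as ! 1)" using h_mono D.arr_le_antisym p(2) by blast
      then show ?thesis using a[of 1] C.arr_le_refl by auto
    qed (use p in auto)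
    then have "h ` {p \<in> ?S. arr_le C (as ! 1) p} = {q \<in> h ` ?S. arr_le D (h (as ! 1)) q}"
      using h_mono by auto
    then show ?thesis using 1 assms(2) by (simp add: C.cut_flag_def D.cut_flag_def)
  next
    case 2
    have "h p \<in> h ` {p \<in> ?S. arr_le C p (as ! n)}" if p: "p \<in> ?S" "arr_le D (h p) (h (as ! n))" for p
    proof (cases "arr_le C p (as ! n)")
      case False
      then have "arr_le C (as ! n) p" using ch p a(1)[of n] by auto
      then have "h p = h (as ! n)" using h_mono D.arr_le_antisym p(2) by blast
      then show ?thesis using a[of n] C.arr_le_refl by auto
    qed (use p in auto)
    then have "h ` {p \<in> ?S. arr_le C p (as ! n)} = {q \<in> h ` ?S. arr_le D q (h (as ! n))}"
      using h_mono by auto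
    then show ?thesis using 2 assms(2) by (simp add: C.cut_flag_def D.cut_flag_def)
  next
    case 3
    then show ?thesis by (simp add: C.cut_flag_def D.cut_flag_def)
  qed
qed

lemma map_face_objs: "map h (face_objs i as) = face_objs i (map h as)"
  by (simp add: face_objs_def take_map drop_map)

lemma map_degen_objs: "map h (degen_objs i as) = degen_objs i (map h as)"
  by (simp add: degen_objs_def take_map drop_map)

lemma bar_map_simplicial: "simplicial_map (bar_space C) (bar_space D) (bar_map H)"
  unfolding simplicial_map_def
proof (intro conjI allI ballI impI)
  fix n i x
  { assume "x \<in> topspace (SpTop (bar_space C) n)"
    then obtain as k xs u where x: "x = (as, rclass (word_space C as) (k, xs, u))" "length as = Suc n" "length xs = n"
      "set as \<subseteq> Obj C" "typed_string (word_typed C k) as xs" "u \<in> standard_simplex k" by (rule bar_pointE)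
    show "bar_map H n x \<in> topspace (SpTop (bar_space D) n)"
      unfolding x(1) bar_map_point[OF x(4)]
      by (rule bar_point_in[OF _ _ resolution_map_typed[OF x(5)] x(6)]) (use x h_set in auto)
  }
  { assume x0: "x \<in> topspace (SpTop (bar_space C) (Suc n))" and i: "i \<le> Suc n"
    from x0 obtain as k xs u where x: "x = (as, rclass (word_space C as) (k, xs, u))" "length as = Suc (Suc n)" "length xs = Suc n"
      "set as \<subseteq> Obj C" "typed_string (word_typed C k) as xs" "u \<in> standard_simplex k" by (rule bar_pointE[of _ _ "Suc n"])
    have sub: "set (face_objs i as) \<subseteq> Obj C" using set_face_objs[of i as] x(4) by blast
    have as': "length (map h as) = Suc (Suc n)" "set (map h as) \<subseteq> Obj D" using x(2,4) h_set by auto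
    have sub': "set (face_objs i (map h as)) \<subseteq> Obj D" using set_face_objs[of i "map h as"] as'(2) by blast
    note f = C.face_arrs_simplicial(2)[OF x(2,4) i x(5)]
    note f' = D.face_arrs_simplicial(2)[OF as' i resolution_map_typed[OF x(5)]]
    have "map (resolution_map H k) (face_arrs (Comp (free_pow (Suc k) C)) (Suc n) i xs) =
        face_arrs (Comp (free_pow (Suc k) D)) (Suc n) i (map (resolution_map H k) xs)"
    proof (rule D.flag_inject[OF _ f' sub'])
      show "typed_string (word_typed D k) (face_objs i (map h as))
         (map (resolution_map H k) (face_arrs (Comp (free_pow (Suc k) C)) (Suc n) i xs))"
        using resolution_map_typed[OF f] by (simp add: map_face_objs)
      fix l assume l: "l \<le> k"
      show "flag D (face_objs i (map h as)) (map (resolution_map H k) (face_arrs (Comp (free_pow (Suc k) C)) (Suc n) i xs)) l =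
        flag D (face_objs i (map h as)) (face_arrs (Comp (free_pow (Suc k) D)) (Suc n) i (map (resolution_map H k) xs)) l"
        using flag_resolution_map[OF f l] C.flag_face[OF x(5,3) i x(4) l] D.flag_face[OF resolution_map_typed[OF x(5)] _ i as'(2) l]
          image_cut_flag[OF x(5,2,4) i, of l] flag_resolution_map[OF x(5) l] x(3) by (simp add: map_face_objs)
    qed
    then show "bar_map H n (SpFace (bar_space C) (Suc n) i x) = SpFace (bar_space D) (Suc n) i (bar_map H (Suc n) x)"
      unfolding x(1) C.SpFace_bar[OF x(2,4) i] bar_map_point[OF x(4)] bar_map_point[OF sub]
        D.SpFace_bar[OF as' i] by (simp add: map_face_objs)
  }
  { assume x0: "x \<in> topspace (SpTop (bar_space C) n)" and i: "i \<le> n"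
    from x0 obtain as k xs u where x: "x = (as, rclass (word_space C as) (k, xs, u))" "length as = Suc n" "length xs = n"
      "set as \<subseteq> Obj C" "typed_string (word_typed C k) as xs" "u \<in> standard_simplex k" by (rule bar_pointE[of _ _ n])
    have sub: "set (degen_objs i as) \<subseteq> Obj C" using set_degen_objs[of i as] x(2,4) i by simp
    have as': "length (map h as) = Suc n" "set (map h as) \<subseteq> Obj D" using x(2,4) h_set by auto
    have sub': "set (degen_objs i (map h as)) \<subseteq> Obj D" using set_degen_objs[of i "map h as"] as' i by simp
    note f = C.degen_arrs_simplicial(2)[OF x(2,4) i x(5)]
    note f' = D.degen_arrs_simplicial(2)[OF as' i resolution_map_typed[OF x(5)]]
    have "map (resolution_map H k) (degen_arrs (Idn (free_pow (Suc k) C) (as ! i)) i xs) =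
        degen_arrs (Idn (free_pow (Suc k) D) (map h as ! i)) i (map (resolution_map H k) xs)"
    proof (rule D.flag_inject[OF _ f' sub'])
      show "typed_string (word_typed D k) (degen_objs i (map h as))
         (map (resolution_map H k) (degen_arrs (Idn (free_pow (Suc k) C) (as ! i)) i xs))"
        using resolution_map_typed[OF f] by (simp add: map_degen_objs)
      fix l assume l: "l \<le> k"
      show "flag D (degen_objs i (map h as)) (map (resolution_map H k) (degen_arrs (Idn (free_pow (Suc k) C) (as ! i)) i xs)) l =
        flag D (degen_objs i (map h as)) (degen_arrs (Idn (free_pow (Suc k) D) (map h as ! i)) i (map (resolution_map H k) xs)) l"
        using flag_resolution_map[OF f l] C.flag_degen[OF x(5,3) i x(4), of l] D.flag_degen[OF resolution_map_typed[OF x(5)] _ i as'(2), of l]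
          flag_resolution_map[OF x(5) l] x(3) by (simp add: map_degen_objs)
    qed
    then show "bar_map H (Suc n) (SpDegen (bar_space C) n i x) = SpDegen (bar_space D) n i (bar_map H n x)"
      unfolding x(1) C.SpDegen_bar[OF x(2,4) i] bar_map_point[OF x(4)] bar_map_point[OF sub]
        D.SpDegen_bar[OF as' i] by (simp add: map_degen_objs)
  }
qed

lemmas bar_push_rclass = realization_map_rclass[OF bar_map_simplicial]

lemma image_cell:
  assumes "C.is_bar_cell as k xs"
  shows "D.is_bar_cell (map h as) k (map (resolution_map H k) xs)"
    and "bar_push (rclass (bar_space C) (C.bar_cell as k xs p)) =
      rclass (bar_space D) (D.bar_cell (map h as) k (map (resolution_map H k) xs) p)"
proof -
  have as: "set as \<subseteq> Obj C" "typed_string (word_typed C k) as xs" using assms by (auto simp: C.is_bar_cell_def)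
  show "D.is_bar_cell (map h as) k (map (resolution_map H k) xs)"
    using resolution_map_typed[OF as(2)] h_set[OF as(1)] by (simp add: D.is_bar_cell_def)
  show "bar_push (rclass (bar_space C) (C.bar_cell as k xs p)) =
      rclass (bar_space D) (D.bar_cell (map h as) k (map (resolution_map H k) xs) p)"
    by (cases p) (simp add: C.bar_cell_def D.bar_cell_def bar_push_rclass bar_map_point[OF as(1)])
qed

lemma continuous_bar_push: "continuous_map (bar_real C) (bar_real D) bar_push"
proof (rule C.continuous_from_bar_real)
  fix as k xs assume c: "C.is_bar_cell as k xs"
  show "continuous_map (C.bar_cell_topology as k) (bar_real D) (\<lambda>p. bar_push (rclass (bar_space C) (C.bar_cell as k xs p)))"
    unfolding image_cell(2)[OF c] using D.continuous_bar_cell[OF image_cell(1)[OF c]] by simp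
qed

lemma bar_push_in: "c \<in> topspace (bar_real C) \<Longrightarrow> bar_push c \<in> topspace (bar_real D)"
  using continuous_map_funspace[OF continuous_bar_push] by blast

subsection \<open>Compatibility with the coordinates\<close>

text \<open>The weights of the image point are \<open>v\<close> pushed forward by sums and \<open>w\<close> pushed forward by maxima: an
  object lies in the image of a member of the flag as soon as some object of its fibre does, and
  the flag is nested.\<close>

lemma comb_bary_push:
  assumes c: "C.is_bar_cell as k xs" "u' \<in> standard_simplex k" "u \<in> standard_simplex (length as - 1)"
  shows "comb_bary D \<kappa> (D.bar_cell (map h as) k (map (resolution_map H k) xs) (u', u)) q =
    sum (comb_bary C (\<lambda>x. \<kappa> (h x)) (C.bar_cell as k xs (u', u))) {p \<in> flag C as xs k. h p = q}"
proof -
  let ?a = "C.bar_cell as k xs (u', u)" and ?b = "D.bar_cell (map h as) k (map (resolution_map H k) xs) (u', u)"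
  let ?T = "flag C as xs k" and ?\<kappa> = "\<lambda>x. \<kappa> (h x)"
  have as: "set as \<subseteq> Obj C" "typed_string (word_typed C k) as xs" using c by (auto simp: C.is_bar_cell_def)
  have len: "length as = Suc (length as - 1)" using C.is_bar_cell_length[OF c(1)] .
  have as': "set (map h as) \<subseteq> Obj D" using h_set[OF as(1)] by simp
  note W = C.weights_bar_cell(1)[OF c] and ch = C.weights_bar_cell(2)[OF c]
  interpret weights "arr_less C" ?T "vertex_wt ?a" "flag_wt C ?a" by (rule W)
  have ai: "as ! i \<in> ?T" if "i \<le> length as - 1" for i using that len by (auto simp: flag_def)
  have v: "vertex_wt ?b d = sum (vertex_wt ?a) {e \<in> ?T. h e = d}" for d
  proof -
    have "sum (vertex_wt ?a) {e \<in> ?T. h e = d} = (\<Sum>e\<in>{e \<in> ?T. h e = d}. \<Sum>i\<le>length as - 1. of_bool (as ! i = e) * u i)"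
      by (simp add: C.bar_cell_def vertex_wt_eq)
    also have "\<dots> = (\<Sum>i\<le>length as - 1. of_bool (h (as ! i) = d) * u i)"
      using ai fin by (intro sum_positions_push) auto
    also have "\<dots> = vertex_wt ?b d"
      unfolding D.bar_cell_def prod.case vertex_wt_eq length_map using len by (intro sum.cong) auto
    finally show ?thesis by simp
  qed
  have wa: "flag_wt C ?a p = (\<Sum>l\<le>k. of_bool (p \<in> flag C as xs l) * u' l)" for p
    by (simp add: C.bar_cell_def flag_wt_eq C.flag_coord_rclass[OF as(1)])
  have wb: "flag_wt D ?b d = (\<Sum>l\<le>k. of_bool (d \<in> h ` flag C as xs l) * u' l)" for d
    unfolding D.bar_cell_def prod.case flag_wt_eq D.flag_coord_rclass[OF as']
    using flag_resolution_map[OF as(2)] by (intro sum.cong) auto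
  have u': "\<And>l. 0 \<le> u' l" using c(2) by (simp add: standard_simplex_iff)
  have w: "flag_wt D ?b d = max0 (flag_wt C ?a) {e \<in> ?T. h e = d}" for d
  proof (cases "d \<in> h ` ?T")
    case False
    then have e: "{e \<in> ?T. h e = d} = {}" by auto
    have "flag_wt D ?b d = 0" unfolding wb using False C.flag_mono[of _ k as xs] by (intro sum.neutral) auto
    then show ?thesis unfolding e by simp
  next
    case True
    define m where "m = (LEAST m. d \<in> h ` flag C as xs m)"
    have m: "d \<in> h ` flag C as xs m" "m \<le> k" unfolding m_def using True by (auto intro: LeastI Least_le)
    have lm: "d \<notin> h ` flag C as xs l" if "l < m" for l using that not_less_Least unfolding m_def by blast
    obtain e0 where e0: "e0 \<in> flag C as xs m" "h e0 = d" using m(1) by auto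
    have 1: "flag_wt D ?b d = sum u' {m..k}"
      unfolding wb by (rule nested_sum[OF image_mono[OF C.flag_mono]]) (use m lm in auto)
    have 2: "flag_wt C ?a e0 = sum u' {m..k}"
      unfolding wa by (rule nested_sum[OF C.flag_mono]) (use m e0 lm in auto)
    have "e0 \<in> ?T" using e0(1) C.flag_mono[OF m(2)] by blast
    then have "sum u' {m..k} \<le> max0 (flag_wt C ?a) {e \<in> ?T. h e = d}"
      using max0_ge[of "{e \<in> ?T. h e = d}" e0 "flag_wt C ?a"] fin e0 2 by simp
    moreover have "max0 (flag_wt C ?a) {e \<in> ?T. h e = d} \<le> flag_wt D ?b d"
    proof (rule max0_le)
      show "0 \<le> flag_wt D ?b d" unfolding wb using u' by (intro sum_nonneg) auto
      show "flag_wt C ?a e \<le> flag_wt D ?b d" if "e \<in> {e \<in> ?T. h e = d}" for e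
        unfolding wa wb using that u' by (intro sum_mono) auto
    qed (use fin in auto)
    ultimately show ?thesis using 1 by simp
  qed
  have ch': "finite_chain (arr_less D) (h ` ?T)" using D.chain_set_finite_chain[OF image_chain_set[OF ch]] .
  have mono: "h x = h y \<or> arr_less D (h x) (h y)" if "arr_less C x y" for x y
    using that h_mono unfolding arr_less_def by blast
  note P = weight_push[OF ch' mono v w]
  have W': "weights (arr_less D) (h ` ?T) (vertex_wt ?b) (flag_wt D ?b)" by (rule P(1))
  have z: "comb_wt D \<kappa> ?b d = sum (comb_wt C ?\<kappa> ?a) {p \<in> ?T. h p = d}" for d
    unfolding comb_wt_def by (rule P(2))
  have "sum (comb_wt D \<kappa> ?b) (h ` ?T) = (\<Sum>d\<in>h ` ?T. sum (comb_wt C ?\<kappa> ?a) {p \<in> ?T. h p = d})"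
    by (intro sum.cong refl z)
  also have "\<dots> = sum (comb_wt C ?\<kappa> ?a) ?T" using fin by (intro sum.group) auto
  finally have tot: "sum (comb_wt D \<kappa> ?b) (h ` ?T) = sum (comb_wt C ?\<kappa> ?a) ?T" .
  show ?thesis
    unfolding comb_bary_def[of D] comb_bary_def[of C, THEN ext]
  proof -
    have "comb_wt D \<kappa> ?b q / sum (comb_wt D \<kappa> ?b) {p. comb_wt D \<kappa> ?b p \<noteq> 0} = comb_wt D \<kappa> ?b q / sum (comb_wt D \<kappa> ?b) (h ` ?T)"
      using D.comb_bary_eq(1)[OF W', of \<kappa> q] by (simp add: comb_bary_def)
    also have "\<dots> = (\<Sum>p\<in>{p \<in> ?T. h p = q}. comb_wt C ?\<kappa> ?a p / sum (comb_wt C ?\<kappa> ?a) ?T)"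
      unfolding tot z by (simp add: sum_divide_distrib)
    also have "\<dots> = (\<Sum>p\<in>{p \<in> ?T. h p = q}. comb_wt C ?\<kappa> ?a p / sum (comb_wt C ?\<kappa> ?a) {p. comb_wt C ?\<kappa> ?a p \<noteq> 0})"
      by (rule sum.cong[OF refl], rule C.comb_bary_eq(1)[OF W, unfolded comb_bary_def, symmetric])
    finally show "comb_wt D \<kappa> ?b q / sum (comb_wt D \<kappa> ?b) {p. comb_wt D \<kappa> ?b p \<noteq> 0} =
      (\<Sum>p\<in>{p \<in> ?T. h p = q}. comb_wt C ?\<kappa> ?a p / sum (comb_wt C ?\<kappa> ?a) {p. comb_wt C ?\<kappa> ?a p \<noteq> 0})" .
  qed
qed

text \<open>The relation that replaces naturality. For \<open>\<kappa> = id\<close> it lifts the \<open>B\<close>-tilde of a functor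
  through its \<open>B\<close>.\<close>

theorem nerve_push_comparison:
  assumes \<kappa>: "convex_fibres D \<kappa>" and c: "c \<in> topspace (bar_real C)"
  shows "nerve_push (comparison C (\<lambda>x. \<kappa> (h x)) c) = comparison D \<kappa> (bar_push c)"
proof -
  obtain as k xs u' u where x: "c = rclass (bar_space C) (C.bar_cell as k xs (u', u))"
    "C.is_bar_cell as k xs" "u' \<in> standard_simplex k" "u \<in> standard_simplex (length as - 1)"
    using c unfolding C.topspace_bar_real by blast
  let ?\<kappa> = "\<lambda>x. \<kappa> (h x)"
  note k' = convex_comp[OF \<kappa>]
  note i = image_cell[OF x(2)]
  have u: "u \<in> standard_simplex (length (map h as) - 1)" using x(4) by simp
  have fin: "finite (flag C as xs k)" using C.weights_bar_cell(2)[OF x(2-4)] by (simp add: chain_set_def)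
  have b: "bary (comparison C ?\<kappa> c) = comb_bary C ?\<kappa> (C.bar_cell as k xs (u', u))"
    unfolding x(1) by (rule C.bary_comparison[OF k' x(2-4)])
  have D: "bary (comparison C ?\<kappa> c) \<in> Delta (flag C as xs k)"
    unfolding b by (rule C.comb_bary_eq(2)[OF C.weights_bar_cell(1)[OF x(2-4)]])
  show ?thesis
  proof (rule D.bary_inject)
    show "nerve_push (comparison C ?\<kappa> c) \<in> topspace (nerve_real D)" using nerve_push_in[OF C.comparison_in[OF k' c]] .
    show "comparison D \<kappa> (bar_push c) \<in> topspace (nerve_real D)" using D.comparison_in[OF \<kappa> bar_push_in[OF c]] .
    show "bary (nerve_push (comparison C ?\<kappa> c)) = bary (comparison D \<kappa> (bar_push c))"
    proof
      fix q
      have "bary (nerve_push (comparison C ?\<kappa> c)) q = sum (comb_bary C ?\<kappa> (C.bar_cell as k xs (u', u))) {p \<in> flag C as xs k. h p = q}"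
        using bary_nerve_push[OF C.comparison_in[OF k' c] fin D] b by simp
      also have "\<dots> = bary (comparison D \<kappa> (bar_push c)) q"
        unfolding x(1) i(2) D.bary_comparison[OF \<kappa> i(1) x(3) u] comb_bary_push[OF x(2-4)] ..
      finally show "bary (nerve_push (comparison C ?\<kappa> c)) q = bary (comparison D \<kappa> (bar_push c)) q" .
    qed
  qed
qed

end

text \<open>Only the fibres of \<open>\<kappa>\<close> enter. In particular an inclusion gives the same map as the
  identity.\<close>

lemma (in poset_cat) comparison_kernel:
  assumes "convex_fibres C \<kappa>" "convex_fibres C \<kappa>'" and c: "c \<in> topspace (bar_real C)"
    and eq: "\<And>x y. x \<in> Obj C \<Longrightarrow> y \<in> Obj C \<Longrightarrow> \<kappa> x = \<kappa> y \<longleftrightarrow> \<kappa>' x = \<kappa>' y"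
  shows "comparison C \<kappa> c = comparison C \<kappa>' c"
proof -
  obtain as k xs u' u where x: "c = rclass (bar_space C) (bar_cell as k xs (u', u))"
    "is_bar_cell as k xs" "u' \<in> standard_simplex k" "u \<in> standard_simplex (length as - 1)"
    using c unfolding topspace_bar_real by blast
  note W = weights_bar_cell[OF x(2-4)]
  have "comb_wt C \<kappa> (bar_cell as k xs (u', u)) = comb_wt C \<kappa>' (bar_cell as k xs (u', u))"
    unfolding comb_wt_def using W(2) by (intro ext weights.weight_kernel[OF W(1)] eq) (auto simp: chain_set_def)
  then show ?thesis
    unfolding x(1) comparison_rclass[OF assms(1)] comparison_rclass[OF assms(2)] comb_bary_def[THEN ext] by simp
qed

section \<open>Functoriality\<close>

lemma nerve_push_id:
  assumes "poset_functor C C (id_functor C)" "c \<in> topspace (nerve_real C)"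
  shows "realization_map (nerve_space C) (nerve_map (id_functor C)) c = c"
proof -
  interpret poset_functor C C "id_functor C" by fact
  obtain n as fs u where x: "c = rclass (nerve_space C) (n, (as, fs), u)" "(as, fs) \<in> Simp (nerve C) n"
    using assms(2) unfolding topspace_discrete_realization by auto
  have "nerve_map (id_functor C) n (as, fs) = (as, fs)"
    using x(2) by (auto simp: nerve_map_def id_functor_def Simp_nerve typed_string_def hom_set_def in_set_conv_nth
        intro!: map_idI)
  then show ?thesis unfolding x(1) nerve_push_rclass by simp
qed

lemma nerve_push_comp:
  assumes "poset_functor C D F" "poset_functor D E G" "poset_functor C E (comp_functor G F)" "c \<in> topspace (nerve_real C)"
  shows "realization_map (nerve_space E) (nerve_map (comp_functor G F)) c =
    realization_map (nerve_space E) (nerve_map G) (realization_map (nerve_space D) (nerve_map F) c)"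
proof -
  interpret F: poset_functor C D F by fact
  interpret G: poset_functor D E G by fact
  interpret GF: poset_functor C E "comp_functor G F" by fact
  obtain n as fs u where x: "c = rclass (nerve_space C) (n, (as, fs), u)" "(as, fs) \<in> Simp (nerve C) n"
    using assms(4) unfolding topspace_discrete_realization by auto
  have "nerve_map (comp_functor G F) n (as, fs) = nerve_map G n (nerve_map F n (as, fs))"
    using x(2) by (auto simp: nerve_map_def comp_functor_def Simp_nerve typed_string_def hom_set_def in_set_conv_nth
        compose_def subset_iff)
  then show ?thesis unfolding x(1) F.nerve_push_rclass G.nerve_push_rclass GF.nerve_push_rclass by simp
qed

lemma bar_push_id:
  assumes "poset_functor C C (id_functor C)" "c \<in> topspace (bar_real C)"
  shows "realization_map (bar_space C) (bar_map (id_functor C)) c = c"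
proof -
  interpret poset_functor C C "id_functor C" by fact
  obtain as k xs u' u where x: "c = rclass (bar_space C) (C.bar_cell as k xs (u', u))" "C.is_bar_cell as k xs"
    using assms(2) unfolding C.topspace_bar_real by blast
  have as: "set as \<subseteq> Obj C" "typed_string (word_typed C k) as xs" using x(2) by (auto simp: C.is_bar_cell_def)
  have id: "OMap (id_functor C) p = p" if "p \<in> Obj C" for p using that by (simp add: id_functor_def)
  have as': "map (OMap (id_functor C)) as = as" using as(1) id by (intro map_idI) auto
  have "map (resolution_map (id_functor C) k) xs = xs"
  proof (rule C.flag_inject[OF _ as(2,1)])
    show "typed_string (word_typed C k) as (map (resolution_map (id_functor C) k) xs)"
      using resolution_map_typed[OF as(2)] as' by simp
    fix l assume "l \<le> k"
    have "flag C as xs l \<subseteq> Obj C" using C.flag_chain[OF as(2,1), of l] by (simp add: chain_in_def)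
    then have "OMap (id_functor C) ` flag C as xs l = flag C as xs l" using id by (force simp: subset_iff)
    then show "flag C as (map (resolution_map (id_functor C) k) xs) l = flag C as xs l"
      using flag_resolution_map[OF as(2) \<open>l \<le> k\<close>] as' by simp
  qed
  then show ?thesis unfolding x(1) image_cell(2)[OF x(2)] as' by simp
qed

lemma bar_push_comp:
  assumes "poset_functor C D F" "poset_functor D E G" "poset_functor C E (comp_functor G F)" "c \<in> topspace (bar_real C)"
  shows "realization_map (bar_space E) (bar_map (comp_functor G F)) c =
    realization_map (bar_space E) (bar_map G) (realization_map (bar_space D) (bar_map F) c)"
proof -
  interpret F: poset_functor C D F by fact
  interpret G: poset_functor D E G by fact
  interpret GF: poset_functor C E "comp_functor G F" by fact
  obtain as k xs u' u where x: "c = rclass (bar_space C) (F.C.bar_cell as k xs (u', u))" "F.C.is_bar_cell as k xs"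
    using assms(4) unfolding F.C.topspace_bar_real by blast
  have as: "set as \<subseteq> Obj C" "typed_string (word_typed C k) as xs" using x(2) by (auto simp: F.C.is_bar_cell_def)
  have id: "OMap (comp_functor G F) p = OMap G (OMap F p)" if "p \<in> Obj C" for p
    using that by (simp add: comp_functor_def compose_def)
  have as': "map (OMap (comp_functor G F)) as = map (OMap G) (map (OMap F) as)" using as(1) id by auto
  note Fx = F.resolution_map_typed[OF as(2)]
  have "map (resolution_map (comp_functor G F) k) xs = map (resolution_map G k) (map (resolution_map F k) xs)"
  proof (rule G.D.flag_inject[OF _ G.resolution_map_typed[OF Fx]])
    show "typed_string (word_typed E k) (map (OMap G) (map (OMap F) as)) (map (resolution_map (comp_functor G F) k) xs)"
      using GF.resolution_map_typed[OF as(2)] as' by simp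
    show "set (map (OMap G) (map (OMap F) as)) \<subseteq> Obj E" using as(1) F.h_Obj G.h_Obj by auto
    fix l assume l: "l \<le> k"
    have "flag C as xs l \<subseteq> Obj C" using F.C.flag_chain[OF as(2,1), of l] by (simp add: chain_in_def)
    then have "OMap (comp_functor G F) ` flag C as xs l = OMap G ` OMap F ` flag C as xs l" using id by (force simp: subset_iff)
    then show "flag E (map (OMap G) (map (OMap F) as)) (map (resolution_map (comp_functor G F) k) xs) l =
      flag E (map (OMap G) (map (OMap F) as)) (map (resolution_map G k) (map (resolution_map F k) xs)) l"
      using GF.flag_resolution_map[OF as(2) l] G.flag_resolution_map[OF Fx l] F.flag_resolution_map[OF as(2) l] as' by simp
  qed
  then show ?thesis
    unfolding x(1) F.image_cell(2)[OF x(2)] G.image_cell(2)[OF F.image_cell(1)[OF x(2)]] GF.image_cell(2)[OF x(2)] as'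
    by (simp only:)
qed

section \<open>Categories of categories\<close>

lemma category_hom:
  assumes "category M"
  shows "f \<in> hom_set M x y \<Longrightarrow> g \<in> hom_set M y z \<Longrightarrow> Comp M g f \<in> hom_set M x z"
    and "f \<in> hom_set M x y \<Longrightarrow> g \<in> hom_set M y z \<Longrightarrow> k \<in> hom_set M z w \<Longrightarrow>
      Comp M k (Comp M g f) = Comp M (Comp M k g) f"
    and "f \<in> hom_set M x y \<Longrightarrow> Comp M f (Idn M x) = f"
    and "f \<in> hom_set M x y \<Longrightarrow> Comp M (Idn M y) f = f"
    and "x \<in> Obj M \<Longrightarrow> Idn M x \<in> hom_set M x x"
    and "f \<in> hom_set M x y \<Longrightarrow> x \<in> Obj M \<and> y \<in> Obj M"
  using assms unfolding category_def hom_set_def by auto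

lemma functor_hom: "is_functor F \<Longrightarrow> f \<in> hom_set (Src F) x y \<Longrightarrow> AMap F f \<in> hom_set (Tgt F) (OMap F x) (OMap F y)"
  and functor_Obj: "is_functor F \<Longrightarrow> x \<in> Obj (Src F) \<Longrightarrow> OMap F x \<in> Obj (Tgt F)"
  and functor_Idn: "is_functor F \<Longrightarrow> x \<in> Obj (Src F) \<Longrightarrow> AMap F (Idn (Src F) x) = Idn (Tgt F) (OMap F x)"
  and functor_Comp: "is_functor F \<Longrightarrow> f \<in> hom_set (Src F) x y \<Longrightarrow> g \<in> hom_set (Src F) y z \<Longrightarrow>
    AMap F (Comp (Src F) g f) = Comp (Tgt F) (AMap F g) (AMap F f)"
  unfolding is_functor_def hom_set_def by auto

lemma functor_ends [simp]:
  "Src (id_functor C) = C" "Tgt (id_functor C) = C" "Src (comp_functor G F) = Src F" "Tgt (comp_functor G F) = Tgt G"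
  by (simp_all add: id_functor_def comp_functor_def)

lemma Cat_simps: "Dom Cat = Src" "Cod Cat = Tgt" "Idn Cat = id_functor" "Comp Cat = comp_functor"
  by (simp_all add: Cat_def)

lemma Arr_Cat: "F \<in> Arr Cat \<longleftrightarrow> is_functor F \<and> normalized (Src F) \<and> normalized (Tgt F)"
  by (simp add: Cat_def)

lemma Obj_Cat: "C \<in> Obj Cat \<longleftrightarrow> category C \<and> normalized C"
  by (simp add: Cat_def)

lemma category_Cat: "category Cat"
proof -
  have f: "is_functor (id_functor C)" if "category C" for C :: "('o, 'm) cat"
    using that by (auto simp: is_functor_def id_functor_def category_def hom_set_def)
  have c: "is_functor (comp_functor G F)" if "is_functor F" "is_functor G" "Src G = Tgt F"
    for F G :: "('o, 'm, 'o, 'm) funct"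
  proof -
    have cat: "category (Src F)" "category (Tgt G)" using that(1,2) by (auto simp: is_functor_def)
    note hF = functor_hom[OF that(1)] and hG = functor_hom[OF that(2), unfolded that(3)]
    note oF = functor_Obj[OF that(1)] and oG = functor_Obj[OF that(2), unfolded that(3)]
    note iF = functor_Idn[OF that(1)] and iG = functor_Idn[OF that(2), unfolded that(3)]
    note cF = functor_Comp[OF that(1)] and cG = functor_Comp[OF that(2), unfolded that(3)]
    have A: "f \<in> Arr K \<longleftrightarrow> f \<in> hom_set K (Dom K f) (Cod K f)" for K :: "('o, 'm) cat" and f
      by (simp add: hom_set_def)
    have s: "OMap (comp_functor G F) x = OMap G (OMap F x)" if "x \<in> Obj (Src F)" for x
      using that by (simp add: comp_functor_def compose_def)
    have m: "AMap (comp_functor G F) f = AMap G (AMap F f)" if "f \<in> hom_set (Src F) x y" for f x y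
      using that by (simp add: comp_functor_def compose_def hom_set_def)
    have st: "Src (comp_functor G F) = Src F" "Tgt (comp_functor G F) = Tgt G" by (simp_all add: comp_functor_def)
    show ?thesis
      unfolding is_functor_def st
    proof (intro conjI ballI impI)
      show "OMap (comp_functor G F) \<in> extensional (Obj (Src F))" "AMap (comp_functor G F) \<in> extensional (Arr (Src F))"
        by (auto simp: comp_functor_def)
      show "OMap (comp_functor G F) x \<in> Obj (Tgt G)" if "x \<in> Obj (Src F)" for x
        using s[OF that] oG oF that by simp
      show "AMap (comp_functor G F) (Idn (Src F) x) = Idn (Tgt G) (OMap (comp_functor G F) x)" if "x \<in> Obj (Src F)" for x
        using s[OF that] m[OF category_hom(5)[OF cat(1) that]] iF[OF that] iG[OF oF[OF that]] by simp
      fix f assume "f \<in> Arr (Src F)"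
      then have f: "f \<in> hom_set (Src F) (Dom (Src F) f) (Cod (Src F) f)" by (simp add: A[symmetric])
      have ob: "Dom (Src F) f \<in> Obj (Src F)" "Cod (Src F) f \<in> Obj (Src F)" using category_hom(6)[OF cat(1) f] by auto
      show "AMap (comp_functor G F) f \<in> hom_set (Tgt G) (OMap (comp_functor G F) (Dom (Src F) f)) (OMap (comp_functor G F) (Cod (Src F) f))"
        unfolding s[OF ob(1)] s[OF ob(2)] m[OF f] by (rule hG[OF hF[OF f]])
      fix g assume "g \<in> Arr (Src F)" "Dom (Src F) g = Cod (Src F) f"
      then have g: "g \<in> hom_set (Src F) (Cod (Src F) f) (Cod (Src F) g)" by (simp add: hom_set_def)
      show "AMap (comp_functor G F) (Comp (Src F) g f) = Comp (Tgt G) (AMap (comp_functor G F) g) (AMap (comp_functor G F) f)"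
        unfolding m[OF f] m[OF g] m[OF category_hom(1)[OF cat(1) f g]] cF[OF f g] by (rule cG[OF hF[OF f] hF[OF g]])
    qed (use cat in auto)
  qed
  have u: "comp_functor F (id_functor (Src F)) = F" "comp_functor (id_functor (Tgt F)) F = F"
    if "is_functor F" for F :: "('o, 'm, 'o, 'm) funct"
  proof -
    have e: "OMap F \<in> extensional (Obj (Src F))" "AMap F \<in> extensional (Arr (Src F))"
      "\<And>x. x \<in> Obj (Src F) \<Longrightarrow> OMap F x \<in> Obj (Tgt F)" "\<And>f. f \<in> Arr (Src F) \<Longrightarrow> AMap F f \<in> Arr (Tgt F)"
      using that by (auto simp: is_functor_def hom_set_def)
    show "comp_functor F (id_functor (Src F)) = F" "comp_functor (id_functor (Tgt F)) F = F"
      using e by (auto simp: comp_functor_def id_functor_def compose_def extensional_def fun_eq_iff intro!: funct.equality)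
  qed
  have a: "comp_functor K (comp_functor G F) = comp_functor (comp_functor K G) F"
    if "is_functor F" "Src G = Tgt F" for F G K :: "('o, 'm, 'o, 'm) funct"
    using that by (auto simp: comp_functor_def compose_def is_functor_def hom_set_def fun_eq_iff)
  show ?thesis
    unfolding category_def Cat_simps
  proof (intro conjI ballI impI)
    fix F :: "('o, 'm, 'o, 'm) funct" assume F: "F \<in> Arr Cat"
    then have F': "is_functor F" by (simp add: Arr_Cat)
    then have "category (Src F)" "category (Tgt F)" by (auto simp: is_functor_def)
    with F show "Src F \<in> Obj Cat" "Tgt F \<in> Obj Cat" by (auto simp: Arr_Cat Obj_Cat)
    show "comp_functor F (id_functor (Src F)) = F" "comp_functor (id_functor (Tgt F)) F = F"
      using u[OF F'] by auto
    fix G :: "('o, 'm, 'o, 'm) funct" assume G: "G \<in> Arr Cat" and FG: "Src G = Tgt F"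
    show "comp_functor G F \<in> hom_set Cat (Src F) (Tgt G)"
      using c[of F G] F G FG by (simp add: hom_set_def Cat_simps Arr_Cat)
    fix K :: "('o, 'm, 'o, 'm) funct"
    show "comp_functor K (comp_functor G F) = comp_functor (comp_functor K G) F"
      by (rule a[OF F' FG])
  next
    show "id_functor C \<in> hom_set Cat C C" if "C \<in> Obj Cat" for C :: "('o, 'm) cat"
      using f[of C] that by (simp add: hom_set_def Cat_simps Arr_Cat Obj_Cat)
  qed
qed

lemma id_functor_Cat: "C \<in> Obj Cat \<Longrightarrow> id_functor C \<in> Arr Cat"
  using category_hom(5)[OF category_Cat, of C] by (simp add: hom_set_def Cat_simps)

lemma comp_functor_Cat: "F \<in> Arr Cat \<Longrightarrow> G \<in> Arr Cat \<Longrightarrow> Src G = Tgt F \<Longrightarrow> comp_functor G F \<in> Arr Cat"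
  using category_hom(1)[OF category_Cat, of F "Src F" "Tgt F" G "Tgt G"] by (simp add: hom_set_def Cat_simps)

lemma Src_Tgt_Cat: "F \<in> Arr Cat \<Longrightarrow> Src F \<in> Obj Cat \<and> Tgt F \<in> Obj Cat"
  using category_hom(6)[OF category_Cat, of F "Src F" "Tgt F"] by (simp add: hom_set_def Cat_simps)

lemma category_subcat:
  assumes "category K" and "S \<subseteq> Obj K" "A \<subseteq> Arr K"
    and "\<And>f. f \<in> A \<Longrightarrow> Dom K f \<in> S \<and> Cod K f \<in> S" "\<And>x. x \<in> S \<Longrightarrow> Idn K x \<in> A"
    and "\<And>f g. f \<in> A \<Longrightarrow> g \<in> A \<Longrightarrow> Dom K g = Cod K f \<Longrightarrow> Comp K g f \<in> A"
  shows "category (K\<lparr>Obj := S, Arr := A\<rparr>)"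
  using assms unfolding category_def hom_set_def by (simp add: subset_iff)

lemma Pos_eq: "Pos = Cat\<lparr>Obj := Obj Cat \<inter> {C. poset_category C},
    Arr := {F \<in> Arr Cat. poset_category (Src F) \<and> poset_category (Tgt F)}\<rparr>"
  by (simp add: Pos_def full_subcat_def Cat_def)

lemma Incl_eq: "inter_cat Cat_i Pos = Cat\<lparr>Obj := Obj Cat \<inter> {C. poset_category C},
    Arr := {F \<in> Arr Cat. inclusion F \<and> poset_category (Src F) \<and> poset_category (Tgt F)}\<rparr>"
  unfolding Pos_eq Cat_i_def wide_subcat_def inter_cat_def by (rule cat.equality) auto

lemma category_Pos: "category Pos"
  unfolding Pos_eq
  by (rule category_subcat[OF category_Cat])
     (auto simp: Cat_simps id_functor_Cat comp_functor_Cat Src_Tgt_Cat)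

lemma inclusion_id: "inclusion (id_functor C)"
  by (auto simp: inclusion_def faithful_def id_functor_def inj_on_def hom_set_def)

lemma inclusion_comp:
  assumes F: "is_functor F" "inclusion F" and G: "is_functor G" "inclusion G" and eq: "Src G = Tgt F"
  shows "inclusion (comp_functor G F)"
proof -
  have o: "x \<in> Obj (Src F) \<Longrightarrow> OMap F x \<in> Obj (Src G)" for x using F eq by (auto simp: is_functor_def)
  have m: "f \<in> hom_set (Src F) x y \<Longrightarrow> AMap F f \<in> hom_set (Src G) (OMap F x) (OMap F y)" for f x y
    using F eq by (auto simp: is_functor_def hom_set_def)
  have "inj_on (OMap (comp_functor G F)) (Obj (Src F))"
    using assms(2,4) o unfolding inclusion_def inj_on_def comp_functor_def compose_def by simp
  moreover have "inj_on (AMap (comp_functor G F)) (hom_set (Src F) x y)" if "x \<in> Obj (Src F)" "y \<in> Obj (Src F)" for x y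
  proof (rule inj_onI)
    fix f g assume f: "f \<in> hom_set (Src F) x y" "g \<in> hom_set (Src F) x y"
      and e: "AMap (comp_functor G F) f = AMap (comp_functor G F) g"
    then have "AMap G (AMap F f) = AMap G (AMap F g)" by (simp add: comp_functor_def compose_def hom_set_def)
    then have "AMap F f = AMap F g"
      using m[OF f(1)] m[OF f(2)] o that G(2) unfolding inclusion_def faithful_def inj_on_def by blast
    then show "f = g" using f that F(2) unfolding inclusion_def faithful_def inj_on_def by blast
  qed
  ultimately show ?thesis by (simp add: inclusion_def faithful_def comp_functor_def)
qed

lemma category_Incl: "category (inter_cat Cat_i Pos)"
  unfolding Incl_eq
proof (rule category_subcat[OF category_Cat])
  fix F G :: "('a, 'b, 'a, 'b) funct"
  assume "F \<in> {F \<in> Arr Cat. inclusion F \<and> poset_category (Src F) \<and> poset_category (Tgt F)}"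
    "G \<in> {F \<in> Arr Cat. inclusion F \<and> poset_category (Src F) \<and> poset_category (Tgt F)}" "Dom Cat G = Cod Cat F"
  then show "Comp Cat G F \<in> {F \<in> Arr Cat. inclusion F \<and> poset_category (Src F) \<and> poset_category (Tgt F)}"
    using comp_functor_Cat[of F G] inclusion_comp[of F G] by (auto simp: Cat_simps Arr_Cat)
qed (use inclusion_id in \<open>auto simp: Cat_simps id_functor_Cat Src_Tgt_Cat\<close>)

lemma wide_Incl: "wide_subcategory (inter_cat Cat_i Pos) Pos"
  unfolding wide_subcategory_def using category_Pos category_Incl
  unfolding Incl_eq unfolding Pos_eq by auto

lemma Arr_Pos: "F \<in> Arr Pos \<longleftrightarrow> is_functor F \<and> normalized (Src F) \<and> normalized (Tgt F) \<and>
    poset_category (Src F) \<and> poset_category (Tgt F)"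
  by (auto simp: Pos_eq Cat_def)

lemma Obj_Pos: "C \<in> Obj Pos \<longleftrightarrow> category C \<and> normalized C \<and> poset_category C"
  by (auto simp: Pos_eq Cat_def)

lemma Pos_simps [simp]: "Dom Pos = Src" "Cod Pos = Tgt" "Idn Pos = id_functor" "Comp Pos = comp_functor"
  by (simp_all add: Pos_eq Cat_def)

lemma Src_Tgt_Pos: "F \<in> Arr Pos \<Longrightarrow> Src F \<in> Obj Pos \<and> Tgt F \<in> Obj Pos"
  using category_hom(6)[OF category_Pos, of F "Src F" "Tgt F"] by (simp add: hom_set_def)

lemma id_functor_Pos: "C \<in> Obj Pos \<Longrightarrow> id_functor C \<in> Arr Pos"
  using category_hom(5)[OF category_Pos, of C] by (simp add: hom_set_def)

lemma comp_functor_Pos: "F \<in> Arr Pos \<Longrightarrow> G \<in> Arr Pos \<Longrightarrow> Src G = Tgt F \<Longrightarrow> comp_functor G F \<in> Arr Pos"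
  using category_hom(1)[OF category_Pos, of F "Src F" "Tgt F" G "Tgt G"] by (simp add: hom_set_def)

lemma poset_functor_Pos: "F \<in> Arr Pos \<Longrightarrow> poset_functor (Src F) (Tgt F) F"
  by unfold_locales (auto simp: Arr_Pos)

lemma category_Top: "category Top"
proof -
  have "restrict id (topspace X) \<in> extensional (topspace X)" for X :: "'p topology" by simp
  moreover have "continuous_map X X (restrict id (topspace X))" for X :: "'p topology"
    by (rule continuous_map_eq[OF continuous_map_id]) simp
  moreover have "continuous_map X Z (compose (topspace X) g f)"
    if "continuous_map X Y f" "continuous_map Y Z g" for X Y Z :: "'p topology" and f g
    by (rule continuous_map_eq[OF continuous_map_compose[OF that]]) (simp add: compose_def)
  moreover have "compose (topspace X) f (restrict id (topspace X)) = f"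
    if "f \<in> extensional (topspace X)" for X :: "'p topology" and f :: "'p \<Rightarrow> 'p"
    using that by (auto simp: compose_def extensional_def fun_eq_iff)
  moreover have "compose (topspace X) (restrict id (topspace Y)) f = f"
    if "continuous_map X Y f" "f \<in> extensional (topspace X)" for X Y :: "'p topology" and f :: "'p \<Rightarrow> 'p"
    using that continuous_map_funspace[OF that(1)] by (auto simp: compose_def extensional_def fun_eq_iff Pi_iff)
  moreover have "compose (topspace X) k (compose (topspace X) g f) = compose (topspace X) (compose (topspace Y) k g) f"
    if "continuous_map X Y f" for X Y :: "'p topology" and f g k :: "'p \<Rightarrow> 'p"
    using continuous_map_funspace[OF that] by (auto simp: compose_def fun_eq_iff Pi_iff)
  moreover have "compose (topspace X) g f \<in> extensional (topspace X)" for X :: "'p topology" and f g :: "'p \<Rightarrow> 'p"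
    by (simp add: compose_def)
  ultimately show ?thesis
    unfolding category_def Top_def hom_set_def by auto
qed

lemma hom_Top: "(X, f, Y) \<in> hom_set Top X' Y' \<longleftrightarrow>
    X = X' \<and> Y = Y' \<and> k_space X \<and> k_space Y \<and> continuous_map X Y f \<and> f \<in> extensional (topspace X)"
  by (auto simp: hom_set_def Top_def)

lemma Comp_Top: "Comp Top (Y', g, Z) (X, f, Y) = (X, compose (topspace X) g f, Z)"
  by (simp add: Top_def)

definition top_map :: "'p topology \<Rightarrow> ('p \<Rightarrow> 'p) \<Rightarrow> 'p topology \<Rightarrow> 'p cmap" where
  "top_map X f Y = (X, restrict f (topspace X), Y)"

lemma top_map_hom: "k_space X \<Longrightarrow> k_space Y \<Longrightarrow> continuous_map X Y f \<Longrightarrow> top_map X f Y \<in> hom_set Top X Y"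
  by (auto simp: top_map_def hom_Top intro: continuous_map_eq)

lemma top_map_comp:
  assumes "continuous_map X Y f"
  shows "Comp Top (top_map Y g Z) (top_map X f Y) = top_map X (g \<circ> f) Z"
  using continuous_map_funspace[OF assms]
  by (auto simp: top_map_def Comp_Top compose_def fun_eq_iff Pi_iff)

lemma top_map_id: "top_map X id X = Idn Top X"
  by (simp add: top_map_def Top_def)

lemma top_map_eq: "(\<And>x. x \<in> topspace X \<Longrightarrow> f x = g x) \<Longrightarrow> top_map X f Y = top_map X g Y"
  by (auto simp: top_map_def intro: restrict_ext)

lemma top_map_iso:
  assumes "k_space X" "k_space Y" "homeomorphic_map X Y f"
  shows "iso_in Top (top_map X f Y)"
proof -
  obtain g where g: "homeomorphic_maps X Y f g" using assms(3) homeomorphic_map_maps by blast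
  then have c: "continuous_map X Y f" "continuous_map Y X g" by (auto simp: homeomorphic_maps_def)
  have D: "Dom Top (top_map X f Y) = X" "Cod Top (top_map X f Y) = Y" by (simp_all add: Top_def top_map_def)
  have "Comp Top (top_map Y g X) (top_map X f Y) = Idn Top X"
    unfolding top_map_comp[OF c(1)] top_map_id[symmetric]
    using g by (intro top_map_eq) (auto simp: homeomorphic_maps_def)
  moreover have "Comp Top (top_map X f Y) (top_map Y g X) = Idn Top Y"
    unfolding top_map_comp[OF c(2)] top_map_id[symmetric]
    using g by (intro top_map_eq) (auto simp: homeomorphic_maps_def)
  ultimately show ?thesis
    unfolding iso_in_def D using top_map_hom[OF assms(1,2) c(1)] top_map_hom[OF assms(2,1) c(2)]
    by (intro conjI bexI[of _ "top_map Y g X"]) (simp_all add: hom_set_def)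
qed

section \<open>Twisted natural isomorphisms from liftings\<close>

text \<open>A natural family \<open>\<tau>\<close> of lifts of \<open>a \<circ> F f\<close> through \<open>G f\<close> is all that is needed. Put
  \<open>\<alpha> f = a \<circ> F f\<close> and \<open>t f = \<tau> f \<circ> a\<^sup>-\<^sup>1\<close>. Then \<open>G h \<circ> t h \<circ> \<alpha> g \<circ> F f = G h \<circ> \<tau> h \<circ> F (g f) = a \<circ> F (h g f)\<close>. On
  arrows of \<open>I\<close> the lift is \<open>a\<close>, which makes \<open>t\<close> trivial and \<open>a\<close> natural there; with the latter the square
  for \<open>\<tau>\<close> becomes the square for \<open>t\<close>.\<close>

lemma twisted_nat_iso_from_lifts:
  assumes C: "category C" and M: "category M" and I: "wide_subcategory I C"
    and F: "is_functor F" "Src F = C" "Tgt F = M" and G: "is_functor G" "Src G = C" "Tgt G = M"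
    and a: "\<And>x. x \<in> Obj C \<Longrightarrow> a x \<in> hom_set M (OMap F x) (OMap G x)" "\<And>x. x \<in> Obj C \<Longrightarrow> iso_in M (a x)"
    and \<tau>: "\<And>f. f \<in> Arr C \<Longrightarrow> \<tau> f \<in> hom_set M (OMap F (Dom C f)) (OMap G (Dom C f))"
    and lift: "\<And>f. f \<in> Arr C \<Longrightarrow> Comp M (AMap G f) (\<tau> f) = Comp M (a (Cod C f)) (AMap F f)"
    and incl: "\<And>f. f \<in> Arr I \<Longrightarrow> \<tau> f = a (Dom C f)"
    and sq: "\<And>f1 f2 g1 g2. f1 \<in> Arr I \<Longrightarrow> f2 \<in> Arr I \<Longrightarrow> g1 \<in> Arr C \<Longrightarrow> g2 \<in> Arr C \<Longrightarrow>
      Dom C f2 = Cod C g1 \<Longrightarrow> Dom C g2 = Cod C f1 \<Longrightarrow> Comp C f2 g1 = Comp C g2 f1 \<Longrightarrow>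
      Comp M (AMap G f1) (\<tau> g1) = Comp M (\<tau> g2) (AMap F f1)"
  shows "\<exists>\<alpha> t. twisted_nat_iso C M I F G \<alpha> t"
proof -
  have IC: "f \<in> Arr C" if "f \<in> Arr I" for f using I that by (auto simp: wide_subcategory_def)
  have ob: "Dom C f \<in> Obj C" "Cod C f \<in> Obj C" if "f \<in> Arr C" for f using C that by (auto simp: category_def)
  have Fh: "AMap F f \<in> hom_set M (OMap F (Dom C f)) (OMap F (Cod C f))" if "f \<in> Arr C" for f
    using F that by (auto simp: is_functor_def)
  have Gh: "AMap G f \<in> hom_set M (OMap G (Dom C f)) (OMap G (Cod C f))" if "f \<in> Arr C" for f
    using G that by (auto simp: is_functor_def)
  have Fc: "AMap F (Comp C g f) = Comp M (AMap F g) (AMap F f)" if "f \<in> Arr C" "g \<in> Arr C" "Dom C g = Cod C f" for f g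
    using F that by (auto simp: is_functor_def)
  note comp = category_hom(1)[OF M] and assoc = category_hom(2)[OF M] and idr = category_hom(3)[OF M] and idl = category_hom(4)[OF M]
  have "\<exists>b\<in>hom_set M (OMap G x) (OMap F x). Comp M b (a x) = Idn M (OMap F x) \<and> Comp M (a x) b = Idn M (OMap G x)"
    if "x \<in> Obj C" for x
    using a[OF that] by (auto simp: iso_in_def hom_set_def)
  then obtain b where b: "\<And>x. x \<in> Obj C \<Longrightarrow> b x \<in> hom_set M (OMap G x) (OMap F x)"
    "\<And>x. x \<in> Obj C \<Longrightarrow> Comp M (b x) (a x) = Idn M (OMap F x)" "\<And>x. x \<in> Obj C \<Longrightarrow> Comp M (a x) (b x) = Idn M (OMap G x)"
    by metis
  define \<alpha> where "\<alpha> f = Comp M (a (Cod C f)) (AMap F f)" for f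
  define t where "t f = Comp M (\<tau> f) (b (Dom C f))" for f
  have \<alpha>: "\<alpha> f \<in> hom_set M (OMap F (Dom C f)) (OMap G (Cod C f))" if "f \<in> Arr C" for f
    unfolding \<alpha>_def using comp[OF Fh a(1)] ob that by blast
  have t: "t f \<in> hom_set M (OMap G (Dom C f)) (OMap G (Dom C f))" if "f \<in> Arr C" for f
    unfolding t_def using comp[OF b(1) \<tau>] ob that by blast
  have tern: "\<alpha> (Comp C h (Comp C g f)) = Comp M (AMap G h) (Comp M (t h) (Comp M (\<alpha> g) (AMap F f)))"
    if f: "f \<in> Arr C" and g: "g \<in> Arr C" and h: "h \<in> Arr C" and fg: "Dom C g = Cod C f" and gh: "Dom C h = Cod C g" for f g h
  proof -
    have gf: "Comp C g f \<in> Arr C" "Dom C (Comp C g f) = Dom C f" "Cod C (Comp C g f) = Cod C g"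
      using category_hom(1)[OF C, of f "Dom C f" "Cod C f" g "Cod C g"] f g fg by (auto simp: hom_set_def)
    have hgf: "Cod C (Comp C h (Comp C g f)) = Cod C h"
      using category_hom(1)[OF C, of "Comp C g f" "Dom C f" "Cod C g" h "Cod C h"] gf h gh by (auto simp: hom_set_def)
    have Fgf: "AMap F (Comp C g f) \<in> hom_set M (OMap F (Dom C f)) (OMap F (Dom C h))" using Fh[OF gf(1)] gf gh by simp
    have ah: "a (Dom C h) \<in> hom_set M (OMap F (Dom C h)) (OMap G (Dom C h))" and bh: "b (Dom C h) \<in> hom_set M (OMap G (Dom C h)) (OMap F (Dom C h))"
      using a(1) b(1) ob h by auto
    have Fg': "AMap F g \<in> hom_set M (OMap F (Cod C f)) (OMap F (Dom C h))" using Fh[OF g] fg gh by simp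
    have 1: "Comp M (\<alpha> g) (AMap F f) = Comp M (a (Dom C h)) (AMap F (Comp C g f))"
      unfolding \<alpha>_def Fc[OF f g fg] gh[symmetric] by (rule assoc[symmetric, OF Fh[OF f] Fg' ah])
    have "Comp M (t h) (Comp M (a (Dom C h)) (AMap F (Comp C g f))) =
        Comp M (Comp M (t h) (a (Dom C h))) (AMap F (Comp C g f))"
      by (rule assoc[OF Fgf ah t[OF h]])
    also have "Comp M (t h) (a (Dom C h)) = Comp M (\<tau> h) (Comp M (b (Dom C h)) (a (Dom C h)))"
      unfolding t_def by (rule assoc[symmetric, OF ah bh \<tau>[OF h]])
    also have "\<dots> = \<tau> h" using b(2)[OF ob(1)[OF h]] idr[OF \<tau>[OF h]] by simp
    finally have 2: "Comp M (t h) (Comp M (\<alpha> g) (AMap F f)) = Comp M (\<tau> h) (AMap F (Comp C g f))" using 1 by simp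
    have "Comp M (AMap G h) (Comp M (\<tau> h) (AMap F (Comp C g f))) = Comp M (Comp M (AMap G h) (\<tau> h)) (AMap F (Comp C g f))"
      by (rule assoc[OF Fgf \<tau>[OF h] Gh[OF h]])
    also have "\<dots> = Comp M (Comp M (a (Cod C h)) (AMap F h)) (AMap F (Comp C g f))" using lift[OF h] by simp
    also have "\<dots> = Comp M (a (Cod C h)) (Comp M (AMap F h) (AMap F (Comp C g f)))"
      by (rule assoc[symmetric, OF Fgf Fh[OF h] a(1)[OF ob(2)[OF h]]])
    also have "\<dots> = \<alpha> (Comp C h (Comp C g f))"
      unfolding \<alpha>_def hgf using Fc[OF gf(1) h] gf gh by simp
    finally show ?thesis using 2 by simp
  qed
  have tI: "t f = Idn M (OMap G (Dom C f))" if "f \<in> Arr I" for f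
    unfolding t_def using incl[OF that] b(3) ob IC[OF that] by simp
  have nat: "Comp M (b (Cod C f)) (AMap G f) = Comp M (AMap F f) (b (Dom C f))" if "f \<in> Arr I" for f
  proof -
    note f = IC[OF that]
    note o = ob[OF f]
    have "Comp M (AMap G f) (a (Dom C f)) = Comp M (a (Cod C f)) (AMap F f)" using lift[OF f] incl[OF that] by simp
    then have "Comp M (b (Cod C f)) (Comp M (AMap G f) (a (Dom C f))) = Comp M (Comp M (b (Cod C f)) (a (Cod C f))) (AMap F f)"
      using assoc[OF Fh[OF f] a(1)[OF o(2)] b(1)[OF o(2)]] by simp
    also have "\<dots> = AMap F f" using b(2)[OF o(2)] idl[OF Fh[OF f]] by simp
    finally have 1: "Comp M (b (Cod C f)) (Comp M (AMap G f) (a (Dom C f))) = AMap F f" .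
    have bG: "Comp M (b (Cod C f)) (AMap G f) \<in> hom_set M (OMap G (Dom C f)) (OMap F (Cod C f))"
      by (rule comp[OF Gh[OF f] b(1)[OF o(2)]])
    have "Comp M (AMap F f) (b (Dom C f)) = Comp M (Comp M (Comp M (b (Cod C f)) (AMap G f)) (a (Dom C f))) (b (Dom C f))"
      using assoc[OF a(1)[OF o(1)] Gh[OF f] b(1)[OF o(2)]] 1 by simp
    also have "\<dots> = Comp M (Comp M (b (Cod C f)) (AMap G f)) (Comp M (a (Dom C f)) (b (Dom C f)))"
      by (rule assoc[symmetric, OF b(1)[OF o(1)] a(1)[OF o(1)] bG])
    also have "\<dots> = Comp M (b (Cod C f)) (AMap G f)" using b(3)[OF o(1)] idr[OF bG] by simp
    finally show ?thesis by simp
  qed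
  have square: "Comp M (AMap G f1) (t g1) = Comp M (t g2) (AMap G f1)"
    if f: "f1 \<in> Arr I" "f2 \<in> Arr I" and g: "g1 \<in> Arr C" "g2 \<in> Arr C"
      and e: "Dom C f2 = Cod C g1" "Dom C g2 = Cod C f1" "Comp C f2 g1 = Comp C g2 f1" for f1 f2 g1 g2
  proof -
    note f1 = IC[OF f(1)] and f2 = IC[OF f(2)]
    have d: "Dom C g1 = Dom C f1"
      using category_hom(1)[OF C, of g1 "Dom C g1" "Cod C g1" f2 "Cod C f2"]
        category_hom(1)[OF C, of f1 "Dom C f1" "Cod C f1" g2 "Cod C g2"] f1 f2 g e by (auto simp: hom_set_def)
    have b1: "b (Dom C f1) \<in> hom_set M (OMap G (Dom C f1)) (OMap F (Dom C f1))" using b(1) ob f1 by blast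
    have \<tau>1: "\<tau> g1 \<in> hom_set M (OMap F (Dom C f1)) (OMap G (Dom C f1))" using \<tau>[OF g(1)] d by simp
    have \<tau>2: "\<tau> g2 \<in> hom_set M (OMap F (Cod C f1)) (OMap G (Cod C f1))" using \<tau>[OF g(2)] e by simp
    have "Comp M (AMap G f1) (t g1) = Comp M (Comp M (AMap G f1) (\<tau> g1)) (b (Dom C f1))"
      unfolding t_def d by (rule assoc[OF b1 \<tau>1 Gh[OF f1]])
    also have "\<dots> = Comp M (Comp M (\<tau> g2) (AMap F f1)) (b (Dom C f1))" using sq[OF f g e] by simp
    also have "\<dots> = Comp M (\<tau> g2) (Comp M (AMap F f1) (b (Dom C f1)))"
      by (rule assoc[symmetric, OF b1 Fh[OF f1] \<tau>2])
    also have "\<dots> = Comp M (\<tau> g2) (Comp M (b (Cod C f1)) (AMap G f1))" using nat[OF f(1)] by simp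
    also have "\<dots> = Comp M (Comp M (\<tau> g2) (b (Cod C f1))) (AMap G f1)"
      by (rule assoc[OF Gh[OF f1] b(1)[OF ob(2)[OF f1]] \<tau>2])
    also have "\<dots> = Comp M (t g2) (AMap G f1)" by (simp add: t_def e)
    finally show ?thesis .
  qed
  have iso: "iso_in M (\<alpha> (Idn C x))" if "x \<in> Obj C" for x
  proof -
    have "Idn C x \<in> hom_set C x x" using category_hom(5)[OF C that] .
    moreover have "AMap F (Idn C x) = Idn M (OMap F x)" using F that by (auto simp: is_functor_def)
    ultimately have "\<alpha> (Idn C x) = a x" unfolding \<alpha>_def using idr[OF a(1)[OF that]] by (simp add: hom_set_def)
    then show ?thesis using a(2)[OF that] by simp
  qed
  have "twisted_nat_iso C M I F G \<alpha> t"
    unfolding twisted_nat_iso_def twisted_nat_trans_def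
    using C M I F G \<alpha> t tern tI square iso by blast
  then show ?thesis by blast
qed

section \<open>The universe\<close>

lemma continuous_map_image_topology:
  assumes "continuous_map X Y f" "\<And>x. x \<in> topspace X \<Longrightarrow> g (e x) = e' (f x)"
  shows "continuous_map (image_topology X e) (image_topology Y e') g"
proof -
  have "continuous_map X (image_topology Y e') (e' \<circ> f)"
    using continuous_map_compose[OF assms(1) quotient_imp_continuous_map[OF quotient_map_image_topology]] .
  then have "continuous_map X (image_topology Y e') (g \<circ> e)"
    by (rule continuous_map_eq) (simp add: assms(2))
  then show ?thesis
    using continuous_compose_quotient_map[OF quotient_map_image_topology] by blast
qed

lemma homeomorphic_map_image_topology:
  assumes f: "homeomorphic_map X Y f" and g: "\<And>x. x \<in> topspace X \<Longrightarrow> g (e x) = e' (f x)" and "inj e" "inj e'"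
  shows "homeomorphic_map (image_topology X e) (image_topology Y e') g"
proof -
  obtain f' where f': "homeomorphic_maps X Y f f'" using f homeomorphic_map_maps by blast
  let ?g' = "\<lambda>y. e (f' (inv_into UNIV e' y))"
  have "homeomorphic_maps (image_topology X e) (image_topology Y e') g ?g'"
    unfolding homeomorphic_maps_def
  proof (intro conjI ballI)
    show "continuous_map (image_topology X e) (image_topology Y e') g"
      using f' g by (intro continuous_map_image_topology[of X Y f]) (auto simp: homeomorphic_maps_def)
    show "continuous_map (image_topology Y e') (image_topology X e) ?g'"
      using f' assms(4) by (intro continuous_map_image_topology[of Y X f']) (auto simp: homeomorphic_maps_def)
  next
    fix x assume "x \<in> topspace (image_topology X e)"
    then obtain x0 where "x0 \<in> topspace X" "x = e x0" by auto
    then show "?g' (g x) = x" using f' g assms(4) by (auto simp: homeomorphic_maps_def)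
  next
    fix y assume "y \<in> topspace (image_topology Y e')"
    then obtain y0 where y: "y0 \<in> topspace Y" "y = e' y0" by auto
    then have "f' y0 \<in> topspace X" using f' continuous_map_funspace by (fastforce simp: homeomorphic_maps_def)
    then show "g (?g' y) = y" using f' g y assms(4) by (auto simp: homeomorphic_maps_def)
  qed
  then show ?thesis using homeomorphic_map_maps by blast
qed

lemma k_space_image_topology: "k_space X \<Longrightarrow> k_space (image_topology X e)"
  using quotient_map_image_topology k_space_quotient_map_image by blast

lemma k_space_B_space: "k_space (B_space C)"
  unfolding B_space_def by (intro k_space_image_topology k_space_realization) simp

lemma k_space_Btilde_space: "k_space (Btilde_space C)"
  unfolding Btilde_space_def by (intro k_space_image_topology k_space_realization) simp

lemma topspace_B_space: "topspace (B_space C) = Inr ` topspace (nerve_real C)"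
  by (simp add: B_space_def)

lemma topspace_Btilde_space: "topspace (Btilde_space C) = Inl ` topspace (bar_real C)"
  by (simp add: Btilde_space_def)

lemma B_map_Inr: "B_map H (Inr c) = Inr (realization_map (nerve_space (Tgt H)) (nerve_map H) c)"
  by (simp add: B_map_def)

lemma Btilde_map_Inl: "Btilde_map H (Inl c) = Inl (realization_map (bar_space (Tgt H)) (bar_map H) c)"
  by (simp add: Btilde_map_def)

lemma continuous_B_map:
  assumes "poset_functor C D H"
  shows "continuous_map (B_space C) (B_space D) (B_map H)"
proof -
  interpret poset_functor C D H by fact
  show ?thesis unfolding B_space_def
    by (rule continuous_map_image_topology[OF continuous_nerve_push]) (simp add: B_map_Inr)
qed

lemma continuous_Btilde_map:
  assumes "poset_functor C D H"
  shows "continuous_map (Btilde_space C) (Btilde_space D) (Btilde_map H)"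
proof -
  interpret poset_functor C D H by fact
  show ?thesis unfolding Btilde_space_def
    by (rule continuous_map_image_topology[OF continuous_bar_push]) (simp add: Btilde_map_Inl)
qed

lemma restrict_B: "F \<in> Arr Pos \<Longrightarrow> AMap (restrict_functor B Pos) F = top_map (B_space (Src F)) (B_map F) (B_space (Tgt F))"
  "C \<in> Obj Pos \<Longrightarrow> OMap (restrict_functor B Pos) C = B_space C"
  by (auto simp: restrict_functor_def B_def top_map_def Arr_Pos Obj_Pos Cat_def)

lemma restrict_Btilde: "F \<in> Arr Pos \<Longrightarrow> AMap (restrict_functor Btilde Pos) F = top_map (Btilde_space (Src F)) (Btilde_map F) (Btilde_space (Tgt F))"
  "C \<in> Obj Pos \<Longrightarrow> OMap (restrict_functor Btilde Pos) C = Btilde_space C"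
  by (auto simp: restrict_functor_def Btilde_def top_map_def Arr_Pos Obj_Pos Cat_def)

text \<open>The common pattern of the two functors, whose values on arrows are restrictions of
  globally defined functions.\<close>

lemma space_functor_PosI:
  assumes "Src \<Phi> = Pos" "Tgt \<Phi> = Top" "OMap \<Phi> \<in> extensional (Obj Pos)" "AMap \<Phi> \<in> extensional (Arr Pos)"
    and O: "\<And>C. C \<in> Obj Pos \<Longrightarrow> OMap \<Phi> C = X C" and A: "\<And>F. F \<in> Arr Pos \<Longrightarrow> AMap \<Phi> F = top_map (X (Src F)) (m F) (X (Tgt F))"
    and k: "\<And>C. k_space (X C)"
    and cont: "\<And>F. F \<in> Arr Pos \<Longrightarrow> continuous_map (X (Src F)) (X (Tgt F)) (m F)"
    and id: "\<And>C x. C \<in> Obj Pos \<Longrightarrow> x \<in> topspace (X C) \<Longrightarrow> m (id_functor C) x = x"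
    and comp: "\<And>F G x. F \<in> Arr Pos \<Longrightarrow> G \<in> Arr Pos \<Longrightarrow> Src G = Tgt F \<Longrightarrow> x \<in> topspace (X (Src F)) \<Longrightarrow>
      m (comp_functor G F) x = m G (m F x)"
  shows "is_functor \<Phi>"
proof -
  show ?thesis
    unfolding is_functor_def assms(1,2) Pos_simps
  proof (intro conjI ballI impI)
    show "OMap \<Phi> C \<in> Obj Top" if "C \<in> Obj Pos" for C using that k by (simp add: O Top_def)
    show "AMap \<Phi> (id_functor C) = Idn Top (OMap \<Phi> C)" if "C \<in> Obj Pos" for C
      unfolding A[OF id_functor_Pos[OF that]] O[OF that] functor_ends top_map_id[symmetric]
      using id[OF that] by (intro top_map_eq) simp
    show "AMap \<Phi> F \<in> hom_set Top (OMap \<Phi> (Src F)) (OMap \<Phi> (Tgt F))" if "F \<in> Arr Pos" for F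
      unfolding A[OF that] O[OF conjunct1[OF Src_Tgt_Pos[OF that]]] O[OF conjunct2[OF Src_Tgt_Pos[OF that]]] by (rule top_map_hom[OF k k cont[OF that]])
    show "AMap \<Phi> (comp_functor G F) = Comp Top (AMap \<Phi> G) (AMap \<Phi> F)"
      if "F \<in> Arr Pos" "G \<in> Arr Pos" "Src G = Tgt F" for F G
      unfolding A[OF that(1)] A[OF that(2)] A[OF comp_functor_Pos[OF that]] functor_ends that(3) top_map_comp[OF cont[OF that(1)]]
      using comp[OF that] by (intro top_map_eq) simp
  qed (use assms(3,4) category_Pos category_Top in auto)
qed

lemma poset_functor_id: "C \<in> Obj Pos \<Longrightarrow> poset_functor C C (id_functor C)"
  using poset_functor_Pos[OF id_functor_Pos, of C] by simp

lemma poset_functor_comp: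
  assumes "F \<in> Arr Pos" "G \<in> Arr Pos" "Src G = Tgt F"
  shows "poset_functor (Src F) (Tgt G) (comp_functor G F)"
proof -
  show ?thesis using poset_functor_Pos[OF comp_functor_Pos[OF assms]] by simp
qed

lemma is_functor_B: "is_functor (restrict_functor B Pos)"
proof (rule space_functor_PosI[where X = B_space and m = B_map])
  show "B_map (id_functor C) x = x" if "C \<in> Obj Pos" "x \<in> topspace (B_space C)" for C :: "('a, 'b) cat" and x
    using nerve_push_id[OF poset_functor_id[OF that(1)]] that(2)
    by (auto simp: topspace_B_space B_map_Inr id_functor_def)
  show "B_map (comp_functor G F) x = B_map G (B_map F x)"
    if "F \<in> Arr Pos" "G \<in> Arr Pos" "Src G = Tgt F" "x \<in> topspace (B_space (Src F))" for F G :: "('a, 'b, 'a, 'b) funct" and x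
    using nerve_push_comp[OF poset_functor_Pos[OF that(1)] _ poset_functor_comp[OF that(1-3)]] poset_functor_Pos[OF that(2)] that(3,4)
    by (auto simp: topspace_B_space B_map_Inr comp_functor_def)
qed (simp_all add: restrict_B k_space_B_space continuous_B_map poset_functor_Pos, simp_all add: restrict_functor_def B_def extensional_def)

lemma is_functor_Btilde: "is_functor (restrict_functor Btilde Pos)"
proof (rule space_functor_PosI[where X = Btilde_space and m = Btilde_map])
  show "Btilde_map (id_functor C) x = x" if "C \<in> Obj Pos" "x \<in> topspace (Btilde_space C)" for C :: "('a, 'b) cat" and x
    using bar_push_id[OF poset_functor_id[OF that(1)]] that(2)
    by (auto simp: topspace_Btilde_space Btilde_map_Inl id_functor_def)
  show "Btilde_map (comp_functor G F) x = Btilde_map G (Btilde_map F x)"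
    if "F \<in> Arr Pos" "G \<in> Arr Pos" "Src G = Tgt F" "x \<in> topspace (Btilde_space (Src F))" for F G :: "('a, 'b, 'a, 'b) funct" and x
    using bar_push_comp[OF poset_functor_Pos[OF that(1)] _ poset_functor_comp[OF that(1-3)]] poset_functor_Pos[OF that(2)] that(3,4)
    by (auto simp: topspace_Btilde_space Btilde_map_Inl comp_functor_def)
qed (simp_all add: restrict_Btilde k_space_Btilde_space continuous_Btilde_map poset_functor_Pos,
    simp_all add: restrict_functor_def Btilde_def extensional_def)

text \<open>The second case is a dummy: the domain of interest consists of left summands.\<close>

definition comparison_univ :: "('o, 'm) cat \<Rightarrow> ('o \<Rightarrow> 'o) \<Rightarrow> ('o, 'm) universe \<Rightarrow> ('o, 'm) universe" where
  "comparison_univ C \<kappa> x = (case x of Inl c \<Rightarrow> Inr (comparison C \<kappa> c) | Inr c \<Rightarrow> Inr c)"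

lemma continuous_comparison_univ:
  assumes "poset_cat C" "convex_fibres C \<kappa>"
  shows "continuous_map (Btilde_space C) (B_space C) (comparison_univ C \<kappa>)"
proof -
  interpret poset_cat C by fact
  show ?thesis unfolding Btilde_space_def B_space_def
    by (rule continuous_map_image_topology[OF continuous_comparison[OF assms(2)]]) (simp add: comparison_univ_def)
qed

lemma (in poset_functor) comparison_univ_natural:
  assumes \<kappa>: "convex_fibres D \<kappa>"
  shows "Comp Top (top_map (B_space C) (B_map H) (B_space D)) (top_map (Btilde_space C) (comparison_univ C (\<lambda>x. \<kappa> (h x))) (B_space C)) =
    Comp Top (top_map (Btilde_space D) (comparison_univ D \<kappa>) (B_space D)) (top_map (Btilde_space C) (Btilde_map H) (Btilde_space D))"
  unfolding top_map_comp[OF continuous_comparison_univ[OF C.poset_cat_axioms convex_comp[OF \<kappa>]]]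
    top_map_comp[OF continuous_Btilde_map[OF poset_functor_axioms]]
proof (rule top_map_eq)
  fix x :: "('o, 'm) universe" assume "x \<in> topspace (Btilde_space C)"
  then obtain c where "c \<in> topspace (bar_real C)" "x = Inl c" unfolding topspace_Btilde_space by blast
  then show "(B_map H \<circ> comparison_univ C (\<lambda>x. \<kappa> (h x))) x = (comparison_univ D \<kappa> \<circ> Btilde_map H) x"
    using nerve_push_comparison[OF \<kappa>] by (simp add: comparison_univ_def B_map_Inr Btilde_map_Inl)
qed

lemma homeomorphic_comparison_univ:
  assumes "poset_cat C"
  shows "homeomorphic_map (Btilde_space C) (B_space C) (comparison_univ C id)"
proof -
  interpret poset_cat C by fact
  show ?thesis unfolding Btilde_space_def B_space_def
    by (rule homeomorphic_map_image_topology[OF homeomorphic_map_comparison]) (auto simp: comparison_univ_def)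
qed

theorem theorem1p2:
  shows "\<exists>\<alpha> t. twisted_nat_iso
           (Pos :: (('o, 'm) cat, ('o, 'm, 'o, 'm) funct) cat)
           (Top :: (('o, 'm) universe topology, ('o, 'm) universe cmap) cat)
           (inter_cat Cat_i Pos)
           (restrict_functor Btilde Pos) (restrict_functor B Pos) \<alpha> t"
proof -
  let ?T = "\<lambda>C \<kappa>. top_map (Btilde_space C) (comparison_univ C \<kappa>) (B_space C) :: ('o, 'm) universe cmap"
  define a where "a C = ?T C id" for C :: "('o, 'm) cat"
  define \<tau> where "\<tau> F = ?T (Src F) (OMap F)" for F :: "('o, 'm, 'o, 'm) funct"
  have P: "Src F \<in> Obj Pos" "Tgt F \<in> Obj Pos" if "F \<in> Arr Pos" for F :: "('o, 'm, 'o, 'm) funct"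
    using Src_Tgt_Pos[OF that] by auto
  have pc: "poset_cat C" if "C \<in> Obj Pos" for C :: "('o, 'm) cat"
    using that by unfold_locales (simp add: Obj_Pos)
  have natural: "Comp Top (top_map (B_space (Src F)) (B_map F) (B_space (Tgt F))) (?T (Src F) (\<lambda>x. \<kappa> (OMap F x))) =
      Comp Top (?T (Tgt F) \<kappa>) (top_map (Btilde_space (Src F)) (Btilde_map F) (Btilde_space (Tgt F)))"
    if F: "F \<in> Arr Pos" and \<kappa>: "convex_fibres (Tgt F) \<kappa>" for F :: "('o, 'm, 'o, 'm) funct" and \<kappa>
  by (rule poset_functor.comparison_univ_natural[OF poset_functor_Pos[OF F] \<kappa>])
  have kernel: "?T C \<kappa> = ?T C \<kappa>'"
    if "C \<in> Obj Pos" "convex_fibres C \<kappa>" "convex_fibres C \<kappa>'"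
      "\<And>x y. x \<in> Obj C \<Longrightarrow> y \<in> Obj C \<Longrightarrow> \<kappa> x = \<kappa> y \<longleftrightarrow> \<kappa>' x = \<kappa>' y" for C and \<kappa> \<kappa>' :: "'o \<Rightarrow> 'o"
    using poset_cat.comparison_kernel[OF pc[OF that(1)] that(2,3) _ that(4)]
    by (intro top_map_eq) (auto simp: topspace_Btilde_space comparison_univ_def)
  have Incl: "F \<in> Arr Pos" "inj_on (OMap F) (Obj (Src F))" if "F \<in> Arr (inter_cat Cat_i Pos)" for F :: "('o, 'm, 'o, 'm) funct"
    using that unfolding Incl_eq by (auto simp: Pos_eq inclusion_def)
  have cv: "convex_fibres (Src F) (OMap F)" if "F \<in> Arr Pos" for F :: "('o, 'm, 'o, 'm) funct"
    using poset_functor.convex_h[OF poset_functor_Pos[OF that]] .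
  show ?thesis
  proof (rule twisted_nat_iso_from_lifts[where a = a and \<tau> = \<tau>,
        OF category_Pos category_Top wide_Incl is_functor_Btilde _ _ is_functor_B])
    show "Src (restrict_functor Btilde Pos) = Pos" "Tgt (restrict_functor Btilde Pos) = Top"
      "Src (restrict_functor B Pos) = Pos" "Tgt (restrict_functor B Pos) = Top"
      by (simp_all add: restrict_functor_def B_def Btilde_def)
    show "a C \<in> hom_set Top (OMap (restrict_functor Btilde Pos) C) (OMap (restrict_functor B Pos) C)"
      if "C \<in> Obj Pos" for C
      unfolding restrict_B(2)[OF that] restrict_Btilde(2)[OF that] a_def
      by (intro top_map_hom k_space_B_space k_space_Btilde_space continuous_comparison_univ pc[OF that] poset_cat.convex_id)
    show "iso_in Top (a C)" if "C \<in> Obj Pos" for C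
      unfolding a_def by (intro top_map_iso k_space_B_space k_space_Btilde_space homeomorphic_comparison_univ pc[OF that])
    show "\<tau> F \<in> hom_set Top (OMap (restrict_functor Btilde Pos) (Dom Pos F)) (OMap (restrict_functor B Pos) (Dom Pos F))"
      if "F \<in> Arr Pos" for F
      unfolding Pos_simps restrict_B(2)[OF P(1)[OF that]] restrict_Btilde(2)[OF P(1)[OF that]] \<tau>_def
      by (intro top_map_hom k_space_B_space k_space_Btilde_space continuous_comparison_univ pc[OF P(1)[OF that]] cv[OF that])
    show "Comp Top (AMap (restrict_functor B Pos) F) (\<tau> F) = Comp Top (a (Cod Pos F)) (AMap (restrict_functor Btilde Pos) F)"
      if "F \<in> Arr Pos" for F
      unfolding Pos_simps restrict_B(1)[OF that] restrict_Btilde(1)[OF that] \<tau>_def a_def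
      using natural[OF that poset_cat.convex_id[OF pc[OF P(2)[OF that]]]] by simp
    show "\<tau> F = a (Dom Pos F)" if "F \<in> Arr (inter_cat Cat_i Pos)" for F
      unfolding Pos_simps \<tau>_def a_def
      by (rule kernel[OF P(1)[OF Incl(1)[OF that]] cv[OF Incl(1)[OF that]] poset_cat.convex_id[OF pc[OF P(1)[OF Incl(1)[OF that]]]]])
         (use Incl(2)[OF that] in \<open>auto simp: inj_on_eq_iff\<close>)
    show "Comp Top (AMap (restrict_functor B Pos) F1) (\<tau> G1) = Comp Top (\<tau> G2) (AMap (restrict_functor Btilde Pos) F1)"
      if F: "F1 \<in> Arr (inter_cat Cat_i Pos)" "F2 \<in> Arr (inter_cat Cat_i Pos)" and G: "G1 \<in> Arr Pos" "G2 \<in> Arr Pos"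
        and e: "Dom Pos F2 = Cod Pos G1" "Dom Pos G2 = Cod Pos F1" "Comp Pos F2 G1 = Comp Pos G2 F1" for F1 F2 G1 G2
    proof -
      note F1 = Incl(1)[OF F(1)]
      have e: "Src F2 = Tgt G1" "Src G2 = Tgt F1" "comp_functor F2 G1 = comp_functor G2 F1" using e by auto
      have s: "Src G1 = Src F1" using arg_cong[OF e(3), of Src] by (simp add: comp_functor_def)
      have o: "OMap F2 (OMap G1 x) = OMap G2 (OMap F1 x)" if "x \<in> Obj (Src F1)" for x
        using fun_cong[OF arg_cong[OF e(3), of OMap], of x] that s by (simp add: comp_functor_def compose_def)
      have c2: "convex_fibres (Tgt F1) (OMap G2)" using cv[OF G(2)] e(2) by simp
      (* F2 is injective, so G1 has the same fibres as F2 G1 = G2 F1. *)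
      have "?T (Src F1) (OMap G1) = ?T (Src F1) (\<lambda>x. OMap G2 (OMap F1 x))"
      proof (rule kernel[OF P(1)[OF F1]])
        show "convex_fibres (Src F1) (OMap G1)" using cv[OF G(1)] s by simp
        show "convex_fibres (Src F1) (\<lambda>x. OMap G2 (OMap F1 x))" by (rule poset_functor.convex_comp[OF poset_functor_Pos[OF F1] c2])
        show "OMap G1 x = OMap G1 y \<longleftrightarrow> OMap G2 (OMap F1 x) = OMap G2 (OMap F1 y)"
          if "x \<in> Obj (Src F1)" "y \<in> Obj (Src F1)" for x y
        proof -
          have "OMap G1 x \<in> Obj (Src F2)" "OMap G1 y \<in> Obj (Src F2)"
            using poset_functor.h_Obj[OF poset_functor_Pos[OF G(1)]] that s e(1) by simp_all
          then show ?thesis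
            unfolding o[OF that(1), symmetric] o[OF that(2), symmetric]
            by (rule inj_on_eq_iff[OF Incl(2)[OF F(2)], symmetric])
        qed
      qed
      then show ?thesis
        using natural[OF F1 c2] unfolding restrict_B(1)[OF F1] restrict_Btilde(1)[OF F1] \<tau>_def s e(2) by simp
    qed
  qed
qed

end
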